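(* Assume that $\alpha > -1$ and $\alpha+\beta > -1/2$. Let $1 < p < \infty$. Then $M^{\alpha,\beta}_*$ is bounded on $L^p(\mathbb{R}_+,d\mu_{\alpha})$ provided that $$\text{(i)}\quad \frac1p<\alpha+\beta+\frac12$$ is satisfied and $$\text{(ii)}\quad \frac{-\beta}{2\alpha+1} < \frac{1}{p} < 1-\frac{1-\beta}{2\alpha+2},$$ with the first inequality in (ii) weakened (that is, "$<$" replaced by "$\le$") if $-\beta \in \mathbb{N}$ or $\alpha+\beta > 1/2$. These conditions are optimal up to a possible weakening of the strict inequality in the lower bound in (ii) when $0 < -\beta \notin \mathbb{N}$ and $\alpha+\beta \le 1/2$.
   Context: $\mathbb{R}_+=(0,\infty)$, $\mathbb{N}=\{0,1,2,\ldots\}$; $\alpha,\beta$ are real. Let $d\mu_\alpha(x)=x^{2\alpha+1}dx$ on $\mathbb{R}_+$, and let $J_\nu$ be the Bessel function of the first kind and order $\nu$. For $\alpha>-1$, $\alpha+\beta>-1/2$ and $t,x,z>0$ with, in general, $t\ne|x-z|$ and $t\ne x+z$, put $$K_t^{\alpha,\beta}(x,z) = \frac{2^{\alpha+\beta}\Gamma(\alpha+\beta+1)}{t^{\alpha+\beta}(xz)^{\alpha}} \int_0^{\infty} J_{\alpha+\beta}(ty)J_{\alpha}(xy) J_{\alpha}(zy) y^{1-\alpha-\beta}\, dy,$$ where the integral converges absolutely if $\alpha+\beta>1/2$, and otherwise its convergence at $\infty$ is only conditional, in the Riemann sense. Define $$M_t^{\alpha,\beta}f(x)=\int_0^{\infty}K^{\alpha,\beta}_t(x,z)f(z)\,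 d\mu_{\alpha}(z),\qquad M_*^{\alpha,\beta}f(x)=\sup_{t>0}\big|M_t^{\alpha,\beta}f(x)\big|,\qquad x\in\mathbb{R}_+.$$ Boundedness on $L^p(\mathbb{R}_+,d\mu_\alpha)$ means $\|M_*^{\alpha,\beta}f\|_{L^p(\mathbb{R}_+,d\mu_\alpha)}\le C\|f\|_{L^p(\mathbb{R}_+,d\mu_\alpha)}$ with $C$ independent of $f$.
   Formalization: The lower bound in (ii) is imposed only for α > -1/2: at α = -1/2 its quotient is undefined, and for α < -1/2 it contradicts (i), so optimality would fail (e.g. α = -3/4, β = 10, p = 2, where the operator is bounded). For α ≤ -1/2 there is no lower bound. *)

theory Defs
  imports "HOL-Analysis.Analysis"
begin

text \<open>
  Used for \<open>\<nu> > -1\<close> and \<open>x > 0\<close>. The entire function \<open>rGamma\<close> is the reciprocal of \<open>Gamma\<close>.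
\<close>
definition bessel_J :: "real \<Rightarrow> real \<Rightarrow> real" where
  "bessel_J \<nu> x =
     (\<Sum>n. (-1) ^ n * rGamma (real n + \<nu> + 1) / fact n * (x / 2) powr (2 * real n + \<nu>))"

definition mu :: "real \<Rightarrow> real measure" where
  "mu \<alpha> = density (restrict_space lborel {0<..}) (\<lambda>x. ennreal (x powr (2 * \<alpha> + 1)))"

definition kernel_integrand :: "real \<Rightarrow> real \<Rightarrow> real \<Rightarrow> real \<Rightarrow> real \<Rightarrow> real \<Rightarrow> real" where
  "kernel_integrand \<alpha> \<beta> t x z y =
     bessel_J (\<alpha> + \<beta>) (t * y) * bessel_J \<alpha> (x * y) * bessel_J \<alpha> (z * y) * y powr (1 - \<alpha> - \<beta>)"

text \<open>
  The integrand is \<open>O(y powr (2 * \<alpha> + 1))\<close> at \<open>0\<close>, hence integrable there; at infinity the integral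
  is an improper one, \<open>\<integral>\<^sub>0\<^sup>\<infinity> = lim \<integral>\<^sub>0\<^sup>R\<close> as \<open>R \<rightarrow> \<infinity>\<close>. If \<open>\<alpha> + \<beta> \<le> 1/2\<close> the limit may fail to exist for
  \<open>t = \<bar>x - z\<bar>\<close> or \<open>t = x + z\<close>; for given \<open>t\<close> and \<open>x\<close> these are finitely many \<open>z\<close>, so the value taken
  there is irrelevant.
\<close>
definition kernel :: "real \<Rightarrow> real \<Rightarrow> real \<Rightarrow> real \<Rightarrow> real \<Rightarrow> real" where
  "kernel \<alpha> \<beta> t x z =
     2 powr (\<alpha> + \<beta>) * Gamma (\<alpha> + \<beta> + 1) / (t powr (\<alpha> + \<beta>) * (x * z) powr \<alpha>)
     * Lim at_top (\<lambda>R. LINT y:{0<..<R}|lborel. kernel_integrand \<alpha> \<beta> t x z y)"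

definition mean_op :: "real \<Rightarrow> real \<Rightarrow> real \<Rightarrow> (real \<Rightarrow> complex) \<Rightarrow> real \<Rightarrow> complex" where
  "mean_op \<alpha> \<beta> t f x = (LINT z|mu \<alpha>. kernel \<alpha> \<beta> t x z *\<^sub>R f z)"

definition max_op :: "real \<Rightarrow> real \<Rightarrow> (real \<Rightarrow> complex) \<Rightarrow> real \<Rightarrow> ennreal" where
  "max_op \<alpha> \<beta> f x = (SUP t\<in>{0<..}. ennreal (cmod (mean_op \<alpha> \<beta> t f x)))"

definition enn_powr :: "ennreal \<Rightarrow> real \<Rightarrow> ennreal" where
  "enn_powr a s = (if a = \<infinity> then \<infinity> else ennreal (enn2real a powr s))"

definition Lp_norm :: "'a measure \<Rightarrow> real \<Rightarrow> ('a \<Rightarrow> ennreal) \<Rightarrow> ennreal" where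
  "Lp_norm M p g = enn_powr (\<integral>\<^sup>+ x. enn_powr (g x) p \<partial>M) (1 / p)"

definition Lp_space :: "'a measure \<Rightarrow> real \<Rightarrow> ('a \<Rightarrow> complex) set" where
  "Lp_space M p = {f \<in> borel_measurable M. Lp_norm M p (\<lambda>x. ennreal (cmod (f x))) < \<infinity>}"

text \<open>
  The Bochner integral of a non-integrable function is \<open>0\<close>, so boundedness explicitly includes that
  the maximal operator is well defined on the whole of \<open>L\<^sup>p\<close>: for almost every \<open>x\<close>, the integrals
  defining \<open>mean_op \<alpha> \<beta> t f x\<close> exist for all \<open>t > 0\<close>. The supremum is over an uncountable family,
  so the maximal function is only required to be measurable with respect to the completed measure.
\<close>
definition max_op_bounded :: "real \<Rightarrow> real \<Rightarrow> real \<Rightarrow> bool" where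
  "max_op_bounded \<alpha> \<beta> p \<longleftrightarrow>
     (\<exists>C::real. \<forall>f \<in> Lp_space (mu \<alpha>) p.
        (AE x in mu \<alpha>. \<forall>t>0. integrable (mu \<alpha>) (\<lambda>z. kernel \<alpha> \<beta> t x z *\<^sub>R f z)) \<and>
        max_op \<alpha> \<beta> f \<in> borel_measurable (completion (mu \<alpha>)) \<and>
        Lp_norm (mu \<alpha>) p (max_op \<alpha> \<beta> f)
          \<le> ennreal C * Lp_norm (mu \<alpha>) p (\<lambda>x. ennreal (cmod (f x))))"

definition cond_i :: "real \<Rightarrow> real \<Rightarrow> real \<Rightarrow> bool" where
  "cond_i \<alpha> \<beta> p \<longleftrightarrow> 1 / p < \<alpha> + \<beta> + 1 / 2"

text \<open>
  The lower bound on \<open>1/p\<close> is \<open>-\<beta> < (2 * \<alpha> + 1) / p\<close> divided by \<open>2 * \<alpha> + 1\<close>, and the quotient form is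
  meaningful only for \<open>2 * \<alpha> + 1 > 0\<close>. If \<open>\<alpha> \<le> -1/2\<close>, the undivided inequality is implied by
  \<open>\<alpha> + \<beta> > -1/2\<close> and \<open>cond_i\<close>, and so there is no lower bound. (For \<open>\<alpha> < -1/2\<close> the literal quotient
  inequality contradicts \<open>cond_i\<close>, although the maximal operator is bounded for e.g. large \<open>\<beta>\<close>.)
\<close>
definition lower_strict :: "real \<Rightarrow> real \<Rightarrow> real \<Rightarrow> bool" where
  "lower_strict \<alpha> \<beta> p \<longleftrightarrow> (2 * \<alpha> + 1 > 0 \<longrightarrow> -\<beta> / (2 * \<alpha> + 1) < 1 / p)"

definition lower_weak :: "real \<Rightarrow> real \<Rightarrow> real \<Rightarrow> bool" where
  "lower_weak \<alpha> \<beta> p \<longleftrightarrow> (2 * \<alpha> + 1 > 0 \<longrightarrow> -\<beta> / (2 * \<alpha> + 1) \<le> 1 / p)"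

definition upper :: "real \<Rightarrow> real \<Rightarrow> real \<Rightarrow> bool" where
  "upper \<alpha> \<beta> p \<longleftrightarrow> 1 / p < 1 - (1 - \<beta>) / (2 * \<alpha> + 2)"

definition cond_ii :: "real \<Rightarrow> real \<Rightarrow> real \<Rightarrow> bool" where
  "cond_ii \<alpha> \<beta> p \<longleftrightarrow>
     (if -\<beta> \<in> \<nat> \<or> \<alpha> + \<beta> > 1 / 2 then lower_weak \<alpha> \<beta> p else lower_strict \<alpha> \<beta> p) \<and> upper \<alpha> \<beta> p"

end

theory Submission
  imports Defs
begin

text \<open>
  Put \<open>\<nu> = \<alpha> + \<beta>\<close> and \<open>\<tau> = (t\<^sup>2 - x\<^sup>2 - z\<^sup>2) / (2 x z)\<close>. The kernel is a constant times
  \<open>t powr (-2 \<nu>) * (x z) powr (\<beta> - 1) * h \<tau>\<close>, where \<open>h\<close> (called \<open>prof\<close> below) is the inverse Laplace transform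
  of \<open>s powr (-\<nu>) * I\<^sub>\<alpha> s\<close>. For \<open>\<beta> > 2\<close> this follows from Weber's second exponential integral and the uniqueness
  of Laplace transforms in \<open>T = t\<^sup>2\<close>. The other \<open>\<beta>\<close> are reached by lowering \<open>\<nu>\<close>: both sides of the formula for
  \<open>\<nu>\<close> are \<open>T\<close>-derivatives of those for \<open>\<nu> + 1\<close>, because the asymptotics of the Bessel functions make the improper
  integrals converge locally uniformly off the singularities \<open>\<tau> = -1\<close> and \<open>\<tau> = 1\<close>. The power series of \<open>h\<close> at \<open>-1\<close> and
  at infinity give sharp bounds for the kernel.

  By homogeneity the means are integrals of \<open>f (x u)\<close> against a kernel depending only on \<open>t / x\<close> and \<open>u\<close>. Hoelder's
  inequality with power weights bounds their supremum, except where \<open>u\<close> is close to \<open>1\<close>, \<open>t\<close> being small, which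
  takes the Hardy-Littlewood maximal theorem, and, at the critical exponent \<open>\<beta> p + 2 \<alpha> + 1 = 0\<close>, where \<open>t\<close> and \<open>u\<close>
  are large, which takes a maximal theorem for a translation invariant kernel.

  Each condition is necessary because the kernel is of size \<open>(1 + \<tau>) powr (\<nu> - 1/2)\<close> near \<open>\<tau> = -1\<close>: test
  the operator on functions concentrated on one side of \<open>1\<close> and take \<open>t = \<bar>x - 1\<bar>\<close>.
\<close>

section \<open>Bessel functions\<close>

text \<open>Bessel functions enter through the entire Bessel-Clifford function
  \<open>bessel_e nu\<close>: J of order nu is a power times its value at -(x/2)^2, I of order nu a
  power times its value at (x/2)^2. One object thus serves the kernel and its Laplace transform, and
  its derivative merely raises nu by one.

  A second one is the range -1 < al \<le> -1/2, where Poisson's integral for I diverges; to cover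
  it, the profile for al is expressed through those for al + 1 and al + 2.

  The exponent g that pervades the estimates lies slightly below min (nu - 1/2) 0. The profile may
  have a logarithm at \<tau> = 1; the small loss absorbs it and treats nu below, at and above 1/2
  alike. Condition (i) is precisely the room for such a g with g r > -1, r being the exponent
  conjugate to p. The power weights reflect (ii): the exponent d at u = 0 comes from the upper
  bound, the exponent e at infinity from the lower one.\<close>

definition bessel_e :: "real => real => real" where
 "bessel_e nu u = (\<Sum>n. rGamma (real n + nu + 1) / fact n * u ^ n)"

lemma bessel_e_summable: "summable (\<lambda>n. norm (rGamma (real n + nu + 1) / fact n * u ^ n))"
proof -
 \<comment> \<open>Past N the quotient 1 / (n + nu + 1) of the Gamma factors is at most 1 and
   \<open>\<bar>u\<bar> / (n + 1)\<close> is at most 1/2.\<close>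
 define N where "N = nat \<lceil>2 * \<bar>u\<bar> + \<bar>nu\<bar>\<rceil>"
 show ?thesis
 proof (rule summable_ratio_test[where c = "1/2" and N = N])
  fix n assume n: "n \<ge> N"
  hence n': "real n \<ge> 2 * \<bar>u\<bar> + \<bar>nu\<bar>" unfolding N_def by linarith
  have "rGamma (real n + nu + 1) = (real n + nu + 1) * rGamma (real n + nu + 2)"
   using rGamma_plus1[of "real n + nu + 1"] by (simp add: add_ac)
  moreover have "real n + nu + 1 \<ge> 1" using n' by linarith
  ultimately have *: "\<bar>rGamma (real n + nu + 2)\<bar> \<le> \<bar>rGamma (real n + nu + 1)\<bar>"
   by (simp add: abs_mult mult_le_cancel_right1)
  have "\<bar>u\<bar> / (real n + 1) \<le> 1/2" using n' by (simp add: field_simps)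
  hence "\<bar>rGamma (real n + nu + 2)\<bar> * (\<bar>u\<bar> / (real n + 1)) \<le> \<bar>rGamma (real n + nu + 1)\<bar> * (1/2)"
   using * by (intro mult_mono) auto
  hence "\<bar>rGamma (real n + nu + 2)\<bar> * (\<bar>u\<bar> / (real n + 1)) * (\<bar>u\<bar>^n / fact n)
    \<le> \<bar>rGamma (real n + nu + 1)\<bar> * (1/2) * (\<bar>u\<bar>^n / fact n)"
   by (intro mult_right_mono) auto
  moreover have "norm (norm (rGamma (real (Suc n) + nu + 1) / fact (Suc n) * u ^ Suc n))
    = \<bar>rGamma (real n + nu + 2)\<bar> * (\<bar>u\<bar> / (real n + 1)) * (\<bar>u\<bar>^n / fact n)"
   by (simp add: abs_mult power_abs add_ac)
  moreover have "1/2 * norm (norm (rGamma (real n + nu + 1) / fact n * u ^ n))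
    = \<bar>rGamma (real n + nu + 1)\<bar> * (1/2) * (\<bar>u\<bar>^n / fact n)"
   by (simp add: abs_mult power_abs)
  ultimately show "norm (norm (rGamma (real (Suc n) + nu + 1) / fact (Suc n) * u ^ Suc n))
    \<le> 1/2 * norm (norm (rGamma (real n + nu + 1) / fact n * u ^ n))" by linarith
 qed simp
qed

lemma bessel_e_sums: "(\<lambda>n. rGamma (real n + nu + 1) / fact n * u ^ n) sums bessel_e nu u"
 unfolding bessel_e_def by (rule summable_sums[OF summable_norm_cancel[OF bessel_e_summable]])

lemma DERIV_bessel_e: "(bessel_e nu has_real_derivative bessel_e (nu + 1) u) (at u)"
proof -
 have "((\<lambda>x. \<Sum>n. (rGamma (real n + nu + 1) / fact n) * x ^ n) has_real_derivative
     (\<Sum>n. diffs (\<lambda>n. rGamma (real n + nu + 1) / fact n) n * u ^ n)) (at u)"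
  by (rule termdiffs_strong_converges_everywhere) (rule summable_norm_cancel[OF bessel_e_summable])
 moreover have "diffs (\<lambda>n. rGamma (real n + nu + 1) / fact n) = (\<lambda>n. rGamma (real n + (nu + 1) + 1) / fact n)"
 proof
  fix n
  have "diffs (\<lambda>n. rGamma (real n + nu + 1) / fact n) n
    = rGamma (real (Suc n) + nu + 1) * (real (Suc n) / fact (Suc n))"
   by (simp add: diffs_def)
  also have "real (Suc n) / fact (Suc n) = (1 / fact n :: real)" by (simp del: of_nat_Suc)
  finally show "diffs (\<lambda>n. rGamma (real n + nu + 1) / fact n) n = rGamma (real n + (nu + 1) + 1) / fact n"
   by (simp add: add_ac)
 qed
 ultimately show ?thesis by (simp add: bessel_e_def[abs_def])
qed

lemma DERIV_bessel_e' [derivative_intros]: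
 "(g has_real_derivative g') (at x within S) ==>
  ((\<lambda>x. bessel_e nu (g x)) has_real_derivative bessel_e (nu + 1) (g x) * g') (at x within S)"
 by (rule DERIV_chain2[OF DERIV_bessel_e])

lemma isCont_bessel_e: "isCont (bessel_e nu) u"
 using DERIV_bessel_e DERIV_isCont by blast

lemma continuous_on_bessel_e [continuous_intros]:
 "continuous_on S g ==> continuous_on S (\<lambda>x. bessel_e nu (g x))"
 by (rule continuous_on_compose2[of UNIV "bessel_e nu"])
   (auto simp: continuous_on_eq_continuous_at isCont_bessel_e)

lemma borel_measurable_bessel_e [measurable]: "bessel_e nu \<in> borel_measurable borel"
 by (intro borel_measurable_continuous_onI continuous_on_bessel_e continuous_on_id)

lemma sums_cong_fun: "f sums s ==> (\<And>n. f n = g n) ==> g sums s"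
 by (simp only: ext[of f g])

text \<open>By \<open>rGamma_plus1\<close> each coefficient of order nu is (nu + 1 + n) times that
  of order nu + 1; the part with the factor n, shifted by one index, is u times the series of order
  nu + 2. This is the three-term recurrence of the Bessel functions.\<close>

lemma bessel_e_recurrence: "bessel_e nu u = (nu + 1) * bessel_e (nu + 1) u + u * bessel_e (nu + 2) u"
proof -
 define c where "c nu n = rGamma (real n + nu + 1) / fact n * u ^ n" for nu :: real and n
 have c: "c nu sums bessel_e nu u" for nu
  using bessel_e_sums unfolding c_def .
 have s: "u * c (nu+2) n = real (Suc n) * c (nu+1) (Suc n)" for n
 proof -
  have "real (Suc n) * c (nu+1) (Suc n) = rGamma (real (Suc n) + (nu + 1) + 1) * (real (Suc n) / fact (Suc n)) * (u * u ^ n)"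
   by (simp add: c_def)
  also have "real (Suc n) / fact (Suc n) = (1 / fact n :: real)" by (simp del: of_nat_Suc)
  finally show ?thesis by (simp add: c_def add_ac)
 qed
 have "(\<lambda>n. u * c (nu+2) n) sums (u * bessel_e (nu+2) u)"
  by (intro sums_mult c)
 hence "(\<lambda>n. real (Suc n) * c (nu+1) (Suc n)) sums (u * bessel_e (nu+2) u)"
  by (rule sums_cong_fun) (rule s)
 hence 1: "(\<lambda>n. real n * c (nu+1) n) sums (u * bessel_e (nu+2) u)"
  using sums_Suc_iff[of "\<lambda>n. real n * c (nu+1) n"] by simp
 have 2: "(\<lambda>n. (nu+1) * c (nu+1) n) sums ((nu+1) * bessel_e (nu+1) u)"
  by (intro sums_mult c)
 have "(nu+1) * c (nu+1) n + real n * c (nu+1) n = c nu n" for n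
 proof -
  have "rGamma (real n + nu + 1) = (nu + 1 + real n) * rGamma (real n + (nu+1) + 1)"
   using rGamma_plus1[of "real n + nu + 1"] by (simp add: add_ac)
  hence "c nu n = (nu + 1 + real n) * c (nu+1) n" unfolding c_def by simp
  thus ?thesis by (simp add: distrib_right)
 qed
 with sums_add[OF 2 1] have "c nu sums ((nu+1) * bessel_e (nu+1) u + u * bessel_e (nu+2) u)"
  by (rule sums_cong_fun)
 with c[of nu] show ?thesis by (rule sums_unique2)
qed

lemma bessel_J_conv_e:
 assumes "x > 0"
 shows "bessel_J nu x = (x / 2) powr nu * bessel_e nu (- ((x / 2)\<^sup>2))"
proof -
 have "(\<lambda>n. (x / 2) powr nu * (rGamma (real n + nu + 1) / fact n * (- ((x / 2)\<^sup>2)) ^ n)) sums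
    ((x / 2) powr nu * bessel_e nu (- ((x / 2)\<^sup>2)))"
  by (intro sums_mult bessel_e_sums)
 hence "(\<lambda>n. (-1) ^ n * rGamma (real n + nu + 1) / fact n * (x / 2) powr (2 * real n + nu)) sums
    ((x / 2) powr nu * bessel_e nu (- ((x / 2)\<^sup>2)))"
 proof (rule sums_cong_fun)
  fix n
  have "(x / 2) powr (2 * real n + nu) = (x / 2) powr nu * ((x/2)\<^sup>2) ^ n"
   using assms powr_realpow[of "x/2" "2*n"] by (simp add: powr_add power_mult)
  moreover have "(- ((x / 2)\<^sup>2)) ^ n = (-1) ^ n * ((x/2)\<^sup>2) ^ n"
   by (metis mult_minus1 power_mult_distrib)
  ultimately show "(x / 2) powr nu * (rGamma (real n + nu + 1) / fact n * (- ((x / 2)\<^sup>2)) ^ n)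
   = (-1) ^ n * rGamma (real n + nu + 1) / fact n * (x / 2) powr (2 * real n + nu)" by simp
 qed
 thus ?thesis unfolding bessel_J_def by (rule sums_unique[symmetric])
qed

text \<open>
 The function \<open>u y = y powr (nu + 1/2) * bessel_e nu (-y\<^sup>2/4)\<close> solves \<open>u'' = - (1 - m / y\<^sup>2) u\<close> with
 \<open>m = nu\<^sup>2 - 1/4\<close>, so that \<open>u\<^sup>2 + u'\<^sup>2\<close> stays bounded, and the amplitudes
 \<open>u cos - u' sin\<close>, \<open>u sin + u' cos\<close> converge at rate \<open>1 / y\<close>.
\<close>
lemma perturbed_oscillator:
 fixes u u1 :: "real => real" and m :: real
 assumes d: "\<And>y. y > 0 ==> (u has_real_derivative u1 y) (at y)"
  and d1: "\<And>y. y > 0 ==> (u1 has_real_derivative - (1 - m / y\<^sup>2) * u y) (at y)"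
 shows "\<exists>r \<phi> C. \<forall>y\<ge>1. \<bar>u y - r * cos (y + \<phi>)\<bar> \<le> C / y"
proof -
 define E where "E y = (u y)\<^sup>2 + (u1 y)\<^sup>2" for y
 \<comment> \<open>A Gronwall factor: E' = 2 m u u1 / y^2 is at most |m| E / y^2, and multiplying E
   by exp (|m| / y) compensates this growth.\<close>
 have dE: "((\<lambda>y. E y * exp (\<bar>m\<bar> / y)) has_real_derivative
   (2 * u y * u1 y * (m / y\<^sup>2) - E y * (\<bar>m\<bar> / y\<^sup>2)) * exp (\<bar>m\<bar> / y)) (at y)" if "y > 0" for y
  unfolding E_def using that
  by (auto intro!: derivative_eq_intros d d1 simp: field_simps power2_eq_square)
 have dE_neg: "(2 * u y * u1 y * (m / y\<^sup>2) - E y * (\<bar>m\<bar> / y\<^sup>2)) * exp (\<bar>m\<bar> / y) \<le> 0" if "y > 0" for y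
 proof -
  have "2 * u y * u1 y * m \<le> \<bar>2 * u y * u1 y\<bar> * \<bar>m\<bar>" by (metis abs_ge_self abs_mult)
  also have "\<bar>2 * u y * u1 y\<bar> \<le> E y" unfolding E_def
   using sum_squares_bound[of "u y" "u1 y"] sum_squares_bound[of "u y" "- u1 y"] by (auto simp: abs_if)
  finally have "2 * u y * u1 y * m \<le> E y * \<bar>m\<bar>" by (simp add: mult_right_mono)
  hence "2 * u y * u1 y * m / y\<^sup>2 \<le> E y * \<bar>m\<bar> / y\<^sup>2" by (rule divide_right_mono) simp
  thus ?thesis by (simp add: mult_le_0_iff)
 qed
 have Ebound: "E y \<le> E 1 * exp \<bar>m\<bar>" if "y \<ge> 1" for y
 proof -
  have "E y * exp (\<bar>m\<bar> / y) \<le> E 1 * exp (\<bar>m\<bar> / 1)"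
  proof (rule DERIV_nonpos_imp_nonincreasing[OF that])
   fix x :: real assume "1 \<le> x" "x \<le> y"
   thus "\<exists>z. ((\<lambda>y. E y * exp (\<bar>m\<bar> / y)) has_real_derivative z) (at x) \<and> z \<le> 0"
    using dE[of x] dE_neg[of x] by (intro exI conjI) auto
  qed
  moreover have "E y * 1 \<le> E y * exp (\<bar>m\<bar> / y)"
   using that by (intro mult_left_mono) (auto simp: E_def)
  ultimately show ?thesis by simp
 qed
 define B where "B = sqrt (E 1 * exp \<bar>m\<bar>)"
 have ub: "\<bar>u y\<bar> \<le> B" if "y \<ge> 1" for y
 proof -
  have "(u y)\<^sup>2 \<le> E y" unfolding E_def by simp
  also have "\<dots> \<le> E 1 * exp \<bar>m\<bar>" by (rule Ebound[OF that])
  finally show ?thesis unfolding B_def using real_le_rsqrt[of "\<bar>u y\<bar>"] by simp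
 qed
 define D where "D = \<bar>m\<bar> * B"
 \<comment> \<open>An amplitude with derivative at most D / y^2 has a limit with rate D / y: A - D /
   y increases, A + D / y decreases, and every value of the former lies below every value of the
   latter.\<close>
 have conv: "\<exists>l. \<forall>y\<ge>1. \<bar>A y - l\<bar> \<le> D / y"
  if dA: "\<And>y. y \<ge> 1 ==> (A has_real_derivative m / y\<^sup>2 * u y * s y) (at y)"
   and s: "\<And>y. \<bar>s y\<bar> \<le> 1" for A s
 proof -
  have bd: "\<bar>m / y\<^sup>2 * u y * s y\<bar> \<le> D / y\<^sup>2" if "y \<ge> 1" for y
  proof -
   have "\<bar>u y\<bar> * \<bar>s y\<bar> \<le> B * 1" using ub[OF that] s[of y] by (intro mult_mono) auto
   hence "\<bar>m\<bar> / y\<^sup>2 * (\<bar>u y\<bar> * \<bar>s y\<bar>) \<le> \<bar>m\<bar> / y\<^sup>2 * B" by (intro mult_left_mono) auto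
   thus ?thesis by (simp add: D_def abs_mult mult_ac)
  qed
  have inc: "A x - D / x \<ge> A y - D / y" and dec: "A x + D / x \<le> A y + D / y" if "1 \<le> y" "y \<le> x" for x y
  proof -
   show "A y - D / y \<le> A x - D / x"
   proof (rule DERIV_nonneg_imp_nondecreasing[OF that(2)])
    fix w assume w: "y \<le> w" "w \<le> x"
    have "((\<lambda>y. A y - D / y) has_real_derivative m / w\<^sup>2 * u w * s w + D / w\<^sup>2) (at w)"
     using w that by (auto intro!: derivative_eq_intros dA simp: power2_eq_square)
    thus "\<exists>z. ((\<lambda>y. A y - D / y) has_real_derivative z) (at w) \<and> 0 \<le> z"
     using abs_le_D2[OF bd[of w]] w that by (intro exI conjI) (assumption, linarith)
   qed
   show "A x + D / x \<le> A y + D / y"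
   proof (rule DERIV_nonpos_imp_nonincreasing[OF that(2)])
    fix w assume w: "y \<le> w" "w \<le> x"
    have "((\<lambda>y. A y + D / y) has_real_derivative m / w\<^sup>2 * u w * s w - D / w\<^sup>2) (at w)"
     using w that by (auto intro!: derivative_eq_intros dA simp: power2_eq_square)
    thus "\<exists>z. ((\<lambda>y. A y + D / y) has_real_derivative z) (at w) \<and> z \<le> 0"
     using abs_le_D1[OF bd[of w]] w that by (intro exI conjI) (assumption, linarith)
   qed
  qed
  have D0: "D \<ge> 0" unfolding D_def B_def E_def by (auto intro!: mult_nonneg_nonneg)
  define l where "l = Sup ((\<lambda>y. A y - D / y) ` {1..})"
  have cross: "A x - D / x \<le> A y + D / y" if "x \<ge> 1" "y \<ge> 1" for x y
  proof (cases "x \<le> y")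
   case True
   from inc[OF that(1) True] have "A x - D / x \<le> A y - D / y" .
   also have "\<dots> \<le> A y + D / y" using D0 that by simp
   finally show ?thesis .
  next
   case False
   hence "A x + D / x \<le> A y + D / y" using dec[of y x] that by simp
   moreover have "A x - D / x \<le> A x + D / x" using D0 that by simp
   ultimately show ?thesis by simp
  qed
  have "\<bar>A y - l\<bar> \<le> D / y" if "y \<ge> 1" for y
  proof -
   have "bdd_above ((\<lambda>y. A y - D / y) ` {1..})"
    by (rule bdd_aboveI2[of _ _ "A 1 + D / 1"], rule cross) auto
   hence "A y - D / y \<le> l" unfolding l_def using that by (intro cSup_upper) auto
   moreover have "l \<le> A y + D / y" unfolding l_def using cross that by (intro cSup_least) auto
   ultimately show ?thesis by linarith
  qed
  thus ?thesis by blast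
 qed
 have "\<exists>l. \<forall>y\<ge>1. \<bar>(u y * cos y - u1 y * sin y) - l\<bar> \<le> D / y"
 proof (rule conv)
  show "((\<lambda>y. u y * cos y - u1 y * sin y) has_real_derivative m / y\<^sup>2 * u y * (- sin y)) (at y)" if "y \<ge> 1" for y
   using that by (auto intro!: derivative_eq_intros d d1 simp: field_simps)
 qed simp
 then obtain a where a: "\<forall>y\<ge>1. \<bar>(u y * cos y - u1 y * sin y) - a\<bar> \<le> D / y" by blast
 have "\<exists>l. \<forall>y\<ge>1. \<bar>(u y * sin y + u1 y * cos y) - l\<bar> \<le> D / y"
 proof (rule conv)
  show "((\<lambda>y. u y * sin y + u1 y * cos y) has_real_derivative m / y\<^sup>2 * u y * cos y) (at y)" if "y \<ge> 1" for y
   using that by (auto intro!: derivative_eq_intros d d1 simp: field_simps)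
 qed simp
 then obtain b where b: "\<forall>y\<ge>1. \<bar>(u y * sin y + u1 y * cos y) - b\<bar> \<le> D / y" by blast
 \<comment> \<open>Modulus and argument of a - i b merge the two limits into one shifted cosine, as
   a cos y + b sin y = r cos (y + \<phi>).\<close>
 define r where "r = cmod (Complex a (-b))"
 define \<phi> where "\<phi> = Arg (Complex a (-b))"
 have "Complex a (-b) = rcis r \<phi>" unfolding r_def \<phi>_def by (simp add: rcis_cmod_Arg)
 hence ab: "a = r * cos \<phi>" "b = - (r * sin \<phi>)" by (auto simp: complex_eq_iff)
 have "\<bar>u y - r * cos (y + \<phi>)\<bar> \<le> 2 * D / y" if "y \<ge> 1" for y
 proof -
  define p where "p = (u y * cos y - u1 y * sin y) - a"
  define q where "q = (u y * sin y + u1 y * cos y) - b"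
  have "u y = u y * (cos y * cos y + sin y * sin y)"
   using sin_cos_squared_add3[of y] by simp
  also have "\<dots> = (p + a) * cos y + (q + b) * sin y"
   unfolding p_def q_def by algebra
  also have "\<dots> = p * cos y + q * sin y + (a * cos y + b * sin y)" by (simp add: algebra_simps)
  also have "a * cos y + b * sin y = r * cos (y + \<phi>)"
   by (simp add: ab cos_add algebra_simps)
  finally have "u y - r * cos (y + \<phi>) = p * cos y + q * sin y" by simp
  also have "\<bar>\<dots>\<bar> \<le> \<bar>p\<bar> * \<bar>cos y\<bar> + \<bar>q\<bar> * \<bar>sin y\<bar>"
   by (metis abs_mult abs_triangle_ineq)
  also have "\<dots> \<le> \<bar>p\<bar> * 1 + \<bar>q\<bar> * 1" by (intro add_mono mult_left_mono) auto
  finally have "\<bar>u y - r * cos (y + \<phi>)\<bar> \<le> \<bar>p\<bar> + \<bar>q\<bar>" by simp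
  moreover have "\<bar>p\<bar> \<le> D / y" "\<bar>q\<bar> \<le> D / y" using a b that by (auto simp: p_def q_def)
  ultimately show ?thesis by (simp add: field_simps)
 qed
 thus ?thesis by blast
qed

lemma bessel_e_asymptotic_aux:
 "\<exists>r \<phi> C. \<forall>y\<ge>1. \<bar>y powr (nu + 1/2) * bessel_e nu (- (y\<^sup>2 / 4)) - r * cos (y + \<phi>)\<bar> \<le> C / y"
proof (rule perturbed_oscillator)
 fix y :: real assume y: "y > 0"
 define p where "p = y powr (nu - 3/2)"
 have p1: "y powr (nu - 1/2) = p * y" and p2: "y powr (nu + 1/2) = p * y\<^sup>2"
  using y powr_add[of y "nu - 3/2" 1] powr_add[of y "nu - 3/2" 2]
  unfolding p_def by (simp_all add: powr_numeral add.commute)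
 show "((\<lambda>y. y powr (nu + 1/2) * bessel_e nu (- (y\<^sup>2 / 4))) has_real_derivative
   (nu + 1/2) * y powr (nu - 1/2) * bessel_e nu (- (y\<^sup>2 / 4))
   - y powr (nu + 1/2) * (y / 2) * bessel_e (nu + 1) (- (y\<^sup>2 / 4))) (at y)"
  using y by (auto intro!: derivative_eq_intros)
 have 1: "((\<lambda>y. (nu + 1/2) * y powr (nu - 1/2) * bessel_e nu (- (y\<^sup>2 / 4))
   - y powr (nu + 1/2) * (y / 2) * bessel_e (nu + 1) (- (y\<^sup>2 / 4))) has_real_derivative
   ((nu + 1/2) * ((nu - 1/2) * y powr (nu - 3/2)) * bessel_e nu (- (y\<^sup>2 / 4))
    + (nu + 1/2) * y powr (nu - 1/2) * (bessel_e (nu + 1) (- (y\<^sup>2 / 4)) * - (y / 2)))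
   - (((nu + 1/2) * y powr (nu - 1/2) * (y / 2) + y powr (nu + 1/2) * (1 / 2)) * bessel_e (nu + 1) (- (y\<^sup>2 / 4))
     + y powr (nu + 1/2) * (y / 2) * (bessel_e (nu + 2) (- (y\<^sup>2 / 4)) * - (y / 2)))) (at y)"
  using y by (auto intro!: derivative_eq_intros simp: add_ac) (simp add: field_simps)
 have "((nu + 1/2) * ((nu - 1/2) * y powr (nu - 3/2)) * bessel_e nu (- (y\<^sup>2 / 4))
    + (nu + 1/2) * y powr (nu - 1/2) * (bessel_e (nu + 1) (- (y\<^sup>2 / 4)) * - (y / 2)))
   - (((nu + 1/2) * y powr (nu - 1/2) * (y / 2) + y powr (nu + 1/2) * (1 / 2)) * bessel_e (nu + 1) (- (y\<^sup>2 / 4))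
     + y powr (nu + 1/2) * (y / 2) * (bessel_e (nu + 2) (- (y\<^sup>2 / 4)) * - (y / 2)))
   = (nu\<^sup>2 - 1/4) * p * bessel_e nu (- (y\<^sup>2 / 4)) - p * y\<^sup>2 *
    ((nu + 1) * bessel_e (nu + 1) (- (y\<^sup>2 / 4)) + (- (y\<^sup>2 / 4)) * bessel_e (nu + 2) (- (y\<^sup>2 / 4)))"
  unfolding p1 p2 p_def[symmetric] by (simp add: field_simps power2_eq_square)
 also have "\<dots> = - (1 - (nu\<^sup>2 - 1/4) / y\<^sup>2) * (p * y\<^sup>2 * bessel_e nu (- (y\<^sup>2 / 4)))"
  unfolding bessel_e_recurrence[of nu "- (y\<^sup>2 / 4)", symmetric] using y by (simp add: field_simps)
 finally show "((\<lambda>y. (nu + 1/2) * y powr (nu - 1/2) * bessel_e nu (- (y\<^sup>2 / 4))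
   - y powr (nu + 1/2) * (y / 2) * bessel_e (nu + 1) (- (y\<^sup>2 / 4))) has_real_derivative
   - (1 - (nu\<^sup>2 - 1/4) / y\<^sup>2) * (y powr (nu + 1/2) * bessel_e nu (- (y\<^sup>2 / 4)))) (at y)"
  using 1 unfolding p2 by simp
qed

text \<open>The preceding estimate at y = 2 sqrt w. Amplitude and phase stay unidentified: what
  counts later is the rate of decay, the oscillation and the gain of w^(-1/2) in the error.\<close>

lemma bessel_e_asymptotic:
 "\<exists>r \<phi> C. 0 \<le> C \<and> (\<forall>w\<ge>1. \<bar>bessel_e nu (-w) - w powr (- nu / 2 - 1/4) * (r * cos (2 * sqrt w + \<phi>))\<bar>
   \<le> C * w powr (- nu / 2 - 3/4))"
proof -
 obtain r \<phi> C where *: "\<And>y. y \<ge> 1 ==>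
   \<bar>y powr (nu + 1/2) * bessel_e nu (- (y\<^sup>2 / 4)) - r * cos (y + \<phi>)\<bar> \<le> C / y"
  using bessel_e_asymptotic_aux[of nu] by blast
 define k where "k = 2 powr (- (nu + 1/2))"
 show ?thesis
 proof (intro exI conjI allI impI)
  fix w :: real assume w: "w \<ge> 1"
  define y where "y = 2 * sqrt w"
  have "sqrt w \<ge> 1" using w by simp
  hence y: "y \<ge> 1" "y\<^sup>2 / 4 = w" "y > 0" using w unfolding y_def by (linarith, simp add: power_mult_distrib, linarith)
  have yp: "y powr (- (nu + 1/2)) = k * w powr (- nu / 2 - 1/4)"
  proof -
   have "y powr (- (nu + 1/2)) = k * (w powr (1/2)) powr (- (nu + 1/2))"
    unfolding y_def k_def using w by (simp add: powr_mult powr_half_sqrt)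
   also have "(w powr (1/2)) powr (- (nu + 1/2)) = w powr (- nu / 2 - 1/4)"
    unfolding powr_powr by (rule arg_cong[where f = "\<lambda>a. w powr a"]) (simp add: field_simps)
   finally show ?thesis .
  qed
  have inv: "y powr (- (nu + 1/2)) * y powr (nu + 1/2) = 1"
   unfolding powr_add[symmetric] using y(3) by simp
  define P where "P = y powr (- (nu + 1/2))"
  have P: "P = k * w powr (- nu / 2 - 1/4)" unfolding P_def by (rule yp)
  have "bessel_e nu (-w) - P * (r * cos (y + \<phi>))
    = P * (y powr (nu + 1/2) * bessel_e nu (- (y\<^sup>2 / 4)) - r * cos (y + \<phi>))"
   using inv y(2) unfolding P_def[symmetric] by (simp add: right_diff_distrib mult.assoc[symmetric])
  also have "\<bar>\<dots>\<bar> = P * \<bar>y powr (nu + 1/2) * bessel_e nu (- (y\<^sup>2 / 4)) - r * cos (y + \<phi>)\<bar>"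
   by (simp add: abs_mult P_def)
  also have "\<dots> \<le> P * (C / y)"
   by (rule mult_left_mono[OF *[OF y(1)]]) (simp add: P_def)
  also have "\<dots> \<le> P * (\<bar>C\<bar> / y)"
   using y by (intro mult_left_mono divide_right_mono) (auto simp: P_def)
  also have "\<bar>C\<bar> / y = \<bar>C\<bar> * (w powr (-1/2) / 2)"
   using w by (simp add: y_def powr_minus_divide powr_half_sqrt)
  also have "P * (\<bar>C\<bar> * (w powr (-1/2) / 2)) = k * \<bar>C\<bar> / 2 * (w powr (- nu / 2 - 1/4) * w powr (-1/2))"
   unfolding P by simp
  also have "w powr (- nu / 2 - 1/4) * w powr (-1/2) = w powr (- nu / 2 - 3/4)"
   unfolding powr_add[symmetric] by (rule arg_cong[where f = "\<lambda>a. w powr a"]) simp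
  also have "P * (r * cos (y + \<phi>)) = w powr (- nu / 2 - 1/4) * (k * r * cos (2 * sqrt w + \<phi>))"
   unfolding P y_def by simp
  finally show "\<bar>bessel_e nu (-w) - w powr (- nu / 2 - 1/4) * (k * r * cos (2 * sqrt w + \<phi>))\<bar>
    \<le> k * \<bar>C\<bar> / 2 * w powr (- nu / 2 - 3/4)" .
 qed (simp add: k_def)
qed

text \<open>The case distinction on the sign of s is made here once, so that the kernel estimates
  can replace a base by a comparable one for exponents of unknown sign.\<close>

lemma powr_comparable:
 fixes a b k s :: real
 assumes "0 < a" "a \<le> k * b" "b \<le> k * a" "1 \<le> k"
 shows "a powr s \<le> k powr \<bar>s\<bar> * b powr s"
proof -
 have b: "b > 0" using assms by (smt (verit) mult_nonneg_nonpos)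
 show ?thesis
 proof (cases "s \<ge> 0")
  case True
  have "a powr s \<le> (k * b) powr s" using assms True by (intro powr_mono2) auto
  also have "(k * b) powr s = k powr \<bar>s\<bar> * b powr s" using True by (simp add: powr_mult)
  finally show ?thesis .
 next
  case False
  have "(k * a) powr s \<le> b powr s" using assms False b by (intro powr_mono2') auto
  hence "k powr s * a powr s \<le> b powr s" using assms by (simp add: powr_mult)
  hence "k powr (-s) * (k powr s * a powr s) \<le> k powr (-s) * b powr s" by (intro mult_left_mono) auto
  moreover have "k powr (-s) * (k powr s * a powr s) = a powr s"
   unfolding mult.assoc[symmetric] powr_add[symmetric] using assms by simp
  moreover have "\<bar>s\<bar> = -s" using False by simp
  ultimately show ?thesis by simp
 qed
qed

text \<open>Compactness of \<open>{0..1}\<close>, the asymptotics beyond 1, and the comparability of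
  \<open>max 1 w\<close> with \<open>1 + w\<close>.\<close>

lemma bessel_e_bound:
 "\<exists>C>0. \<forall>w\<ge>0. \<bar>bessel_e nu (-w)\<bar> \<le> C * (1 + w) powr (- nu / 2 - 1/4)"
proof -
 define s where "s = - nu / 2 - 1/4"
 obtain r \<phi> C where C: "C \<ge> 0" and *: "\<And>w. w \<ge> 1 ==>
   \<bar>bessel_e nu (-w) - w powr s * (r * cos (2 * sqrt w + \<phi>))\<bar> \<le> C * w powr (s - 1/2)"
 proof -
  from bessel_e_asymptotic obtain r \<phi> C where "C \<ge> 0" and *: "\<forall>w\<ge>1. \<bar>bessel_e nu (-w) - w powr (- nu / 2 - 1/4) * (r * cos (2 * sqrt w + \<phi>))\<bar>
   \<le> C * w powr (- nu / 2 - 3/4)" by blast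
  have eq: "- nu / 2 - 1/4 = s" "- nu / 2 - 3/4 = s - 1/2" by (simp_all add: s_def)
  show ?thesis using that[OF \<open>C \<ge> 0\<close>] *[unfolded eq] by blast
 qed
 have "compact ((\<lambda>w. bessel_e nu (-w)) ` {0..1})"
  by (intro compact_continuous_image continuous_intros) auto
 then obtain M where M: "\<And>w. w \<in> {0..1} ==> \<bar>bessel_e nu (-w)\<bar> \<le> M"
  by (metis (no_types, lifting) bounded_iff compact_imp_bounded image_eqI real_norm_def)
 have M0: "M \<ge> 0" using M[of 0] by simp
 define K where "K = 2 powr \<bar>s\<bar> * (M + \<bar>r\<bar> + C) + 1"
 have "K > 0" unfolding K_def using M0 C by (intro add_nonneg_pos mult_nonneg_nonneg) auto
 moreover have "\<bar>bessel_e nu (-w)\<bar> \<le> K * (1 + w) powr s" if w: "w \<ge> 0" for w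
 proof -
  have "\<bar>bessel_e nu (-w)\<bar> \<le> (M + \<bar>r\<bar> + C) * (max 1 w) powr s"
  proof (cases "w \<le> 1")
   case True
   hence "\<bar>bessel_e nu (-w)\<bar> \<le> M + \<bar>r\<bar> + C" using M[of w] w C by simp
   moreover have "max 1 w = 1" using True by simp
   ultimately show ?thesis by simp
  next
   case False
   hence w1: "w \<ge> 1" by simp
   have "\<bar>bessel_e nu (-w)\<bar> \<le> \<bar>w powr s * (r * cos (2 * sqrt w + \<phi>))\<bar> + C * w powr (s - 1/2)"
    using *[OF w1] by linarith
   also have "\<bar>w powr s * (r * cos (2 * sqrt w + \<phi>))\<bar> \<le> w powr s * (\<bar>r\<bar> * 1)"
    unfolding abs_mult by (intro mult_mono) auto
   also have "C * w powr (s - 1/2) \<le> C * w powr s"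
    using C w1 by (intro mult_left_mono powr_mono) auto
   finally have "\<bar>bessel_e nu (-w)\<bar> \<le> (\<bar>r\<bar> + C) * w powr s" by (simp add: algebra_simps)
   also have "\<dots> \<le> (M + \<bar>r\<bar> + C) * w powr s" using M0 by (intro mult_right_mono) auto
   finally show ?thesis using w1 by (simp add: max_def)
  qed
  also have "\<dots> \<le> (M + \<bar>r\<bar> + C) * (2 powr \<bar>s\<bar> * (1 + w) powr s)"
   using w M0 C by (intro mult_left_mono powr_comparable) auto
  also have "\<dots> \<le> K * (1 + w) powr s"
   unfolding K_def by (simp add: algebra_simps)
  finally show ?thesis .
 qed
 ultimately show ?thesis unfolding s_def by blast
qed

section \<open>Integrals of powers and of oscillating powers\<close>

lemma set_integrable_lborelI:
 fixes f :: "real => real"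
 assumes "f absolutely_integrable_on S" "S \<in> sets borel" "f \<in> borel_measurable borel"
 shows "set_integrable lborel S f"
proof -
 have "(\<lambda>x. indicat_real S x *\<^sub>R f x) \<in> borel_measurable lborel" using assms(2,3) by measurable
 with assms(1) show ?thesis unfolding set_integrable_def by (simp add: integrable_completion)
qed

lemma set_integrable_powr:
 fixes a c :: real
 assumes "a > -1"
 shows "set_integrable lborel {0<..<c} (\<lambda>y. y powr a)"
proof (cases "c \<ge> 0")
 case True
 have "(\<lambda>y. y powr a) absolutely_integrable_on {0..c}"
  using integrable_on_powr_from_0[OF assms True] by (intro nonnegative_absolutely_integrable_1) auto
 hence "set_integrable lborel {0..c} (\<lambda>y. y powr a)"
  by (rule set_integrable_lborelI) auto
 thus ?thesis by (rule set_integrable_subset) auto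
next
 case False
 hence "{0<..<c} = {}" by auto
 thus ?thesis by (simp add: set_integrable_def)
qed

lemma set_integrable_powr_mult_continuous:
 fixes a c :: real
 assumes "a > -1" "continuous_on UNIV b"
 shows "set_integrable lborel {0<..<c} (\<lambda>y. y powr a * b y)"
proof -
 have "compact (b ` {0..c})" by (rule compact_continuous_image[OF continuous_on_subset[OF assms(2)]]) auto
 then obtain M where M: "\<And>w. w \<in> {0..c} ==> \<bar>b w\<bar> \<le> M"
  by (metis (no_types, lifting) bounded_iff compact_imp_bounded image_eqI real_norm_def)
 have [measurable]: "b \<in> borel_measurable borel" using assms(2) by (rule borel_measurable_continuous_onI)
 have "set_integrable lborel {0<..<c} (\<lambda>y. y powr a * M)"
  by (intro set_integrable_mult_left set_integrable_powr assms)
 thus ?thesis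
 proof (rule set_integrable_bound)
  show "AE x in lborel. x \<in> {0<..<c} --> norm (x powr a * b x) \<le> norm (x powr a * M)"
  proof (intro AE_I2 impI)
   fix x assume x: "x \<in> {0<..<c}"
   hence "\<bar>b x\<bar> \<le> \<bar>M\<bar>" using M[of x] by auto
   thus "norm (x powr a * b x) \<le> norm (x powr a * M)" by (simp add: abs_mult mult_left_mono)
  qed
 qed (simp add: set_borel_measurable_def)
qed

text \<open>The product majorant makes the double integral absolutely convergent; every exchange of
  a T-integral with a Y-integral below goes through it.\<close>

lemma Fubini_product_bound:
 fixes g :: "real => real => real"
 assumes [measurable]: "case_prod g \<in> borel_measurable (lborel \<Otimes>\<^sub>M lborel)"
  and f: "integrable lborel \<phi>" "integrable lborel \<psi>" and bound: "\<And>T Y. \<bar>g T Y\<bar> \<le> \<phi> T * \<psi> Y"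
 shows "integrable lborel (\<lambda>T. LINT Y|lborel. g T Y)"
  and "(LINT T|lborel. LINT Y|lborel. g T Y) = (LINT Y|lborel. LINT T|lborel. g T Y)"
proof -
 have [measurable]: "\<phi> \<in> borel_measurable lborel" "\<psi> \<in> borel_measurable lborel"
  using f by (auto simp: borel_measurable_integrable)
 have "integrable (lborel \<Otimes>\<^sub>M lborel) (\<lambda>(T,Y). \<phi> T * \<psi> Y)"
 proof (rule lborel_pair.Fubini_integrable)
  have "integrable lborel (\<lambda>T. norm (\<phi> T) * (\<integral>Y. norm (\<psi> Y) \<partial>lborel))" using f by simp
  thus "integrable lborel (\<lambda>T. \<integral>Y. norm (case (T,Y) of (T,Y) => \<phi> T * \<psi> Y) \<partial>lborel)"
   by (simp add: abs_mult)
 qed (use f in auto)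
 hence g: "integrable (lborel \<Otimes>\<^sub>M lborel) (case_prod g)"
 proof (rule Bochner_Integration.integrable_bound)
  show "AE p in lborel \<Otimes>\<^sub>M lborel. norm (case_prod g p) \<le> norm (case p of (T,Y) => \<phi> T * \<psi> Y)"
   by (intro AE_I2) (auto intro: order_trans[OF bound abs_ge_self])
 qed simp
 show "integrable lborel (\<lambda>T. LINT Y|lborel. g T Y)"
  using lborel_pair.integrable_fst'[OF g] by simp
 show "(LINT T|lborel. LINT Y|lborel. g T Y) = (LINT Y|lborel. LINT T|lborel. g T Y)"
  by (rule lborel_pair.Fubini_integral[OF g, symmetric])
qed

text \<open>Integration by parts: the derivative of sin (2 om sqrt y + \<phi>) carries the factor om
  / sqrt y, so \<open>f\<close> is the derivative of \<open>F\<close> up to \<open>r\<close>, where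
  the power is differentiated. As s > 0, the integral of |r| is at most (a^(-s) - b^(-s)) / |om|,
  and its second term cancels the boundary term at b.\<close>

lemma oscillatory_integral_bound:
 fixes s om \<phi> a b :: real
 assumes s: "s > 0" and om: "om \<noteq> 0" and ab: "0 < a" "a \<le> b"
 shows "\<bar>integral {a..b} (\<lambda>y. y powr (- s - 1/2) * cos (2 * om * sqrt y + \<phi>))\<bar> \<le> 2 * a powr (-s) / \<bar>om\<bar>"
proof -
 define F where "F y = y powr (-s) * sin (2 * om * sqrt y + \<phi>) / om" for y
 define f where "f y = y powr (- s - 1/2) * cos (2 * om * sqrt y + \<phi>)" for y
 define r where "r y = s * y powr (- s - 1) * sin (2 * om * sqrt y + \<phi>) / om" for y
 have dF: "(F has_real_derivative (f y - r y)) (at y)" if y: "y > 0" for y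
 proof -
  have "((\<lambda>y. y powr (-s) * sin (2 * om * sqrt y + \<phi>) / om) has_real_derivative
    ((-s) * y powr (-s - 1) * sin (2 * om * sqrt y + \<phi>)
     + cos (2 * om * sqrt y + \<phi>) * (2 * om * (inverse (sqrt y) / 2)) * y powr (-s)) / om) (at y)"
   using y om by (auto intro!: derivative_eq_intros)
  moreover have "y powr (-s) * inverse (sqrt y) = y powr (- s - 1/2)"
   using y powr_add[of y "-s" "-1/2"] by (simp add: powr_minus powr_half_sqrt)
  hence "((-s) * y powr (-s - 1) * sin (2 * om * sqrt y + \<phi>)
     + cos (2 * om * sqrt y + \<phi>) * (2 * om * (inverse (sqrt y) / 2)) * y powr (-s)) / om = f y - r y"
   unfolding f_def r_def using om by (simp add: add_divide_distrib diff_divide_distrib mult_ac)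
  ultimately show ?thesis unfolding F_def[abs_def] by simp
 qed
 have cr: "continuous_on {a..b} r" unfolding r_def using ab om by (auto intro!: continuous_intros)
 have "((\<lambda>y. f y - r y) has_integral (F b - F a)) {a..b}"
  using ab dF by (intro fundamental_theorem_of_calculus)
   (auto simp: has_real_derivative_iff_has_vector_derivative[symmetric] intro: has_field_derivative_at_within)
 moreover have r: "(r has_integral (integral {a..b} r)) {a..b}"
  by (intro integrable_integral integrable_continuous_real cr)
 ultimately have "((\<lambda>y. (f y - r y) + r y) has_integral (F b - F a + integral {a..b} r)) {a..b}"
  by (rule has_integral_add)
 hence "integral {a..b} f = F b - F a + integral {a..b} r" by (simp add: integral_unique)
 moreover have "\<bar>F y\<bar> \<le> y powr (-s) / \<bar>om\<bar>" for y
  unfolding F_def by (simp add: abs_mult divide_right_mono mult_left_le)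
 moreover have "\<bar>integral {a..b} r\<bar> \<le> (a powr (-s) - b powr (-s)) / \<bar>om\<bar>"
 proof -
  define k where "k = 1 / \<bar>om\<bar>"
  have P: "((\<lambda>y. k * (s * y powr (- s - 1))) has_integral (k * (- (b powr (-s))) - k * (- (a powr (-s))))) {a..b}"
   using ab by (intro fundamental_theorem_of_calculus)
    (auto simp: has_real_derivative_iff_has_vector_derivative[symmetric] intro!: derivative_eq_intros)
  have "norm (r y) \<le> k * (s * y powr (- s - 1))" for y
   unfolding r_def k_def using s by (simp add: abs_mult divide_right_mono mult_left_le)
  hence "norm (integral {a..b} r) \<le> integral {a..b} (\<lambda>y. k * (s * y powr (- s - 1)))"
   by (intro integral_norm_bound_integral has_integral_integrable[OF r] has_integral_integrable[OF P]) auto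
  also have "\<dots> = k * (- (b powr (-s))) - k * (- (a powr (-s)))" using P by (rule integral_unique)
  finally have "\<bar>integral {a..b} r\<bar> \<le> k * (a powr (-s)) - k * b powr (-s)" by simp
  thus ?thesis by (simp add: diff_divide_distrib k_def)
 qed
 moreover have "b powr (-s) / \<bar>om\<bar> + a powr (-s) / \<bar>om\<bar> + (a powr (-s) - b powr (-s)) / \<bar>om\<bar> = 2 * a powr (-s) / \<bar>om\<bar>"
  by (simp add: diff_divide_distrib)
 ultimately have "\<bar>integral {a..b} f\<bar> \<le> 2 * a powr (-s) / \<bar>om\<bar>" by (smt (verit))
 thus ?thesis unfolding f_def .
qed

section \<open>The integral of a triple product and its derivative\<close>

text \<open>
 The substitution \<open>Y = (y / 2)\<^sup>2\<close> turns the integral in the kernel into that of \<open>triple\<close> with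
 \<open>X = x\<^sup>2\<close>, \<open>Z = z\<^sup>2\<close> and \<open>T = t\<^sup>2\<close>, up to a constant factor.
\<close>
definition triple :: "real => real => real => real => real => real => real" where
 "triple al nu X Z T Y = Y powr al * (bessel_e nu (-(T*Y)) * bessel_e al (-(X*Y)) * bessel_e al (-(Z*Y)))"

definition triple_int :: "real => real => real => real => real => real => real" where
 "triple_int al nu X Z T rho = (LINT Y:{0<..<rho}|lborel. triple al nu X Z T Y)"

lemma triple_measurable [measurable]: "triple al nu X Z T \<in> borel_measurable borel"
 unfolding triple_def[abs_def] by measurable

lemma set_integrable_triple:
 "al > -1 ==> set_integrable lborel {0<..<rho} (triple al nu X Z T)"
 unfolding triple_def by (intro set_integrable_powr_mult_continuous continuous_intros)

text \<open>One envelope E serves the function, its leading cosine and, with the gain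
  \<open>Y powr (-1/2)\<close>, their difference; in this shape three factors can be multiplied by
  \<open>product3_diff_bound\<close>.\<close>

definition cos_approx :: "real => real => real => real => real => real => bool" where
 "cos_approx \<mu> c \<phi> M S Y \<longleftrightarrow> (let E = M * Y powr (-\<mu>/2-1/4); A = Y powr (-\<mu>/2-1/4) * (c * cos (2 * sqrt S * sqrt Y + \<phi>)) in
   \<bar>bessel_e \<mu> (-(S*Y))\<bar> \<le> E \<and> \<bar>A\<bar> \<le> E \<and> \<bar>c\<bar> \<le> M \<and> \<bar>bessel_e \<mu> (-(S*Y)) - A\<bar> \<le> E * Y powr (-1/2))"

text \<open>Uniformity over a compact range of S comes from bounding S^s and S^(s - 1/2) by their
  endpoint values. A true interval is needed for S = T only; for x^2 and z^2 the range is a single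
  point.\<close>

lemma bessel_e_scaled_asymptotic:
 assumes S1: "0 < S1"
 shows "\<exists>c \<phi> M. M \<ge> 0 \<and> (\<forall>S Y. S1 \<le> S --> S \<le> S2 --> 1 / S1 \<le> Y --> cos_approx \<mu> (c S) \<phi> M S Y)"
proof -
 define s where "s = -\<mu>/2-1/4"
 have s': "-\<mu>/2-3/4 = s - 1/2" by (simp add: s_def)
 from bessel_e_asymptotic[of \<mu>] obtain r \<phi> C where C: "C \<ge> 0" and
  *: "\<forall>w\<ge>1. \<bar>bessel_e \<mu> (-w) - w powr s * (r * cos (2 * sqrt w + \<phi>))\<bar> \<le> C * w powr (s - 1/2)"
  unfolding s_def[symmetric] s' by blast
 define P where "P = S1 powr s + S2 powr s + S1 powr (s - 1/2) + S2 powr (s - 1/2)"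
 have P: "S powr a \<le> P" if "S1 \<le> S" "S \<le> S2" "a = s \<or> a = s - 1/2" for S a
 proof -
  have "S powr a \<le> S1 powr a + S2 powr a"
  proof (cases "a \<ge> 0")
   case True
   hence "S powr a \<le> S2 powr a" using that S1 by (intro powr_mono2) auto
   thus ?thesis by (simp add: add_increasing)
  next
   case False
   hence "S powr a \<le> S1 powr a" using that S1 by (intro powr_mono2') auto
   thus ?thesis by (simp add: add_increasing2)
  qed
  also have "\<dots> \<le> P" using that(3) by (auto simp: P_def)
  finally show ?thesis .
 qed
 define K where "K = P * \<bar>r\<bar> + P * C * (1 + S1 powr (1/2))"
 have P0: "P \<ge> 0" by (simp add: P_def)
 have K0: "K \<ge> 0" unfolding K_def using P0 C by auto
 show ?thesis unfolding cos_approx_def s_def[symmetric] Let_def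
 proof (rule exI[of _ "\<lambda>S. S powr s * r"], rule exI[of _ \<phi>], rule exI[of _ K], intro conjI allI impI)
  fix S Y assume S: "S1 \<le> S" "S \<le> S2" and Y: "1 / S1 \<le> Y"
  have Y0: "Y > 0" and S0: "S > 0" using S S1 Y by (smt (verit) divide_pos_pos zero_less_one)+
  have "1 \<le> S1 * Y" using Y S1 by (simp add: field_simps)
  also have "\<dots> \<le> S * Y" using S Y0 by (intro mult_right_mono) auto
  finally have SY: "S * Y \<ge> 1" .
  define A where "A = Y powr s * (S powr s * r * cos (2 * sqrt S * sqrt Y + \<phi>))"
  have "\<bar>S powr s * r\<bar> \<le> P * \<bar>r\<bar>" using P[OF S] by (simp add: abs_mult mult_right_mono)
  thus r: "\<bar>S powr s * r\<bar> \<le> K" unfolding K_def using P0 C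
   by (smt (verit) mult_nonneg_nonneg powr_ge_zero)
  have rc: "\<bar>S powr s * r * cos (2 * sqrt S * sqrt Y + \<phi>)\<bar> \<le> P * \<bar>r\<bar>"
   using \<open>\<bar>S powr s * r\<bar> \<le> P * \<bar>r\<bar>\<close> mult_left_le[of "\<bar>cos (2 * sqrt S * sqrt Y + \<phi>)\<bar>" "\<bar>S powr s * r\<bar>"]
   by (simp add: abs_mult)
  have A: "\<bar>A\<bar> \<le> P * \<bar>r\<bar> * Y powr s"
   unfolding A_def abs_mult[of "Y powr s"] using mult_left_mono[OF rc, of "Y powr s"] by (simp add: mult_ac)
  have "P * \<bar>r\<bar> \<le> K" unfolding K_def using P0 C by simp
  hence "P * \<bar>r\<bar> * Y powr s \<le> K * Y powr s" by (rule mult_right_mono) simp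
  with A show "\<bar>Y powr s * (S powr s * r * cos (2 * sqrt S * sqrt Y + \<phi>))\<bar> \<le> K * Y powr s"
   unfolding A_def by linarith
  have "\<bar>bessel_e \<mu> (-(S*Y)) - A\<bar> \<le> C * (S * Y) powr (s - 1/2)"
   using *[rule_format, OF SY] S0 Y0 by (simp add: A_def powr_mult real_sqrt_mult mult_ac)
  also have "\<dots> = C * S powr (s - 1/2) * (Y powr s * Y powr (-1/2))"
   using S0 Y0 powr_add[of Y s "-1/2"] by (simp add: powr_mult)
  also have "\<dots> \<le> C * P * (Y powr s * Y powr (-1/2))"
   using P[OF S, of "s - 1/2"] C by (intro mult_right_mono mult_left_mono) auto
  finally have d: "\<bar>bessel_e \<mu> (-(S*Y)) - A\<bar> \<le> C * P * (Y powr s * Y powr (-1/2))" .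
  also have "C * P \<le> K" unfolding K_def using P0 C by (simp add: algebra_simps)
  hence "C * P * (Y powr s * Y powr (-1/2)) \<le> K * (Y powr s * Y powr (-1/2))" by (intro mult_right_mono) auto
  finally show "\<bar>bessel_e \<mu> (-(S*Y)) - Y powr s * (S powr s * r * cos (2 * sqrt S * sqrt Y + \<phi>))\<bar>
    \<le> K * Y powr s * Y powr (-1/2)" by (simp add: A_def mult_ac)
  have "Y powr (-1/2) \<le> (1 / S1) powr (-1/2)" using Y S1 by (intro powr_mono2') auto
  also have "\<dots> = S1 powr (1/2)" using S1 by (simp add: powr_divide powr_minus_divide)
  finally have "C * P * (Y powr s * Y powr (-1/2)) \<le> C * P * (Y powr s * S1 powr (1/2))"
   using C P0 by (intro mult_left_mono) auto
  with d A have "\<bar>bessel_e \<mu> (-(S*Y))\<bar> \<le> P * \<bar>r\<bar> * Y powr s + C * P * (Y powr s * S1 powr (1/2))" by linarith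
  also have "\<dots> \<le> K * Y powr s" unfolding K_def using C P0 by (simp add: algebra_simps)
  finally show "\<bar>bessel_e \<mu> (-(S*Y))\<bar> \<le> K * Y powr s" .
 qed (rule K0)
qed

text \<open>Telescoping: the factors are exchanged one at a time while the others are bounded by
  their envelopes.\<close>

lemma product3_diff_bound:
 fixes e1 e2 e3 a1 a2 a3 E1 E2 E3 q :: real
 assumes e: "\<bar>e1\<bar> \<le> E1" "\<bar>e2\<bar> \<le> E2" "\<bar>e3\<bar> \<le> E3" and a: "\<bar>a1\<bar> \<le> E1" "\<bar>a2\<bar> \<le> E2" "\<bar>a3\<bar> \<le> E3"
  and d: "\<bar>e1 - a1\<bar> \<le> E1 * q" "\<bar>e2 - a2\<bar> \<le> E2 * q" "\<bar>e3 - a3\<bar> \<le> E3 * q"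
 shows "\<bar>e1 * e2 * e3 - a1 * a2 * a3\<bar> \<le> 3 * (E1 * E2 * E3) * q"
proof -
 note nn = order_trans[OF abs_ge_zero e(1)] order_trans[OF abs_ge_zero e(2)] order_trans[OF abs_ge_zero e(3)]
  order_trans[OF abs_ge_zero d(1)] order_trans[OF abs_ge_zero d(2)] order_trans[OF abs_ge_zero d(3)]
 have *: "\<bar>u * (v * w)\<bar> \<le> U * (V * W)"
  if "\<bar>u\<bar> \<le> U" "\<bar>v\<bar> \<le> V" "\<bar>w\<bar> \<le> W" "0 \<le> U" "0 \<le> V" "0 \<le> W" for u v w U V W :: real
  unfolding abs_mult by (intro mult_mono mult_nonneg_nonneg that abs_ge_zero)
 have "e1 * e2 * e3 - a1 * a2 * a3 = (e1 - a1) * (e2 * e3) + a1 * ((e2 - a2) * e3) + a1 * (a2 * (e3 - a3))"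
  by (simp add: algebra_simps)
 also have "\<bar>\<dots>\<bar> \<le> \<bar>(e1 - a1) * (e2 * e3)\<bar> + \<bar>a1 * ((e2 - a2) * e3)\<bar> + \<bar>a1 * (a2 * (e3 - a3))\<bar>"
  by linarith
 also have "\<dots> \<le> (E1 * q) * (E2 * E3) + E1 * ((E2 * q) * E3) + E1 * (E2 * (E3 * q))"
  by (intro add_mono * d e a nn)
 finally show ?thesis by (simp add: mult_ac)
qed

lemma cos_product3:
 fixes a b c :: real
 shows "cos a * cos b * cos c = (cos (a + b + c) + cos (a + b - c) + cos (a - b + c) + cos (a - b - c)) / 4"
 by (simp add: cos_add cos_diff sin_add sin_diff algebra_simps)

text \<open>The product of the three leading cosines is a sum of four with frequencies sqrt T
  \<plusminus> x \<plusminus> z, which the hypothesis keeps away from 0. The powers of Y multiply to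
  Y^(-sg - 1/2) with sg = nu/2 + 1/4, positive because nu > -1/2: the oscillatory part is then
  O(a^(-sg)) by integration by parts, and the error, of size Y^(-sg - 1), is absolutely integrable
  with the same bound.\<close>

lemma triple_tail:
 assumes nu: "nu > -1/2" and x: "x > 0" and z: "z > 0" and T1: "0 < T1" and om0: "om0 > 0"
  and om: "\<And>T. T1 \<le> T ==> T \<le> T2 ==> om0 \<le> \<bar>sqrt T + x + z\<bar> \<and> om0 \<le> \<bar>sqrt T + x - z\<bar> \<and>
    om0 \<le> \<bar>sqrt T - x + z\<bar> \<and> om0 \<le> \<bar>sqrt T - x - z\<bar>"
 shows "\<exists>C Y0. Y0 > 0 \<and> C \<ge> 0 \<and> (\<forall>T\<in>{T1..T2}. \<forall>a b. Y0 \<le> a --> a \<le> b -->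
      \<bar>integral {a..b} (triple al nu (x\<^sup>2) (z\<^sup>2) T)\<bar> \<le> C * a powr (-nu/2-1/4))"
proof -
 define m n sg where "m = -nu/2-1/4" and "n = -al/2-1/4" and "sg = -m"
 have sg: "sg > 0" and exps: "al + m + n + n = - sg - 1/2" using nu by (auto simp: sg_def m_def n_def)
 have x2: "0 < x\<^sup>2" and z2: "0 < z\<^sup>2" using x z by auto
 obtain C1 f1 M1 where 1: "M1 \<ge> 0" "\<And>S Y. T1 \<le> S ==> S \<le> T2 ==> 1 / T1 \<le> Y ==> cos_approx nu (C1 S) f1 M1 S Y"
  using bessel_e_scaled_asymptotic[OF T1, of T2 nu] by blast
 obtain c2 f2 M2 where 2: "M2 \<ge> 0" "\<And>Y. 1 / x\<^sup>2 \<le> Y ==> cos_approx al c2 f2 M2 (x\<^sup>2) Y"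
  using bessel_e_scaled_asymptotic[OF x2, of "x\<^sup>2" al] by blast
 obtain c3 f3 M3 where 3: "M3 \<ge> 0" "\<And>Y. 1 / z\<^sup>2 \<le> Y ==> cos_approx al c3 f3 M3 (z\<^sup>2) Y"
  using bessel_e_scaled_asymptotic[OF z2, of "z\<^sup>2" al] by blast
 define Y0 where "Y0 = max (1/T1) (max (1/x\<^sup>2) (1/z\<^sup>2))"
 have Y0: "Y0 > 0" "1/T1 \<le> Y0" "1/x\<^sup>2 \<le> Y0" "1/z\<^sup>2 \<le> Y0" using T1 by (auto simp: Y0_def less_max_iff_disj)
 define M where "M = M1 * M2 * M3"
 have M: "M \<ge> 0" using 1 2 3 by (simp add: M_def)
 define h where "h v f Y = Y powr (- sg - 1/2) * cos (2 * v * sqrt Y + f)" for v f Y :: real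
 have "\<bar>integral {a..b} (triple al nu (x\<^sup>2) (z\<^sup>2) T)\<bar> \<le> (2 * M / om0 + 3 * M / sg) * a powr (-sg)"
  if T: "T1 \<le> T" "T \<le> T2" and ab: "Y0 \<le> a" "a \<le> b" for T a b
 proof -
  have a0: "a > 0" using ab Y0 by linarith
  define c1 where "c1 = C1 T"
  note app = 1(2)[OF T, folded c1_def] 2(2) 3(2)
  note cos_def = cos_approx_def Let_def m_def[symmetric] n_def[symmetric]
  have c: "\<bar>c1 * c2 * c3\<bar> \<le> M" unfolding M_def abs_mult
   using app(1)[of Y0, OF Y0(2)] app(2)[of Y0, OF Y0(3)] app(3)[of Y0, OF Y0(4)] 1(1) 2(1) 3(1) unfolding cos_def by (intro mult_mono) auto
  define w where "w Y = c1 * c2 * c3 / 4 * (h (sqrt T + x + z) (f1 + f2 + f3) Y + h (sqrt T + x - z) (f1 + f2 - f3) Y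
    + h (sqrt T - x + z) (f1 - f2 + f3) Y + h (sqrt T - x - z) (f1 - f2 - f3) Y)" for Y
  have diff: "\<bar>triple al nu (x\<^sup>2) (z\<^sup>2) T Y - w Y\<bar> \<le> 3 * M * Y powr (-sg - 1)" if Y: "a \<le> Y" for Y
  proof -
   have Yp: "Y > 0" and YY: "1/T1 \<le> Y" "1/x\<^sup>2 \<le> Y" "1/z\<^sup>2 \<le> Y" using a0 Y ab Y0 by linarith+
   define A1 A2 A3 where "A1 = Y powr m * (c1 * cos (2 * sqrt T * sqrt Y + f1))"
    and "A2 = Y powr n * (c2 * cos (2 * x * sqrt Y + f2))" and "A3 = Y powr n * (c3 * cos (2 * z * sqrt Y + f3))"
   define e where "e = bessel_e nu (-(T*Y)) * bessel_e al (-(x\<^sup>2*Y)) * bessel_e al (-(z\<^sup>2*Y))"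
   have d: "\<bar>e - A1 * A2 * A3\<bar> \<le> 3 * ((M1 * Y powr m) * (M2 * Y powr n) * (M3 * Y powr n)) * Y powr (-1/2)"
    using app(1)[OF YY(1)] app(2)[OF YY(2)] app(3)[OF YY(3)] x z unfolding cos_def A1_def A2_def A3_def e_def
    by (intro product3_diff_bound) auto
   have e: "Y powr al * Y powr m * Y powr n * Y powr n = Y powr (- sg - 1/2)"
    unfolding powr_add[symmetric] exps ..
   have "Y powr al * (A1 * A2 * A3) = (Y powr al * Y powr m * Y powr n * Y powr n) * (c1 * c2 * c3) *
     (cos (2 * sqrt T * sqrt Y + f1) * cos (2 * x * sqrt Y + f2) * cos (2 * z * sqrt Y + f3))"
    unfolding A1_def A2_def A3_def by (simp only: mult_ac)
   also have "\<dots> = w Y" unfolding w_def e cos_product3 h_def by (simp add: algebra_simps)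
   finally have "triple al nu (x\<^sup>2) (z\<^sup>2) T Y - w Y = Y powr al * (e - A1 * A2 * A3)"
    by (simp add: triple_def e_def algebra_simps)
   hence "\<bar>triple al nu (x\<^sup>2) (z\<^sup>2) T Y - w Y\<bar> = Y powr al * \<bar>e - A1 * A2 * A3\<bar>" by (simp add: abs_mult)
   also have "\<dots> \<le> Y powr al * (3 * ((M1 * Y powr m) * (M2 * Y powr n) * (M3 * Y powr n)) * Y powr (-1/2))"
    using d by (rule mult_left_mono) simp
   also have "\<dots> = 3 * M * ((Y powr al * Y powr m * Y powr n * Y powr n) * Y powr (-1/2))"
    by (simp add: M_def mult_ac)
   also have "\<dots> = 3 * M * Y powr (-sg - 1)" unfolding e by (simp only: powr_add[symmetric]) (simp add: algebra_simps)
   finally show ?thesis .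
  qed
  have osc: "\<bar>integral {a..b} (h v f)\<bar> \<le> 2 * a powr (-sg) / om0" if "om0 \<le> \<bar>v\<bar>" for v f
  proof -
   have "\<bar>integral {a..b} (h v f)\<bar> \<le> 2 * a powr (-sg) / \<bar>v\<bar>"
    using oscillatory_integral_bound[OF sg _ a0 ab(2), of v f] that om0 by (auto simp: h_def[abs_def])
   also have "\<dots> \<le> 2 * a powr (-sg) / om0" using that om0 by (intro divide_left_mono) auto
   finally show ?thesis .
  qed
  have ic: "h v f integrable_on {a..b}" for v f
   unfolding h_def[abs_def] using a0 by (intro integrable_continuous_real continuous_intros) auto
  have iw: "w integrable_on {a..b}" unfolding w_def[abs_def] by (intro integrable_on_mult_right integrable_add ic)
  have it: "triple al nu (x\<^sup>2) (z\<^sup>2) T integrable_on {a..b}" unfolding triple_def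
   using a0 by (intro integrable_continuous_real continuous_intros) auto
  have "integral {a..b} w = c1 * c2 * c3 / 4 * (integral {a..b} (h (sqrt T + x + z) (f1 + f2 + f3)) + integral {a..b} (h (sqrt T + x - z) (f1 + f2 - f3))
    + integral {a..b} (h (sqrt T - x + z) (f1 - f2 + f3)) + integral {a..b} (h (sqrt T - x - z) (f1 - f2 - f3)))"
   (is "_ = _ * ?i")
   unfolding w_def by (simp only: Henstock_Kurzweil_Integration.integral_mult_right
    Henstock_Kurzweil_Integration.integral_add ic integrable_add)
  also have "\<bar>\<dots>\<bar> \<le> M / 4 * (4 * (2 * a powr (-sg) / om0))"
  proof -
   have "\<bar>?i\<bar> \<le> 4 * (2 * a powr (-sg) / om0)"
    using osc[of "sqrt T + x + z" "f1 + f2 + f3"] osc[of "sqrt T + x - z" "f1 + f2 - f3"]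
     osc[of "sqrt T - x + z" "f1 - f2 + f3"] osc[of "sqrt T - x - z" "f1 - f2 - f3"] om[OF T] by linarith
   thus ?thesis unfolding abs_mult[of "c1 * c2 * c3 / 4"] using c M by (intro mult_mono) auto
  qed
  finally have W: "\<bar>integral {a..b} w\<bar> \<le> 2 * M / om0 * a powr (-sg)" by simp
  have P: "((\<lambda>y. 3 * M * y powr (- sg - 1)) has_integral (3 * M * (- (b powr (-sg)) / sg) - 3 * M * (- (a powr (-sg)) / sg))) {a..b}"
   using ab a0 sg by (intro fundamental_theorem_of_calculus)
    (auto simp: has_real_derivative_iff_has_vector_derivative[symmetric] intro!: derivative_eq_intros)
  have "norm (integral {a..b} (\<lambda>Y. triple al nu (x\<^sup>2) (z\<^sup>2) T Y - w Y)) \<le> integral {a..b} (\<lambda>y. 3 * M * y powr (- sg - 1))"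
   using diff by (intro integral_norm_bound_integral integrable_diff it iw has_integral_integrable[OF P]) auto
  also have "\<dots> \<le> 3 * M / sg * a powr (-sg)" unfolding integral_unique[OF P] using sg M by simp
  also have "integral {a..b} (\<lambda>Y. triple al nu (x\<^sup>2) (z\<^sup>2) T Y - w Y)
    = integral {a..b} (triple al nu (x\<^sup>2) (z\<^sup>2) T) - integral {a..b} w"
   by (intro integral_diff it iw)
  finally show ?thesis using W by (simp add: algebra_simps)
 qed
 moreover have "2 * M / om0 + 3 * M / sg \<ge> 0" using M om0 sg by simp
 moreover have "-nu/2-1/4 = -sg" by (simp add: sg_def m_def)
 ultimately show ?thesis using Y0(1) by (intro exI[of _ "2 * M / om0 + 3 * M / sg"] exI[of _ Y0]) auto
qed

text \<open>The chain rule followed by \<open>bessel_e_recurrence\<close>. This identity drives the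
  descent: a derivative in T lowers nu by one without producing a factor Y.\<close>

lemma DERIV_powr_bessel_e:
 assumes "T > 0"
 shows "((\<lambda>T. T powr (nu + 1) * bessel_e (nu + 1) (-(T*Y))) has_real_derivative T powr nu * bessel_e nu (-(T*Y))) (at T)"
proof -
 have "((\<lambda>T. T powr (nu + 1) * bessel_e (nu + 1) (-(T*Y))) has_real_derivative
   (nu + 1) * T powr nu * bessel_e (nu + 1) (-(T*Y)) + T powr (nu + 1) * (bessel_e (nu + 2) (-(T*Y)) * -Y)) (at T)"
  using assms by (auto intro!: derivative_eq_intros simp: add_ac)
 moreover have "T powr (nu + 1) = T powr nu * T" using assms by (simp add: powr_add)
 ultimately show ?thesis unfolding bessel_e_recurrence[of nu] by (simp add: algebra_simps)
qed

lemma triple_int_measurable [measurable]: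
 "(\<lambda>T. triple_int al nu X Z T rho) \<in> borel_measurable borel"
 unfolding triple_int_def set_lebesgue_integral_def triple_def by measurable

lemma continuous_bounded_Icc_prod:
 fixes f :: "real => real"
 assumes "continuous_on UNIV f"
 obtains M where "M \<ge> 0" "\<And>w. a \<le> w ==> w \<le> b ==> \<bar>f w\<bar> \<le> M"
proof -
 have "compact (f ` {a..b})" by (rule compact_continuous_image[OF continuous_on_subset[OF assms]]) auto
 then obtain M where "\<And>w. w \<in> {a..b} ==> \<bar>f w\<bar> \<le> M"
  by (metis (no_types, lifting) bounded_iff compact_imp_bounded image_eqI real_norm_def)
 with that[of "max M 0"] show ?thesis by fastforce
qed

text \<open>For a bounded cutoff rho the argument T Y stays in a compact set, so one integrable
  majorant serves all T up to T2.\<close>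

lemma triple_dominated:
 assumes al: "al > -1"
 obtains w where "integrable lborel w" "\<And>T Y. 0 \<le> T ==> T \<le> T2 ==> norm (indicator {0<..<rho} Y *\<^sub>R triple al nu X Z T Y) \<le> w Y"
proof -
 define b where "b Y = bessel_e al (-(X*Y)) * bessel_e al (-(Z*Y))" for Y
 obtain M where M: "M \<ge> 0" "\<And>w. - (T2 * rho) \<le> w ==> w \<le> 0 ==> \<bar>bessel_e nu w\<bar> \<le> M"
  using continuous_bounded_Icc_prod[OF continuous_on_bessel_e[OF continuous_on_id], of "- (T2 * rho)" 0 nu] by blast
 have "set_integrable lborel {0<..<rho} (\<lambda>Y. Y powr al * (M * b Y))" unfolding b_def
  by (intro set_integrable_powr_mult_continuous[OF al] continuous_intros)
 hence "integrable lborel (\<lambda>Y. norm (indicator {0<..<rho} Y *\<^sub>R (Y powr al * (M * b Y))))"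
  unfolding set_integrable_def by (rule integrable_norm)
 thus ?thesis
 proof (rule that)
  fix T Y assume T: "0 \<le> T" "T \<le> T2"
  show "norm (indicator {0<..<rho} Y *\<^sub>R triple al nu X Z T Y) \<le> norm (indicator {0<..<rho} Y *\<^sub>R (Y powr al * (M * b Y)))"
  proof (cases "Y \<in> {0<..<rho}")
   case True
   have "T * Y \<le> T2 * rho" using True T by (intro mult_mono) auto
   hence "\<bar>bessel_e nu (-(T * Y))\<bar> \<le> M" using M(2)[of "-(T * Y)"] T True by simp
   hence "\<bar>bessel_e nu (-(T * Y))\<bar> * \<bar>b Y\<bar> \<le> M * \<bar>b Y\<bar>" by (rule mult_right_mono) simp
   with True M(1) show ?thesis unfolding triple_def b_def
    by (simp add: abs_mult mult.assoc mult_left_mono)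
  qed simp
 qed
qed

lemma triple_int_continuous:
 assumes al: "al > -1" and T12: "0 \<le> T1"
 shows "continuous_on {T1..T2} (\<lambda>T. triple_int al nu X Z T rho)"
proof (rule continuous_on_sequentiallyI)
 fix u :: "nat => real" and T assume u: "\<forall>n. u n \<in> {T1..T2}" and T: "T \<in> {T1..T2}" "u \<longlonglongrightarrow> T"
 obtain w where w: "integrable lborel w" "\<And>T Y. 0 \<le> T ==> T \<le> T2 ==> norm (indicator {0<..<rho} Y *\<^sub>R triple al nu X Z T Y) \<le> w Y"
  by (rule triple_dominated[OF al]) blast
 have "(\<lambda>n. triple al nu X Z (u n) Y) \<longlonglongrightarrow> triple al nu X Z T Y" for Y
  unfolding triple_def using T(2) by (intro tendsto_intros isCont_tendsto_compose[OF isCont_bessel_e])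
 moreover have "norm (indicator {0<..<rho} Y *\<^sub>R triple al nu X Z (u n) Y) \<le> w Y" for n Y
  using u[rule_format, of n] T12 by (intro w(2)) auto
 ultimately show "(\<lambda>n. triple_int al nu X Z (u n) rho) \<longlonglongrightarrow> triple_int al nu X Z T rho"
  unfolding triple_int_def set_lebesgue_integral_def
  by (intro integral_dominated_convergence[OF _ _ w(1)] AE_I2 tendsto_intros) (use triple_measurable in auto)
qed

text \<open>\<open>DERIV_powr_bessel_e\<close> integrated over T, with Fubini on a bounded
  rectangle. The cutoff rho is kept so that convergence at infinity is not yet an issue.\<close>

lemma triple_int_FTC:
 assumes al: "al > -1" and T1: "0 < T1" and T12: "T1 \<le> T2"
 shows "((\<lambda>T. T powr nu * triple_int al nu X Z T rho) has_integral
   (T2 powr (nu + 1) * triple_int al (nu + 1) X Z T2 rho - T1 powr (nu + 1) * triple_int al (nu + 1) X Z T1 rho)) {T1..T2}"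
proof -
 define b where "b Y = bessel_e al (-(X*Y)) * bessel_e al (-(Z*Y))" for Y
 define g where "g T Y = indicator {T1..T2} T * indicator {0<..<rho} Y * (T powr nu * triple al nu X Z T Y)" for T Y
 have [measurable]: "case_prod g \<in> borel_measurable (lborel \<Otimes>\<^sub>M lborel)"
  unfolding g_def triple_def by measurable
 obtain w where w: "integrable lborel w" "\<And>T Y. 0 \<le> T ==> T \<le> T2 ==> norm (indicator {0<..<rho} Y *\<^sub>R triple al nu X Z T Y) \<le> w Y"
  by (rule triple_dominated[OF al]) blast
 have iT: "set_integrable lborel {T1..T2} (\<lambda>T. T powr nu)"
  using T1 by (intro borel_integrable_atLeastAtMost' continuous_intros) auto
 have "(LINT T|lborel. LINT Y|lborel. g T Y) = (LINT Y|lborel. LINT T|lborel. g T Y)"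
 proof (rule Fubini_product_bound(2))
  show "integrable lborel (\<lambda>T. indicator {T1..T2} T *\<^sub>R T powr nu)" using iT by (simp add: set_integrable_def)
  fix T Y
  show "\<bar>g T Y\<bar> \<le> indicator {T1..T2} T *\<^sub>R T powr nu * w Y"
   using w(2)[of T Y] T1 by (auto simp: g_def abs_mult indicator_def intro: mult_left_mono)
 qed (use w(1) in auto)
 moreover have 1: "(LINT Y|lborel. g T Y) = indicator {T1..T2} T *\<^sub>R (T powr nu * triple_int al nu X Z T rho)" for T
  unfolding g_def triple_int_def set_lebesgue_integral_def
  by (simp add: mult_ac flip: integral_mult_right_zero)
 moreover have 2: "(LINT T|lborel. g T Y) = indicator {0<..<rho} Y *\<^sub>R
   (T2 powr (nu + 1) * triple al (nu + 1) X Z T2 Y - T1 powr (nu + 1) * triple al (nu + 1) X Z T1 Y)" for Y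
 proof -
  have "((\<lambda>T. T powr nu * bessel_e nu (-(T*Y))) has_integral
   (T2 powr (nu + 1) * bessel_e (nu + 1) (-(T2*Y)) - T1 powr (nu + 1) * bessel_e (nu + 1) (-(T1*Y)))) {T1..T2}"
   using T1 T12 DERIV_powr_bessel_e by (intro fundamental_theorem_of_calculus)
    (auto simp: has_real_derivative_iff_has_vector_derivative[symmetric] intro: has_field_derivative_at_within)
  moreover have "set_integrable lborel {T1..T2} (\<lambda>T. T powr nu * bessel_e nu (-(T*Y)))"
   using T1 by (intro borel_integrable_atLeastAtMost' continuous_intros) auto
  ultimately have I: "(LINT T:{T1..T2}|lborel. T powr nu * bessel_e nu (-(T*Y)))
   = T2 powr (nu + 1) * bessel_e (nu + 1) (-(T2*Y)) - T1 powr (nu + 1) * bessel_e (nu + 1) (-(T1*Y))"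
   by (simp add: set_borel_integral_eq_integral(2) integral_unique)
  have "(LINT T|lborel. g T Y) = indicator {0<..<rho} Y * (Y powr al * b Y) * (LINT T:{T1..T2}|lborel. T powr nu * bessel_e nu (-(T*Y)))"
   unfolding set_lebesgue_integral_def integral_mult_right_zero[symmetric]
   by (intro Bochner_Integration.integral_cong) (auto simp: g_def triple_def b_def)
  thus ?thesis unfolding I by (simp add: triple_def b_def algebra_simps)
 qed
 moreover have "(LINT Y|lborel. indicator {0<..<rho} Y *\<^sub>R
   (T2 powr (nu + 1) * triple al (nu + 1) X Z T2 Y - T1 powr (nu + 1) * triple al (nu + 1) X Z T1 Y))
  = T2 powr (nu + 1) * triple_int al (nu + 1) X Z T2 rho - T1 powr (nu + 1) * triple_int al (nu + 1) X Z T1 rho"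
  unfolding triple_int_def set_lebesgue_integral_def[symmetric]
  by (subst set_integral_diff) (auto intro!: set_integrable_mult_right set_integrable_triple[OF al])
 ultimately have "(LINT T:{T1..T2}|lborel. T powr nu * triple_int al nu X Z T rho)
   = T2 powr (nu + 1) * triple_int al (nu + 1) X Z T2 rho - T1 powr (nu + 1) * triple_int al (nu + 1) X Z T1 rho"
  unfolding set_lebesgue_integral_def[of lborel "{T1..T2}"] by simp
 moreover have c: "continuous_on {T1..T2} (\<lambda>T. T powr nu * triple_int al nu X Z T rho)"
  using T1 by (intro continuous_intros triple_int_continuous al) auto
 ultimately show ?thesis
  using set_borel_integral_eq_integral(2)[OF borel_integrable_atLeastAtMost'[OF c]] integrable_continuous_real[OF c]
  by (simp add: has_integral_iff)
qed

lemma triple_int_diff: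
 assumes "al > -1" "0 < a" "a \<le> b"
 shows "triple_int al nu X Z T b - triple_int al nu X Z T a = integral {a..b} (triple al nu X Z T)"
proof -
 have i: "set_integrable lborel {0<..<b} (triple al nu X Z T)"
  by (rule set_integrable_triple[OF assms(1)])
 have e: "{0<..<b} = {0<..<a} \<union> {a..<b}" using assms by auto
 have "triple_int al nu X Z T b = triple_int al nu X Z T a + (LINT Y:{a..<b}|lborel. triple al nu X Z T Y)"
  unfolding triple_int_def e
  by (rule set_integral_Un) (use assms in \<open>auto intro: set_integrable_subset[OF i]\<close>)
 also have "(LINT Y:{a..<b}|lborel. triple al nu X Z T Y) = integral {a..<b} (triple al nu X Z T)"
  by (rule set_borel_integral_eq_integral) (use assms in \<open>auto intro: set_integrable_subset[OF i]\<close>)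
 also have "\<dots> = integral {a..b} (triple al nu X Z T)"
  by (rule integral_subset_negligible) (auto intro: negligible_subset[of "{b}"])
 finally show ?thesis by simp
qed

text \<open>The four frequencies are continuous in T and one of them vanishes only if T is (x + z)^2
  or (x - z)^2; on a compact interval that avoids both, their moduli have a positive
  minimum.\<close>

lemma triple_int_tail_uniform:
 assumes al: "al > -1" and nu: "nu > -1/2" and x: "x > 0" and z: "z > 0" and T1: "0 < T1"
  and avoid: "(x + z)\<^sup>2 \<notin> {T1..T2}" "(x - z)\<^sup>2 \<notin> {T1..T2}"
 shows "\<exists>C Y0. Y0 > 0 \<and> C \<ge> 0 \<and> (\<forall>T\<in>{T1..T2}. \<forall>a b. Y0 \<le> a --> a \<le> b -->
   \<bar>triple_int al nu (x\<^sup>2) (z\<^sup>2) T b - triple_int al nu (x\<^sup>2) (z\<^sup>2) T a\<bar> \<le> C * a powr (-nu/2-1/4))"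
proof (cases "T1 \<le> T2")
 case True
 define m where "m T = min (min \<bar>sqrt T + x + z\<bar> \<bar>sqrt T + x - z\<bar>) (min \<bar>sqrt T - x + z\<bar> \<bar>sqrt T - x - z\<bar>)" for T
 have "continuous_on {T1..T2} m" unfolding m_def by (intro continuous_intros)
 then obtain T0 where T0: "T0 \<in> {T1..T2}" "\<And>T. T \<in> {T1..T2} ==> m T0 \<le> m T"
  using continuous_attains_inf[of "{T1..T2}" m] True by auto
 have "m T0 > 0"
 proof (rule ccontr)
  assume "\<not> m T0 > 0"
  moreover have "sqrt T0 + x + z > 0" using x z T0(1) T1 by (intro add_pos_pos) auto
  ultimately have "sqrt T0 + x - z = 0 \<or> sqrt T0 - x + z = 0 \<or> sqrt T0 - x - z = 0"
   unfolding m_def by linarith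
  hence "sqrt T0 = z - x \<or> sqrt T0 = x - z \<or> sqrt T0 = x + z" by linarith
  hence "(sqrt T0)\<^sup>2 = (x - z)\<^sup>2 \<or> (sqrt T0)\<^sup>2 = (x + z)\<^sup>2" by (auto simp: power2_commute)
  with avoid T0(1) T1 show False by auto
 qed
 moreover have "m T0 \<le> \<bar>sqrt T + x + z\<bar> \<and> m T0 \<le> \<bar>sqrt T + x - z\<bar> \<and>
    m T0 \<le> \<bar>sqrt T - x + z\<bar> \<and> m T0 \<le> \<bar>sqrt T - x - z\<bar>" if "T1 \<le> T" "T \<le> T2" for T
  using T0(2)[of T] that unfolding m_def[of T] by simp
 ultimately obtain C Y0 where *: "Y0 > 0" "C \<ge> 0" "\<forall>T\<in>{T1..T2}. \<forall>a b. Y0 \<le> a --> a \<le> b -->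
      \<bar>integral {a..b} (triple al nu (x\<^sup>2) (z\<^sup>2) T)\<bar> \<le> C * a powr (-nu/2-1/4)"
  using triple_tail[OF nu x z T1, of "m T0" T2 al] by blast
 show ?thesis
 proof (intro exI conjI ballI allI impI)
  fix T a b assume "T \<in> {T1..T2}" "Y0 \<le> a" "a \<le> b"
  thus "\<bar>triple_int al nu (x\<^sup>2) (z\<^sup>2) T b - triple_int al nu (x\<^sup>2) (z\<^sup>2) T a\<bar> \<le> C * a powr (-nu/2-1/4)"
   using *(1,3) by (subst triple_int_diff[OF al]) auto
 qed (use * in auto)
next
 case False
 thus ?thesis by (intro exI[of _ 1]) auto
qed

text \<open>Uniformly Cauchy tails give a continuous limit G of the truncated integrals of order nu.
  In the limit \<open>triple_int_FTC\<close> says that \<Phi> is a primitive of G, so its derivative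
  \<phi> at T is G T, the limit sought. Thus nothing is ever differentiated under an improper
  integral.\<close>

lemma triple_int_descent_aux:
 assumes al: "al > -1" and nu: "nu > -1/2" and x: "x > 0" and z: "z > 0" and T1: "0 < T1" and T12: "T1 < T2"
  and avoid: "(x + z)\<^sup>2 \<notin> {T1..T2}" "(x - z)\<^sup>2 \<notin> {T1..T2}"
  and lim: "\<And>T. T \<in> {T1..T2} ==> ((\<lambda>rho. T powr (nu + 1) * triple_int al (nu + 1) (x\<^sup>2) (z\<^sup>2) T rho) \<longlongrightarrow> \<Phi> T) at_top"
  and d: "(\<Phi> has_real_derivative \<phi>) (at T)" and T: "T1 < T" "T < T2"
 shows "((\<lambda>rho. T powr nu * triple_int al nu (x\<^sup>2) (z\<^sup>2) T rho) \<longlongrightarrow> \<phi>) at_top"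
proof -
 define I where "I T n = triple_int al nu (x\<^sup>2) (z\<^sup>2) T n" for T n
 define J where "J T n = triple_int al (nu + 1) (x\<^sup>2) (z\<^sup>2) T n" for T n
 define s where "s = nu/2+1/4"
 have s: "s > 0" "-nu/2-1/4 = -s" using nu by (auto simp: s_def)
 obtain C Y0 where Y0: "Y0 > 0" "C \<ge> 0" and C: "\<And>T a b. T \<in> {T1..T2} ==> Y0 \<le> a ==> a \<le> b ==>
   \<bar>I T b - I T a\<bar> \<le> C * a powr (-s)"
  using triple_int_tail_uniform[OF al nu x z T1 avoid] unfolding I_def s(2) by blast
 have dec: "((\<lambda>a. C * a powr (-s)) \<longlongrightarrow> C * 0) at_top"
  by (intro tendsto_intros tendsto_neg_powr filterlim_ident) (use s(1) in linarith)
 have small: "\<exists>a0\<ge>Y0. \<forall>a\<ge>a0. C * a powr (-s) < e" if "e > 0" for e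
 proof -
  have "eventually (\<lambda>a. C * a powr (-s) < e) at_top"
   using order_tendstoD(2)[OF dec, of e] that by simp
  then obtain a1 where "\<And>a. a \<ge> a1 ==> C * a powr (-s) < e" by (auto simp: eventually_at_top_linorder)
  thus ?thesis by (intro exI[of _ "max a1 Y0"]) auto
 qed
 obtain B where B: "B > 0" "\<And>T. T \<in> {T1..T2} ==> T powr nu \<le> B"
 proof -
  have "compact ((\<lambda>T. T powr nu) ` {T1..T2})" using T1 by (intro compact_continuous_image continuous_intros) auto
  then obtain B where "\<And>T. T \<in> {T1..T2} ==> norm (T powr nu) \<le> B"
   by (metis (no_types, lifting) bounded_iff compact_imp_bounded image_eqI)
  thus ?thesis using that[of "max B 1"] by fastforce
 qed
 have "uniformly_Cauchy_on {T1..T2} (\<lambda>n T. T powr nu * I T (real n))"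
 proof (rule uniformly_Cauchy_onI')
  fix e :: real assume e: "e > 0"
  then obtain a0 where a0: "a0 \<ge> Y0" "\<And>a. a \<ge> a0 ==> C * a powr (-s) < e / B" using small[of "e/B"] B by auto
  obtain N where N: "real N \<ge> a0" using real_arch_simple by blast
  have "dist (T powr nu * I T (real m)) (T powr nu * I T (real n)) < e" if "T \<in> {T1..T2}" "m \<ge> N" "n > m" for T m n
  proof -
   have m: "a0 \<le> real m" using N that by linarith
   have "dist (T powr nu * I T (real m)) (T powr nu * I T (real n)) = T powr nu * \<bar>I T (real n) - I T (real m)\<bar>"
    by (simp add: dist_real_def right_diff_distrib[symmetric] abs_mult abs_minus_commute)
   also have "\<dots> \<le> B * (C * real m powr (-s))"
    using C[of T "real m" "real n"] B that m a0(1) by (intro mult_mono) auto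
   also have "\<dots> < B * (e / B)" using a0(2)[OF m] B(1) by (intro mult_strict_left_mono) auto
   finally show ?thesis using B(1) by simp
  qed
  thus "\<exists>M. \<forall>x\<in>{T1..T2}. \<forall>m\<ge>M. \<forall>n>m. dist (x powr nu * I x (real m)) (x powr nu * I x (real n)) < e" by blast
 qed
 then obtain G where ul: "uniform_limit {T1..T2} (\<lambda>n T. T powr nu * I T (real n)) G sequentially"
  using Cauchy_uniformly_convergent uniformly_convergent_on_def by blast
 have cI: "continuous_on {T1..T2} (\<lambda>T. T powr nu * I T (real n))" for n
  unfolding I_def using T1 by (intro continuous_intros triple_int_continuous al) auto
 have cG: "continuous_on {T1..T2} G"
  by (rule uniform_limit_theorem[OF _ ul]) (simp_all add: cI)
 have Phi: "\<Phi> u = \<Phi> T1 + integral {T1..u} G" if u: "u \<in> {T1..T2}" for u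
 proof -
  have sub: "{T1..u} \<subseteq> {T1..T2}" using u by auto
  have ul': "uniform_limit (cbox T1 u) (\<lambda>n T. T powr nu * I T (real n)) G sequentially"
   using uniform_limit_on_subset[OF ul sub] by simp
  obtain L K where LK: "\<And>n. ((\<lambda>T. T powr nu * I T (real n)) has_integral L n) (cbox T1 u)"
   "(G has_integral K) (cbox T1 u)" "L \<longlonglongrightarrow> K"
   using uniform_limit_integral_cbox[OF ul' continuous_on_subset[OF cI]] sub by auto
  have "L n = u powr (nu + 1) * J u (real n) - T1 powr (nu + 1) * J T1 (real n)" for n
   using triple_int_FTC[OF al T1, of u nu "x\<^sup>2" "z\<^sup>2" "real n"] LK(1)[of n] u
   by (auto simp: I_def J_def intro: has_integral_unique)
  hence "L = (\<lambda>n. u powr (nu + 1) * J u (real n) - T1 powr (nu + 1) * J T1 (real n))" by (rule ext)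
  hence "(\<lambda>n. u powr (nu + 1) * J u (real n) - T1 powr (nu + 1) * J T1 (real n)) \<longlonglongrightarrow> K"
   using LK(3) by simp
  moreover have "(\<lambda>n. u powr (nu + 1) * J u (real n) - T1 powr (nu + 1) * J T1 (real n)) \<longlonglongrightarrow> \<Phi> u - \<Phi> T1"
   unfolding J_def using T12 u
   by (intro tendsto_diff filterlim_compose[OF lim filterlim_real_sequentially]) auto
  ultimately have "\<Phi> u - \<Phi> T1 = K" using LIMSEQ_unique by blast
  thus ?thesis using LK(2) by (simp add: integral_unique)
 qed
 have "((\<lambda>u. integral {T1..u} G) has_real_derivative (G T)) (at T within {T1..T2})"
  using T by (intro integral_has_real_derivative cG) auto
 hence "((\<lambda>u. \<Phi> T1 + integral {T1..u} G) has_real_derivative (G T)) (at T within {T1..T2})"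
  by (auto intro!: derivative_eq_intros)
 hence "(\<Phi> has_real_derivative (G T)) (at T within {T1..T2})"
 proof (rule has_field_derivative_transform_within[where d = 1])
  fix u assume "u \<in> {T1..T2}"
  thus "\<Phi> T1 + integral {T1..u} G = \<Phi> u" by (rule Phi[symmetric])
 qed (use T in auto)
 moreover have "at T within {T1..T2} = at T" using T by (intro at_within_interior) auto
 ultimately have "\<phi> = G T" using d DERIV_unique by metis
 \<comment> \<open>G was obtained along integer cutoffs; the tail bound carries the limit over to
   real rho.\<close>
 moreover have "((\<lambda>rho. T powr nu * I T rho) \<longlongrightarrow> G T) at_top"
 proof (rule Lim_transform2)
  show "((\<lambda>rho. T powr nu * I T (real (nat \<lceil>rho\<rceil>))) \<longlongrightarrow> G T) at_top"
   using T by (intro filterlim_compose[OF tendsto_uniform_limitI[OF ul, of T]] filterlim_at_top_mono[OF filterlim_compose[OF filterlim_nat_sequentially filterlim_floor_sequentially]] always_eventually) (auto intro!: nat_mono floor_le_ceiling)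
  show "((\<lambda>rho. T powr nu * I T (real (nat \<lceil>rho\<rceil>)) - T powr nu * I T rho) \<longlongrightarrow> 0) at_top"
  proof (rule Lim_null_comparison)
   show "eventually (\<lambda>rho. norm (T powr nu * I T (real (nat \<lceil>rho\<rceil>)) - T powr nu * I T rho) \<le> T powr nu * (C * rho powr -s)) at_top"
    using eventually_ge_at_top[of Y0]
   proof eventually_elim
    case (elim rho)
    thus ?case using C[of T rho "real (nat \<lceil>rho\<rceil>)"] T Y0(1) real_nat_ceiling_ge[of rho]
     by (auto simp: right_diff_distrib[symmetric] abs_mult intro: mult_left_mono)
   qed
   show "((\<lambda>rho. T powr nu * (C * rho powr -s)) \<longlongrightarrow> 0) at_top" using tendsto_mult_right_zero[of _ at_top "T powr nu"] dec by simp
  qed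
 qed
 ultimately show ?thesis by (simp add: I_def)
qed

lemma triple_int_descent:
 assumes al: "al > -1" and nu: "nu > -1/2" and x: "x > 0" and z: "z > 0"
  and U: "open U" "T \<in> U" "U \<subseteq> {0<..}" "(x + z)\<^sup>2 \<notin> U" "(x - z)\<^sup>2 \<notin> U"
  and lim: "\<And>T. T \<in> U ==> ((\<lambda>rho. T powr (nu + 1) * triple_int al (nu + 1) (x\<^sup>2) (z\<^sup>2) T rho) \<longlongrightarrow> \<Phi> T) at_top"
  and d: "(\<Phi> has_real_derivative \<phi>) (at T)"
 shows "((\<lambda>rho. T powr nu * triple_int al nu (x\<^sup>2) (z\<^sup>2) T rho) \<longlongrightarrow> \<phi>) at_top"
proof -
 obtain e where e: "e > 0" "cball T e \<subseteq> U" using U(1,2) by (auto simp: open_contains_cball)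
 have sub: "{T-e..T+e} \<subseteq> U" using e(2) by (simp add: cball_eq_atLeastAtMost)
 have "T - e > 0" using subsetD[OF sub, of "T - e"] U(3) e(1) by auto
 thus ?thesis
  by (intro triple_int_descent_aux[OF al nu x z, of "T-e" "T+e" \<Phi>])
    (use sub U e(1) lim d in \<open>auto simp: subset_iff\<close>)
qed

section \<open>Laplace transforms\<close>

text \<open>Two-sided, because the profile lives on (-1, \<infinity>) and its affine images need not
  start at 0. The predicate includes integrability, which therefore need not be carried along
  separately.\<close>

definition has_laplace :: "(real => real) => real => real => bool" where
 "has_laplace f s v \<longleftrightarrow> has_bochner_integral lborel (\<lambda>T. exp (-(s*T)) * f T) v"

abbreviation has_laplace_pos :: "(real => real) => real => real => bool" where
 "has_laplace_pos f \<equiv> has_laplace (\<lambda>T. indicator {0<..} T * f T)"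

lemma has_laplace_cmult: "has_laplace f s v ==> has_laplace (\<lambda>T. c * f T) s (c * v)"
 unfolding has_laplace_def by (subst mult.left_commute) (rule has_bochner_integral_mult_right)

lemma has_laplace_add: "has_laplace f s v ==> has_laplace g s w ==> has_laplace (\<lambda>T. f T + g T) s (v + w)"
 unfolding has_laplace_def distrib_left by (rule has_bochner_integral_add)

lemma has_laplace_cong_AE:
 assumes "has_laplace f s v" "f \<in> borel_measurable borel" "g \<in> borel_measurable borel" "AE T in lborel. f T = g T"
 shows "has_laplace g s v"
 using assms(1) unfolding has_laplace_def
 by (rule has_bochner_integral_cong_AE[THEN iffD1, rotated 3]) (use assms(2-) in auto)

lemma has_laplace_affine:
 assumes f: "has_laplace f (s * a) v" and a: "a > 0"
 shows "has_laplace (\<lambda>T. f (T / a - q)) s (a * exp (-(s * a * q)) * v)"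
proof -
 have "has_bochner_integral lborel (\<lambda>T. exp (-(s*a*(-q + (1/a)*T))) * f (-q + (1/a)*T)) (v /\<^sub>R \<bar>1/a\<bar>)"
  using f a unfolding has_laplace_def by (subst (asm) lborel_has_bochner_integral_real_affine_iff[of "1/a" _ _ "-q"]) auto
 from has_bochner_integral_mult_right[OF this, of "exp (-(s*a*q))"]
 have "has_bochner_integral lborel (\<lambda>T. exp (-(s*a*q)) * exp (-(s*a*(-q + (1/a)*T))) * f (-q + (1/a)*T)) (exp (-(s*a*q)) * (v /\<^sub>R \<bar>1/a\<bar>))"
  by (simp only: mult.assoc)
 moreover have "exp (-(s*a*q)) * exp (-(s*a*(-q + (1/a)*T))) = exp (-(s*T))" for T
  unfolding exp_add[symmetric] using a by (simp add: algebra_simps)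
 ultimately show ?thesis using a by (simp add: has_laplace_def mult_ac)
qed

lemma Gamma_moment:
 assumes b: "b > 0" and s: "s > 0"
 shows "has_laplace_pos (\<lambda>T. T powr (b - 1)) s (Gamma b * s powr (-b))"
proof -
 have "has_laplace_pos (\<lambda>T. T powr (b - 1)) (s * (1/s)) (Gamma b)" unfolding has_laplace_def
 proof (rule has_bochner_integral_nn_integral)
  show "(\<integral>\<^sup>+t. ennreal (exp (-(s*(1/s)*t)) * (indicator {0<..} t * t powr (b - 1))) \<partial>lborel) = ennreal (Gamma b)"
   unfolding Gamma_conv_nn_integral_real[OF b] using s by (intro nn_integral_cong) (auto simp: indicator_def exp_minus divide_inverse)
 qed (use b in \<open>auto intro: less_imp_le Gamma_real_pos\<close>)
 from has_laplace_cmult[OF has_laplace_affine[OF this, of 0], of "s powr (1 - b)"]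
 have "has_laplace (\<lambda>T. s powr (1 - b) * (indicator {0<..} (T/(1/s) - 0) * (T/(1/s) - 0) powr (b - 1))) s (s powr (1 - b) * (1/s * exp (-(s * (1/s) * 0)) * Gamma b))"
  using s by simp
 moreover have "s powr (1 - b) * (indicator {0<..} (T/(1/s) - 0) * (T/(1/s) - 0) powr (b - 1)) = indicator {0<..} T * T powr (b - 1)" for T
  using s by (auto simp: indicator_def zero_less_mult_iff powr_mult powr_diff field_simps)
 ultimately show ?thesis using s by (simp add: powr_diff powr_minus field_simps)
qed

text \<open>Termwise integration: the Gamma function in the n-th moment cancels the
  \<open>rGamma\<close> in the n-th coefficient, and what remains is the exponential series of c /
  s. The absolute values of the terms are the terms for |c|, whose sum is finite.\<close>

lemma bessel_e_laplace:
 assumes nu: "nu > -1" and s: "s > 0"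
 shows "has_laplace_pos (\<lambda>T. T powr nu * bessel_e nu (c*T)) s (s powr (-nu-1) * exp (c/s))"
proof -
 define f where "f c n T = exp (-(s*T)) * (indicator {0<..} T * (T powr nu * (rGamma (real n + nu + 1) / fact n * (c*T)^n)))" for c n T
 have pos: "real n + nu + 1 > 0" for n using nu by (simp add: add_nonneg_pos)
 have rG: "rGamma (real n + nu + 1) * Gamma (real n + nu + 1) = 1" "rGamma (real n + nu + 1) > 0" for n
  using Gamma_real_pos[OF pos[of n]] by (simp_all add: rGamma_inverse_Gamma)
 have I: "has_bochner_integral lborel (f c n) (s powr (-nu-1) * ((c/s)^n / fact n))" for c n
 proof -
  have "(rGamma (real n + nu + 1) / fact n * c^n) * (indicator {0<..} T * T powr (real n + nu + 1 - 1))
    = indicator {0<..} T * (T powr nu * (rGamma (real n + nu + 1) / fact n * (c*T)^n))" for T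
   using powr_realpow[of T n] by (cases "T > 0") (auto simp: powr_add power_mult_distrib)
  with has_laplace_cmult[OF Gamma_moment[OF pos s], of "rGamma (real n + nu + 1) / fact n * c^n" n]
  have "has_bochner_integral lborel (f c n) ((rGamma (real n + nu + 1) / fact n * c^n) * (Gamma (real n + nu + 1) * s powr (-(real n + nu + 1))))"
   unfolding has_laplace_def f_def[abs_def] by (simp only:)
  also have "s powr (-(real n + nu + 1)) = s powr (-nu-1) * (1/s)^n"
  proof -
   have "s powr (-(real n + nu + 1)) = s powr (-nu-1) * s powr (- real n)" unfolding powr_add[symmetric] by (rule arg_cong[where f = "\<lambda>p. s powr p"]) simp
   thus ?thesis using s powr_realpow[of s n] by (simp add: powr_minus power_one_over inverse_eq_divide)
  qed
  also have "(rGamma (real n + nu + 1) / fact n * c^n) * (Gamma (real n + nu + 1) * (s powr (-nu-1) * (1/s)^n))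
    = (rGamma (real n + nu + 1) * Gamma (real n + nu + 1)) * (s powr (-nu-1) * ((c/s)^n / fact n))"
   by (simp add: power_divide mult_ac)
  finally show ?thesis by (simp add: rG)
 qed
 have n: "norm (f c n T) = f \<bar>c\<bar> n T" for n T using rG(2)[of n] by (auto simp: f_def abs_mult power_abs indicator_def)
 have S: "summable (\<lambda>n. \<integral>T. norm (f c n T) \<partial>lborel)"
  unfolding n has_bochner_integral_integral_eq[OF I] using summable_exp[of "\<bar>c\<bar>/s"] by (intro summable_mult) (simp add: field_simps)
 have AE: "AE T in lborel. summable (\<lambda>n. norm (f c n T))"
 proof (rule AE_I2)
  fix T
  have "norm (f c n T) = indicator {0<..} T * T powr nu * exp (-(s*T)) * norm (rGamma (real n + nu + 1) / fact n * (c*T)^n)" for n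
   by (auto simp: f_def abs_mult)
  thus "summable (\<lambda>n. norm (f c n T))" by (simp only:) (intro summable_mult bessel_e_summable)
 qed
 have fi: "integrable lborel (f c n)" for n using I has_bochner_integral_iff by blast
 have sum: "(\<Sum>n. f c n T) = exp (-(s*T)) * (indicator {0<..} T * (T powr nu * bessel_e nu (c*T)))" for T
  unfolding f_def by (intro sums_unique[symmetric] sums_mult bessel_e_sums)
 have "(\<lambda>n. integral\<^sup>L lborel (f c n)) sums (\<integral>T. (\<Sum>n. f c n T) \<partial>lborel)"
  by (rule sums_integral[OF fi AE S])
 moreover have "(\<lambda>n. s powr (-nu-1) * ((c/s)^n / fact n)) sums (s powr (-nu-1) * exp (c/s))"
  using exp_converges[of "c/s"] by (intro sums_mult) (simp add: scaleR_conv_of_real field_simps)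
 ultimately have "(\<integral>T. (\<Sum>n. f c n T) \<partial>lborel) = s powr (-nu-1) * exp (c/s)"
  unfolding has_bochner_integral_integral_eq[OF I] by (rule sums_unique2)
 moreover have "integrable lborel (\<lambda>T. \<Sum>n. f c n T)" by (rule integrable_suminf[OF fi AE S])
 ultimately show ?thesis unfolding sum by (simp add: has_laplace_def has_bochner_integral_iff)
qed

text \<open>
 Uniqueness of Laplace transforms: after the substitution \<open>u = exp (-T)\<close> a vanishing transform at all
 positive integers means that all moments vanish, and polynomials are dense by Weierstrass.
\<close>
lemma laplace_zero:
 assumes D: "\<And>n::nat. n \<ge> 1 ==> has_laplace_pos D (real n) 0" and T0: "T0 > 0" and cont: "isCont D T0"
 shows "D T0 = 0"
proof -
 define w where "w T = exp (-T) * (indicator {0<..} T * D T)" for T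
 have wi: "integrable lborel w" unfolding w_def using D[of 1] by (simp add: has_laplace_def has_bochner_integral_iff)
 have poly: "has_bochner_integral lborel (\<lambda>T. (\<Sum>i\<le>m. a i * exp (-T) ^ i) * w T) 0" for a :: "nat => real" and m
 proof -
  have "(\<Sum>i\<le>m. a i * exp (-T) ^ i) * w T = (\<Sum>i\<le>m. a i * (exp (-(real (Suc i) * T)) * (indicator {0<..} T * D T)))" for T
   unfolding sum_distrib_right w_def by (intro sum.cong refl) (simp add: exp_of_nat_mult[symmetric] algebra_simps flip: exp_add)
  moreover have "has_bochner_integral lborel (\<lambda>T. \<Sum>i\<le>m. a i * (exp (-(real (Suc i) * T)) * (indicator {0<..} T * D T))) (\<Sum>i\<le>m. a i * 0)"
   by (intro has_bochner_integral_sum has_bochner_integral_mult_right D[unfolded has_laplace_def]) simp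
  ultimately show ?thesis by simp
 qed
 have cpsi: "integrable lborel (\<lambda>T. \<psi> (exp (-T)) * w T) \<and> (\<integral>T. \<psi> (exp (-T)) * w T \<partial>lborel) = 0"
  if c: "continuous_on UNIV \<psi>" for \<psi> :: "real => real"
 proof -
  have [measurable]: "\<psi> \<in> borel_measurable borel" using c by (rule borel_measurable_continuous_onI)
  obtain M where M: "M \<ge> 0" "\<And>u. 0 \<le> u ==> u \<le> 1 ==> \<bar>\<psi> u\<bar> \<le> M"
   using continuous_bounded_Icc_prod[OF c, of 0 1] by blast
  have wm [measurable]: "w \<in> borel_measurable borel" using wi by (simp add: borel_measurable_integrable)
  have i: "integrable lborel (\<lambda>T. \<psi> (exp (-T)) * w T)"
  proof (rule Bochner_Integration.integrable_bound)
   show "integrable lborel (\<lambda>T. M * w T)" using wi by simp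
   show "AE T in lborel. norm (\<psi> (exp (-T)) * w T) \<le> norm (M * w T)"
   proof (rule AE_I2)
    fix T show "norm (\<psi> (exp (-T)) * w T) \<le> norm (M * w T)"
     using M(1) M(2)[of "exp (-T)"] by (cases "T > 0") (auto simp: w_def abs_mult intro!: mult_right_mono)
   qed
  qed simp
  have "\<bar>\<integral>T. \<psi> (exp (-T)) * w T \<partial>lborel\<bar> \<le> 0"
  proof (rule field_le_epsilon)
   fix e :: real assume e: "e > 0"
   define K where "K = (\<integral>T. \<bar>w T\<bar> \<partial>lborel) + 1"
   have K: "K > 0" unfolding K_def by (simp add: add_nonneg_pos)
   have cc: "continuous_on {0..1} \<psi>" using c continuous_on_subset by blast
   obtain g where g: "real_polynomial_function g" "\<And>u. u \<in> {0..1} ==> \<bar>\<psi> u - g u\<bar> < e / K"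
    using Stone_Weierstrass_real_polynomial_function[OF _ cc, of "e/K"] e K by auto
   then obtain a m where am: "g = (\<lambda>u. \<Sum>i\<le>m. a i * u ^ i)" using real_polynomial_function_iff_sum by auto
   have "(\<integral>T. \<psi> (exp (-T)) * w T \<partial>lborel) = (\<integral>T. \<psi> (exp (-T)) * w T \<partial>lborel) - (\<integral>T. g (exp (-T)) * w T \<partial>lborel)"
    unfolding am using poly[of a m] by (simp add: has_bochner_integral_iff)
   also have "\<dots> = (\<integral>T. (\<psi> (exp (-T)) - g (exp (-T))) * w T \<partial>lborel)"
    using i poly[of a m] unfolding am by (subst Bochner_Integration.integral_diff[symmetric]) (auto simp: left_diff_distrib has_bochner_integral_iff)
   also have "\<bar>\<dots>\<bar> \<le> (\<integral>T. (e / K) * \<bar>w T\<bar> \<partial>lborel)"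
   proof (rule integral_abs_bound[THEN order_trans, OF integral_mono'])
    show "integrable lborel (\<lambda>T. e / K * \<bar>w T\<bar>)" using wi by simp
    fix T show "\<bar>(\<psi> (exp (-T)) - g (exp (-T))) * w T\<bar> \<le> e / K * \<bar>w T\<bar>"
    proof (cases "T > 0")
     case True
     hence "\<bar>\<psi> (exp (-T)) - g (exp (-T))\<bar> \<le> e / K" by (intro less_imp_le g(2)) simp
     thus ?thesis unfolding abs_mult by (rule mult_right_mono) simp
    qed (simp add: w_def)
   qed (use e K in auto)
   also have "\<dots> = e / K * (K - 1)" unfolding K_def by simp
   also have "\<dots> \<le> 0 + e" using e K by (simp add: field_simps)
   finally show "\<bar>\<integral>T. \<psi> (exp (-T)) * w T \<partial>lborel\<bar> \<le> 0 + e" .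
  qed
  with i show ?thesis by simp
 qed
 \<comment> \<open>If D or -D were positive at T0, it would be positive on a neighbourhood. The
   function \<psi> constructed below is nonnegative, and \<open>\<psi> (exp (-T))\<close> is
   positive exactly for T in such a neighbourhood, which contradicts the vanishing integral.\<close>
 have nonpos: "\<not> D' T0 > 0" if D': "D' = D \<or> D' = (\<lambda>T. - D T)" for D'
 proof
  assume pos: "D' T0 > 0"
  have "isCont D' T0" using cont D' by (auto intro: continuous_intros)
  then obtain d where d: "d > 0" "\<And>T. \<bar>T - T0\<bar> < d ==> D' T > 0"
   using pos unfolding continuous_at_eps_delta
   by (metis (no_types, opaque_lifting) abs_diff_less_iff add.commute dist_real_def diff_add_cancel less_add_same_cancel1 real_norm_def diff_less_eq linorder_not_less diff_self)
  define d' where "d' = min (d/2) (T0/2)"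
  have d': "d' > 0" "d' < d" "d' < T0" using d(1) T0 by (auto simp: d'_def)
  define \<psi> where "\<psi> u = max 0 ((u - exp (-(T0+d'))) * (exp (-(T0-d')) - u))" for u :: real
  have c: "continuous_on UNIV \<psi>" unfolding \<psi>_def by (intro continuous_intros)
  have ps: "\<psi> (exp (-T)) > 0 \<longleftrightarrow> T \<in> {T0-d'<..<T0+d'}" for T
  proof -
   have "\<psi> (exp (-T)) > 0 \<longleftrightarrow> (exp (-T) - exp (-(T0+d'))) * (exp (-(T0-d')) - exp (-T)) > 0"
    unfolding \<psi>_def by auto
   also have "\<dots> \<longleftrightarrow> T \<in> {T0-d'<..<T0+d'}" using d'(1)
    by (auto simp: zero_less_mult_iff)
   finally show ?thesis .
  qed
  have p0: "\<psi> u \<ge> 0" for u by (simp add: \<psi>_def)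
  define w' where "w' T = exp (-T) * (indicator {0<..} T * D' T)" for T
  have w': "w' = w \<or> w' = (\<lambda>T. - w T)" using D' by (auto simp: w_def w'_def fun_eq_iff)
  have i0: "integrable lborel (\<lambda>T. \<psi> (exp (-T)) * w' T) \<and> (\<integral>T. \<psi> (exp (-T)) * w' T \<partial>lborel) = 0"
   using w' cpsi[OF c] by auto
  have nn: "\<psi> (exp (-T)) * w' T \<ge> 0 \<and> (T \<in> {T0-d'<..<T0+d'} --> \<psi> (exp (-T)) * w' T > 0)" for T
  proof (cases "T \<in> {T0-d'<..<T0+d'}")
   case True
   hence "D' T > 0" "T > 0" using d(2)[of T] d' by auto
   hence "w' T > 0" by (simp add: w'_def)
   with True ps[of T] show ?thesis by simp
  next
   case False
   with ps[of T] p0[of "exp (-T)"] have "\<psi> (exp (-T)) = 0" by auto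
   thus ?thesis using False by auto
  qed
  have "AE T in lborel. \<psi> (exp (-T)) * w' T = 0"
   using i0 nn by (subst integral_nonneg_eq_0_iff_AE[symmetric]) auto
  hence "AE T in lborel. T \<notin> {T0-d'<..<T0+d'}"
   by eventually_elim (use nn in force)
  hence "emeasure lborel {T0-d'<..<T0+d'} = 0"
   by (subst (asm) AE_iff_measurable[of "{T0-d'<..<T0+d'}"]) auto
  thus False using d'(1) by simp
 qed
 from nonpos[of D] nonpos[of "\<lambda>T. - D T"] show ?thesis by (metis linorder_neqE_linordered_idom neg_0_less_iff_less)
qed

lemma laplace_unique:
 assumes F: "\<And>n::nat. n \<ge> 1 ==> has_laplace_pos F (real n) (v n)" and G: "\<And>n::nat. n \<ge> 1 ==> has_laplace_pos G (real n) (v n)"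
  and T: "T > 0" and cont: "isCont F T" "isCont G T"
 shows "F T = G T"
proof -
 have "has_laplace_pos (\<lambda>T. F T - G T) (real n) 0" if "n \<ge> 1" for n :: nat
  using has_laplace_add[OF F[OF that] has_laplace_cmult[OF G[OF that], of "-1"]] by (simp add: right_diff_distrib)
 hence "F T - G T = 0" using T cont by (intro laplace_zero[of "\<lambda>T. F T - G T"] continuous_intros)
 thus ?thesis by simp
qed

text \<open>The majorant is shaped for two uses: growth linear in T with q = 0 for Weber's integral,
  and the factor T^(-3/4) for the triple product. The condition q < nu + 1 makes T^(nu - q)
  integrable at 0.\<close>

lemma bessel_e_laplace_Fubini:
 fixes b :: "real => real"
 assumes nu: "nu > -1" and q: "q < nu + 1" and [measurable]: "b \<in> borel_measurable borel"
  and psi: "integrable lborel \<psi>" "\<And>Y. \<psi> Y \<ge> 0"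
  and bound: "\<And>T Y. T > 0 ==> Y > 0 ==> \<bar>bessel_e nu (-(T*Y)) * b Y\<bar> \<le> (1 + T + T powr (-q)) * \<psi> Y"
  and s: "s > 0"
 shows "has_laplace_pos (\<lambda>T. T powr nu * (LINT Y:{0<..}|lborel. bessel_e nu (-(T*Y)) * b Y)) s
   (s powr (-nu-1) * (LINT Y:{0<..}|lborel. b Y * exp (-(Y/s))))"
proof -
 define g where "g T Y = exp (-(s*T)) * (indicator {0<..} T * (T powr nu * (indicator {0<..} Y * (bessel_e nu (-(T*Y)) * b Y))))" for T Y
 have [measurable]: "case_prod g \<in> borel_measurable (lborel \<Otimes>\<^sub>M lborel)" unfolding g_def by measurable
 define \<phi> where "\<phi> T = exp (-(s*T)) * (indicator {0<..} T * T powr (nu + 1 - 1) + indicator {0<..} T * T powr (nu + 2 - 1)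
   + indicator {0<..} T * T powr (nu - q + 1 - 1))" for T
 have phi: "integrable lborel \<phi>"
 proof -
  have "\<exists>v. has_laplace (\<lambda>T. indicator {0<..} T * T powr (nu + 1 - 1) + indicator {0<..} T * T powr (nu + 2 - 1) + indicator {0<..} T * T powr (nu - q + 1 - 1)) s v"
   by (rule exI, rule has_laplace_add[OF has_laplace_add[OF Gamma_moment[OF _ s] Gamma_moment[OF _ s]] Gamma_moment[OF _ s]]) (use nu q in simp_all)
  thus ?thesis by (auto simp: has_laplace_def has_bochner_integral_iff \<phi>_def[abs_def])
 qed
 have phi_eq: "\<phi> T = exp (-(s*T)) * T powr nu * (1 + T + T powr (-q))" if "T > 0" for T
 proof -
  have "T powr (nu + 2 - 1) = T powr nu * T" "T powr (nu - q + 1 - 1) = T powr nu * T powr (-q)"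
   unfolding powr_add[symmetric] using that powr_add[of T nu 1] by (auto simp: add.commute)
  thus ?thesis using that by (simp add: \<phi>_def algebra_simps)
 qed
 have gb: "\<bar>g T Y\<bar> \<le> \<phi> T * \<psi> Y" for T Y
 proof (cases "T > 0 \<and> Y > 0")
  case True
  have "\<bar>g T Y\<bar> = exp (-(s*T)) * T powr nu * \<bar>bessel_e nu (-(T*Y)) * b Y\<bar>"
   using True by (simp add: g_def abs_mult)
  also have "\<dots> \<le> exp (-(s*T)) * T powr nu * ((1 + T + T powr (-q)) * \<psi> Y)"
   using True by (intro mult_left_mono bound) auto
  also have "\<dots> = \<phi> T * \<psi> Y" using True by (simp add: phi_eq)
  finally show ?thesis .
 next
  case False
  hence "g T Y = 0" by (auto simp: g_def)
  thus ?thesis using psi(2)[of Y] by (auto simp: \<phi>_def)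
 qed
 have gY: "(LINT Y|lborel. g T Y) = exp (-(s*T)) * (indicator {0<..} T * (T powr nu * (LINT Y:{0<..}|lborel. bessel_e nu (-(T*Y)) * b Y)))" for T
  unfolding g_def set_lebesgue_integral_def by (simp only: integral_mult_right_zero real_scaleR_def)
 have gT: "(LINT T|lborel. g T Y) = s powr (-nu-1) * (indicator {0<..} Y *\<^sub>R (b Y * exp (-(Y/s))))" for Y
 proof -
  have "has_bochner_integral lborel (\<lambda>T. (indicator {0<..} Y * b Y) * (exp (-(s*T)) * (indicator {0<..} T * (T powr nu * bessel_e nu ((-Y)*T)))))
    ((indicator {0<..} Y * b Y) * (s powr (-nu-1) * exp ((-Y)/s)))"
   using bessel_e_laplace[OF nu s, of "-Y"] unfolding has_laplace_def by (rule has_bochner_integral_mult_right)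
  also have "(\<lambda>T. (indicator {0<..} Y * b Y) * (exp (-(s*T)) * (indicator {0<..} T * (T powr nu * bessel_e nu ((-Y)*T))))) = (\<lambda>T. g T Y)"
   by (auto simp: g_def fun_eq_iff mult_ac)
  finally show ?thesis by (simp add: has_bochner_integral_iff mult_ac)
 qed
 have "(LINT T|lborel. LINT Y|lborel. g T Y) = (LINT Y|lborel. LINT T|lborel. g T Y)"
  by (rule Fubini_product_bound(2)[OF _ phi psi(1) gb]) measurable
 moreover have "integrable lborel (\<lambda>T. LINT Y|lborel. g T Y)" by (rule Fubini_product_bound(1)[OF _ phi psi(1) gb]) measurable
 ultimately show ?thesis unfolding has_laplace_def has_bochner_integral_iff gY gT by (simp add: set_lebesgue_integral_def)
qed

lemma bessel_e_transform_continuous: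
 fixes b :: "real => real"
 assumes [measurable]: "b \<in> borel_measurable borel"
  and psi: "integrable lborel \<psi>" "\<And>Y. \<psi> Y \<ge> 0"
  and bound: "\<And>T Y. T > 0 ==> Y > 0 ==> \<bar>bessel_e nu (-(T*Y)) * b Y\<bar> \<le> (1 + T + T powr (-q)) * \<psi> Y"
  and T: "T > 0"
 shows "isCont (\<lambda>T. LINT Y:{0<..}|lborel. bessel_e nu (-(T*Y)) * b Y) T"
proof -
 define K where "K = {T/2..2*T}"
 have "continuous_on K (\<lambda>T. 1 + T + T powr (-q))" unfolding K_def using T by (intro continuous_intros) auto
 hence "compact ((\<lambda>T. 1 + T + T powr (-q)) ` K)" by (rule compact_continuous_image) (simp add: K_def)
 then obtain M where "\<And>S. S \<in> K ==> norm (1 + S + S powr (-q)) \<le> M"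
  by (metis (no_types, lifting) bounded_iff compact_imp_bounded image_eqI)
 hence M: "1 + S + S powr (-q) \<le> M" if "S \<in> K" for S using that by (metis abs_le_D1 real_norm_def)
 have "continuous_on K (\<lambda>T. LINT Y:{0<..}|lborel. bessel_e nu (-(T*Y)) * b Y)"
 proof (rule continuous_on_sequentiallyI)
  fix u S assume u: "\<forall>n. u n \<in> K" and S: "S \<in> K" "u \<longlonglongrightarrow> S"
  show "(\<lambda>n. LINT Y:{0<..}|lborel. bessel_e nu (-(u n*Y)) * b Y) \<longlonglongrightarrow> (LINT Y:{0<..}|lborel. bessel_e nu (-(S*Y)) * b Y)"
   unfolding set_lebesgue_integral_def
  proof (rule integral_dominated_convergence[where w = "\<lambda>Y. M * \<psi> Y"])
   show "integrable lborel (\<lambda>Y. M * \<psi> Y)" using psi(1) by simp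
   show "AE Y in lborel. (\<lambda>n. indicat_real {0<..} Y *\<^sub>R (bessel_e nu (-(u n*Y)) * b Y)) \<longlonglongrightarrow> indicat_real {0<..} Y *\<^sub>R (bessel_e nu (-(S*Y)) * b Y)"
    using S(2) by (intro AE_I2 tendsto_intros isCont_tendsto_compose[OF isCont_bessel_e])
   fix n
   have "u n \<in> K" using u by blast
   hence un: "u n > 0" "1 + u n + u n powr (-q) \<le> M" using T M by (auto simp: K_def)
   show "AE Y in lborel. norm (indicat_real {0<..} Y *\<^sub>R (bessel_e nu (-(u n*Y)) * b Y)) \<le> M * \<psi> Y"
   proof (rule AE_I2)
    fix Y
    have M0: "0 \<le> M" using un by (smt (verit) powr_ge_zero)
    show "norm (indicat_real {0<..} Y *\<^sub>R (bessel_e nu (-(u n*Y)) * b Y)) \<le> M * \<psi> Y"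
    proof (cases "Y > 0")
     case True
     have "\<bar>bessel_e nu (-(u n*Y)) * b Y\<bar> \<le> (1 + u n + u n powr (-q)) * \<psi> Y"
      using bound[OF un(1) True] .
     also have "\<dots> \<le> M * \<psi> Y" using un psi(2) by (intro mult_right_mono) auto
     finally show ?thesis using True by simp
    qed (use M0 psi(2) in simp)
   qed
  qed simp_all
 qed
 thus ?thesis using T continuous_on_interior[of K _ T] by (simp add: K_def)
qed

section \<open>Weber's integral and the Laplace transform of the triple integral\<close>

lemma integrable_indicator_powr:
 fixes a c :: real
 assumes a: "a > -1" and c: "a + c < -1"
 shows "integrable lborel (\<lambda>Y. indicator {0<..} Y * (Y powr a * (1 + Y) powr c))"
proof -
 have i1: "set_integrable lborel {0<..<1} (\<lambda>y. y powr a)" by (rule set_integrable_powr[OF a])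
 have "(\<lambda>y. y powr (a + c)) absolutely_integrable_on {1..}"
  using has_integral_powr_to_inf[of "a + c" 1] c by (intro nonnegative_absolutely_integrable_1) (auto simp: has_integral_iff)
 hence i2: "set_integrable lborel {1..} (\<lambda>y. y powr (a + c))" by (rule set_integrable_lborelI) auto
 have "integrable lborel (\<lambda>Y. 2 powr \<bar>c\<bar> * (indicator {0<..<1} Y *\<^sub>R Y powr a) + 2 powr \<bar>c\<bar> * (indicator {1..} Y *\<^sub>R Y powr (a + c)))"
  using i1 i2 unfolding set_integrable_def by (intro Bochner_Integration.integrable_add integrable_mult_right) auto
 thus ?thesis
 proof (rule Bochner_Integration.integrable_bound)
  show "AE Y in lborel. norm (indicator {0<..} Y * (Y powr a * (1 + Y) powr c)) \<le>
    norm (2 powr \<bar>c\<bar> * (indicator {0<..<1} Y *\<^sub>R Y powr a) + 2 powr \<bar>c\<bar> * (indicator {1..} Y *\<^sub>R Y powr (a + c)))"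
  proof (rule AE_I2)
   fix Y :: real
   consider "Y \<le> 0" | "0 < Y" "Y < 1" | "Y \<ge> 1" by linarith
   thus "norm (indicator {0<..} Y * (Y powr a * (1 + Y) powr c)) \<le>
    norm (2 powr \<bar>c\<bar> * (indicator {0<..<1} Y *\<^sub>R Y powr a) + 2 powr \<bar>c\<bar> * (indicator {1..} Y *\<^sub>R Y powr (a + c)))"
   proof cases
    case 2
    have "(1 + Y) powr c \<le> 2 powr \<bar>c\<bar> * 1 powr c" using 2 by (intro powr_comparable) auto
    hence "Y powr a * (1 + Y) powr c \<le> Y powr a * 2 powr \<bar>c\<bar>" by (intro mult_left_mono) auto
    thus ?thesis using 2 by (simp add: mult_ac)
   next
    case 3
    have "(1 + Y) powr c \<le> 2 powr \<bar>c\<bar> * Y powr c" using 3 by (intro powr_comparable) auto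
    hence "Y powr a * (1 + Y) powr c \<le> Y powr a * (2 powr \<bar>c\<bar> * Y powr c)" by (intro mult_left_mono) auto
    thus ?thesis using 3 by (simp add: mult_ac powr_add)
   qed simp
  qed
 qed simp
qed

lemma bessel_e_bound':
 assumes X: "X > 0"
 shows "\<exists>C>0. \<forall>Y>0. \<bar>bessel_e nu (-(X*Y))\<bar> \<le> C * (1 + Y) powr (- nu / 2 - 1/4)"
proof -
 obtain C where C: "C > 0" "\<And>w. w \<ge> 0 ==> \<bar>bessel_e nu (-w)\<bar> \<le> C * (1 + w) powr (- nu / 2 - 1/4)"
  using bessel_e_bound[of nu] by blast
 define k where "k = 1 + X + 1 / X"
 have "1 / X > 0" using X by simp
 hence k1: "k \<ge> 1" unfolding k_def using X by linarith
 have "\<bar>bessel_e nu (-(X*Y))\<bar> \<le> C * k powr \<bar>- nu / 2 - 1/4\<bar> * (1 + Y) powr (- nu / 2 - 1/4)" if Y: "Y > 0" for Y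
 proof -
  have "\<bar>bessel_e nu (-(X*Y))\<bar> \<le> C * (1 + X*Y) powr (- nu / 2 - 1/4)" using C(2) X Y by simp
  also have "\<dots> \<le> C * (k powr \<bar>- nu / 2 - 1/4\<bar> * (1 + Y) powr (- nu / 2 - 1/4))"
  proof (intro mult_left_mono powr_comparable)
   have "k * (1 + Y) = 1 + X * Y + (X + 1/X + Y + Y/X)" by (simp add: k_def algebra_simps add_divide_distrib)
   thus "1 + X*Y \<le> k * (1 + Y)" using X Y by simp
   have "k * (1 + X*Y) = 1 + Y + (X + 1/X + X*Y + X*X*Y)" using X by (simp add: k_def algebra_simps)
   thus "1 + Y \<le> k * (1 + X*Y)" using X Y by simp
  qed (use C(1) X Y k1 in \<open>auto simp: add_pos_pos\<close>)
  finally show ?thesis by (simp add: mult_ac)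
 qed
 moreover have "C * k powr \<bar>- nu / 2 - 1/4\<bar> > 0"
  using C(1) k1 by (intro mult_pos_pos) auto
 ultimately show ?thesis by blast
qed

lemma bessel_e_linear_bound:
 assumes "nu > -1"
 shows "\<exists>C>0. \<forall>X>0. \<forall>Y>0. \<bar>bessel_e nu (-(X*Y))\<bar> \<le> C * (1 + X) * (1 + Y)"
proof -
 obtain C where C: "C > 0" "\<And>w. w \<ge> 0 ==> \<bar>bessel_e nu (-w)\<bar> \<le> C * (1 + w) powr (- nu / 2 - 1/4)"
  using bessel_e_bound[of nu] by blast
 have "\<bar>bessel_e nu (-(X*Y))\<bar> \<le> C * (1 + X) * (1 + Y)" if "X > 0" "Y > 0" for X Y
 proof -
  have "\<bar>bessel_e nu (-(X*Y))\<bar> \<le> C * (1 + X*Y) powr (- nu / 2 - 1/4)" using C(2) that by simp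
  also have "\<dots> \<le> C * (1 + X*Y) powr 1" using C that assms by (intro mult_left_mono powr_mono) auto
  also have "\<dots> \<le> C * ((1 + X) * (1 + Y))" using C that by (intro mult_left_mono) (auto simp: algebra_simps)
  finally show ?thesis by (simp add: mult.assoc)
 qed
 thus ?thesis using C(1) by blast
qed

text \<open>Weber's second exponential integral. Both sides, multiplied by X^al, have the same
  Laplace transform in X: on the left the transform leaves another Laplace integral in Y, on the
  right the factor exp (-(s X)) shifts the transform variable from n to n + s. Uniqueness and
  continuity finish the proof.\<close>

lemma weber_integral:
 assumes al: "al > -1" and X: "X > 0" and Z: "Z > 0" and s: "s > 0"
 shows "(LINT Y:{0<..}|lborel. bessel_e al (-(X*Y)) * (Y powr al * bessel_e al (-(Z*Y)) * exp (-(Y/s))))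
   = s powr (al+1) * exp (-(s*(X+Z))) * bessel_e al (s\<^sup>2*X*Z)"
proof -
 obtain C where C: "C > 0" "\<And>X Y. X > 0 ==> Y > 0 ==> \<bar>bessel_e al (-(X*Y))\<bar> \<le> C * (1 + X) * (1 + Y)"
  using bessel_e_linear_bound[OF al] by blast
 define b where "b Y = Y powr al * bessel_e al (-(Z*Y)) * exp (-(Y/s))" for Y
 have [measurable]: "b \<in> borel_measurable borel" unfolding b_def[abs_def] by measurable
 let ?m = "\<lambda>c Y. indicator {0<..} Y * Y powr (c - 1)"
 define \<psi> where "\<psi> Y = exp (-(1/s*Y)) * (C\<^sup>2 * (1 + Z) * (?m (al+1) Y + 2 * ?m (al+2) Y + ?m (al+3) Y))" for Y
 have psi_nn: "\<psi> Y \<ge> 0" for Y using C Z by (simp add: \<psi>_def)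
 have psi_int: "integrable lborel \<psi>"
 proof -
  have "\<exists>v. has_laplace (\<lambda>Y. C\<^sup>2 * (1 + Z) * (?m (al+1) Y + 2 * ?m (al+2) Y + ?m (al+3) Y)) (1/s) v"
   by (rule exI, rule has_laplace_cmult[OF has_laplace_add[OF has_laplace_add[OF Gamma_moment has_laplace_cmult[OF Gamma_moment]] Gamma_moment]]) (use al s in simp_all)
  thus ?thesis by (auto simp: has_laplace_def has_bochner_integral_iff \<psi>_def[abs_def])
 qed
 have bound: "\<bar>bessel_e al (-(T*Y)) * b Y\<bar> \<le> (1 + T + T powr (-0)) * \<psi> Y" if "T > 0" "Y > 0" for T Y
 proof -
  have "Y powr (al+2-1) = Y powr al * Y" "Y powr (al+3-1) = Y powr al * Y\<^sup>2"
   using that powr_add[of Y al 1] powr_add[of Y al 2] by (auto simp: powr_numeral add.commute)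
  hence psi: "\<psi> Y = (C\<^sup>2 * (1 + Z) * (1 + Y)\<^sup>2) * (Y powr al * exp (-(Y/s)))" using that by (simp add: \<psi>_def algebra_simps power2_eq_square)
  have "\<bar>bessel_e al (-(T*Y)) * b Y\<bar> = (\<bar>bessel_e al (-(T*Y))\<bar> * \<bar>bessel_e al (-(Z*Y))\<bar>) * (Y powr al * exp (-(Y/s)))"
   by (simp add: b_def abs_mult mult_ac)
  also have "\<dots> \<le> ((C * (1 + T) * (1 + Y)) * (C * (1 + Z) * (1 + Y))) * (Y powr al * exp (-(Y/s)))"
   using that C Z by (intro mult_right_mono mult_mono) auto
  also have "\<dots> = (1 + T) * \<psi> Y" unfolding psi by (simp add: power2_eq_square mult_ac)
  also have "\<dots> \<le> (1 + T + T powr (-0)) * \<psi> Y" using psi_nn by (intro mult_right_mono) auto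
  finally show ?thesis .
 qed
 have ring: "r * (k' * ez) = (sp * e1) * (ns * e2)" if "r * k' = sp * ns" "ez = e1 * e2" for r k' ez sp e1 ns e2 :: real
  using that by algebra
 define f where "f X = X powr al * (LINT Y:{0<..}|lborel. bessel_e al (-(X*Y)) * b Y)" for X
 define g where "g X = s powr (al+1) * exp (-(s*Z)) * (exp (-(s*X)) * (X powr al * bessel_e al (s\<^sup>2*Z*X)))" for X
 have "f X = g X"
 proof (rule laplace_unique[OF _ _ X])
  show "isCont f X" "isCont g X"
   unfolding f_def g_def using X
   by (intro continuous_intros bessel_e_transform_continuous[OF _ psi_int psi_nn bound]
     isCont_o2[OF _ isCont_bessel_e]; simp)+
  fix n :: nat assume "n \<ge> 1"
  hence n0: "real n > 0" by simp
  \<comment> \<open>b contains exp (-(Y/s)) and the transform at n contributes exp (-(Y/n)), so the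
    Y-integral is a Laplace transform at 1/s + 1/n.\<close>
  define k where "k = 1/s + 1/real n"
  have k: "k > 0" using s n0 by (simp add: k_def add_pos_pos)
  let ?v = "(s powr (al+1) * exp (-(s*Z))) * ((real n + s) powr (-al-1) * exp ((s\<^sup>2*Z)/(real n + s)))"
  have "has_laplace_pos f (real n) (real n powr (-al-1) * (LINT Y:{0<..}|lborel. b Y * exp (-(Y/real n))))"
   unfolding f_def using al by (intro bessel_e_laplace_Fubini[OF al _ _ psi_int psi_nn bound n0]) simp_all
  also have "(LINT Y:{0<..}|lborel. b Y * exp (-(Y/real n))) = k powr (-al-1) * exp ((-Z)/k)"
  proof -
   have "exp (-(k*Y)) * (indicator {0<..} Y * (Y powr al * bessel_e al ((-Z)*Y))) = indicator {0<..} Y *\<^sub>R (b Y * exp (-(Y/real n)))" for Y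
    by (simp add: b_def k_def ring_distribs exp_add[symmetric] mult.assoc)
   thus ?thesis using bessel_e_laplace[OF al k, of "-Z"] unfolding has_laplace_def set_lebesgue_integral_def by (simp only: has_bochner_integral_integral_eq)
  qed
  also have "real n powr (-al-1) * (k powr (-al-1) * exp ((-Z)/k)) = ?v"
  proof (rule ring)
   have ke: "k = (real n + s) / (s * real n)" using s n0 by (simp add: k_def field_simps)
   have "real n powr (-al-1) * k powr (-al-1) = (real n * k) powr (-al-1)" using n0 k by (simp add: powr_mult)
   also have "real n * k = (real n + s) / s" using n0 s by (simp add: ke)
   also have "\<dots> powr (-al-1) = (real n + s) powr (-al-1) / s powr (-al-1)" using n0 s by (simp add: powr_divide)
   also have "s powr (-al-1) = 1 / s powr (al+1)" using powr_minus_divide[of s "al+1"] by simp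
   finally show "real n powr (-al-1) * k powr (-al-1) = s powr (al+1) * (real n + s) powr (-al-1)" by simp
   have "(-Z)/k = -(s*Z) + (s\<^sup>2*Z)/(real n + s)"
    using s n0 by (simp add: ke field_simps power2_eq_square)
   thus "exp ((-Z)/k) = exp (-(s*Z)) * exp ((s\<^sup>2*Z)/(real n + s))" by (simp only: exp_add)
  qed
  finally show "has_laplace_pos f (real n) ?v" .
  have "exp (-((real n + s)*T)) = exp (-(real n*T)) * exp (-(s*T))" for T
   unfolding exp_add[symmetric] by (simp add: algebra_simps)
  hence h: "exp (-((real n + s)*T)) * (indicator {0<..} T * (T powr al * bessel_e al (s\<^sup>2*Z*T)))
    = exp (-(real n*T)) * (indicator {0<..} T * (exp (-(s*T)) * (T powr al * bessel_e al (s\<^sup>2*Z*T))))" for T by (simp add: mult_ac)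
  have "real n + s > 0" using s n0 by simp
  from bessel_e_laplace[OF al this, of "s\<^sup>2*Z"]
  have "has_laplace_pos (\<lambda>T. exp (-(s*T)) * (T powr al * bessel_e al (s\<^sup>2*Z*T))) (real n) ((real n + s) powr (-al-1) * exp ((s\<^sup>2*Z)/(real n + s)))"
   unfolding has_laplace_def h .
  from has_laplace_cmult[OF this, of "s powr (al+1) * exp (-(s*Z))"] show "has_laplace_pos g (real n) ?v"
   by (simp add: g_def[abs_def] mult_ac)
 qed
 moreover have "exp (-(s*(X+Z))) = exp (-(s*Z)) * exp (-(s*X))" unfolding exp_add[symmetric] by (simp add: algebra_simps)
 ultimately show ?thesis using X unfolding f_def g_def b_def by (simp add: mult_ac)
qed

text \<open>For nu > 1 the factor of order nu decays at least like (T Y)^(-3/4). With the two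
  factors of order al and the power Y^al this makes Y^(-5/4), which is integrable at infinity, so
  the improper integral is absolutely convergent and Fubini applies. The transform at n is n^(-nu -
  1) times Weber's integral with s = n.\<close>

lemma triple_transform:
 assumes al: "al > -1" and nu: "nu > 1" and X: "X > 0" and Z: "Z > 0"
 defines "F \<equiv> \<lambda>T. T powr nu * (LINT Y:{0<..}|lborel. triple al nu X Z T Y)"
 shows "\<And>T. T > 0 ==> ((\<lambda>rho. T powr nu * triple_int al nu X Z T rho) \<longlongrightarrow> F T) at_top"
  and "\<And>T. T > 0 ==> isCont F T"
  and "\<And>n::nat. n \<ge> 1 ==> has_laplace_pos F (real n) (real n powr (al-nu) * exp (-(real n*(X+Z))) * bessel_e al ((real n)\<^sup>2*X*Z))"
proof -
 define b where "b Y = Y powr al * bessel_e al (-(X*Y)) * bessel_e al (-(Z*Y))" for Y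
 have [measurable]: "b \<in> borel_measurable borel" unfolding b_def[abs_def] by measurable
 have tb: "triple al nu X Z T Y = bessel_e nu (-(T*Y)) * b Y" for T Y by (simp add: triple_def b_def)
 obtain C1 where C1: "C1 > 0" "\<And>Y. Y > 0 ==> \<bar>bessel_e al (-(X*Y))\<bar> \<le> C1 * (1 + Y) powr (- al / 2 - 1/4)"
  using bessel_e_bound'[OF X] by blast
 obtain C2 where C2: "C2 > 0" "\<And>Y. Y > 0 ==> \<bar>bessel_e al (-(Z*Y))\<bar> \<le> C2 * (1 + Y) powr (- al / 2 - 1/4)"
  using bessel_e_bound'[OF Z] by blast
 obtain C where C: "C > 0" "\<And>w. w \<ge> 0 ==> \<bar>bessel_e nu (-w)\<bar> \<le> C * (1 + w) powr (- nu / 2 - 1/4)"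
  using bessel_e_bound[of nu] by blast
 define c where "c = - al / 2 - 1/4 + (- al / 2 - 1/4) - 3/4"
 have c: "al + c < -1" by (simp add: c_def)
 define \<psi> where "\<psi> Y = C * C1 * C2 * (indicator {0<..} Y * (Y powr al * (1 + Y) powr c))" for Y
 have psi_nn: "\<psi> Y \<ge> 0" for Y using C C1 C2 by (simp add: \<psi>_def)
 have psi_int: "integrable lborel \<psi>" unfolding \<psi>_def[abs_def]
  by (intro integrable_mult_right integrable_indicator_powr al c)
 have bound: "\<bar>bessel_e nu (-(T*Y)) * b Y\<bar> \<le> (1 + T + T powr (-(3/4))) * \<psi> Y" if T: "T > 0" and Y: "Y > 0" for T Y
 proof -
  have "(1 + T*Y) powr (- nu / 2 - 1/4) \<le> (1 + T*Y) powr (-(3/4))" using T Y nu by (intro powr_mono) auto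
  also have "\<dots> \<le> (1 + T + T powr (-(3/4))) * (1 + Y) powr (-(3/4))"
  proof (cases "T \<ge> 1")
   case True
   have "(1 + T*Y) powr (-(3/4)) \<le> (1 + Y) powr (-(3/4))" using True Y by (intro powr_mono2') auto
   also have "\<dots> \<le> (1 + T + T powr (-(3/4))) * (1 + Y) powr (-(3/4))"
    using T by (simp add: mult_le_cancel_right1 add_increasing2)
   finally show ?thesis .
  next
   case False
   have "T * (1 + Y) > 0" using T Y by (intro mult_pos_pos) auto
   hence "(1 + T*Y) powr (-(3/4)) \<le> (T * (1 + Y)) powr (-(3/4))" using False T Y by (intro powr_mono2') (auto simp: algebra_simps)
   also have "\<dots> = T powr (-(3/4)) * (1 + Y) powr (-(3/4))" using T Y by (simp add: powr_mult)
   also have "\<dots> \<le> (1 + T + T powr (-(3/4))) * (1 + Y) powr (-(3/4))" using T by (intro mult_right_mono) auto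
   finally show ?thesis .
  qed
  finally have 1: "\<bar>bessel_e nu (-(T*Y))\<bar> \<le> C * ((1 + T + T powr (-(3/4))) * (1 + Y) powr (-(3/4)))"
   by (intro order_trans[OF C(2) mult_left_mono]) (use C(1) T Y in auto)
  have "\<bar>bessel_e nu (-(T*Y)) * b Y\<bar> = \<bar>bessel_e nu (-(T*Y))\<bar> * (\<bar>bessel_e al (-(X*Y))\<bar> * \<bar>bessel_e al (-(Z*Y))\<bar>) * Y powr al"
   by (simp add: b_def abs_mult mult_ac)
  also have "\<dots> \<le> C * ((1 + T + T powr (-(3/4))) * (1 + Y) powr (-(3/4))) *
    ((C1 * (1 + Y) powr (- al / 2 - 1/4)) * (C2 * (1 + Y) powr (- al / 2 - 1/4))) * Y powr al"
   using C1 C2 C(1) T Y by (intro mult_right_mono mult_mono 1 mult_nonneg_nonneg add_nonneg_nonneg) auto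
  also have "\<dots> = (1 + T + T powr (-(3/4))) * (C * C1 * C2 * (Y powr al *
    ((1 + Y) powr (- al / 2 - 1/4) * (1 + Y) powr (- al / 2 - 1/4) * (1 + Y) powr (-(3/4)))))"
   by (simp only: mult_ac)
  also have "(1 + Y) powr (- al / 2 - 1/4) * (1 + Y) powr (- al / 2 - 1/4) * (1 + Y) powr (-(3/4)) = (1 + Y) powr c"
   unfolding powr_add[symmetric] c_def by simp
  finally show ?thesis using Y by (simp add: \<psi>_def)
 qed
 have F: "F = (\<lambda>T. T powr nu * (LINT Y:{0<..}|lborel. bessel_e nu (-(T*Y)) * b Y))"
  by (simp add: F_def tb)
 show "isCont F T" if "T > 0" for T unfolding F
  using that by (intro continuous_intros bessel_e_transform_continuous[OF _ psi_int psi_nn bound]) auto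
 have nu': "nu > -1" "3/4 < nu + 1" using nu by auto
 show "((\<lambda>rho. T powr nu * triple_int al nu X Z T rho) \<longlongrightarrow> F T) at_top" if T: "T > 0" for T
 proof -
 have "((\<lambda>rho. \<integral>Y. indicator {0<..<rho} Y *\<^sub>R triple al nu X Z T Y \<partial>lborel) \<longlongrightarrow> (\<integral>Y. indicator {0<..} Y *\<^sub>R triple al nu X Z T Y \<partial>lborel)) at_top"
 proof (rule integral_dominated_convergence_at_top[where w = "\<lambda>Y. (1 + T + T powr (-(3/4))) * \<psi> Y"])
  show "integrable lborel (\<lambda>Y. (1 + T + T powr (-(3/4))) * \<psi> Y)" using psi_int by simp
  have "\<bar>indicator {0<..<rho} Y * triple al nu X Z T Y\<bar> \<le> (1 + T + T powr (-(3/4))) * \<psi> Y" for rho Y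
  proof (cases "Y \<in> {0<..<rho}")
   case True
   thus ?thesis using bound[OF T, of Y] by (simp add: tb)
  qed (use T psi_nn in \<open>simp add: add_nonneg_nonneg\<close>)
  thus "\<forall>\<^sub>F rho in at_top. AE Y in lborel. norm (indicat_real {0<..<rho} Y *\<^sub>R triple al nu X Z T Y) \<le> (1 + T + T powr (-(3/4))) * \<psi> Y"
   by simp
  show "AE Y in lborel. ((\<lambda>rho. indicat_real {0<..<rho} Y *\<^sub>R triple al nu X Z T Y) \<longlongrightarrow> indicat_real {0<..} Y *\<^sub>R triple al nu X Z T Y) at_top"
  proof (rule AE_I2)
   fix Y :: real
   have "eventually (\<lambda>rho. indicat_real {0<..} Y *\<^sub>R triple al nu X Z T Y = indicat_real {0<..<rho} Y *\<^sub>R triple al nu X Z T Y) at_top"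
    using eventually_gt_at_top[of Y] by eventually_elim (auto simp: indicator_def)
   thus "((\<lambda>rho. indicat_real {0<..<rho} Y *\<^sub>R triple al nu X Z T Y) \<longlongrightarrow> indicat_real {0<..} Y *\<^sub>R triple al nu X Z T Y) at_top"
    by (rule Lim_transform_eventually[OF tendsto_const])
  qed
 qed measurable
 thus ?thesis
  unfolding F_def triple_int_def set_lebesgue_integral_def by (intro tendsto_intros)
 qed
 fix n :: nat assume "n \<ge> 1"
 hence n: "real n > 0" by simp
 have "has_laplace_pos F (real n) (real n powr (-nu-1) * (LINT Y:{0<..}|lborel. b Y * exp (-(Y/real n))))"
  unfolding F by (rule bessel_e_laplace_Fubini[OF nu' _ psi_int psi_nn bound n]) simp_all
 also have "(LINT Y:{0<..}|lborel. b Y * exp (-(Y/real n))) = real n powr (al+1) * exp (-(real n*(X+Z))) * bessel_e al ((real n)\<^sup>2*X*Z)"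
  using weber_integral[OF al X Z n] by (simp add: b_def mult_ac)
 also have "real n powr (-nu-1) * (real n powr (al+1) * exp (-(real n*(X+Z))) * bessel_e al ((real n)\<^sup>2*X*Z))
   = (real n powr (-nu-1) * real n powr (al+1)) * exp (-(real n*(X+Z))) * bessel_e al ((real n)\<^sup>2*X*Z)" by (simp only: mult.assoc)
 also have "real n powr (-nu-1) * real n powr (al+1) = real n powr (al-nu)" unfolding powr_add[symmetric] by (simp add: algebra_simps)
 finally show "has_laplace_pos F (real n) (real n powr (al-nu) * exp (-(real n*(X+Z))) * bessel_e al ((real n)\<^sup>2*X*Z))" .
qed

section \<open>The profile of the kernel\<close>

text \<open>From N on the quotient of \<open>\<bar>c k\<bar>\<close> by \<open>d k\<close> does not
  increase; the finitely many earlier quotients go into the constant.\<close>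

lemma ratio_comparison:
 fixes c d :: "nat => real"
 assumes d: "\<And>k. d k > 0" and r: "\<And>k. k \<ge> N ==> \<bar>c (Suc k)\<bar> * d k \<le> \<bar>c k\<bar> * d (Suc k)"
 shows "\<exists>C>0. \<forall>k. \<bar>c k\<bar> \<le> C * d k"
proof -
 define C where "C = (\<Sum>k\<le>N. \<bar>c k\<bar> / d k) + 1"
 have le: "\<bar>c k\<bar> / d k \<le> (\<Sum>k\<le>N. \<bar>c k\<bar> / d k)" if "k \<le> N" for k
  using that by (intro member_le_sum) (auto intro!: divide_nonneg_pos d)
 have "\<bar>c k\<bar> / d k \<le> \<bar>c N\<bar> / d N" if "k \<ge> N" for k
  using that
 proof (induction k rule: dec_induct)
  case (step n)
  have "\<bar>c (Suc n)\<bar> / d (Suc n) \<le> \<bar>c n\<bar> / d n"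
   using r[OF step.hyps(1)] d[of n] d[of "Suc n"] by (simp add: field_simps)
  with step.IH show ?case by simp
 qed simp
 note ge = this
 have "\<bar>c k\<bar> / d k \<le> (\<Sum>k\<le>N. \<bar>c k\<bar> / d k)" for k
 proof (cases "k \<le> N")
  case False
  hence "\<bar>c k\<bar> / d k \<le> \<bar>c N\<bar> / d N" by (intro ge) simp
  also have "\<dots> \<le> (\<Sum>k\<le>N. \<bar>c k\<bar> / d k)" by (rule le) simp
  finally show ?thesis .
 qed (rule le)
 hence "\<bar>c k\<bar> \<le> C * d k" for k
  using d[of k] by (simp add: C_def divide_le_eq) (smt (verit) d mult_right_mono)
 moreover have "C > 0" unfolding C_def by (intro add_nonneg_pos sum_nonneg) (auto intro!: divide_nonneg_pos d)
 ultimately show ?thesis by blast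
qed

lemma powser_Euler:
 fixes c :: "nat => real"
 assumes "summable (\<lambda>n. c n * K ^ n)" "\<bar>w\<bar> < \<bar>K\<bar>"
 shows "\<exists>D. ((\<lambda>w. \<Sum>n. c n * w ^ n) has_real_derivative D) (at w) \<and> (\<lambda>n. real n * c n * w ^ n) sums (w * D)"
proof -
 define D where "D = (\<Sum>n. diffs c n * w ^ n)"
 have "((\<lambda>w. \<Sum>n. c n * w ^ n) has_real_derivative D) (at w)"
  unfolding D_def by (rule termdiffs_strong[OF assms(1)]) (use assms(2) in simp)
 moreover have "summable (\<lambda>n. diffs c n * w ^ n)"
 proof (rule termdiff_converges[of w "\<bar>K\<bar>"])
  fix x :: real assume "norm x < \<bar>K\<bar>"
  thus "summable (\<lambda>n. c n * x ^ n)" using powser_inside[OF assms(1), of x] by simp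
 qed (use assms(2) in simp)
 hence "(\<lambda>n. w * (diffs c n * w ^ n)) sums (w * D)" unfolding D_def by (intro sums_mult summable_sums)
 hence "(\<lambda>n. real (Suc n) * c (Suc n) * w ^ Suc n) sums (w * D)"
  by (rule sums_cong_fun) (simp add: diffs_def mult_ac)
 hence "(\<lambda>n. real n * c n * w ^ n) sums (w * D)"
  using sums_Suc_iff[of "\<lambda>n. real n * c n * w ^ n" "w * D"] by simp
 ultimately show ?thesis by blast
qed

text \<open>The operator s + q w d/dw multiplies the n-th coefficient by s + q n. For both series of
  the profile this factor turns \<open>rGamma\<close> at one argument into \<open>rGamma\<close> at
  the argument less by one, and so lowers nu by one.\<close>

lemma powser_DERIV_powr:
 fixes c c' :: "nat => real"
 assumes "summable (\<lambda>n. c n * K ^ n)" "\<bar>w\<bar> < \<bar>K\<bar>" and w: "w > 0"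
  and c': "\<And>n. c' n = (s + q * real n) * c n"
 shows "\<exists>D. ((\<lambda>w. \<Sum>n. c n * w ^ n) has_real_derivative D) (at w) \<and> s * (\<Sum>n. c n * w ^ n) + q * (w * D) = (\<Sum>n. c' n * w ^ n)"
proof -
 obtain D where D: "((\<lambda>w. \<Sum>n. c n * w ^ n) has_real_derivative D) (at w)" "(\<lambda>n. real n * c n * w ^ n) sums (w * D)"
  using powser_Euler[OF assms(1,2)] by blast
 have "summable (\<lambda>n. c n * w ^ n)" using powser_inside[OF assms(1), of w] assms(2) by simp
 hence "(\<lambda>n. s * (c n * w ^ n) + q * (real n * c n * w ^ n)) sums (s * (\<Sum>n. c n * w ^ n) + q * (w * D))"
  by (intro sums_add sums_mult D(2) summable_sums)
 hence "(\<lambda>n. c' n * w ^ n) sums (s * (\<Sum>n. c n * w ^ n) + q * (w * D))"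
  by (rule sums_cong_fun) (simp add: c' algebra_simps)
 with D(1) show ?thesis by (auto simp: sums_iff)
qed

text \<open>Coefficients of the asymptotic expansion of I of order al: I s is asymptotically exp s /
  sqrt s times the sum of the terms coefA al k / s^k. Inverting s^(-nu - 1/2 - k) exp s term by term
  gives \<open>serA\<close> in \<tau> + 1.\<close>

definition coefA :: "real => nat => real" where
 "coefA al k = pochhammer (1/2 - al) k * pochhammer (1/2 + al) k / (2 ^ k * fact k * sqrt (2 * pi))"

definition serA :: "real => real => real => real" where
 "serA al nu w = (\<Sum>k. coefA al k * rGamma (nu + 1/2 + real k) * w ^ k)"

text \<open>Coefficients of the ascending series: I s is the sum of the terms coefB al k s^(al + 2
  k). The formal inverse of s^(al + 2 k - nu) supplies the factor \<open>rGamma\<close> in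
  \<open>serB\<close>.\<close>

definition coefB :: "real => nat => real" where
 "coefB al k = 2 powr (-al) / (4 ^ k * fact k) * rGamma (real k + al + 1)"

definition serB :: "real => real => real => real" where
 "serB al nu v = (\<Sum>k. coefB al k * rGamma (nu - al - 2 * real k) * v ^ k)"

text \<open>
 The inverse Laplace transform of \<open>s powr (-nu) * I s\<close>, \<open>I\<close> being the modified Bessel function of order \<open>al\<close>; it vanishes on \<open>(-\<infinity>, -1)\<close>, and the
 values at \<open>\<plusminus>1\<close> are irrelevant. The two series are its expansions at \<open>-1\<close> and at infinity.
\<close>
definition prof :: "real => real => real => real" where
 "prof al nu ta = (if ta \<le> -1 then 0
   else if ta < 1 then (ta + 1) powr (nu - 1/2) * serA al nu (ta + 1)
   else if ta = 1 then 0
   else ta powr (nu - al - 1) * serB al nu (1 / ta\<^sup>2))"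

text \<open>The Taylor coefficients of (1 - x)^g. They are positive for g < 0, which makes them
  majorants.\<close>

definition bin :: "real => nat => real" where
 "bin g k = (-1) ^ k * (g gchoose k)"

lemma bin_0 [simp]: "bin g 0 = 1"
 by (simp add: bin_def)

lemma bin_Suc: "bin g (Suc k) = bin g k * ((real k - g) / (real k + 1))"
proof -
 have "(real k + 1) * (g gchoose (Suc k)) = (g - real k) * (g gchoose k)"
  using gbinomial_absorption[of k g] gbinomial_absorb_comp[of g k] by (simp add: add_ac)
 hence "(g gchoose (Suc k)) = (g gchoose k) * ((g - real k) / (real k + 1))"
  by (simp add: field_simps)
 thus ?thesis unfolding bin_def by (simp only:) (simp add: field_simps)
qed

lemma bin_pos: "g < 0 ==> bin g k > 0"
 by (induction k) (auto simp: bin_Suc)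

lemma bin_sums: "\<bar>x\<bar> < 1 ==> (\<lambda>k. bin g k * x ^ k) sums ((1 - x) powr g)"
proof -
 assume x: "\<bar>x\<bar> < 1"
 hence "(\<lambda>n. (g gchoose n) * (-x)^n) sums (1 + (-x)) powr g" by (intro gen_binomial_real) simp
 hence "(\<lambda>k. bin g k * x ^ k) sums ((1 + (-x)) powr g)"
 proof (rule sums_cong_fun)
  fix n show "(g gchoose n) * (-x)^n = bin g n * x ^ n"
   by (subst power_minus) (simp add: bin_def mult_ac)
 qed
 thus ?thesis by simp
qed

lemma abs_quotient_le:
 fixes a b c d :: real
 assumes "\<bar>a\<bar> \<le> b * c" "c > 0" "d > 0"
 shows "\<bar>a / (d * c)\<bar> \<le> b / d"
proof -
 have "\<bar>a / (d * c)\<bar> = \<bar>a\<bar> / (d * c)" using assms by (simp add: abs_mult)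
 also have "\<dots> \<le> (b * c) / (d * c)" using assms by (intro divide_right_mono) auto
 finally show ?thesis using assms by simp
qed

text \<open>The coefficient quotient is 1 - (nu + 1/2) / k up to O(1 / k^2), that of
  \<open>bin g\<close> is 1 - (g + 1) / k, and g < nu - 1/2 decides the comparison. The singularity
  at \<tau> = 1 has the order (1 - \<tau>)^(nu - 1/2), possibly with a logarithm, hence the strict
  inequality; g < 0 keeps the majorant positive when nu > 1/2.\<close>

lemma coefA_bound:
 assumes nu: "nu > -1/2" and g: "g < 0" "g < nu - 1/2"
 shows "\<exists>C>0. \<forall>k. \<bar>coefA al k * rGamma (nu + 1/2 + real k) * 2 ^ k\<bar> \<le> C * bin g k"
proof -
 define c where "c k = coefA al k * rGamma (nu + 1/2 + real k) * 2 ^ k" for k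
 define d where "d = nu - 1/2 - g"
 have d: "d > 0" using g by (simp add: d_def)
 \<comment> \<open>\<open>\<bar>al\<bar>\<close> makes both factors in the numerator nonnegative; 1
   / (4 d) pays for the 1/4 in (k + 1/2)^2.\<close>
 define N where "N = nat \<lceil>\<bar>al\<bar> + 1 / (4 * d)\<rceil>"
 have "\<exists>C>0. \<forall>k. \<bar>c k\<bar> \<le> C * bin g k"
 proof (rule ratio_comparison)
  fix k assume "k \<ge> N"
  hence k: "real k \<ge> \<bar>al\<bar> + 1 / (4 * d)" unfolding N_def by linarith
  have k1: "real k \<ge> \<bar>al\<bar>" "real k \<ge> 1 / (4 * d)" using k d by (smt (verit) divide_pos_pos)+
  have p: "nu + 1/2 + real k > 0" using nu by (simp add: add_pos_nonneg)
  have "rGamma (nu + 1/2 + real (Suc k)) = rGamma (nu + 1/2 + real k) / (nu + 1/2 + real k)"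
   using rGamma_plus1[of "nu + 1/2 + real k"] p by (simp add: field_simps add_ac)
  hence "c (Suc k) = c k * ((1/2 - al + real k) * (1/2 + al + real k) / ((real k + 1) * (nu + 1/2 + real k)))"
  proof -
   have ring: "P * a * (Q * b) / ((2 * t) * (k1 * f) * sq) * (R / p') * (2 * t) = (P * Q / (t * f * sq) * R * t) * (a * b / (k1 * p'))"
    if "t \<noteq> 0" for P Q a b t k1 f sq R p' :: real
    using that by (simp add: divide_simps)
   show ?thesis
    unfolding c_def coefA_def pochhammer_Suc fact_Suc power_Suc
     \<open>rGamma (nu + 1/2 + real (Suc k)) = rGamma (nu + 1/2 + real k) / (nu + 1/2 + real k)\<close>
    unfolding of_nat_Suc add.commute[of 1 "real k"] by (rule ring) simp
  qed
  moreover have "\<bar>(1/2 - al + real k) * (1/2 + al + real k) / ((real k + 1) * (nu + 1/2 + real k))\<bar> \<le> (real k - g) / (real k + 1)"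
  proof -
   have "(1/2 - al + real k) * (1/2 + al + real k) \<ge> 0" using k1(1) by (intro mult_nonneg_nonneg) linarith+
   hence "\<bar>(1/2 - al + real k) * (1/2 + al + real k)\<bar> = (1/2 - al + real k) * (1/2 + al + real k)" by simp
   also have "\<dots> = (real k + 1/2)\<^sup>2 - al\<^sup>2" by (simp add: power2_eq_square algebra_simps)
   also have "\<dots> \<le> (real k + 1/2)\<^sup>2" by simp
   also have "\<dots> \<le> (real k - g) * (nu + 1/2 + real k)"
   proof -
    have "1/4 \<le> d * real k" using k1(2) d by (simp add: field_simps)
    moreover have "0 \<le> (-g) * (nu + 1/2)" using g nu by (intro mult_nonneg_nonneg) auto
    moreover have "(real k - g) * (nu + 1/2 + real k) - (real k + 1/2)\<^sup>2 = d * real k + (-g) * (nu + 1/2) - 1/4"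
     by (simp add: d_def power2_eq_square field_simps)
    ultimately show ?thesis by linarith
   qed
   finally show ?thesis using p by (intro abs_quotient_le) auto
  qed
  ultimately have "\<bar>c (Suc k)\<bar> \<le> \<bar>c k\<bar> * ((real k - g) / (real k + 1))"
   by (simp only: abs_mult[of "c k"]) (rule mult_left_mono; simp)
  hence "\<bar>c (Suc k)\<bar> * bin g k \<le> \<bar>c k\<bar> * ((real k - g) / (real k + 1)) * bin g k"
   using bin_pos[OF g(1), of k] by (intro mult_right_mono) auto
  thus "\<bar>c (Suc k)\<bar> * bin g k \<le> \<bar>c k\<bar> * bin g (Suc k)" by (simp add: bin_Suc mult_ac)
 qed (rule bin_pos[OF g(1)])
 thus ?thesis by (simp add: c_def)
qed

text \<open>The same comparison at v = 1. The functional equation of \<open>rGamma\<close> is used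
  downwards, as a product, so the terminating series, where \<open>rGamma\<close> vanishes, are
  included.\<close>

lemma coefB_bound:
 assumes al: "al > -1" and g: "g < 0" "g < nu - 1/2"
 shows "\<exists>C>0. \<forall>k. \<bar>coefB al k * rGamma (nu - al - 2 * real k)\<bar> \<le> C * bin g k"
proof -
 define c where "c k = coefB al k * rGamma (nu - al - 2 * real k)" for k
 define be where "be = nu - al"
 define d where "d = nu - 1/2 - g"
 define e where "e = \<bar>(1 - be/2) * (1/2 - be/2)\<bar>"
 have d: "d > 0" using g by (simp add: d_def)
 define N where "N = nat \<lceil>\<bar>be\<bar> + e / d\<rceil>"
 have e0: "e \<ge> 0" by (simp add: e_def)
 have "\<exists>C>0. \<forall>k. \<bar>c k\<bar> \<le> C * bin g k"
 proof (rule ratio_comparison)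
  fix k assume "k \<ge> N"
  hence k: "real k \<ge> \<bar>be\<bar> + e / d" unfolding N_def by linarith
  have k1: "real k \<ge> \<bar>be\<bar>" "real k \<ge> e / d" using k d e0 by (smt (verit) divide_nonneg_pos)+
  have p: "real k + 1 + al > 0" using al by (simp add: add_nonneg_pos)
  have r1: "rGamma (real (Suc k) + al + 1) = rGamma (real k + al + 1) / (real k + 1 + al)"
   using rGamma_plus1[of "real k + al + 1"] p by (simp add: field_simps add_ac)
  have r2: "rGamma (be - 2 * real (Suc k)) = (be - 2 * real k - 2) * ((be - 2 * real k - 1) * rGamma (be - 2 * real k))"
   using rGamma_plus1[of "be - 2 * real k - 2"] rGamma_plus1[of "be - 2 * real k - 1"] by (simp add: algebra_simps)
  have "c (Suc k) = c k * ((real k + 1 - be/2) * (real k + 1/2 - be/2) / ((real k + 1) * (real k + 1 + al)))"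
  proof -
   have ring: "s / ((4 * t) * (k1 * f)) * (G / p') * (a * (b * R)) = s / (t * f) * G * R * ((-a/2) * (-b/2) / (k1 * p'))"
    for s t f k1 G p' a b R :: real by (simp add: divide_simps)
   have eq: "real k + 1 - be/2 = -(be - 2 * real k - 2)/2" "real k + 1/2 - be/2 = -(be - 2 * real k - 1)/2"
    by (simp_all add: field_simps)
   show ?thesis
    unfolding c_def coefB_def r1 be_def[symmetric] r2 eq
    unfolding fact_Suc power_Suc of_nat_Suc add.commute[of 1 "real k"] by (rule ring)
  qed
  moreover have "\<bar>(real k + 1 - be/2) * (real k + 1/2 - be/2) / ((real k + 1) * (real k + 1 + al))\<bar> \<le> (real k - g) / (real k + 1)"
  proof -
   have "(real k + 1 - be/2) * (real k + 1/2 - be/2) \<ge> 0" using k1(1) by (intro mult_nonneg_nonneg) linarith+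
   hence "\<bar>(real k + 1 - be/2) * (real k + 1/2 - be/2)\<bar> = (real k + 1 - be/2) * (real k + 1/2 - be/2)" by simp
   also have "\<dots> = real k * real k + (3/2 - be) * real k + (1 - be/2) * (1/2 - be/2)" by (simp add: field_simps)
   also have "\<dots> \<le> real k * real k + (3/2 - be) * real k + e" by (simp add: e_def)
   also have "\<dots> \<le> (real k - g) * (real k + 1 + al)"
   proof -
    have "e \<le> d * real k" using k1(2) d by (simp add: field_simps)
    moreover have "0 \<le> (-g) * (1 + al)" using g al by (intro mult_nonneg_nonneg) auto
    ultimately show ?thesis by (simp add: d_def be_def algebra_simps)
   qed
   finally show ?thesis using p by (intro abs_quotient_le) auto
  qed
  ultimately have "\<bar>c (Suc k)\<bar> \<le> \<bar>c k\<bar> * ((real k - g) / (real k + 1))"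
   by (simp only: abs_mult[of "c k"]) (rule mult_left_mono; simp)
  hence "\<bar>c (Suc k)\<bar> * bin g k \<le> \<bar>c k\<bar> * ((real k - g) / (real k + 1)) * bin g k"
   using bin_pos[OF g(1), of k] by (intro mult_right_mono) auto
  thus "\<bar>c (Suc k)\<bar> * bin g k \<le> \<bar>c k\<bar> * bin g (Suc k)" by (simp add: bin_Suc mult_ac)
 qed (rule bin_pos[OF g(1)])
 thus ?thesis by (simp add: c_def)
qed

text \<open>nu/2 - 3/4 is the midpoint of -1 and nu - 1/2.\<close>

lemma exists_exponent:
 fixes nu :: real
 assumes "nu > -1/2"
 obtains g where "g < 0" "g < nu - 1/2" "g > -1"
 using assms that[of "min (-1/2) (nu/2 - 3/4)"] by (simp add: min_def split: if_splits)

lemma bounded_by_binomial_series: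
 fixes c :: "nat => real"
 assumes C: "C > 0" and c: "\<And>k. \<bar>c k\<bar> \<le> C * bin g k" and x: "\<bar>x\<bar> < 1"
 shows "summable (\<lambda>k. c k * x ^ k)" and "\<bar>\<Sum>k. c k * x ^ k\<bar> \<le> C * (1 - \<bar>x\<bar>) powr g"
proof -
 have s: "(\<lambda>k. C * (bin g k * \<bar>x\<bar> ^ k)) sums (C * (1 - \<bar>x\<bar>) powr g)"
  using x by (intro sums_mult bin_sums) simp
 have b: "norm (c k * x ^ k) \<le> C * (bin g k * \<bar>x\<bar> ^ k)" for k
  using mult_right_mono[OF c[of k], of "\<bar>x\<bar> ^ k"] by (simp add: abs_mult power_abs mult_ac)
 show "summable (\<lambda>k. c k * x ^ k)"
  by (rule summable_comparison_test[OF _ sums_summable[OF s]]) (use b in blast)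
 show "\<bar>\<Sum>k. c k * x ^ k\<bar> \<le> C * (1 - \<bar>x\<bar>) powr g"
  using norm_suminf_le[OF b sums_summable[OF s]] s by (simp add: sums_iff)
qed

lemma serA_bound:
 assumes nu: "nu > -1/2" and g: "g < 0" "g < nu - 1/2"
 shows "\<exists>C>0. \<forall>w. \<bar>w\<bar> < 2 --> \<bar>serA al nu w\<bar> \<le> C * (1 - \<bar>w\<bar>/2) powr g"
proof -
 obtain C where C: "C > 0" "\<And>k. \<bar>coefA al k * rGamma (nu + 1/2 + real k) * 2 ^ k\<bar> \<le> C * bin g k"
  using coefA_bound[OF nu g] by blast
 have "\<bar>serA al nu w\<bar> \<le> C * (1 - \<bar>w\<bar>/2) powr g" if "\<bar>w\<bar> < 2" for w
 proof -
  have "coefA al k * rGamma (nu + 1/2 + real k) * 2 ^ k * (w/2) ^ k = coefA al k * rGamma (nu + 1/2 + real k) * w ^ k" for k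
   by (simp add: power_divide)
  from bounded_by_binomial_series(2)[OF C, of "w/2", unfolded this] show ?thesis
   using that unfolding serA_def by simp
 qed
 thus ?thesis using C(1) by blast
qed

lemma serA_summable:
 assumes nu: "nu > -1/2" and w: "\<bar>w\<bar> < 2"
 shows "summable (\<lambda>k. coefA al k * rGamma (nu + 1/2 + real k) * w ^ k)"
proof -
 obtain g where g: "g < 0" "g < nu - 1/2" using exists_exponent[OF nu] by blast
 obtain C where C: "C > 0" "\<And>k. \<bar>coefA al k * rGamma (nu + 1/2 + real k) * 2 ^ k\<bar> \<le> C * bin g k"
  using coefA_bound[OF nu g] by blast
 have "coefA al k * rGamma (nu + 1/2 + real k) * 2 ^ k * (w/2) ^ k = coefA al k * rGamma (nu + 1/2 + real k) * w ^ k" for k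
  by (simp add: power_divide)
 from bounded_by_binomial_series(1)[OF C, of "w/2", unfolded this] show ?thesis using w by simp
qed

lemma serB_bound:
 assumes al: "al > -1" and g: "g < 0" "g < nu - 1/2"
 shows "\<exists>C>0. \<forall>v. \<bar>v\<bar> < 1 --> \<bar>serB al nu v\<bar> \<le> C * (1 - \<bar>v\<bar>) powr g"
proof -
 obtain C where C: "C > 0" "\<And>k. \<bar>coefB al k * rGamma (nu - al - 2 * real k)\<bar> \<le> C * bin g k"
  using coefB_bound[OF al g] by blast
 have "\<bar>serB al nu v\<bar> \<le> C * (1 - \<bar>v\<bar>) powr g" if "\<bar>v\<bar> < 1" for v
  using bounded_by_binomial_series(2)[OF C that] by (simp add: serB_def)
 thus ?thesis using C(1) by blast
qed

lemma serB_summable: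
 assumes al: "al > -1" and nu: "nu > -1/2" and v: "\<bar>v\<bar> < 1"
 shows "summable (\<lambda>k. coefB al k * rGamma (nu - al - 2 * real k) * v ^ k)"
proof -
 obtain g where g: "g < 0" "g < nu - 1/2" using exists_exponent[OF nu] by blast
 obtain C where C: "C > 0" "\<And>k. \<bar>coefB al k * rGamma (nu - al - 2 * real k)\<bar> \<le> C * bin g k"
  using coefB_bound[OF al g] by blast
 show ?thesis using bounded_by_binomial_series(1)[OF C v] .
qed

lemma DERIV_serA_part:
 assumes nu: "nu > -1/2" and ta: "-1 < ta" "ta < 1"
 shows "((\<lambda>ta. (ta + 1) powr (nu + 1/2) * serA al (nu + 1) (ta + 1)) has_real_derivative
   (ta + 1) powr (nu - 1/2) * serA al nu (ta + 1)) (at ta)"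
proof -
 define w where "w = ta + 1"
 have w: "0 < w" "w < 2" using ta by (auto simp: w_def)
 define c where "c k = coefA al k * rGamma (nu + 1 + 1/2 + real k)" for k
 define K where "K = 1 + w/2"
 have K: "\<bar>w\<bar> < \<bar>K\<bar>" "\<bar>K\<bar> < 2" using w by (auto simp: K_def)
 have "summable (\<lambda>k. c k * K ^ k)" unfolding c_def using nu K by (intro serA_summable) auto
 moreover have "coefA al k * rGamma (nu + 1/2 + real k) = (nu + 1/2 + 1 * real k) * c k" for k
  using rGamma_plus1[of "nu + 1/2 + real k"] by (simp add: c_def add_ac)
 ultimately obtain D where D: "((\<lambda>w. \<Sum>n. c n * w ^ n) has_real_derivative D) (at w)"
  "(nu + 1/2) * (\<Sum>n. c n * w ^ n) + 1 * (w * D) = (\<Sum>n. coefA al n * rGamma (nu + 1/2 + real n) * w ^ n)"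
  using powser_DERIV_powr[OF _ K(1) w(1), of c "\<lambda>k. coefA al k * rGamma (nu + 1/2 + real k)" "nu + 1/2" 1] by blast
 have S: "serA al (nu + 1) = (\<lambda>w. \<Sum>n. c n * w ^ n)" by (simp add: serA_def c_def fun_eq_iff add_ac)
 have "((\<lambda>w. w powr (nu + 1/2) * serA al (nu + 1) w) has_real_derivative
   (nu + 1/2) * w powr (nu + 1/2 - 1) * serA al (nu + 1) w + D * w powr (nu + 1/2)) (at w)"
  using w D(1) unfolding S by (auto intro!: derivative_eq_intros)
 moreover have "w powr (nu + 1/2) = w powr (nu - 1/2) * w" using w powr_add[of w "nu - 1/2" 1] by (simp add: add.commute)
 moreover have "nu + 1/2 - 1 = nu - 1/2" by simp
 ultimately have "((\<lambda>w. w powr (nu + 1/2) * serA al (nu + 1) w) has_real_derivative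
   w powr (nu - 1/2) * ((nu + 1/2) * serA al (nu + 1) w + 1 * (w * D))) (at w)"
  by (simp add: algebra_simps)
 hence "((\<lambda>w. w powr (nu + 1/2) * serA al (nu + 1) w) has_real_derivative w powr (nu - 1/2) * serA al nu w) (at w)"
  unfolding S D(2) by (simp add: serA_def)
 thus ?thesis unfolding w_def by (rule DERIV_shift[THEN iffD1])
qed

lemma DERIV_serB_part:
 assumes al: "al > -1" and nu: "nu > -1/2" and ta: "ta > 1"
 shows "((\<lambda>ta. ta powr (nu - al) * serB al (nu + 1) (1 / ta\<^sup>2)) has_real_derivative
   ta powr (nu - al - 1) * serB al nu (1 / ta\<^sup>2)) (at ta)"
proof -
 define w where "w = 1 / ta\<^sup>2"
 have w: "0 < w" "w < 1" using ta by (auto simp: w_def one_less_power)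
 define c where "c k = coefB al k * rGamma (nu + 1 - al - 2 * real k)" for k
 define K where "K = (1 + w)/2"
 have K: "\<bar>w\<bar> < \<bar>K\<bar>" "\<bar>K\<bar> < 1" using w by (auto simp: K_def)
 have "summable (\<lambda>k. c k * K ^ k)" unfolding c_def using nu K by (intro serB_summable al) auto
 moreover have "coefB al k * rGamma (nu - al - 2 * real k) = (nu - al + (-2) * real k) * c k" for k
  using rGamma_plus1[of "nu - al - 2 * real k"] by (simp add: c_def algebra_simps)
 ultimately obtain D where D: "((\<lambda>w. \<Sum>n. c n * w ^ n) has_real_derivative D) (at w)"
  "(nu - al) * (\<Sum>n. c n * w ^ n) + (-2) * (w * D) = (\<Sum>n. coefB al n * rGamma (nu - al - 2 * real n) * w ^ n)"
  using powser_DERIV_powr[OF _ K(1) w(1), of c "\<lambda>k. coefB al k * rGamma (nu - al - 2 * real k)" "nu - al" "-2"] by blast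
 have S: "serB al (nu + 1) = (\<lambda>w. \<Sum>n. c n * w ^ n)" by (simp add: serB_def c_def fun_eq_iff)
 have d1: "((\<lambda>ta. 1 / ta\<^sup>2) has_real_derivative (-2) * w / ta) (at ta)"
  using ta by (auto intro!: derivative_eq_intros simp: w_def power2_eq_square power4_eq_xxxx field_simps)
 have "((\<lambda>ta. serB al (nu + 1) (1 / ta\<^sup>2)) has_real_derivative D * ((-2) * w / ta)) (at ta)"
  using DERIV_chain2[OF _ d1, of "serB al (nu + 1)" D] D(1) unfolding S w_def by simp
 hence "((\<lambda>ta. ta powr (nu - al) * serB al (nu + 1) (1 / ta\<^sup>2)) has_real_derivative
   (nu - al) * ta powr (nu - al - 1) * serB al (nu + 1) w + D * ((-2) * w / ta) * ta powr (nu - al)) (at ta)"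
  using ta by (auto intro!: derivative_eq_intros simp: w_def)
 moreover have "ta powr (nu - al) = ta powr (nu - al - 1) * ta" using ta powr_add[of ta "nu - al - 1" 1] by simp
 hence "(nu - al) * ta powr (nu - al - 1) * serB al (nu + 1) w + D * ((-2) * w / ta) * ta powr (nu - al)
   = ta powr (nu - al - 1) * ((nu - al) * serB al (nu + 1) w + (-2) * (w * D))"
  using ta by (simp add: algebra_simps)
 ultimately show ?thesis unfolding S D(2) by (simp add: serB_def w_def)
qed

text \<open>On the transform side this multiplies s^(-nu - 1) I s by s. It matches the descent of
  the triple integral, which also differentiates once to lower nu by one.\<close>

lemma DERIV_prof:
 assumes al: "al > -1" and nu: "nu > -1/2" and ta: "ta \<noteq> -1" "ta \<noteq> 1"
 shows "(prof al (nu + 1) has_real_derivative prof al nu ta) (at ta)"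
proof -
 consider "ta < -1" | "-1 < ta" "ta < 1" | "ta > 1" using ta by linarith
 thus ?thesis
 proof cases
  case 1
  have "((\<lambda>_. 0) has_real_derivative prof al nu ta) (at ta)" using 1 by (simp add: prof_def)
  thus ?thesis
   by (rule has_field_derivative_transform_within_open[of _ _ _ "{..<-1}"]) (use 1 in \<open>auto simp: prof_def\<close>)
 next
  case 2
  have "((\<lambda>ta. (ta + 1) powr (nu + 1/2) * serA al (nu + 1) (ta + 1)) has_real_derivative prof al nu ta) (at ta)"
   using DERIV_serA_part[OF nu 2] 2 by (simp add: prof_def)
  thus ?thesis
   by (rule has_field_derivative_transform_within_open[of _ _ _ "{-1<..<1}"]) (use 2 in \<open>auto simp: prof_def add.commute\<close>)
 next
  case 3
  have "((\<lambda>ta. ta powr (nu - al) * serB al (nu + 1) (1 / ta\<^sup>2)) has_real_derivative prof al nu ta) (at ta)"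
   using DERIV_serB_part[OF al nu 3] 3 by (simp add: prof_def)
  thus ?thesis
   by (rule has_field_derivative_transform_within_open[of _ _ _ "{1<..}"]) (use 3 in \<open>auto simp: prof_def\<close>)
 qed
qed

text \<open>At \<tau> = -1 the exponent is exact, as the local estimate at scale t requires; only at
  \<tau> = 1 is it weakened to g.\<close>

lemma prof_bound:
 assumes al: "al > -1" and nu: "nu > -1/2" and g: "g < 0" "g < nu - 1/2"
 shows "\<exists>C>0. (\<forall>ta. -1 < ta --> ta < 1 --> \<bar>prof al nu ta\<bar> \<le> C * (ta + 1) powr (nu - 1/2) * (1 - ta) powr g)
  \<and> (\<forall>ta>1. \<bar>prof al nu ta\<bar> \<le> C * ta powr (nu - al - 1) * (1 - 1/ta\<^sup>2) powr g)"
proof -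
 obtain C1 where C1: "C1 > 0" "\<And>w. \<bar>w\<bar> < 2 ==> \<bar>serA al nu w\<bar> \<le> C1 * (1 - \<bar>w\<bar>/2) powr g"
  using serA_bound[OF nu g] by blast
 obtain C2 where C2: "C2 > 0" "\<And>v. \<bar>v\<bar> < 1 ==> \<bar>serB al nu v\<bar> \<le> C2 * (1 - \<bar>v\<bar>) powr g"
  using serB_bound[OF al g] by blast
 define k where "k = (1/2) powr g"
 have k: "k > 0" by (simp add: k_def)
 define C where "C = C1 * k + C2"
 have C: "C > 0" "C1 * k \<le> C" "C2 \<le> C" using C1(1) C2(1) k by (auto simp: C_def add_pos_pos)
 have "\<bar>prof al nu ta\<bar> \<le> C * (ta + 1) powr (nu - 1/2) * (1 - ta) powr g" if ta: "-1 < ta" "ta < 1" for ta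
 proof -
  have "\<bar>ta + 1\<bar> = ta + 1" using ta by simp
  hence "1 - \<bar>ta + 1\<bar>/2 = (1/2) * (1 - ta)" by (simp add: field_simps)
  hence "\<bar>serA al nu (ta + 1)\<bar> \<le> C1 * (k * (1 - ta) powr g)"
   using C1(2)[of "ta + 1"] ta by (simp only: k_def powr_mult)
  also have "\<dots> \<le> C * (1 - ta) powr g" using mult_right_mono[OF C(2), of "(1 - ta) powr g"] by (simp add: mult_ac)
  finally have "(ta + 1) powr (nu - 1/2) * \<bar>serA al nu (ta + 1)\<bar> \<le> (ta + 1) powr (nu - 1/2) * (C * (1 - ta) powr g)"
   by (rule mult_left_mono) simp
  thus ?thesis using ta by (simp add: prof_def abs_mult mult_ac)
 qed
 moreover have "\<bar>prof al nu ta\<bar> \<le> C * ta powr (nu - al - 1) * (1 - 1/ta\<^sup>2) powr g" if ta: "ta > 1" for ta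
 proof -
  have "1/ta\<^sup>2 < 1" using ta by (simp add: one_less_power)
  hence "\<bar>serB al nu (1/ta\<^sup>2)\<bar> \<le> C2 * (1 - 1/ta\<^sup>2) powr g"
   using C2(2)[of "1/ta\<^sup>2"] by simp
  also have "\<dots> \<le> C * (1 - 1/ta\<^sup>2) powr g" using C(3) by (intro mult_right_mono) auto
  finally have "ta powr (nu - al - 1) * \<bar>serB al nu (1/ta\<^sup>2)\<bar> \<le> ta powr (nu - al - 1) * (C * (1 - 1/ta\<^sup>2) powr g)"
   by (rule mult_left_mono) simp
  thus ?thesis using ta by (simp add: prof_def abs_mult mult_ac)
 qed
 ultimately show ?thesis using C(1) by blast
qed

text \<open>\<open>serA\<close> is continuous at 0 with the positive value 1 / (Gamma (nu + 1/2)
  sqrt (2 pi)). All necessary conditions rest on this.\<close>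

lemma prof_lower_bound:
 assumes nu: "nu > -1/2"
 shows "\<exists>c>0. \<exists>eta>0. \<forall>ta. -1 < ta --> ta < -1 + eta --> prof al nu ta \<ge> c * (ta + 1) powr (nu - 1/2)"
proof -
 define c where "c k = coefA al k * rGamma (nu + 1/2 + real k)" for k
 have "summable (\<lambda>k. c k * 1 ^ k)" unfolding c_def using nu by (intro serA_summable) auto
 then obtain D where "((\<lambda>w. \<Sum>n. c n * w ^ n) has_real_derivative D) (at 0)"
  using powser_Euler[of c 1 0] by auto
 hence cont: "isCont (serA al nu) 0" unfolding serA_def[abs_def] c_def[symmetric] by (rule DERIV_isCont)
 have "serA al nu 0 = rGamma (nu + 1/2) / sqrt (2 * pi)"
  unfolding serA_def using powser_zero[of "\<lambda>k. coefA al k * rGamma (nu + 1/2 + real k)"] by (simp add: coefA_def)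
 moreover have "rGamma (nu + 1/2) > 0" using nu Gamma_real_pos[of "nu + 1/2"] by (simp add: rGamma_inverse_Gamma)
 ultimately have pos: "serA al nu 0 > 0" by simp
 define m where "m = serA al nu 0 / 2"
 have m: "m > 0" "m < serA al nu 0" using pos by (auto simp: m_def)
 have "eventually (\<lambda>w. serA al nu w > m) (nhds 0)"
  using cont m(2) order_tendstoD(1)[of "serA al nu" "serA al nu 0" "nhds 0" m]
  by (simp add: isCont_def tendsto_at_iff_tendsto_nhds)
 then obtain e where e: "e > 0" "\<And>w. \<bar>w\<bar> < e ==> serA al nu w > m"
  by (auto simp: eventually_nhds_metric dist_real_def)
 have "prof al nu ta \<ge> m * (ta + 1) powr (nu - 1/2)" if ta: "-1 < ta" "ta < -1 + min e 1" for ta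
 proof -
  have "(ta + 1) powr (nu - 1/2) * m \<le> (ta + 1) powr (nu - 1/2) * serA al nu (ta + 1)"
  proof (intro mult_left_mono less_imp_le e(2))
   have "ta + 1 < e" using ta(2) by (simp add: min_def split: if_splits)
   thus "\<bar>ta + 1\<bar> < e" using ta(1) by simp
  qed (use ta(1) in simp)
  moreover have "ta < -1 + 1" using ta(2) by linarith
  ultimately show ?thesis using ta(1) by (simp add: prof_def mult_ac)
 qed
 moreover have "min e 1 > 0" using e(1) by simp
 ultimately show ?thesis using m(1) by blast
qed

section \<open>Poisson's integral as a model of the profile for al > -1/2\<close>

lemma termwise_power_series:
 fixes q :: "nat => real" and W p :: "real => real"
 assumes W: "integrable lborel W" and [measurable]: "p \<in> borel_measurable borel"
  and r: "0 \<le> r" and p: "\<And>u. W u \<noteq> 0 ==> \<bar>p u\<bar> \<le> r" and s: "summable (\<lambda>n. \<bar>q n\<bar> * r ^ n)"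
 shows "(\<lambda>n. q n * (\<integral>u. p u ^ n * W u \<partial>lborel)) sums (\<integral>u. (\<Sum>n. q n * p u ^ n) * W u \<partial>lborel)"
proof -
 have [measurable]: "W \<in> borel_measurable borel" using W by (simp add: borel_measurable_integrable)
 define f where "f n u = q n * (p u ^ n * W u)" for n u
 have [measurable]: "f n \<in> borel_measurable borel" for n unfolding f_def[abs_def] by measurable
 have bound: "norm (f n u) \<le> \<bar>q n\<bar> * r ^ n * \<bar>W u\<bar>" for n u
 proof (cases "W u = 0")
  case False
  hence "\<bar>p u\<bar> ^ n \<le> r ^ n" using p by (intro power_mono) auto
  thus ?thesis by (simp add: f_def abs_mult power_abs mult.assoc mult_left_mono mult_right_mono)
 qed (simp add: f_def)
 have i: "integrable lborel (f n)" for n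
  by (rule Bochner_Integration.integrable_bound[of _ "\<lambda>u. \<bar>q n\<bar> * r ^ n * \<bar>W u\<bar>"])
    (use W bound[of n] r in \<open>auto simp: abs_mult\<close>)
 have le: "(\<integral>u. norm (f n u) \<partial>lborel) \<le> \<bar>q n\<bar> * r ^ n * (\<integral>u. \<bar>W u\<bar> \<partial>lborel)" for n
 proof -
  have "(\<integral>u. norm (f n u) \<partial>lborel) \<le> (\<integral>u. \<bar>q n\<bar> * r ^ n * \<bar>W u\<bar> \<partial>lborel)"
   using W bound by (intro integral_mono integrable_norm i) auto
  thus ?thesis by simp
 qed
 have "summable (\<lambda>n. \<integral>u. norm (f n u) \<partial>lborel)"
  by (rule summable_comparison_test'[OF summable_mult2[OF s]]) (use le in auto)
 moreover have "AE u in lborel. summable (\<lambda>n. norm (f n u))"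
  by (rule AE_I2, rule summable_comparison_test'[OF summable_mult2[OF s]]) (use bound in auto)
 ultimately have "(\<lambda>n. integral\<^sup>L lborel (f n)) sums (\<integral>u. (\<Sum>n. f n u) \<partial>lborel)"
  by (intro sums_integral i)
 moreover have "(\<lambda>u. \<Sum>n. f n u) = (\<lambda>u. (\<Sum>n. q n * p u ^ n) * W u)"
 proof
  fix u show "(\<Sum>n. f n u) = (\<Sum>n. q n * p u ^ n) * W u"
  proof (cases "W u = 0")
   case False
   hence "summable (\<lambda>n. q n * p u ^ n)"
    using p by (intro summable_comparison_test'[OF s]) (auto simp: abs_mult power_abs intro!: mult_left_mono power_mono)
   from suminf_mult2[OF this, of "W u"] show ?thesis by (simp add: f_def mult.assoc)
  qed (simp add: f_def)
 qed
 moreover have "integral\<^sup>L lborel (f n) = q n * (\<integral>u. p u ^ n * W u \<partial>lborel)" for n unfolding f_def[abs_def] by simp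
 ultimately show ?thesis by (simp only:)
qed

lemma Beta_lborel:
 assumes a: "a > 0" and b: "b > (0::real)"
 shows "has_bochner_integral lborel (\<lambda>t. indicator {0<..<1} t * (t powr (a - 1) * (1 - t) powr (b - 1))) (Beta a b)"
proof -
 have i: "set_integrable lborel {0<..<1} (\<lambda>t. t powr (a - 1) * (1 - t) powr (b - 1))"
  by (rule set_integrable_subset[OF integrable_Beta[OF assms]]) auto
 have "(LINT t:{0<..<1}|lborel. t powr (a - 1) * (1 - t) powr (b - 1)) = Beta a b"
  using set_borel_integral_eq_integral(2)[OF i] has_integral_Beta_real[OF assms]
  by (simp add: has_integral_Icc_iff_Ioo integral_unique)
 with i show ?thesis unfolding set_integrable_def set_lebesgue_integral_def by (simp add: has_bochner_integral_iff)
qed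

text \<open>The weight in Poisson's integral: I of order a is a constant times s^a times the Laplace
  transform of this weight.\<close>

definition jac :: "real => real => real" where
 "jac a u = indicator {-1<..<1} u * (1 - u\<^sup>2) powr (a - 1/2)"

lemma jac_nonneg [simp]: "jac a u \<ge> 0"
 by (simp add: jac_def)

lemma jac_measurable [measurable]: "jac a \<in> borel_measurable borel"
 unfolding jac_def[abs_def] by measurable

lemma AE_lborel_neq: "AE x in lborel. x \<noteq> (a::real)"
 by (rule AE_I'[of "{a}"]) auto

text \<open>Used with c = 1 to reduce the moments of \<open>jac\<close> to Beta integrals and with c
  = 1/4 for the kernel.\<close>

lemma set_integral_square_substitution:
 fixes f :: "real => real"
 assumes f: "set_integrable lborel {0<..<c * R\<^sup>2} f" and [measurable]: "f \<in> borel_measurable borel" and R: "R > 0" and c: "c > 0"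
 shows "set_integrable lborel {0<..<R} (\<lambda>y. 2 * c * y * f (c * y\<^sup>2))"
  and "(LINT y:{0<..<R}|lborel. 2 * c * y * f (c * y\<^sup>2)) = (LINT Y:{0<..<c * R\<^sup>2}|lborel. f Y)"
proof -
 have im: "(\<lambda>y. c * y\<^sup>2) ` {0<..<R} = {0<..<c * R\<^sup>2}"
 proof safe
  fix y assume "y \<in> {0<..<R}"
  thus "c * y\<^sup>2 \<in> {0<..<c * R\<^sup>2}" using c by (auto intro: power_strict_mono)
 next
  fix Y assume Y: "Y \<in> {0<..<c * R\<^sup>2}"
  have "sqrt (Y/c) < R" using Y R c real_sqrt_less_mono[of "Y/c" "R\<^sup>2"] by (simp add: pos_divide_less_eq mult.commute)
  thus "Y \<in> (\<lambda>y. c * y\<^sup>2) ` {0<..<R}" using Y c by (intro image_eqI[of _ _ "sqrt (Y/c)"]) auto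
 qed
 have "(\<lambda>y. \<bar>2 * c * y\<bar> * f (c * y\<^sup>2)) absolutely_integrable_on {0<..<R} \<and>
   integral {0<..<R} (\<lambda>y. \<bar>2 * c * y\<bar> * f (c * y\<^sup>2)) = integral {0<..<c * R\<^sup>2} f"
 proof (subst has_absolute_integral_change_of_variables_1'[where g = "\<lambda>y. c * y\<^sup>2"])
  show "((\<lambda>y. c * y\<^sup>2) has_real_derivative 2 * c * y) (at y within {0<..<R})" for y
   by (auto intro!: derivative_eq_intros)
  show "inj_on (\<lambda>y. c * y\<^sup>2) {0<..<R}" using c by (auto simp: inj_on_def)
  have "(\<lambda>x. indicat_real {0<..<c * R\<^sup>2} x *\<^sub>R f x) \<in> borel_measurable lborel" by measurable
  hence "f absolutely_integrable_on {0<..<c * R\<^sup>2}"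
   using f unfolding set_integrable_def by (simp add: integrable_completion)
  thus "f absolutely_integrable_on (\<lambda>y. c * y\<^sup>2) ` {0<..<R} \<and> integral ((\<lambda>y. c * y\<^sup>2) ` {0<..<R}) f = integral {0<..<c * R\<^sup>2} f"
   unfolding im by simp
 qed auto
 hence a: "set_integrable lborel {0<..<R} (\<lambda>y. \<bar>2 * c * y\<bar> * f (c * y\<^sup>2))"
  and b: "integral {0<..<R} (\<lambda>y. \<bar>2 * c * y\<bar> * f (c * y\<^sup>2)) = integral {0<..<c * R\<^sup>2} f" by (auto intro: set_integrable_lborelI)
 have eq: "indicator {0<..<R} y *\<^sub>R (\<bar>2 * c * y\<bar> * f (c * y\<^sup>2)) = indicator {0<..<R} y *\<^sub>R (2 * c * y * f (c * y\<^sup>2))" for y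
  using c by (auto simp: indicator_def)
 show "set_integrable lborel {0<..<R} (\<lambda>y. 2 * c * y * f (c * y\<^sup>2))" using a unfolding set_integrable_def eq .
 show "(LINT y:{0<..<R}|lborel. 2 * c * y * f (c * y\<^sup>2)) = (LINT Y:{0<..<c * R\<^sup>2}|lborel. f Y)"
  using set_borel_integral_eq_integral(2)[OF a] set_borel_integral_eq_integral(2)[OF f] b unfolding set_lebesgue_integral_def eq by simp
qed

text \<open>The substitution Y = u^2 gives a Beta integral. Its value is arranged so that a factor
  independent of k splits off and \<open>rGamma (real k + a + 1)\<close>, as in the coefficients of
  \<open>bessel_e a\<close>, remains.\<close>

lemma jac_moment_even:
 assumes a: "a > -1/2"
 shows "has_bochner_integral lborel (\<lambda>u. u ^ (2*k) * jac a u) (sqrt pi * Gamma (a + 1/2) * (pochhammer (1/2) k * rGamma (real k + a + 1)))"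
proof -
 let ?b = "real k + 1/2" and ?c = "a + 1/2"
 define f where "f Y = indicator {0<..<1} Y * (Y powr (?b - 1) * (1 - Y) powr (?c - 1))" for Y :: real
 have B: "has_bochner_integral lborel f (Beta ?b ?c)" unfolding f_def using a by (intro Beta_lborel) auto
 have fi: "indicator {0<..<1} Y *\<^sub>R f Y = f Y" for Y by (simp add: f_def indicator_def)
 have si: "set_integrable lborel {0<..<1 * 1\<^sup>2} f" using B unfolding set_integrable_def one_power2 mult_1 fi by (simp add: has_bochner_integral_iff)
 have m: "f \<in> borel_measurable borel" unfolding f_def[abs_def] by measurable
 define h where "h u = indicator {0<..<1} u * (u ^ (2*k) * (1 - u\<^sup>2) powr (a - 1/2))" for u :: real
 have [measurable]: "h \<in> borel_measurable borel" unfolding h_def[abs_def] by measurable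
 have h: "indicator {0<..<1} u *\<^sub>R (2 * 1 * u * f (1 * u\<^sup>2)) = 2 * h u" for u
 proof (cases "u \<in> {0<..<1}")
  case True
  have "(u\<^sup>2) powr (real k - 1/2) = u powr (2 * real k - 1)" using True powr_powr[of u 2 "real k - 1/2"] by (simp add: powr_numeral algebra_simps)
  also have "u * \<dots> = u ^ (2*k)" using True powr_add[of u 1 "2 * real k - 1"] powr_realpow[of u "2*k"] by simp
  finally show ?thesis using True by (simp add: f_def h_def abs_square_less_1)
 qed (simp add: h_def)
 have "has_bochner_integral lborel (\<lambda>u. 2 * h u) (Beta ?b ?c)"
  using set_integral_square_substitution[OF si m] B unfolding set_integrable_def set_lebesgue_integral_def h unfolding one_power2 mult_1 fi by (simp add: has_bochner_integral_iff)
 from has_bochner_integral_mult_right[OF this, of "1/2"] have H: "has_bochner_integral lborel h (Beta ?b ?c / 2)" by simp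
 hence "has_bochner_integral lborel (\<lambda>u. h (0 + (-1) * u)) ((Beta ?b ?c / 2) /\<^sub>R \<bar>-1\<bar>)"
  by (subst (asm) lborel_has_bochner_integral_real_affine_iff[of "-1" _ _ 0]) auto
 from has_bochner_integral_add[OF H this] have "has_bochner_integral lborel (\<lambda>u. h u + h (-u)) (Beta ?b ?c)" by simp
 moreover have "AE u in lborel. h u + h (-u) = u ^ (2*k) * jac a u"
  using AE_lborel_neq[of 0] by eventually_elim (auto simp: h_def jac_def indicator_def)
 ultimately have *: "has_bochner_integral lborel (\<lambda>u. u ^ (2*k) * jac a u) (Beta ?b ?c)"
  using has_bochner_integral_cong_AE[of "\<lambda>u. h u + h (-u)" lborel "\<lambda>u. u ^ (2*k) * jac a u"] by simp
 have half: "1/2 \<notin> (\<int>\<^sub>\<le>\<^sub>0 :: real set)" by (auto dest: nonpos_Ints_nonpos)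
 have "Gamma (real k + 1/2) = sqrt pi * pochhammer (1/2) k"
  using pochhammer_Gamma[OF half, of k] by (simp add: Gamma_one_half_real add.commute)
 with * show ?thesis by (simp add: Beta_altdef add_ac mult_ac)
qed

lemma jac_integrable: "a > -1/2 ==> integrable lborel (jac a)"
 using jac_moment_even[of a 0] by (simp add: has_bochner_integral_iff)

lemma jac_poly_integrable:
 assumes a: "a > -1/2" and [measurable]: "f \<in> borel_measurable borel" and f: "\<And>u. -1 < u ==> u < 1 ==> \<bar>f u\<bar> \<le> B"
 shows "integrable lborel (\<lambda>u. f u * jac a u)"
proof (rule Bochner_Integration.integrable_bound[of _ "\<lambda>u. B * jac a u"])
 show "AE u in lborel. norm (f u * jac a u) \<le> norm (B * jac a u)"
 proof (rule AE_I2)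
  fix u show "norm (f u * jac a u) \<le> norm (B * jac a u)"
  proof (cases "-1 < u \<and> u < 1")
   case True
   hence "\<bar>f u\<bar> \<le> \<bar>B\<bar>" using f[of u] by simp
   thus ?thesis by (simp add: abs_mult mult_right_mono)
  qed (simp add: jac_def)
 qed
qed (use jac_integrable[OF a] in auto)

lemma jac_minus: "jac a (-u) = jac a u"
 by (auto simp: jac_def indicator_def)

lemma jac_moment_odd:
 assumes "odd n"
 shows "(\<integral>u. u ^ n * jac a u \<partial>lborel) = 0"
proof -
 have "(\<integral>u. u ^ n * jac a u \<partial>lborel) = (\<integral>u. - (u ^ n * jac a u) \<partial>lborel)"
  using lborel_integral_real_affine[of "-1" "\<lambda>u. u ^ n * jac a u" 0] assms by (simp add: jac_minus)
 thus ?thesis by simp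
qed

lemma even_sums_reindex:
 fixes f :: "nat => real"
 assumes "f sums c" "\<And>n. odd n ==> f n = 0"
 shows "(\<lambda>k. f (2 * k)) sums c"
proof -
 have "n \<notin> range (\<lambda>k. 2 * k) ==> odd n" for n :: nat by (auto elim!: evenE)
 with sums_mono_reindex[of "\<lambda>k. 2 * k" f c] assms show ?thesis by (auto simp: strict_mono_def)
qed

text \<open>Poisson's integral for I of order a. Only even moments survive in the exponential
  series, and the identity (2 k)! = 4^k (1/2)_k k! cancels the Pochhammer symbol of the
  moments.\<close>

lemma jac_laplace:
 assumes a: "a > -1/2"
 shows "(\<integral>u. exp (-(s*u)) * jac a u \<partial>lborel) = sqrt pi * Gamma (a + 1/2) * bessel_e a (s\<^sup>2 / 4)"
proof -
 define K where "K = sqrt pi * Gamma (a + 1/2)"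
 have "(\<lambda>n. inverse (fact n) * (\<integral>u. (-(s*u)) ^ n * jac a u \<partial>lborel)) sums (\<integral>u. (\<Sum>n. inverse (fact n) * (-(s*u)) ^ n) * jac a u \<partial>lborel)"
 proof (rule termwise_power_series[where r = "\<bar>s\<bar>"])
  show "summable (\<lambda>n. \<bar>inverse (fact n)\<bar> * \<bar>s\<bar> ^ n)" using summable_exp[of "\<bar>s\<bar>"] by simp
  fix u assume "jac a u \<noteq> 0"
  hence "\<bar>u\<bar> \<le> 1" by (auto simp: jac_def indicator_def split: if_splits)
  thus "\<bar>-(s*u)\<bar> \<le> \<bar>s\<bar>" by (simp add: abs_mult mult_left_le)
 qed (use jac_integrable[OF a] in auto)
 moreover have "(\<Sum>n. inverse (fact n) * (-(s*u)) ^ n) = exp (-(s*u))" for u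
  by (simp add: exp_def)
 moreover have "inverse (fact n) * (\<integral>u. (-(s*u)) ^ n * jac a u \<partial>lborel) = inverse (fact n) * (-s) ^ n * (\<integral>u. u ^ n * jac a u \<partial>lborel)" for n
 proof -
  have "(\<lambda>u. (-(s*u)) ^ n * jac a u) = (\<lambda>u. (-s) ^ n * (u ^ n * jac a u))"
   by (rule ext) (metis minus_mult_left mult.assoc power_mult_distrib)
  thus ?thesis by (simp only: integral_mult_right_zero mult.assoc)
 qed
 ultimately have "(\<lambda>n. inverse (fact n) * (-s) ^ n * (\<integral>u. u ^ n * jac a u \<partial>lborel)) sums (\<integral>u. exp (-(s*u)) * jac a u \<partial>lborel)"
  by (simp only:)
 hence "(\<lambda>k. inverse (fact (2*k)) * (-s) ^ (2*k) * (\<integral>u. u ^ (2*k) * jac a u \<partial>lborel)) sums (\<integral>u. exp (-(s*u)) * jac a u \<partial>lborel)"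
  by (rule even_sums_reindex) (simp add: jac_moment_odd)
 moreover have "inverse (fact (2*k)) * (-s) ^ (2*k) * (\<integral>u. u ^ (2*k) * jac a u \<partial>lborel) = K * (rGamma (real k + a + 1) / fact k * (s\<^sup>2/4) ^ k)" for k
 proof -
  have ph: "pochhammer (1/2::real) k > 0" by (intro pochhammer_pos) simp
  have "(-s) ^ (2*k) = (s\<^sup>2) ^ k" by (simp add: power_mult)
  moreover have "(fact (2*k) :: real) = 4 ^ k * pochhammer (1/2) k * fact k" by (simp add: fact_double power_mult)
  ultimately show ?thesis unfolding has_bochner_integral_integral_eq[OF jac_moment_even[OF a]] K_def[symmetric]
   using ph by (simp add: power_divide divide_simps)
 qed
 ultimately have "(\<lambda>k. K * (rGamma (real k + a + 1) / fact k * (s\<^sup>2/4) ^ k)) sums (\<integral>u. exp (-(s*u)) * jac a u \<partial>lborel)"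
  by (simp only:)
 moreover have "(\<lambda>k. K * (rGamma (real k + a + 1) / fact k * (s\<^sup>2/4) ^ k)) sums (K * bessel_e a (s\<^sup>2/4))"
  by (intro sums_mult bessel_e_sums)
 ultimately show ?thesis unfolding K_def by (rule sums_unique2)
qed

text \<open>The convolution of \<open>jac a\<close> with the power b - 1 of the positive part, so
  that its transform is a multiple of s^(-b) times Poisson's integral. As
  \<open>0 powr c = 0\<close> for every c, the \<open>max\<close> cuts off correctly also when b
  \<le> 1.\<close>

definition poisson_int :: "real => real => real => real" where
 "poisson_int a b ta = (\<integral>u. max 0 (ta - u) powr (b - 1) * jac a u \<partial>lborel)"

lemma poisson_int_laplace:
 assumes a: "a > -1/2" and b: "b > 0" and s: "s > 0"
 shows "has_laplace (poisson_int a b) s (Gamma b * s powr (-b) * (sqrt pi * Gamma (a + 1/2) * bessel_e a (s\<^sup>2 / 4)))"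
proof -
 define g where "g u ta = exp (-(s*ta)) * (max 0 (ta - u) powr (b - 1) * jac a u)" for u ta
 have [measurable]: "case_prod g \<in> borel_measurable (lborel \<Otimes>\<^sub>M lborel)" unfolding g_def by measurable
 have inner: "has_bochner_integral lborel (\<lambda>ta. g u ta) (Gamma b * s powr (-b) * (exp (-(s*u)) * jac a u))" for u
 proof -
  have "has_laplace (\<lambda>T. jac a u * (indicator {0<..} (T/1 - u) * (T/1 - u) powr (b - 1))) s (jac a u * (1 * exp (-(s*1*u)) * (Gamma b * s powr (-b))))"
   by (rule has_laplace_cmult[OF has_laplace_affine]) (use Gamma_moment[OF b s] in simp_all)
  moreover have "exp (-(s*ta)) * (jac a u * (indicator {0<..} (ta/1 - u) * (ta/1 - u) powr (b - 1))) = g u ta" for ta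
   by (auto simp: g_def max_def indicator_def)
  ultimately show ?thesis by (simp add: has_laplace_def mult_ac)
 qed
 have g0: "g u ta \<ge> 0" for u ta by (simp add: g_def)
 have ej: "integrable lborel (\<lambda>u. exp (-(s*u)) * jac a u)"
 proof (rule jac_poly_integrable[OF a])
  fix u :: real assume "-1 < u" "u < 1"
  hence "-(s*u) \<le> s" using s by (metis mult.commute mult_minus_left mult_le_cancel_right1 less_imp_le minus_less_iff not_less)
  thus "\<bar>exp (-(s*u))\<bar> \<le> exp s" by simp
 qed simp
 have int: "integrable (lborel \<Otimes>\<^sub>M lborel) (case_prod g)"
 proof (rule lborel_pair.Fubini_integrable)
  have "(\<lambda>u. \<integral>ta. norm (case (u,ta) of (u,ta) => g u ta) \<partial>lborel) = (\<lambda>u. Gamma b * s powr (-b) * (exp (-(s*u)) * jac a u))"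
   using inner g0 by (simp add: has_bochner_integral_iff fun_eq_iff)
  thus "integrable lborel (\<lambda>u. \<integral>ta. norm (case (u,ta) of (u,ta) => g u ta) \<partial>lborel)"
   using ej by simp
  show "AE u in lborel. integrable lborel (\<lambda>ta. case (u,ta) of (u,ta) => g u ta)"
   using inner by (simp add: has_bochner_integral_iff)
 qed simp
 have gP: "(\<integral>u. g u ta \<partial>lborel) = exp (-(s*ta)) * poisson_int a b ta" for ta
  unfolding g_def poisson_int_def by (simp only: integral_mult_right_zero)
 have "(\<integral>ta. (\<integral>u. g u ta \<partial>lborel) \<partial>lborel) = (\<integral>u. (\<integral>ta. g u ta \<partial>lborel) \<partial>lborel)"
  by (rule lborel_pair.Fubini_integral[OF int])
 also have "(\<lambda>u. \<integral>ta. g u ta \<partial>lborel) = (\<lambda>u. Gamma b * s powr (-b) * (exp (-(s*u)) * jac a u))"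
  using inner by (simp add: has_bochner_integral_iff fun_eq_iff)
 finally have "(\<integral>ta. exp (-(s*ta)) * poisson_int a b ta \<partial>lborel) = Gamma b * s powr (-b) * (\<integral>u. exp (-(s*u)) * jac a u \<partial>lborel)"
  unfolding gP by simp
 moreover have "integrable lborel (\<lambda>ta. \<integral>u. g u ta \<partial>lborel)"
  using lborel_pair.integrable_snd[OF int] .
 hence "integrable lborel (\<lambda>ta. exp (-(s*ta)) * poisson_int a b ta)" by (simp only: gP)
 ultimately show ?thesis by (simp add: has_laplace_def has_bochner_integral_iff jac_laplace[OF a])
qed

lemma bin_pochhammer: "bin g k = pochhammer (- g) k / fact k"
 by (simp add: bin_def gbinomial_pochhammer power_mult_distrib[symmetric] mult.assoc[symmetric])

lemma bin_abs_summable: "0 \<le> x ==> x < 1 ==> summable (\<lambda>k. \<bar>bin g k\<bar> * x ^ k)"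
proof -
 assume x: "0 \<le> x" "x < 1"
 have "summable (\<lambda>k. bin g k * ((1 + x)/2) ^ k)" using bin_sums[of "(1+x)/2" g] x by (auto simp: sums_iff)
 from powser_insidea[OF this, of x] x show ?thesis by (simp add: abs_mult)
qed

lemma rGamma_minus_nat: "rGamma (b - real n) = (-1) ^ n * pochhammer (1 - b) n * rGamma b"
proof (induction n)
 case (Suc n)
 have "rGamma (b - real (Suc n)) = (b - real n - 1) * rGamma (b - real n)"
  using rGamma_plus1[of "b - real n - 1"] by (simp add: algebra_simps)
 thus ?case unfolding Suc.IH by (simp add: pochhammer_Suc algebra_simps)
qed simp

text \<open>For \<tau> > 1 the binomial series of (1 - u / \<tau>)^(b - 1) converges uniformly on
  the support of \<open>jac a\<close>. The odd moments vanish, and the even coefficients combine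
  with \<open>rGamma b\<close> to \<open>rGamma\<close> at b - 2 k, that is, to the coefficients of
  \<open>serB\<close>.\<close>

lemma poisson_int_outer:
 assumes a: "a > -1/2" and b: "b > 0" and ta: "ta > 1"
 shows "rGamma b / (sqrt pi * Gamma (a + 1/2) * 2 powr a) * poisson_int a b ta = prof a (a + b) ta"
proof -
 define K where "K = sqrt pi * Gamma (a + 1/2)"
 have K: "K > 0" unfolding K_def using a by (intro mult_pos_pos Gamma_real_pos) auto
 have "(\<lambda>n. bin (b-1) n * (\<integral>u. (u/ta) ^ n * jac a u \<partial>lborel)) sums (\<integral>u. (\<Sum>n. bin (b-1) n * (u/ta) ^ n) * jac a u \<partial>lborel)"
 proof (rule termwise_power_series[where r = "1/ta"])
  show "summable (\<lambda>n. \<bar>bin (b-1) n\<bar> * (1/ta) ^ n)" using ta by (intro bin_abs_summable) auto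
  fix u assume "jac a u \<noteq> 0"
  hence "\<bar>u\<bar> \<le> 1" by (auto simp: jac_def indicator_def split: if_splits)
  thus "\<bar>u/ta\<bar> \<le> 1/ta" using ta by (simp add: divide_right_mono)
 qed (use jac_integrable[OF a] ta in auto)
 moreover have pt: "(\<Sum>n. bin (b-1) n * (u/ta) ^ n) * jac a u = ta powr (1-b) * (max 0 (ta - u) powr (b - 1) * jac a u)" for u
 proof (cases "-1 < u \<and> u < 1")
  case True
  hence u: "\<bar>u/ta\<bar> < 1" using ta by (simp add: field_simps abs_less_iff)
  have "(\<Sum>n. bin (b-1) n * (u/ta) ^ n) = (1 - u/ta) powr (b-1)" using bin_sums[OF u] by (simp add: sums_iff)
  also have "1 - u/ta = (ta - u) / ta" using ta by (simp add: field_simps)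
  also have "\<dots> powr (b-1) = (ta - u) powr (b-1) * ta powr (1-b)"
   using True ta powr_minus_divide[of ta "b - 1"] by (simp add: powr_divide)
  finally show ?thesis using True ta by (simp add: max_def)
 qed (simp add: jac_def)
 have "(\<integral>u. (\<Sum>n. bin (b-1) n * (u/ta) ^ n) * jac a u \<partial>lborel) = ta powr (1-b) * poisson_int a b ta"
  unfolding poisson_int_def pt by (rule integral_mult_right_zero)
 ultimately have "(\<lambda>n. bin (b-1) n * (\<integral>u. (u/ta) ^ n * jac a u \<partial>lborel)) sums (ta powr (1-b) * poisson_int a b ta)"
  by (simp only:)
 moreover have "(\<integral>u. (u/ta) ^ n * jac a u \<partial>lborel) = (1/ta)^n * (\<integral>u. u ^ n * jac a u \<partial>lborel)" for n
  by (simp add: power_divide)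
 ultimately have "(\<lambda>n. bin (b-1) n * ((1/ta)^n * (\<integral>u. u ^ n * jac a u \<partial>lborel))) sums (ta powr (1-b) * poisson_int a b ta)"
  by (simp only:)
 hence "(\<lambda>k. bin (b-1) (2*k) * ((1/ta)^(2*k) * (\<integral>u. u ^ (2*k) * jac a u \<partial>lborel))) sums (ta powr (1-b) * poisson_int a b ta)"
  by (rule even_sums_reindex) (simp add: jac_moment_odd)
 hence "(\<lambda>k. rGamma b / (K * 2 powr a) * (bin (b-1) (2*k) * ((1/ta)^(2*k) * (\<integral>u. u ^ (2*k) * jac a u \<partial>lborel)))) sums (rGamma b / (K * 2 powr a) * (ta powr (1-b) * poisson_int a b ta))"
  by (rule sums_mult)
 moreover have "rGamma b / (K * 2 powr a) * (bin (b-1) (2*k) * ((1/ta)^(2*k) * (\<integral>u. u ^ (2*k) * jac a u \<partial>lborel)))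
   = coefB a k * rGamma (a + b - a - 2 * real k) * (1/ta\<^sup>2) ^ k" for k
 proof -
  have ph: "pochhammer (1/2::real) k > 0" by (intro pochhammer_pos) simp
  have rb: "rGamma (a + b - a - 2 * real k) = pochhammer (1 - b) (2*k) * rGamma b"
   using rGamma_minus_nat[of b "2*k"] by simp
  have f: "(fact (2*k) :: real) = 4 ^ k * pochhammer (1/2) k * fact k" by (simp add: fact_double power_mult)
  have pm: "2 powr (-a) = 1 / 2 powr a" by (simp add: powr_minus_divide)
  have t: "(1/ta)^(2*k) = (1/ta\<^sup>2) ^ k" by (simp add: power_mult power_divide)
  have "-(b - 1) = 1 - b" by simp
  thus ?thesis unfolding has_bochner_integral_integral_eq[OF jac_moment_even[OF a]] K_def[symmetric] bin_pochhammer rb coefB_def f pm t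
   using ph K by (simp add: divide_simps)
 qed
 ultimately have "(\<lambda>k. coefB a k * rGamma (a + b - a - 2 * real k) * (1/ta\<^sup>2) ^ k) sums (rGamma b / (K * 2 powr a) * (ta powr (1-b) * poisson_int a b ta))"
  by (simp only:)
 hence "serB a (a + b) (1/ta\<^sup>2) = rGamma b / (K * 2 powr a) * (ta powr (1-b) * poisson_int a b ta)"
  unfolding serB_def by (rule sums_unique[symmetric])
 moreover have "ta powr (a + b - a - 1) * ta powr (1-b) = 1" using ta by (simp add: powr_add[symmetric])
 ultimately show ?thesis using ta unfolding prof_def K_def[symmetric] by (simp add: mult_ac)
qed

text \<open>With u = v - 1 the weight becomes (v (2 - v))^(a - 1/2). Expanding (1 - v/2)^(a - 1/2)
  on 0 < v < w, where w < 2, leaves Beta integrals whose Gamma quotients are the coefficients of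
  \<open>serA\<close>.\<close>

lemma poisson_int_inner:
 assumes a: "a > -1/2" and b: "b > 0" and ta: "-1 < ta" "ta < 1"
 shows "rGamma b / (sqrt pi * Gamma (a + 1/2) * 2 powr a) * poisson_int a b ta = prof a (a + b) ta"
proof -
 define w where "w = ta + 1"
 have w: "0 < w" "w < 2" using ta by (auto simp: w_def)
 define W where "W v = indicator {0<..<w} v * ((w - v) powr (b-1) * v powr (a - 1/2))" for v
 have scale: "has_bochner_integral lborel (\<lambda>v. indicator {0<..<w} v * ((w - v) powr (b-1) * v powr (c-1))) (w powr (b+c-1) * Beta c b)"
  if c: "c > 0" for c :: real
 proof -
  have "has_bochner_integral lborel (\<lambda>v. w powr (b+c-2) * (indicator {0<..<1} (0 + v/w) * ((0 + v/w) powr (c-1) * (1 - (0 + v/w)) powr (b-1)))) (w powr (b+c-2) * (Beta c b /\<^sub>R \<bar>1/w\<bar>))"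
   using Beta_lborel[OF c b] w by (intro has_bochner_integral_mult_right) (subst (asm) lborel_has_bochner_integral_real_affine_iff[of "1/w" _ _ 0], auto)
  moreover have "w powr (b+c-2) * (Beta c b /\<^sub>R \<bar>1/w\<bar>) = w powr (b+c-1) * Beta c b"
  proof -
   have "w powr (b+c-1) = w powr (b+c-2) * w" using w powr_add[of w "b+c-2" 1] by simp
   thus ?thesis using w by simp
  qed
  moreover have "w powr (b+c-2) * (indicator {0<..<1} (0 + v/w) * ((0 + v/w) powr (c-1) * (1 - (0 + v/w)) powr (b-1)))
    = indicator {0<..<w} v * ((w - v) powr (b-1) * v powr (c-1))" for v
  proof (cases "v \<in> {0<..<w}")
   case True
   hence "1 - v/w = (w - v)/w" using w by (simp add: field_simps)
   moreover have "w powr (b+c-2) = w powr (c-1) * w powr (b-1)" by (simp add: powr_add[symmetric] algebra_simps)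
   ultimately show ?thesis using True w by (simp add: powr_divide)
  qed (use w in \<open>auto simp: indicator_def field_simps\<close>)
  ultimately show ?thesis by (simp only:)
 qed
 have WI: "integrable lborel W" unfolding W_def[abs_def] using scale[of "a + 1/2"] a by (simp add: has_bochner_integral_iff)
 have WM: "(\<integral>v. (v/2) ^ k * W v \<partial>lborel) = (1/2) ^ k * (w powr (b + (a + 1/2 + real k) - 1) * Beta (a + 1/2 + real k) b)" for k
 proof -
  have c: "a + 1/2 + real k > 0" using a by (simp add: add_pos_nonneg)
  have "(v/2) ^ k * W v = (1/2) ^ k * (indicator {0<..<w} v * ((w - v) powr (b-1) * v powr (a + 1/2 + real k - 1)))" for v
  proof (cases "v \<in> {0<..<w}")
   case True
   hence "v powr (a + 1/2 + real k - 1) = v powr (a - 1/2) * v ^ k"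
    using powr_add[of v "a - 1/2" "real k"] by (simp add: powr_realpow algebra_simps)
   thus ?thesis by (simp add: W_def power_divide)
  qed (simp add: W_def)
  thus ?thesis using scale[OF c] by (simp add: has_bochner_integral_iff)
 qed
 have "(\<lambda>n. bin (a - 1/2) n * (\<integral>v. (v/2) ^ n * W v \<partial>lborel)) sums (\<integral>v. (\<Sum>n. bin (a - 1/2) n * (v/2) ^ n) * W v \<partial>lborel)"
 proof (rule termwise_power_series[where r = "w/2"])
  show "summable (\<lambda>n. \<bar>bin (a - 1/2) n\<bar> * (w/2) ^ n)" using w by (intro bin_abs_summable) auto
  fix v assume "W v \<noteq> 0"
  thus "\<bar>v/2\<bar> \<le> w/2" by (auto simp: W_def indicator_def split: if_splits)
 qed (use WI w in auto)
 moreover have P: "(\<integral>v. (\<Sum>n. bin (a - 1/2) n * (v/2) ^ n) * W v \<partial>lborel) = 2 powr (1/2 - a) * poisson_int a b ta"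
 proof -
  have "poisson_int a b ta = (\<integral>v. max 0 (ta - (-1 + 1 * v)) powr (b - 1) * jac a (-1 + 1 * v) \<partial>lborel)"
   unfolding poisson_int_def using lborel_integral_real_affine[of 1 "\<lambda>u. max 0 (ta - u) powr (b - 1) * jac a u" "-1"] by simp
  moreover have "(\<Sum>n. bin (a - 1/2) n * (v/2) ^ n) * W v = 2 powr (1/2 - a) * (max 0 (ta - (-1 + 1 * v)) powr (b - 1) * jac a (-1 + 1 * v))" for v
  proof (cases "v \<in> {0<..<w}")
   case True
   hence v: "\<bar>v/2\<bar> < 1" using w by simp
   have "(\<Sum>n. bin (a - 1/2) n * (v/2) ^ n) = (1 - v/2) powr (a - 1/2)" using bin_sums[OF v] by (simp add: sums_iff)
   also have "1 - v/2 = (2 - v)/2" by (simp add: field_simps)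
   also have "\<dots> powr (a - 1/2) = (2 - v) powr (a - 1/2) * 2 powr (1/2 - a)"
    using True w powr_minus_divide[of 2 "a - 1/2"] by (simp add: powr_divide)
   finally have 1: "(\<Sum>n. bin (a - 1/2) n * (v/2) ^ n) = (2 - v) powr (a - 1/2) * 2 powr (1/2 - a)" .
   have "1 - (-1 + 1 * v)\<^sup>2 = v * (2 - v)" by (simp add: power2_eq_square algebra_simps)
   hence 2: "jac a (-1 + 1 * v) = v powr (a - 1/2) * (2 - v) powr (a - 1/2)"
    using True w by (simp add: jac_def powr_mult)
   have 3: "max 0 (ta - (-1 + 1 * v)) = w - v" using True by (simp add: w_def)
   show ?thesis unfolding 1 2 3 using True by (simp add: W_def)
  next
   case False
   thus ?thesis by (auto simp: W_def jac_def w_def indicator_def max_def)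
  qed
  ultimately show ?thesis by simp
 qed
 ultimately have S: "(\<lambda>n. bin (a - 1/2) n * ((1/2) ^ n * (w powr (b + (a + 1/2 + real n) - 1) * Beta (a + 1/2 + real n) b))) sums (2 powr (1/2 - a) * poisson_int a b ta)"
  unfolding WM by (simp only:)
 define N where "N = rGamma b / (sqrt pi * Gamma (a + 1/2) * 2 powr (1/2))"
 have G: "Gamma (a + 1/2) > 0" "Gamma b > 0" using a b by (auto intro!: Gamma_real_pos)
 have "(\<lambda>n. N * (bin (a - 1/2) n * ((1/2) ^ n * (w powr (b + (a + 1/2 + real n) - 1) * Beta (a + 1/2 + real n) b)))) sums (N * (2 powr (1/2 - a) * poisson_int a b ta))"
  by (rule sums_mult[OF S])
 moreover have "N * (bin (a - 1/2) n * ((1/2) ^ n * (w powr (b + (a + 1/2 + real n) - 1) * Beta (a + 1/2 + real n) b)))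
   = w powr (a + b - 1/2) * (coefA a n * rGamma (a + b + 1/2 + real n) * w ^ n)" for n
 proof -
  have nn: "a + 1/2 \<notin> \<int>\<^sub>\<le>\<^sub>0" using a by (auto dest: nonpos_Ints_nonpos)
  have "Gamma (a + 1/2 + real n) = pochhammer (1/2 + a) n * Gamma (a + 1/2)"
   using pochhammer_Gamma[OF nn, of n] G by (simp add: field_simps add_ac)
  hence B: "Beta (a + 1/2 + real n) b = pochhammer (1/2 + a) n * Gamma (a + 1/2) * Gamma b * rGamma (a + b + 1/2 + real n)"
   by (simp add: Beta_altdef add_ac)
  have bn: "bin (a - 1/2) n = pochhammer (1/2 - a) n / fact n" by (simp add: bin_pochhammer)
  have wn: "w powr (b + (a + 1/2 + real n) - 1) = w powr (a + b - 1/2) * w ^ n"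
   using w powr_add[of w "a + b - 1/2" "real n"] by (simp add: powr_realpow algebra_simps)
  have sq: "sqrt (2 * pi) = sqrt pi * 2 powr (1/2)" by (simp add: real_sqrt_mult powr_half_sqrt mult.commute)
  have "rGamma b * Gamma b = 1" using G by (simp add: rGamma_inverse_Gamma)
  hence "N * (Gamma (a + 1/2) * Gamma b) = 1 / sqrt (2 * pi)" using G unfolding N_def sq by (simp add: field_simps)
  hence "1 / sqrt (2 * pi) = N * (Gamma (a + 1/2) * Gamma b)" ..
  moreover have "coefA a n = pochhammer (1/2 - a) n * pochhammer (1/2 + a) n / (2 ^ n * fact n) * (1 / sqrt (2 * pi))"
   by (simp add: coefA_def)
  ultimately have cA: "coefA a n = pochhammer (1/2 - a) n * pochhammer (1/2 + a) n / (2 ^ n * fact n) * (N * (Gamma (a + 1/2) * Gamma b))" by simp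
  show ?thesis unfolding B bn wn cA by (simp add: power_one_over field_simps)
 qed
 ultimately have "(\<lambda>n. w powr (a + b - 1/2) * (coefA a n * rGamma (a + b + 1/2 + real n) * w ^ n)) sums (N * (2 powr (1/2 - a) * poisson_int a b ta))"
  by (simp only:)
 moreover have "summable (\<lambda>n. coefA a n * rGamma (a + b + 1/2 + real n) * w ^ n)"
  using w a b by (intro serA_summable) auto
 hence "(\<lambda>n. w powr (a + b - 1/2) * (coefA a n * rGamma (a + b + 1/2 + real n) * w ^ n)) sums (w powr (a + b - 1/2) * serA a (a + b) w)"
  unfolding serA_def by (intro sums_mult summable_sums)
 ultimately have "N * (2 powr (1/2 - a) * poisson_int a b ta) = w powr (a + b - 1/2) * serA a (a + b) w"
  by (rule sums_unique2)
 moreover have "N * 2 powr (1/2 - a) = rGamma b / (sqrt pi * Gamma (a + 1/2) * 2 powr a)"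
  unfolding N_def powr_diff[of 2 "1/2" a] by simp
 ultimately show ?thesis using ta by (simp add: prof_def w_def mult.assoc[symmetric])
qed

section \<open>Raising al: the recurrence of I carried over to the series and the profile\<close>

lemma coefA_recurrence_0: "coefA al 0 = coefA (al + 2) 0"
 by (simp add: coefA_def)

text \<open>The coefficient form of I_al(s) = I_(al+2)(s) + 2 (al + 1) I_(al+1)(s) / s; dividing by
  s shifts the index k by one.\<close>

lemma coefA_recurrence_Suc: "coefA al (Suc k) = coefA (al + 2) (Suc k) + 2 * (al + 1) * coefA (al + 1) k"
proof -
 define q where "q = al + 1/2"
 define n where "n = real (Suc k)"
 have s: "pochhammer (1 - q) (Suc k) * pochhammer q (Suc k)
   = pochhammer (-1 - q) (Suc k) * pochhammer (q + 2) (Suc k)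
    + 4 * n * (q + 1/2) * (pochhammer (- q) k * pochhammer (q + 1) k)"
 proof (cases k)
  case 0
  thus ?thesis by (simp add: n_def algebra_simps)
 next
  case (Suc j)
  \<comment> \<open>Each of the three products contains R, and what is left is a polynomial identity
    in q and j.\<close>
  define R where "R = pochhammer (1 - q) j * pochhammer (q + 2) j"
  have n: "n = real j + 2" by (simp add: n_def Suc)
  have 1: "pochhammer (1 - q) (Suc k) = pochhammer (1 - q) j * (1 - q + real j) * (1 - q + real j + 1)"
   by (simp add: Suc pochhammer_Suc algebra_simps)
  have 2: "pochhammer q (Suc k) = q * (q + 1) * pochhammer (q + 2) j"
   by (simp add: Suc pochhammer_rec add.assoc)
  have 3: "pochhammer (-1 - q) (Suc k) = (-1 - q) * (- q) * pochhammer (1 - q) j"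
   by (simp add: Suc pochhammer_rec add.assoc)
  have 4: "pochhammer (q + 2) (Suc k) = pochhammer (q + 2) j * (q + 2 + real j) * (q + 2 + real j + 1)"
   by (simp add: Suc pochhammer_Suc algebra_simps)
  have 5: "pochhammer (- q) k = (- q) * pochhammer (1 - q) j" by (simp add: Suc pochhammer_rec)
  have 6: "pochhammer (q + 1) k = (q + 1) * pochhammer (q + 2) j" by (simp add: Suc pochhammer_rec add.assoc)
  show ?thesis unfolding 1 2 3 4 5 6 n by algebra
 qed
 have args: "1/2 - al = 1 - q" "1/2 + al = q" "1/2 - (al + 2) = -1 - q" "1/2 + (al + 2) = q + 2"
  "1/2 - (al + 1) = - q" "1/2 + (al + 1) = q + 1" "al + 1 = q + 1/2"
  by (simp_all add: q_def)
 have f: "fact (Suc k) = n * (fact k :: real)" by (simp add: n_def)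
 have n0: "n > 0" by (simp add: n_def)
 have "coefA al (Suc k) = (pochhammer (1 - q) (Suc k) * pochhammer q (Suc k)) / (2 ^ Suc k * fact (Suc k) * sqrt (2 * pi))"
  by (simp only: coefA_def args(1,2))
 also have "\<dots> = pochhammer (-1 - q) (Suc k) * pochhammer (q + 2) (Suc k) / (2 ^ Suc k * fact (Suc k) * sqrt (2 * pi))
   + 4 * n * (q + 1/2) * (pochhammer (- q) k * pochhammer (q + 1) k) / (2 ^ Suc k * fact (Suc k) * sqrt (2 * pi))"
  unfolding s by (rule add_divide_distrib)
 also have "4 * n * (q + 1/2) * (pochhammer (- q) k * pochhammer (q + 1) k) / (2 ^ Suc k * fact (Suc k) * sqrt (2 * pi))
   = 2 * (q + 1/2) * (pochhammer (- q) k * pochhammer (q + 1) k / (2 ^ k * fact k * sqrt (2 * pi)))"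
  unfolding f using n0 by (simp add: divide_simps)
 finally have X: "coefA al (Suc k) = pochhammer (-1 - q) (Suc k) * pochhammer (q + 2) (Suc k) / (2 ^ Suc k * fact (Suc k) * sqrt (2 * pi))
   + 2 * (q + 1/2) * (pochhammer (- q) k * pochhammer (q + 1) k / (2 ^ k * fact k * sqrt (2 * pi)))" .
 have A: "coefA (al + 2) (Suc k) = pochhammer (-1 - q) (Suc k) * pochhammer (q + 2) (Suc k) / (2 ^ Suc k * fact (Suc k) * sqrt (2 * pi))"
  by (simp only: coefA_def args(3,4))
 have B: "coefA (al + 1) k = pochhammer (- q) k * pochhammer (q + 1) k / (2 ^ k * fact k * sqrt (2 * pi))"
  by (simp only: coefA_def args(5,6))
 show ?thesis unfolding A B X unfolding args(7) ..
qed

lemma serA_recurrence: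
 assumes nu: "nu > -1/2" and w: "\<bar>w\<bar> < 2"
 shows "serA al nu w = serA (al + 2) nu w + 2 * (al + 1) * (w * serA (al + 1) (nu + 1) w)"
proof -
 define a where "a k = coefA al k * rGamma (nu + 1/2 + real k) * w ^ k" for k
 define b where "b k = coefA (al + 2) k * rGamma (nu + 1/2 + real k) * w ^ k" for k
 define c where "c k = coefA (al + 1) k * rGamma (nu + 1 + 1/2 + real k) * w ^ k" for k
 have S: "summable a" "summable b" unfolding a_def b_def
  using nu w by (auto intro!: serA_summable)
 have S3: "summable c" unfolding c_def by (rule serA_summable) (use nu w in auto)
 note S = S S3
 have e: "a (Suc k) = b (Suc k) + 2 * (al + 1) * (w * c k)" for k
 proof -
  have "nu + 1/2 + real (Suc k) = nu + 1 + 1/2 + real k" by simp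
  thus ?thesis unfolding a_def b_def c_def coefA_recurrence_Suc[of al k] by (simp only: power_Suc) (simp add: algebra_simps)
 qed
 have "suminf a = a 0 + (\<Sum>k. a (Suc k))" using suminf_split_head[OF S(1)] by simp
 also have "(\<Sum>k. a (Suc k)) = (\<Sum>k. b (Suc k)) + 2 * (al + 1) * (w * suminf c)"
  unfolding e using S by (subst suminf_add[symmetric]) (auto simp: summable_Suc_iff suminf_mult intro!: summable_mult)
 also have "a 0 = b 0" by (simp add: a_def b_def coefA_recurrence_0[of al])
 finally have "suminf a = (b 0 + (\<Sum>k. b (Suc k))) + 2 * (al + 1) * (w * suminf c)" by simp
 also have "b 0 + (\<Sum>k. b (Suc k)) = suminf b" using suminf_split_head[OF S(2)] by simp
 finally show ?thesis by (simp only: serA_def a_def[abs_def] b_def[abs_def] c_def[abs_def])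
qed

lemma coefB_recurrence_0: "coefB al 0 = 2 * (al + 1) * coefB (al + 1) 0"
proof -
 have p: "2 powr (-(al + 1)) = 2 powr (-al) / (2::real)" by (simp add: powr_diff)
 have r: "rGamma (al + 1) = (al + 1) * rGamma (al + 2)"
  using rGamma_plus1[of "al + 1"] by (simp add: add_ac)
 have c1: "coefB al 0 = 2 powr (-al) * rGamma (al + 1)" by (simp add: coefB_def)
 have c2: "coefB (al + 1) 0 = 2 powr (-(al + 1)) * rGamma (al + 2)" by (simp add: coefB_def add_ac)
 show ?thesis unfolding c1 c2 p r by simp
qed

lemma coefB_recurrence_Suc: "coefB al (Suc k) = coefB (al + 2) k + 2 * (al + 1) * coefB (al + 1) (Suc k)"
proof -
 define P where "P = (2::real) powr (-al)"
 define G where "G = rGamma (real k + al + 3)"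
 have p: "2 powr (-(al + 2)) = P / 4" "2 powr (-(al + 1)) = P / 2"
  by (simp_all add: P_def powr_diff powr_numeral)
 have g: "rGamma (real (Suc k) + al + 1) = (real k + al + 2) * G"
  using rGamma_plus1[of "real k + al + 2"] by (simp add: G_def algebra_simps)
 have g1: "rGamma (real k + (al + 2) + 1) = G" "rGamma (real (Suc k) + (al + 1) + 1) = G" by (simp_all add: G_def add_ac)
 show ?thesis unfolding coefB_def p g g1 P_def[symmetric] by (simp add: divide_simps) (simp add: algebra_simps)
qed

lemma serB_recurrence:
 assumes al: "al > -1" and nu: "nu > -1/2" and v: "\<bar>v\<bar> < 1"
 shows "serB al nu v = v * serB (al + 2) nu v + 2 * (al + 1) * serB (al + 1) (nu + 1) v"
proof -
 define a where "a k = coefB al k * rGamma (nu - al - 2 * real k) * v ^ k" for k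
 define b where "b k = coefB (al + 2) k * rGamma (nu - (al + 2) - 2 * real k) * v ^ k" for k
 define c where "c k = coefB (al + 1) k * rGamma (nu + 1 - (al + 1) - 2 * real k) * v ^ k" for k
 have S1: "summable a" unfolding a_def by (rule serB_summable) (use al nu v in auto)
 have S2: "summable b" unfolding b_def by (rule serB_summable) (use al nu v in auto)
 have S3: "summable c" unfolding c_def by (rule serB_summable) (use al nu v in auto)
 note S = S1 S2 S3
 have e: "a (Suc k) = v * b k + 2 * (al + 1) * c (Suc k)" for k
 proof -
  have "nu - (al + 2) - 2 * real k = nu - al - 2 * real (Suc k)" "nu + 1 - (al + 1) - 2 * real (Suc k) = nu - al - 2 * real (Suc k)" by simp_all
  thus ?thesis unfolding a_def b_def c_def coefB_recurrence_Suc[of al k] by (simp only: power_Suc) (simp add: algebra_simps)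
 qed
 have "suminf a = a 0 + (\<Sum>k. a (Suc k))" using suminf_split_head[OF S(1)] by simp
 also have "(\<Sum>k. a (Suc k)) = v * suminf b + 2 * (al + 1) * (\<Sum>k. c (Suc k))"
  unfolding e using S by (subst suminf_add[symmetric]) (auto simp: summable_Suc_iff suminf_mult intro!: summable_mult)
 also have "a 0 = 2 * (al + 1) * c 0" by (simp add: a_def c_def coefB_recurrence_0[of al])
 finally have "suminf a = v * suminf b + 2 * (al + 1) * (c 0 + (\<Sum>k. c (Suc k)))" by (simp add: algebra_simps)
 also have "c 0 + (\<Sum>k. c (Suc k)) = suminf c" using suminf_split_head[OF S(3)] by simp
 finally show ?thesis by (simp only: serB_def a_def[abs_def] b_def[abs_def] c_def[abs_def])
qed

text \<open>The inverse transform of the recurrence of I, where dividing by s raises nu by one. It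
  reaches every al > -1 from indices al + 1 and al + 2 above -1/2, for which Poisson's integral
  exists.\<close>

lemma prof_recurrence:
 assumes al: "al > -1" and nu: "nu > -1/2" and ta: "ta \<noteq> 1"
 shows "prof al nu ta = prof (al + 2) nu ta + 2 * (al + 1) * prof (al + 1) (nu + 1) ta"
proof -
 consider "ta \<le> -1" | "-1 < ta" "ta < 1" | "ta > 1" using ta by linarith
 thus ?thesis
 proof cases
  case 1 thus ?thesis by (simp add: prof_def)
 next
  case 2
  have "(ta + 1) powr (nu + 1 - 1/2) = (ta + 1) powr (nu - 1/2) * (ta + 1)"
   using 2 powr_add[of "ta + 1" "nu - 1/2" 1] by (simp add: algebra_simps)
  moreover have "serA al nu (ta + 1) = serA (al + 2) nu (ta + 1) + 2 * (al + 1) * ((ta + 1) * serA (al + 1) (nu + 1) (ta + 1))"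
   using 2 by (intro serA_recurrence nu) auto
  ultimately show ?thesis using 2 by (simp only: prof_def) (simp add: algebra_simps)
 next
  case 3
  have "\<bar>1/ta\<^sup>2\<bar> < 1" using 3 by (simp add: one_less_power)
  note r = serB_recurrence[OF al nu this]
  have "ta powr (nu - (al + 2) - 1) = ta powr (nu - al - 1) * (1/ta\<^sup>2)"
   using 3 powr_add[of ta "nu - al - 1" "-2"] by (simp add: powr_minus_divide powr_numeral algebra_simps)
  moreover have "nu + 1 - (al + 1) - 1 = nu - al - 1" by simp
  ultimately show ?thesis using 3 r by (simp only: prof_def) (simp add: algebra_simps)
 qed
qed

lemma prof_measurable [measurable]: "prof al nu \<in> borel_measurable borel"
proof -
 have [measurable]: "serA al nu \<in> borel_measurable borel" "serB al nu \<in> borel_measurable borel"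
  unfolding serA_def[abs_def] serB_def[abs_def] by measurable
 show ?thesis unfolding prof_def[abs_def] by measurable
qed

section \<open>The transform of the profile and the closed form of the kernel\<close>

lemma poisson_laplace_prof:
 assumes a: "a > -1/2" and b: "b > 0" and s: "s > 0"
 shows "has_laplace (prof a (a + b)) s (s powr (-b) * 2 powr (-a) * bessel_e a (s\<^sup>2 / 4))"
proof -
 define c where "c = rGamma b / (sqrt pi * Gamma (a + 1/2) * 2 powr a)"
 have G: "Gamma (a + 1/2) > 0" "Gamma b > 0" using a b by (auto intro!: Gamma_real_pos)
 have "has_laplace (\<lambda>T. c * poisson_int a b T) s (c * (Gamma b * s powr (-b) * (sqrt pi * Gamma (a + 1/2) * bessel_e a (s\<^sup>2 / 4))))"
  by (intro has_laplace_cmult poisson_int_laplace assms)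
 also have "c * (Gamma b * s powr (-b) * (sqrt pi * Gamma (a + 1/2) * bessel_e a (s\<^sup>2 / 4))) = s powr (-b) * 2 powr (-a) * bessel_e a (s\<^sup>2 / 4)"
  using G by (simp add: c_def rGamma_inverse_Gamma powr_minus divide_simps)
 finally show ?thesis
 proof (rule has_laplace_cong_AE)
  show "(\<lambda>T. c * poisson_int a b T) \<in> borel_measurable borel" unfolding poisson_int_def by measurable
  show "AE ta in lborel. c * poisson_int a b ta = prof a (a + b) ta"
   using AE_lborel_neq[of "-1"] AE_lborel_neq[of 1]
  proof eventually_elim
   case (elim ta)
   show ?case
   proof (cases "ta \<le> -1")
    case True
    hence "(\<lambda>u. max 0 (ta - u) powr (b - 1) * jac a u) = (\<lambda>u. 0)" by (auto simp: fun_eq_iff jac_def indicator_def max_def)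
    hence "poisson_int a b ta = 0" unfolding poisson_int_def by (simp only:) simp
    thus ?thesis using True by (simp add: prof_def)
   next
    case False
    thus ?thesis using elim poisson_int_inner[OF a b, of ta] poisson_int_outer[OF a b, of ta]
     unfolding c_def by linarith
   qed
  qed
 qed measurable
qed

text \<open>In \<open>prof_recurrence\<close> the term of index al + 2 keeps the order al + be, so
  its Poisson integral has b = be - 2; this is where be > 2 comes from. The two transforms add up by
  \<open>bessel_e_recurrence\<close>.\<close>

lemma prof_laplace:
 assumes al: "al > -1" and be: "be > 2" and s: "s > 0"
 shows "has_laplace (prof al (al + be)) s (s powr (-be) * 2 powr (-al) * bessel_e al (s\<^sup>2 / 4))"
proof -
 have e: "al + 2 + (be - 2) = al + be" "al + 1 + be = al + be + 1" by simp_all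
 have "has_laplace (\<lambda>ta. prof (al + 2) (al + be) ta + 2 * (al + 1) * prof (al + 1) (al + be + 1) ta) s
   (s powr (-(be - 2)) * 2 powr (-(al + 2)) * bessel_e (al + 2) (s\<^sup>2 / 4) + 2 * (al + 1) * (s powr (-be) * 2 powr (-(al + 1)) * bessel_e (al + 1) (s\<^sup>2 / 4)))"
  using poisson_laplace_prof[of "al + 2" "be - 2" s] poisson_laplace_prof[of "al + 1" be s] assms unfolding e by (intro has_laplace_add has_laplace_cmult) auto
 also have "s powr (-(be - 2)) * 2 powr (-(al + 2)) * bessel_e (al + 2) (s\<^sup>2 / 4) + 2 * (al + 1) * (s powr (-be) * 2 powr (-(al + 1)) * bessel_e (al + 1) (s\<^sup>2 / 4))
   = s powr (-be) * 2 powr (-al) * bessel_e al (s\<^sup>2 / 4)"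
 proof -
  have "s powr (-(be - 2)) = s powr (-be) * s\<^sup>2" using s powr_add[of s "-be" 2] by (simp add: powr_numeral)
  moreover have "2 powr (-(al + 2)) = 2 powr (-al) / (4::real)" "2 powr (-(al + 1)) = 2 powr (-al) / (2::real)"
   by (simp_all add: powr_diff powr_numeral)
  ultimately show ?thesis unfolding bessel_e_recurrence[of al] by (simp only:) (simp add: algebra_simps)
 qed
 finally show ?thesis
 proof (rule has_laplace_cong_AE)
  show "AE ta in lborel. prof (al + 2) (al + be) ta + 2 * (al + 1) * prof (al + 1) (al + be + 1) ta = prof al (al + be) ta"
   using AE_lborel_neq[of 1] by eventually_elim (rule prof_recurrence[symmetric], use al be in auto)
 qed measurable
qed

text \<open>Both sides have the same Laplace transform in T at the positive integers: the left by
  Weber's integral, the right because \<tau> is affine in T with slope 1 / (2 x z), the shift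
  producing exp (-(n (x^2 + z^2))). Both are continuous in T off the two singular values.\<close>

lemma triple_limit_base:
 assumes al: "al > -1" and be: "be > 2" and x: "x > 0" and z: "z > 0" and T: "T > 0"
  and T': "T \<noteq> (x - z)\<^sup>2" "T \<noteq> (x + z)\<^sup>2"
 defines "ta \<equiv> \<lambda>T. (T - x\<^sup>2 - z\<^sup>2) / (2 * x * z)"
 shows "((\<lambda>rho. T powr (al + be) * triple_int al (al + be) (x\<^sup>2) (z\<^sup>2) T rho) \<longlongrightarrow>
   (x * z) powr (-al) * (2 * x * z) powr (al + be - 1) * prof al (al + be) (ta T)) at_top"
proof -
 define nu where "nu = al + be"
 have nu: "nu > 1" using al be by (simp add: nu_def)
 have x2: "x\<^sup>2 > 0" and z2: "z\<^sup>2 > 0" using x z by auto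
 define a where "a = 2 * x * z"
 have a: "a > 0" using x z by (simp add: a_def)
 define c where "c = (x * z) powr (-al) * a powr (nu - 1)"
 define F where "F T = T powr nu * (LINT Y:{0<..}|lborel. triple al nu (x\<^sup>2) (z\<^sup>2) T Y)" for T
 define G where "G T = c * prof al nu (ta T)" for T
 note tr = triple_transform[OF al nu x2 z2, folded F_def]
 have tam1: "ta T = -1 \<longleftrightarrow> T = (x - z)\<^sup>2" and tap1: "ta T = 1 \<longleftrightarrow> T = (x + z)\<^sup>2" for T
 proof -
  have t: "ta T = (T - x\<^sup>2 - z\<^sup>2) / a" by (simp add: ta_def a_def)
  have sq: "(x - z)\<^sup>2 = x\<^sup>2 + z\<^sup>2 - a" "(x + z)\<^sup>2 = x\<^sup>2 + z\<^sup>2 + a"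
   by (simp_all add: a_def power2_diff power2_sum)
  have "ta T = -1 \<longleftrightarrow> T - x\<^sup>2 - z\<^sup>2 = - a" "ta T = 1 \<longleftrightarrow> T - x\<^sup>2 - z\<^sup>2 = a"
   unfolding t using a by (auto simp: divide_eq_eq)
  thus "ta T = -1 \<longleftrightarrow> T = (x - z)\<^sup>2" "ta T = 1 \<longleftrightarrow> T = (x + z)\<^sup>2" unfolding sq by linarith+
 qed
 have "F T = G T"
 proof (rule laplace_unique[OF _ _ T])
  have "isCont (prof al nu) (ta T)"
   using DERIV_isCont[OF DERIV_prof[OF al, of "nu - 1" "ta T"]] nu T' tam1 tap1 by auto
  moreover have "isCont ta T" unfolding ta_def by (intro continuous_intros) (use x z in auto)
  ultimately have "isCont (\<lambda>T. prof al nu (ta T)) T" by (rule isCont_o2[rotated])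
  thus "isCont G T" unfolding G_def[abs_def] by (rule continuous_mult_left)
  show "isCont F T" by (rule tr(2)[OF T])
  fix n :: nat assume n: "n \<ge> 1"
  show "has_laplace_pos F (real n) (real n powr (al-nu) * exp (-(real n*(x\<^sup>2+z\<^sup>2))) * bessel_e al ((real n)\<^sup>2*x\<^sup>2*z\<^sup>2))"
   by (rule tr(3)[OF n])
  have n0: "real n > 0" using n by simp
  define q where "q = (x\<^sup>2 + z\<^sup>2) / a"
  have ta: "T / a - q = ta T" for T by (simp add: ta_def q_def a_def[symmetric] diff_divide_distrib add_divide_distrib)
  have "has_laplace (prof al nu) (real n * a) ((real n * a) powr (-be) * 2 powr (-al) * bessel_e al ((real n * a)\<^sup>2 / 4))"
   unfolding nu_def using n0 a by (intro prof_laplace al be) simp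
  from has_laplace_cmult[OF has_laplace_affine[OF this a, of q], of c]
  have "has_laplace G (real n) (c * (a * exp (-(real n * a * q)) * ((real n * a) powr (-be) * 2 powr (-al) * bessel_e al ((real n * a)\<^sup>2 / 4))))"
   unfolding ta G_def[abs_def] .
  \<comment> \<open>For T \<le> 0 the inequality 2 x z \<le> x^2 + z^2 gives \<tau> \<le> -1, where
    the profile vanishes; so the two-sided transform of G is already one-sided.\<close>
  moreover have "G = (\<lambda>T. indicator {0<..} T * G T)"
  proof
   fix T
   have "ta T \<le> -1" if "T \<le> 0"
   proof -
    have "2 * x * z \<le> x\<^sup>2 + z\<^sup>2" using sum_squares_bound[of x z] by simp
    hence "T - x\<^sup>2 - z\<^sup>2 \<le> - a" using that by (simp add: a_def)
    thus ?thesis using a by (simp add: ta_def a_def[symmetric] pos_divide_le_eq)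
   qed
   thus "G T = indicator {0<..} T * G T" by (auto simp: indicator_def G_def prof_def)
  qed
  moreover have "c * (a * exp (-(real n * a * q)) * ((real n * a) powr (-be) * 2 powr (-al) * bessel_e al ((real n * a)\<^sup>2 / 4)))
    = real n powr (al-nu) * exp (-(real n*(x\<^sup>2+z\<^sup>2))) * bessel_e al ((real n)\<^sup>2*x\<^sup>2*z\<^sup>2)"
  proof -
   have 1: "(real n * a)\<^sup>2 / 4 = (real n)\<^sup>2*x\<^sup>2*z\<^sup>2" by (simp add: a_def power_mult_distrib)
   have 2: "(real n * a) powr (-be) = real n powr (al-nu) * a powr (-be)" using n0 a by (simp add: powr_mult nu_def)
   have 3: "real n * a * q = real n*(x\<^sup>2+z\<^sup>2)" using a by (simp add: q_def)
   have "a powr (-al) = 2 powr (-al) * (x * z) powr (-al)"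
    using x z powr_mult[of 2 "x * z" "-al"] by (simp add: a_def mult.assoc)
   hence h: "(x * z) powr (-al) = a powr (-al) * 2 powr al" by (simp add: powr_minus)
   have "c * a powr (-be) * 2 powr (-al) * a = (2 powr al * 2 powr (-al)) * (a powr (-al) * a powr (nu - 1) * a powr (-be) * a powr 1)"
    using a unfolding c_def h by simp
   also have "\<dots> = 1" using a unfolding powr_add[symmetric] by (simp add: nu_def)
   finally have 4: "c * a powr (-be) * 2 powr (-al) * a = 1" .
   have "c * (a * exp (-(real n * a * q)) * ((real n * a) powr (-be) * 2 powr (-al) * bessel_e al ((real n * a)\<^sup>2 / 4)))
    = (c * a powr (-be) * 2 powr (-al) * a) * (real n powr (al-nu) * exp (-(real n*(x\<^sup>2+z\<^sup>2))) * bessel_e al ((real n)\<^sup>2*x\<^sup>2*z\<^sup>2))"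
    unfolding 1 2 3 by simp
   thus ?thesis unfolding 4 by simp
  qed
  ultimately show "has_laplace_pos G (real n) (real n powr (al-nu) * exp (-(real n*(x\<^sup>2+z\<^sup>2))) * bessel_e al ((real n)\<^sup>2*x\<^sup>2*z\<^sup>2))" by simp
 qed
 with tr(1)[OF T] show ?thesis by (simp add: G_def c_def nu_def a_def)
qed

definition tau :: "real => real => real => real" where
 "tau t x z = (t\<^sup>2 - x\<^sup>2 - z\<^sup>2) / (2 * x * z)"

lemma triple_limit_descent:
 assumes al: "al > -1" and nu: "nu > -1/2" and x: "x > 0" and z: "z > 0"
  and IH: "\<And>T. T > 0 ==> T \<noteq> (x - z)\<^sup>2 ==> T \<noteq> (x + z)\<^sup>2 ==>
   ((\<lambda>rho. T powr (nu + 1) * triple_int al (nu + 1) (x\<^sup>2) (z\<^sup>2) T rho) \<longlongrightarrow>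
    (x * z) powr (-al) * (2 * x * z) powr nu * prof al (nu + 1) ((T - x\<^sup>2 - z\<^sup>2) / (2 * x * z))) at_top"
  and T: "T > 0" "T \<noteq> (x - z)\<^sup>2" "T \<noteq> (x + z)\<^sup>2"
 shows "((\<lambda>rho. T powr nu * triple_int al nu (x\<^sup>2) (z\<^sup>2) T rho) \<longlongrightarrow>
    (x * z) powr (-al) * (2 * x * z) powr (nu - 1) * prof al nu ((T - x\<^sup>2 - z\<^sup>2) / (2 * x * z))) at_top"
proof (rule triple_int_descent[OF al nu x z])
 define a where "a = 2 * x * z"
 have a: "a > 0" using x z by (simp add: a_def)
 define U where "U = {0<..} - {(x - z)\<^sup>2, (x + z)\<^sup>2}"
 show "open U" unfolding U_def by (intro open_Diff finite_imp_closed) auto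
 show "T \<in> U" "U \<subseteq> {0<..}" "(x + z)\<^sup>2 \<notin> U" "(x - z)\<^sup>2 \<notin> U" using T by (auto simp: U_def)
 define \<Phi> where "\<Phi> T = (x * z) powr (-al) * a powr nu * prof al (nu + 1) ((T - x\<^sup>2 - z\<^sup>2) / a)" for T
 show "((\<lambda>rho. T powr (nu + 1) * triple_int al (nu + 1) (x\<^sup>2) (z\<^sup>2) T rho) \<longlongrightarrow> \<Phi> T) at_top" if "T \<in> U" for T
  using IH[of T] that by (simp add: \<Phi>_def a_def U_def)
 have sq: "(x - z)\<^sup>2 = x\<^sup>2 + z\<^sup>2 - a" "(x + z)\<^sup>2 = x\<^sup>2 + z\<^sup>2 + a"
  by (simp_all add: a_def power2_diff power2_sum)
 have ne: "(T - x\<^sup>2 - z\<^sup>2) / a \<noteq> -1" "(T - x\<^sup>2 - z\<^sup>2) / a \<noteq> 1"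
  using T(2,3) a unfolding sq by (auto simp: divide_eq_eq)
 have "((\<lambda>T. (T - x\<^sup>2 - z\<^sup>2) / a) has_real_derivative 1 / a) (at T)"
  using a by (auto intro!: derivative_eq_intros)
 from DERIV_chain2[OF DERIV_prof[OF al nu ne] this]
 have "((\<lambda>T. prof al (nu + 1) ((T - x\<^sup>2 - z\<^sup>2) / a)) has_real_derivative prof al nu ((T - x\<^sup>2 - z\<^sup>2) / a) * (1 / a)) (at T)" .
 hence "(\<Phi> has_real_derivative ((x * z) powr (-al) * a powr nu) * (prof al nu ((T - x\<^sup>2 - z\<^sup>2) / a) * (1 / a))) (at T)"
  unfolding \<Phi>_def[abs_def] by (rule DERIV_cmult)
 moreover have "a powr nu = a powr (nu - 1) * a" using a powr_add[of a "nu - 1" 1] by simp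
 ultimately show "(\<Phi> has_real_derivative (x * z) powr (-al) * (2 * x * z) powr (nu - 1) * prof al nu ((T - x\<^sup>2 - z\<^sup>2) / (2 * x * z))) (at T)"
  using a unfolding a_def[symmetric] by (simp add: mult.assoc)
qed

text \<open>Induction on the number m of unit steps by which nu has to be raised to reach the case
  be > 2.\<close>

lemma triple_limit:
 assumes al: "al > -1" and nu: "nu > -1/2" and x: "x > 0" and z: "z > 0"
  and T: "T > 0" "T \<noteq> (x - z)\<^sup>2" "T \<noteq> (x + z)\<^sup>2"
 shows "((\<lambda>rho. T powr nu * triple_int al nu (x\<^sup>2) (z\<^sup>2) T rho) \<longlongrightarrow>
    (x * z) powr (-al) * (2 * x * z) powr (nu - 1) * prof al nu ((T - x\<^sup>2 - z\<^sup>2) / (2 * x * z))) at_top"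
proof -
 have "((\<lambda>rho. T powr nu * triple_int al nu (x\<^sup>2) (z\<^sup>2) T rho) \<longlongrightarrow>
    (x * z) powr (-al) * (2 * x * z) powr (nu - 1) * prof al nu ((T - x\<^sup>2 - z\<^sup>2) / (2 * x * z))) at_top"
  if "nu > -1/2" "nu + real m - al > 2" "T > 0" "T \<noteq> (x - z)\<^sup>2" "T \<noteq> (x + z)\<^sup>2" for m nu T
  using that
 proof (induction m arbitrary: nu T)
  case 0
  have "al + (nu - al) = nu" by simp
  with triple_limit_base[OF al _ x z 0(3-5), of "nu - al"] 0(2) show ?case by simp
 next
  case (Suc m)
  show ?case
  proof (rule triple_limit_descent[OF al Suc.prems(1) x z _ Suc.prems(3-5)])
   fix T assume "T > 0" "T \<noteq> (x - z)\<^sup>2" "T \<noteq> (x + z)\<^sup>2"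
   from Suc.IH[OF _ _ this, of "nu + 1"] Suc.prems(1,2)
   show "((\<lambda>rho. T powr (nu + 1) * triple_int al (nu + 1) (x\<^sup>2) (z\<^sup>2) T rho) \<longlongrightarrow>
     (x * z) powr (-al) * (2 * x * z) powr nu * prof al (nu + 1) ((T - x\<^sup>2 - z\<^sup>2) / (2 * x * z))) at_top"
    by (simp add: add_ac)
  qed
 qed
 note * = this
 obtain m where "real m > 2 + al - nu" using reals_Archimedean2 by blast
 hence "nu + real m - al > 2" by simp
 thus ?thesis by (rule *[OF nu _ T])
qed

lemma kernel_integrand_triple:
 assumes "t > 0" "x > 0" "z > 0" "y > 0"
 shows "kernel_integrand al be t x z y
  = 2 powr (1 - (al + be)) * t powr (al + be) * (x * z) powr al * (y / 2 * triple al (al + be) (x\<^sup>2) (z\<^sup>2) (t\<^sup>2) (y\<^sup>2 / 4))"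
proof -
 define nu where "nu = al + be"
 define e where "e = bessel_e nu (- (t\<^sup>2 * (y\<^sup>2/4))) * bessel_e al (- (x\<^sup>2 * (y\<^sup>2/4))) * bessel_e al (- (z\<^sup>2 * (y\<^sup>2/4)))"
 define h where "h = y / 2"
 have h: "h > 0" "y = 2 * h" using assms by (auto simp: h_def)
 have J: "bessel_J \<mu> (s * y) = s powr \<mu> * h powr \<mu> * bessel_e \<mu> (- (s\<^sup>2 * (y\<^sup>2/4)))" if "s > 0" for s \<mu>
  using bessel_J_conv_e[of "s * y" \<mu>] that assms by (simp add: h_def powr_mult power_mult_distrib power_divide flip: powr_mult)
 have "kernel_integrand al be t x z y = (t powr nu * (x powr al * z powr al)) * (h powr nu * h powr al * h powr al * y powr (1 - nu)) * e"
 proof -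
  have "1 - al - be = 1 - nu" by (simp add: nu_def)
  thus ?thesis unfolding kernel_integrand_def nu_def[symmetric] J[OF assms(1)] J[OF assms(2)] J[OF assms(3)] e_def
   by (simp only: mult_ac)
 qed
 also have "h powr nu * h powr al * h powr al * y powr (1 - nu) = 2 powr (1 - nu) * (h * (y\<^sup>2 / 4) powr al)"
 proof -
  have "y powr (1 - nu) = 2 powr (1 - nu) * h powr (1 - nu)" using h by (simp add: powr_mult)
  moreover have "(y\<^sup>2 / 4) powr al = h powr al * h powr al"
   using h by (simp add: power_mult_distrib power2_eq_square powr_mult)
  moreover have "h powr nu * h powr (1 - nu) = h" using h by (simp add: powr_add[symmetric])
  ultimately show ?thesis by (metis (no_types, opaque_lifting) mult.assoc mult.commute)
 qed
 also have "x powr al * z powr al = (x * z) powr al" using assms by (simp add: powr_mult)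
 finally show ?thesis by (simp add: nu_def triple_def e_def h_def mult_ac)
qed

text \<open>Off the singular values of t the improper integral really converges, so
  \<open>Lim\<close> is its value. The cutoff R becomes R^2 / 4 under Y = (y / 2)^2, and the
  prefactors t^nu and (x z)^al of the integrand cancel those in front of the integral.\<close>

lemma kernel_eq:
 assumes al: "al > -1" and nu: "al + be > -1/2" and t: "t > 0" and x: "x > 0" and z: "z > 0"
  and sing: "t \<noteq> \<bar>x - z\<bar>" "t \<noteq> x + z"
 shows "kernel al be t x z = 2 powr (al + be) * Gamma (al + be + 1) * (t powr (- 2 * (al + be)) * (x * z) powr (be - 1) * prof al (al + be) (tau t x z))"
proof -
 define nu where "nu = al + be"
 define c where "c = 2 powr (1 - nu) * t powr nu * (x * z) powr al"
 define p where "p = prof al nu (tau t x z)"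
 have I: "(LINT y:{0<..<R}|lborel. kernel_integrand al be t x z y) = c * triple_int al nu (x\<^sup>2) (z\<^sup>2) (t\<^sup>2) (R\<^sup>2 / 4)" if R: "R > 0" for R
 proof -
  have "(LINT y:{0<..<R}|lborel. kernel_integrand al be t x z y)
    = (LINT y:{0<..<R}|lborel. c * (y / 2 * triple al nu (x\<^sup>2) (z\<^sup>2) (t\<^sup>2) (y\<^sup>2 / 4)))"
   using kernel_integrand_triple[OF t x z] by (intro set_lebesgue_integral_cong) (auto simp: c_def nu_def)
  also have "\<dots> = c * (LINT y:{0<..<R}|lborel. y / 2 * triple al nu (x\<^sup>2) (z\<^sup>2) (t\<^sup>2) (y\<^sup>2 / 4))" by simp
  also have "(LINT y:{0<..<R}|lborel. y / 2 * triple al nu (x\<^sup>2) (z\<^sup>2) (t\<^sup>2) (y\<^sup>2 / 4)) = triple_int al nu (x\<^sup>2) (z\<^sup>2) (t\<^sup>2) (R\<^sup>2 / 4)"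
   unfolding triple_int_def using R set_integral_square_substitution(2)[of "1/4" R, OF set_integrable_triple[OF al] triple_measurable] by simp
  finally show ?thesis .
 qed
 have T: "t\<^sup>2 > 0" "t\<^sup>2 \<noteq> (x - z)\<^sup>2" "t\<^sup>2 \<noteq> (x + z)\<^sup>2"
  using t sing x z by (auto simp: power2_eq_iff abs_if split: if_splits)
 define L where "L = (x * z) powr (-al) * (2 * x * z) powr (nu - 1) * p"
 have "((\<lambda>rho. (t\<^sup>2) powr nu * triple_int al nu (x\<^sup>2) (z\<^sup>2) (t\<^sup>2) rho) \<longlongrightarrow> L) at_top"
  using triple_limit[OF al nu[folded nu_def] x z T] by (simp add: L_def p_def tau_def)
 hence "((\<lambda>rho. (c * t powr (- 2 * nu)) * ((t\<^sup>2) powr nu * triple_int al nu (x\<^sup>2) (z\<^sup>2) (t\<^sup>2) rho)) \<longlongrightarrow> (c * t powr (- 2 * nu)) * L) at_top"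
  by (intro tendsto_intros)
 moreover have "t powr (- 2 * nu) * (t\<^sup>2) powr nu = 1"
 proof -
  have "(t\<^sup>2) powr nu = t powr (2 * nu)" using t powr_powr[of t 2 nu] by (simp add: powr_numeral)
  thus ?thesis using t by (simp add: powr_add[symmetric])
 qed
 ultimately have lim: "((\<lambda>rho. c * triple_int al nu (x\<^sup>2) (z\<^sup>2) (t\<^sup>2) rho) \<longlongrightarrow> c * t powr (- 2 * nu) * L) at_top"
  by (simp add: mult.assoc) (simp add: mult.assoc[symmetric])
 have "filterlim (\<lambda>R::real. (1/4) * R\<^sup>2) at_top at_top"
  by (intro filterlim_tendsto_pos_mult_at_top[OF tendsto_const] filterlim_pow_at_top filterlim_ident) auto
 hence "filterlim (\<lambda>R::real. R\<^sup>2 / 4) at_top at_top" by simp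
 from filterlim_compose[OF lim this]
 have "((\<lambda>R. c * triple_int al nu (x\<^sup>2) (z\<^sup>2) (t\<^sup>2) (R\<^sup>2 / 4)) \<longlongrightarrow> c * t powr (- 2 * nu) * L) at_top" .
 moreover have "eventually (\<lambda>R. c * triple_int al nu (x\<^sup>2) (z\<^sup>2) (t\<^sup>2) (R\<^sup>2 / 4) = (LINT y:{0<..<R}|lborel. kernel_integrand al be t x z y)) at_top"
  using eventually_gt_at_top[of 0] by eventually_elim (simp add: I)
 ultimately have "((\<lambda>R. LINT y:{0<..<R}|lborel. kernel_integrand al be t x z y) \<longlongrightarrow> c * t powr (- 2 * nu) * L) at_top"
  by (rule Lim_transform_eventually)
 hence Lim: "Lim at_top (\<lambda>R. LINT y:{0<..<R}|lborel. kernel_integrand al be t x z y) = c * t powr (- 2 * nu) * L"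
  by (intro tendsto_Lim) auto
 have xz: "x * z > 0" using x z by simp
 have "kernel al be t x z = 2 powr nu * Gamma (nu + 1) / (t powr nu * (x * z) powr al) * (c * t powr (- 2 * nu) * L)"
  unfolding kernel_def Lim by (simp add: nu_def)
 also have "\<dots> = 2 powr nu * Gamma (nu + 1) * (t powr (- 2 * nu) * (2 powr (1 - nu) * L))"
  using t x z by (simp add: c_def)
 also have "2 powr (1 - nu) * L = (x * z) powr (be - 1) * p"
 proof -
  have "(2 * x * z) powr (nu - 1) = 2 powr (nu - 1) * (x * z) powr (nu - 1)"
   using xz powr_mult[of 2 "x * z" "nu - 1"] by (simp add: mult.assoc)
  moreover have "2 powr (1 - nu) * 2 powr (nu - 1) = (1::real)" by (simp add: powr_add[symmetric])
  moreover have "(x * z) powr (-al) * (x * z) powr (nu - 1) = (x * z) powr (be - 1)"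
   unfolding powr_add[symmetric] by (rule arg_cong[where f = "\<lambda>q. (x * z) powr q"]) (simp add: nu_def)
  ultimately show ?thesis unfolding L_def by (metis (no_types, opaque_lifting) mult.assoc mult.commute mult_1)
 qed
 finally show ?thesis by (simp add: nu_def p_def mult.assoc)
qed

section \<open>Maximal operators of dilation kernels\<close>

lemma enn_powr_ennreal [simp]: "a \<ge> 0 ==> enn_powr (ennreal a) s = ennreal (a powr s)"
 by (simp add: enn_powr_def)

lemma enn_powr_top [simp]: "enn_powr top s = top"
 by (simp add: enn_powr_def)

lemma enn_powr_0 [simp]: "enn_powr 0 s = 0"
 by (simp add: enn_powr_def)

lemma enn_powr_mono: "s > 0 ==> a \<le> b ==> enn_powr a s \<le> enn_powr b s"
 by (cases a; cases b) (auto simp: ennreal_le_iff top_unique intro!: ennreal_leI powr_mono2)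

lemma enn_powr_inverse: "s > 0 ==> enn_powr (enn_powr a s) (1 / s) = a"
 by (cases a) (auto simp: powr_powr)

lemma enn_powr_inverse': "s > 0 ==> enn_powr (enn_powr a (1 / s)) s = a"
 by (cases a) (auto simp: powr_powr)

lemma enn_powr_le_iff: "s > 0 ==> enn_powr a s \<le> b \<longleftrightarrow> a \<le> enn_powr b (1 / s)"
 by (metis enn_powr_inverse enn_powr_inverse' enn_powr_mono zero_less_divide_1_iff)

lemma enn_powr_add_le:
 assumes s: "s > 0"
 shows "enn_powr (a + b) s \<le> ennreal (2 powr s) * (enn_powr a s + enn_powr b s)"
proof -
 have "a + b \<le> 2 * max a b" by (simp add: mult_2 add_mono)
 hence "enn_powr (a + b) s \<le> enn_powr (2 * max a b) s" by (rule enn_powr_mono[OF s])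
 also have "\<dots> \<le> ennreal (2 powr s) * enn_powr (max a b) s"
 proof (cases "max a b")
  case (real m)
  have "(2::ennreal) * ennreal m = ennreal (2 * m)" using real by (simp add: ennreal_mult')
  hence "enn_powr (2 * ennreal m) s = enn_powr (ennreal (2 * m)) s" by (simp only:)
  also have "\<dots> = ennreal ((2 * m) powr s)" using real by (intro enn_powr_ennreal) simp
  also have "\<dots> = ennreal (2 powr s * m powr s)" using real by (simp add: powr_mult)
  also have "\<dots> = ennreal (2 powr s) * enn_powr (ennreal m) s" using real by (simp add: ennreal_mult)
  finally show ?thesis using real by simp
 qed (simp add: ennreal_mult_top)
 also have "enn_powr (max a b) s \<le> enn_powr a s + enn_powr b s" by (simp add: max_def)
 finally show ?thesis by (simp add: mult_left_mono)
qed

lemma enn_powr_measurable [measurable]: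
 assumes [measurable]: "f \<in> borel_measurable M"
 shows "(\<lambda>x. enn_powr (f x) s) \<in> borel_measurable M"
 unfolding enn_powr_def by measurable

lemma enn_powr_cmult: "c \<ge> 0 ==> s > 0 ==> enn_powr (ennreal c * a) s = ennreal (c powr s) * enn_powr a s"
 by (cases a; cases "c = 0") (auto simp: ennreal_mult[symmetric] powr_mult ennreal_mult_top)

lemma enn_powr_enn_powr: "enn_powr (enn_powr a s) t = enn_powr a (s * t)"
 by (cases a) (auto simp: powr_powr)

abbreviation pint :: "'a measure => ('a => real) => ennreal" where
 "pint M f \<equiv> \<integral>\<^sup>+u. ennreal (f u) \<partial>M"

text \<open>The product N F is split as (N w^(-1/p)) (w^(1/p) F). Young's inequality with a free
  scale l is integrated, and the optimal l gives Hoelder's inequality with both sides possibly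
  infinite.\<close>

lemma Holder_weight:
 fixes N w F :: "'a => real"
 assumes p: "p > 1" and r: "r > 1" and pr: "1/p + 1/r = 1"
  and [measurable]: "N \<in> borel_measurable M" "w \<in> borel_measurable M" "F \<in> borel_measurable M"
  and n0: "\<And>x. N x \<ge> 0" "\<And>x. w x \<ge> 0" "\<And>x. F x \<ge> 0" and z: "AE x in M. w x = 0 --> N x = 0"
  and C: "C > 0" and NC: "pint M (\<lambda>x. N x powr r * w x powr (1 - r)) \<le> ennreal C"
 shows "enn_powr (pint M (\<lambda>x. N x * F x)) p \<le> ennreal (C powr (p - 1)) * pint M (\<lambda>x. w x * F x powr p)"
proof (cases "pint M (\<lambda>x. w x * F x powr p)")
 case top
 thus ?thesis using C by (simp add: ennreal_mult_top)
next
 case (real B)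
 note B = real
 show ?thesis
 proof (cases "B = 0")
  case True
  hence "AE x in M. ennreal (w x * F x powr p) = 0" using B by (subst nn_integral_0_iff_AE[symmetric]) auto
  hence "AE x in M. w x * F x powr p = 0"
   by eventually_elim (metis ennreal_eq_0_iff antisym n0(2) powr_ge_zero mult_nonneg_nonneg)
  with z have "AE x in M. ennreal (N x * F x) = 0" by eventually_elim auto
  hence "pint M (\<lambda>x. N x * F x) = 0" by (subst nn_integral_0_iff_AE) auto
  thus ?thesis by simp
 next
  case False
  hence B0: "B > 0" using B by simp
  \<comment> \<open>The scale at which l^r C and l^(-p) B agree; their common value is B^(1/p)
    C^(1/r).\<close>
  define l where "l = (B / C) powr (1 / (p * r))"
  have l: "l > 0" using B0 C by (simp add: l_def)
  have lr: "l powr r = (B / C) powr (1 / p)" and lp: "l powr (-p) = (C / B) powr (1 / r)"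
   using p r B0 C by (simp_all add: l_def powr_powr powr_minus powr_divide)
  have Y: "N x * F x \<le> l powr r / r * (N x powr r * w x powr (1 - r)) + l powr (-p) / p * (w x * F x powr p)"
   if z: "w x = 0 --> N x = 0" for x
  proof (cases "w x = 0")
   case False
   hence w: "w x > 0" using n0(2)[of x] by simp
   have e: "-1/p * r = 1 - r" using pr p r by (simp add: field_simps)
   have "(l * N x * w x powr (-1/p)) * (w x powr (1/p) * F x / l)
     \<le> (l * N x * w x powr (-1/p)) powr r / r + (w x powr (1/p) * F x / l) powr p / p"
    using p r pr n0 l by (intro Youngs_inequality) auto
   moreover have "(l * N x * w x powr (-1/p)) powr r = l powr r * (N x powr r * w x powr (1 - r))"
    unfolding e[symmetric] using n0 l by (simp add: powr_mult powr_powr mult.assoc)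
   moreover have "(w x powr (1/p) * F x / l) powr p = l powr (-p) * (w x * F x powr p)"
    using n0 l p w by (simp add: powr_mult powr_divide powr_powr powr_minus_divide)
   moreover have "(l * N x * w x powr (-1/p)) * (w x powr (1/p) * F x / l) = N x * F x * (w x powr (-1/p) * w x powr (1/p))"
    using l by simp
   moreover have "w x powr (-1/p) * w x powr (1/p) = 1" using w by (simp add: powr_add[symmetric])
   ultimately show ?thesis by simp
  qed (use z p r in simp)
  have "pint M (\<lambda>x. N x * F x) \<le> (\<integral>\<^sup>+x. ennreal (l powr r / r) * ennreal (N x powr r * w x powr (1 - r))
    + ennreal (l powr (-p) / p) * ennreal (w x * F x powr p) \<partial>M)"
   by (rule nn_integral_mono_AE, use z in eventually_elim)
     (use Y p r n0 in \<open>simp add: ennreal_mult[symmetric] ennreal_plus[symmetric] ennreal_leI del: ennreal_plus\<close>)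
  also have "\<dots> = ennreal (l powr r / r) * pint M (\<lambda>x. N x powr r * w x powr (1 - r)) + ennreal (l powr (-p) / p) * ennreal B"
   using B by (simp add: nn_integral_add nn_integral_cmult)
  also have "\<dots> \<le> ennreal (l powr r / r) * ennreal C + ennreal (l powr (-p) / p) * ennreal B"
   by (intro add_mono mult_left_mono NC order_refl) auto
  also have "\<dots> = ennreal (l powr r / r * C + l powr (-p) / p * B)"
   using p r C B0 by (simp add: ennreal_mult[symmetric] ennreal_plus[symmetric] del: ennreal_plus)
  also have "l powr r / r * C + l powr (-p) / p * B = B powr (1/p) * C powr (1/r)"
  proof -
   have i: "1/r = 1 - 1/p" "1/p = 1 - 1/r" using pr by auto
   have "l powr r * C = B powr (1/p) * C powr (1/r)"
    unfolding lr using B0 C by (simp add: powr_divide i(1) powr_diff)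
   moreover have "l powr (-p) * B = B powr (1/p) * C powr (1/r)"
    unfolding lp using B0 C by (simp add: powr_divide i(2) powr_diff)
   moreover have "l powr r / r * C + l powr (-p) / p * B = (l powr r * C) * (1/r) + (l powr (-p) * B) * (1/p)" by simp
   ultimately have "l powr r / r * C + l powr (-p) / p * B = (B powr (1/p) * C powr (1/r)) * (1/p + 1/r)" by (simp add: algebra_simps)
   thus ?thesis using pr by simp
  qed
  finally have "enn_powr (pint M (\<lambda>x. N x * F x)) p \<le> enn_powr (ennreal (B powr (1/p) * C powr (1/r))) p"
   using p by (intro enn_powr_mono) auto
  also have "\<dots> = ennreal (B * C powr (p - 1))"
  proof -
   have "1 / r * p = p - 1" using pr p by (simp add: field_simps)
   thus ?thesis using B0 C p by (simp add: powr_mult powr_powr)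
  qed
  finally show ?thesis using B B0 by (simp add: ennreal_mult[symmetric] mult.commute)
 qed
qed

text \<open>The measure \<open>mu\<close> carried by the whole line, so that measurability is plain
  Borel measurability and dilations need no restriction; \<open>mu_eq\<close> recovers
  \<open>mu\<close>.\<close>

definition wm :: "real => real measure" where
 "wm al = density lborel (\<lambda>u. ennreal (indicator {0<..} u * u powr (2 * al + 1)))"

lemma sets_wm [simp, measurable_cong]: "sets (wm al) = sets borel"
 by (simp add: wm_def)

lemma space_wm [simp]: "space (wm al) = UNIV"
 by (simp add: wm_def)

interpretation wm: sigma_finite_measure "wm al" for al
 unfolding wm_def by (subst sigma_finite_measure.sigma_finite_iff_density_finite[OF sigma_finite_lborel]) auto

interpretation wm_pair: pair_sigma_finite "wm al" "wm al" for al
 by unfold_locales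

lemma AE_wm: "AE u in wm al. u > 0"
 unfolding wm_def by (subst AE_density) (auto simp: indicator_def)

lemma nn_integral_wm_mono: "(\<And>u. u > 0 ==> f u \<le> g u) ==> (\<integral>\<^sup>+u. f u \<partial>wm al) \<le> (\<integral>\<^sup>+u. g u \<partial>wm al)"
 by (rule nn_integral_mono_AE, use AE_wm in eventually_elim) auto

lemma nn_integral_wm_cong: "(\<And>u. u > 0 ==> f u = g u) ==> (\<integral>\<^sup>+u. f u \<partial>wm al) = (\<integral>\<^sup>+u. g u \<partial>wm al)"
 by (rule nn_integral_cong_AE, use AE_wm in eventually_elim) auto

lemma nn_integral_wm:
 "f \<in> borel_measurable borel ==> (\<integral>\<^sup>+u. f u \<partial>wm al) = (\<integral>\<^sup>+u. ennreal (indicator {0<..} u * u powr (2 * al + 1)) * f u \<partial>lborel)"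
 unfolding wm_def by (rule nn_integral_density) auto

lemma nn_integral_wm_dilation:
 assumes [measurable]: "f \<in> borel_measurable borel" and c: "c > 0"
 shows "(\<integral>\<^sup>+u. f (c * u) \<partial>wm al) = ennreal (c powr (-(2 * al + 2))) * (\<integral>\<^sup>+u. f u \<partial>wm al)"
proof -
 have c1: "c powr (-(2 * al + 2)) * (c * (c * u) powr (2 * al + 1)) = u powr (2 * al + 1)" if "u > 0" for u
 proof -
  have "c powr (-(2 * al + 2)) * (c powr 1 * c powr (2 * al + 1)) = 1" unfolding powr_add[symmetric] using c by simp
  thus ?thesis using c that by (simp add: powr_mult)
 qed
 have "ennreal (c powr (-(2 * al + 2))) * (\<integral>\<^sup>+u. f u \<partial>wm al)
   = ennreal (c powr (-(2 * al + 2))) * (ennreal c * (\<integral>\<^sup>+u. ennreal (indicator {0<..} (c * u) * (c * u) powr (2 * al + 1)) * f (c * u) \<partial>lborel))"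
  using nn_integral_real_affine[of "\<lambda>u. ennreal (indicator {0<..} u * u powr (2 * al + 1)) * f u" c 0] c by (simp add: nn_integral_wm)
 also have "\<dots> = (\<integral>\<^sup>+u. ennreal (c powr (-(2 * al + 2))) * (ennreal c * (ennreal (indicator {0<..} (c * u) * (c * u) powr (2 * al + 1)) * f (c * u))) \<partial>lborel)"
  by (simp add: nn_integral_cmult)
 also have "\<dots> = (\<integral>\<^sup>+u. ennreal (indicator {0<..} u * u powr (2 * al + 1)) * f (c * u) \<partial>lborel)"
 proof (intro nn_integral_cong)
  fix u
  show "ennreal (c powr (-(2 * al + 2))) * (ennreal c * (ennreal (indicator {0<..} (c * u) * (c * u) powr (2 * al + 1)) * f (c * u)))
    = ennreal (indicator {0<..} u * u powr (2 * al + 1)) * f (c * u)"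
   using c c1[of u] by (cases "u > 0") (simp_all add: mult.assoc[symmetric] ennreal_mult[symmetric] zero_less_mult_iff)
 qed
 finally show ?thesis by (simp add: nn_integral_wm)
qed

text \<open>The supremum is over rational \<open>t\<close> for the sake of measurability.\<close>
definition strong :: "real => real => (real => real => real) => bool" where
 "strong al p N \<longleftrightarrow> (\<exists>C\<ge>0. \<forall>F\<in>borel_measurable borel. (\<forall>y. 0 \<le> F y) -->
   (\<integral>\<^sup>+x. (SUP t\<in>\<rat> \<inter> {0<..}. enn_powr (pint (wm al) (\<lambda>u. N t u * F (x * u))) p) \<partial>wm al)
    \<le> ennreal C * pint (wm al) (\<lambda>x. F x powr p))"

lemma countable_pos_rat [simp]: "countable (\<rat> \<inter> {0<..} :: real set)"
 using countable_rat by blast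

lemma strong_mono_add:
 assumes "strong al p N1" "strong al p N2" and p: "p > 0" and K: "K \<ge> 0"
  and le: "\<And>t u. t > 0 ==> u > 0 ==> N t u \<le> K * (N1 t u + N2 t u)"
  and [measurable]: "\<And>t. N1 t \<in> borel_measurable borel" "\<And>t. N2 t \<in> borel_measurable borel"
  and n0: "\<And>t u. N1 t u \<ge> 0" "\<And>t u. N2 t u \<ge> 0"
 shows "strong al p N"
proof -
 define S where "S N F x = (SUP t\<in>\<rat> \<inter> {0<..}. enn_powr (pint (wm al) (\<lambda>u. N t u * F (x * u))) p)" for N :: "real => real => real" and F x
 obtain C1 C2 where C: "C1 \<ge> 0" "C2 \<ge> 0" and S12: "\<And>F. F \<in> borel_measurable borel ==> \<forall>y. 0 \<le> F y ==>
   (\<integral>\<^sup>+x. S N1 F x \<partial>wm al) \<le> ennreal C1 * pint (wm al) (\<lambda>x. F x powr p)"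
   "\<And>F. F \<in> borel_measurable borel ==> \<forall>y. 0 \<le> F y ==>
   (\<integral>\<^sup>+x. S N2 F x \<partial>wm al) \<le> ennreal C2 * pint (wm al) (\<lambda>x. F x powr p)"
  using assms(1,2) unfolding strong_def S_def by (elim exE conjE) (simp add: Ball_def)
 have "(\<integral>\<^sup>+x. S N F x \<partial>wm al) \<le> ennreal ((2 * K) powr p * (C1 + C2)) * pint (wm al) (\<lambda>x. F x powr p)"
  if [measurable]: "F \<in> borel_measurable borel" and F: "\<forall>y. 0 \<le> F y" for F
 proof -
  have [measurable]: "S N1 F \<in> borel_measurable borel" "S N2 F \<in> borel_measurable borel"
   unfolding S_def[abs_def] by (intro borel_measurable_SUP; simp)+
  have "S N F x \<le> ennreal ((2 * K) powr p) * (S N1 F x + S N2 F x)" for x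
   unfolding S_def[of N]
  proof (rule SUP_least)
   fix t :: real assume t: "t \<in> \<rat> \<inter> {0<..}"
   have "pint (wm al) (\<lambda>u. N t u * F (x * u)) \<le> (\<integral>\<^sup>+u. ennreal K * (ennreal (N1 t u * F (x * u)) + ennreal (N2 t u * F (x * u))) \<partial>wm al)"
   proof (rule nn_integral_wm_mono)
    fix u :: real assume "u > 0"
    hence "N t u * F (x * u) \<le> K * (N1 t u * F (x * u) + N2 t u * F (x * u))"
     using mult_right_mono[OF le[of t u], of "F (x * u)"] t F by (simp add: algebra_simps)
    thus "ennreal (N t u * F (x * u)) \<le> ennreal K * (ennreal (N1 t u * F (x * u)) + ennreal (N2 t u * F (x * u)))"
     using K n0 F by (simp add: ennreal_mult[symmetric] ennreal_plus[symmetric] ennreal_leI del: ennreal_plus)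
   qed
   also have "\<dots> = ennreal K * (pint (wm al) (\<lambda>u. N1 t u * F (x * u)) + pint (wm al) (\<lambda>u. N2 t u * F (x * u)))"
    by (simp add: nn_integral_cmult nn_integral_add)
   finally have "enn_powr (pint (wm al) (\<lambda>u. N t u * F (x * u))) p \<le> enn_powr (ennreal K * (pint (wm al) (\<lambda>u. N1 t u * F (x * u)) + pint (wm al) (\<lambda>u. N2 t u * F (x * u)))) p"
    by (rule enn_powr_mono[OF p])
   also have "\<dots> \<le> ennreal (K powr p) * (ennreal (2 powr p) * (S N1 F x + S N2 F x))"
    unfolding enn_powr_cmult[OF K p] S_def
    by (intro mult_left_mono order_trans[OF enn_powr_add_le[OF p]] add_mono SUP_upper t) auto
   finally show "enn_powr (pint (wm al) (\<lambda>u. N t u * F (x * u))) p \<le> ennreal ((2 * K) powr p) * (S N1 F x + S N2 F x)"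
    using K by (simp add: powr_mult ennreal_mult mult_ac)
  qed
  hence "(\<integral>\<^sup>+x. S N F x \<partial>wm al) \<le> (\<integral>\<^sup>+x. ennreal ((2 * K) powr p) * (S N1 F x + S N2 F x) \<partial>wm al)"
   by (intro nn_integral_mono)
  also have "\<dots> = ennreal ((2 * K) powr p) * ((\<integral>\<^sup>+x. S N1 F x \<partial>wm al) + (\<integral>\<^sup>+x. S N2 F x \<partial>wm al))"
   by (simp add: nn_integral_cmult nn_integral_add)
  also have "\<dots> \<le> ennreal ((2 * K) powr p) * (ennreal C1 * pint (wm al) (\<lambda>x. F x powr p) + ennreal C2 * pint (wm al) (\<lambda>x. F x powr p))"
   by (intro mult_left_mono add_mono S12 F) auto
  finally show ?thesis using C by (simp add: ennreal_mult distrib_right mult.assoc)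
 qed
 thus ?thesis unfolding strong_def S_def using C by (intro exI[of _ "(2 * K) powr p * (C1 + C2)"]) auto
qed

text \<open>Hoelder's inequality in u with the weight W dominates the p-th power of the means of F
  by the power p/q of the W-means of F^q. This trades the exponent p for p/q and the kernel N for
  any W whose dual moment against N is bounded in t.\<close>

lemma strong_power:
 assumes W: "strong al (p/q) W" and q: "q > 1" and s: "s > 1" and qs: "1/q + 1/s = 1" and p: "p > 0"
  and [measurable]: "\<And>t. N t \<in> borel_measurable borel" "\<And>t. W t \<in> borel_measurable borel"
  and n0: "\<And>t u. N t u \<ge> 0" "\<And>t u. W t u \<ge> 0" and z: "\<And>t u. t > 0 ==> u > 0 ==> W t u = 0 ==> N t u = 0"
  and D: "\<And>t. t > 0 ==> pint (wm al) (\<lambda>u. N t u powr s * W t u powr (1 - s)) \<le> ennreal D"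
 shows "strong al p N"
proof -
 obtain C where C: "C \<ge> 0" "\<And>F. F \<in> borel_measurable borel ==> \<forall>y. 0 \<le> F y ==>
   (\<integral>\<^sup>+x. (SUP t\<in>\<rat> \<inter> {0<..}. enn_powr (pint (wm al) (\<lambda>u. W t u * F (x * u))) (p/q)) \<partial>wm al)
    \<le> ennreal C * pint (wm al) (\<lambda>x. F x powr (p/q))"
  using W unfolding strong_def by (auto simp: Ball_def)
 define k where "k = ((\<bar>D\<bar> + 1) powr (q - 1)) powr (p/q)"
 have "(\<integral>\<^sup>+x. (SUP t\<in>\<rat> \<inter> {0<..}. enn_powr (pint (wm al) (\<lambda>u. N t u * F (x * u))) p) \<partial>wm al) \<le> ennreal (k * C) * pint (wm al) (\<lambda>x. F x powr p)"
  if [measurable]: "F \<in> borel_measurable borel" and F: "\<forall>y. 0 \<le> F y" for F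
 proof -
  let ?S = "\<lambda>x. SUP t\<in>\<rat> \<inter> {0<..}. enn_powr (pint (wm al) (\<lambda>u. W t u * F (x * u) powr q)) (p/q)"
  have [measurable]: "?S \<in> borel_measurable borel" by (intro borel_measurable_SUP; simp)
  have "(\<integral>\<^sup>+x. (SUP t\<in>\<rat> \<inter> {0<..}. enn_powr (pint (wm al) (\<lambda>u. N t u * F (x * u))) p) \<partial>wm al) \<le> (\<integral>\<^sup>+x. ennreal k * ?S x \<partial>wm al)"
  proof (intro nn_integral_mono SUP_least)
   fix x t :: real assume t: "t \<in> \<rat> \<inter> {0<..}"
   have "enn_powr (pint (wm al) (\<lambda>u. N t u * F (x * u))) p = enn_powr (enn_powr (pint (wm al) (\<lambda>u. N t u * F (x * u))) q) (p/q)"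
    using q by (simp add: enn_powr_enn_powr)
   also have "\<dots> \<le> enn_powr (ennreal ((\<bar>D\<bar> + 1) powr (q - 1)) * pint (wm al) (\<lambda>u. W t u * F (x * u) powr q)) (p/q)"
   proof (intro enn_powr_mono Holder_weight[OF q s qs])
    show "pint (wm al) (\<lambda>u. N t u powr s * W t u powr (1 - s)) \<le> ennreal (\<bar>D\<bar> + 1)"
     using order_trans[OF D[of t] ennreal_leI[of D "\<bar>D\<bar> + 1"]] t by auto
    show "AE u in wm al. W t u = 0 --> N t u = 0" using AE_wm by eventually_elim (use z t in auto)
   qed (use n0 F p q in auto)
   also have "\<dots> = ennreal k * enn_powr (pint (wm al) (\<lambda>u. W t u * F (x * u) powr q)) (p/q)"
    using p q by (simp add: enn_powr_cmult k_def)
   also have "\<dots> \<le> ennreal k * ?S x" by (intro mult_left_mono SUP_upper t) auto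
   finally show "enn_powr (pint (wm al) (\<lambda>u. N t u * F (x * u))) p \<le> ennreal k * ?S x" .
  qed
  also have "\<dots> = ennreal k * (\<integral>\<^sup>+x. ?S x \<partial>wm al)" by (simp add: nn_integral_cmult)
  also have "\<dots> \<le> ennreal k * (ennreal C * pint (wm al) (\<lambda>x. (F x powr q) powr (p/q)))"
   by (intro mult_left_mono C(2)) auto
  finally show ?thesis using q C by (simp add: powr_powr k_def ennreal_mult mult.assoc)
 qed
 thus ?thesis unfolding strong_def using C by (intro exI[of _ "k * C"]) (auto simp: k_def)
qed

text \<open>A kernel independent of t needs no maximal theorem: by Fubini each dilation F (x u) has
  the L^1 norm u^(-(2 al + 2)) times that of F.\<close>

lemma strong_dilation:
 assumes [measurable]: "w \<in> borel_measurable borel" and w: "\<And>u. w u \<ge> 0"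
  and D: "D \<ge> 0" "pint (wm al) (\<lambda>u. w u * u powr (-(2*al+2))) \<le> ennreal D"
 shows "strong al 1 (\<lambda>t. w)"
 unfolding strong_def
proof (intro exI[of _ D] conjI ballI impI D)
 fix F :: "real => real" assume [measurable]: "F \<in> borel_measurable borel" and F: "\<forall>y. 0 \<le> F y"
 have one: "enn_powr a 1 = a" for a by (cases a) auto
 have "(\<integral>\<^sup>+x. (SUP t\<in>\<rat> \<inter> {0<..}. enn_powr (pint (wm al) (\<lambda>u. w u * F (x * u))) 1) \<partial>wm al) \<le> (\<integral>\<^sup>+x. pint (wm al) (\<lambda>u. w u * F (x * u)) \<partial>wm al)"
  by (intro nn_integral_mono SUP_least) (simp add: one)
 also have "\<dots> = (\<integral>\<^sup>+u. pint (wm al) (\<lambda>x. w u * F (x * u)) \<partial>wm al)" by (rule wm_pair.Fubini') measurable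
 also have "\<dots> = (\<integral>\<^sup>+u. ennreal (w u * u powr (-(2*al+2))) * pint (wm al) F \<partial>wm al)"
 proof (rule nn_integral_wm_cong)
  fix u :: real assume "u > 0"
  thus "pint (wm al) (\<lambda>x. w u * F (x * u)) = ennreal (w u * u powr (-(2*al+2))) * pint (wm al) F"
   using nn_integral_wm_dilation[of "\<lambda>y. ennreal (F y)" u al] w F by (simp add: ennreal_mult nn_integral_cmult mult_ac)
 qed
 also have "\<dots> = pint (wm al) (\<lambda>u. w u * u powr (-(2*al+2))) * pint (wm al) F" by (rule nn_integral_multc) measurable
 also have "\<dots> \<le> ennreal D * pint (wm al) (\<lambda>x. F x powr 1)" using D F by (simp add: mult_right_mono)
 finally show "(\<integral>\<^sup>+x. (SUP t\<in>\<rat> \<inter> {0<..}. enn_powr (pint (wm al) (\<lambda>u. w u * F (x * u))) 1) \<partial>wm al) \<le> ennreal D * pint (wm al) (\<lambda>x. F x powr 1)" .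
qed

section \<open>Weak type bounds, interpolation and two maximal theorems\<close>

lemma nn_integral_powr_0:
 assumes e: "e > -1" and L: "L \<ge> (0::real)"
 shows "(\<integral>\<^sup>+y. ennreal (indicator {0<..<L} y * y powr e) \<partial>lborel) = ennreal (L powr (e + 1) / (e + 1))"
proof -
 have i: "set_integrable lborel {0<..<L} (\<lambda>y. y powr e)" by (rule set_integrable_powr[OF e])
 have "(LINT y:{0<..<L}|lborel. y powr e) = integral {0<..<L} (\<lambda>y. y powr e)"
  by (rule set_borel_integral_eq_integral(2)[OF i])
 also have "\<dots> = integral {0..L} (\<lambda>y. y powr e)" by (rule integral_open_interval_real[symmetric])
 also have "\<dots> = L powr (e + 1) / (e + 1)"
  using has_integral_powr_from_0[OF e L] by (simp add: integral_unique)
 finally have "(\<integral>y. indicator {0<..<L} y * y powr e \<partial>lborel) = L powr (e + 1) / (e + 1)"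
  by (simp add: set_lebesgue_integral_def)
 thus ?thesis using i unfolding set_integrable_def
  by (subst nn_integral_eq_integral) auto
qed

lemma nn_integral_powr_inf:
 assumes e: "e < -1" and a: "a > (0::real)"
 shows "(\<integral>\<^sup>+y. ennreal (indicator {a<..} y * y powr e) \<partial>lborel) = ennreal (- (a powr (e + 1)) / (e + 1))"
proof -
 have h: "((\<lambda>y. y powr e) has_integral (-(a powr (e + 1)) / (e + 1))) {a..}"
  using has_integral_powr_to_inf[of e a] e a by simp
 have "(\<integral>\<^sup>+y. ennreal (indicator {a..} y * y powr e) \<partial>lborel) = ennreal (-(a powr (e + 1)) / (e + 1))"
  using nn_integral_has_integral_lebesgue[OF _ h] by simp
 moreover have "AE y in lborel. ennreal (indicator {a..} y * y powr e) = ennreal (indicator {a<..} y * y powr e)"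
  using AE_lborel_neq[of a] by eventually_elim (auto simp: indicator_def)
 ultimately show ?thesis by (simp cong: nn_integral_cong_AE)
qed

text \<open>The factor k anticipates that the level set of the maximal function at k l, not at l, is
  the one controlled in \<open>marcinkiewicz\<close>.\<close>

lemma layer_cake_powr:
 assumes r: "r > 0" and k: "k > 0"
 shows "(\<integral>\<^sup>+l. ennreal (indicator {0<..} l * (r * k powr r * l powr (r - 1))) * (if ennreal (k * l) < a then 1 else 0) \<partial>lborel) = enn_powr a r"
proof -
 have fin: "(\<integral>\<^sup>+l. ennreal (indicator {0<..<L / k} l * (r * k powr r * l powr (r - 1))) \<partial>lborel) = ennreal (L powr r)" if L: "L \<ge> 0" for L
 proof -
  have "(\<integral>\<^sup>+l. ennreal (indicator {0<..<L / k} l * (r * k powr r * l powr (r - 1))) \<partial>lborel)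
    = (\<integral>\<^sup>+l. ennreal (r * k powr r) * ennreal (indicator {0<..<L / k} l * l powr (r - 1)) \<partial>lborel)"
   using r by (intro nn_integral_cong) (simp add: ennreal_mult[symmetric] mult_ac)
  also have "\<dots> = ennreal (r * k powr r) * ennreal ((L/k) powr (r - 1 + 1) / (r - 1 + 1))"
   using r k L by (subst nn_integral_cmult) (auto simp: nn_integral_powr_0)
  also have "\<dots> = ennreal (L powr r)" using r k L by (simp add: ennreal_mult[symmetric] powr_divide)
  finally show ?thesis .
 qed
 show ?thesis
 proof (cases a)
  case (real L)
  have "ennreal (indicator {0<..} l * (r * k powr r * l powr (r - 1))) * (if ennreal (k * l) < a then 1 else 0)
    = ennreal (indicator {0<..<L / k} l * (r * k powr r * l powr (r - 1)))" for l
   using real k by (auto simp: indicator_def ennreal_less_iff pos_less_divide_eq mult.commute)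
  thus ?thesis using fin[of L] real by simp
 next
  case top
  have "(\<integral>\<^sup>+l. ennreal (indicator {0<..} l * (r * k powr r * l powr (r - 1))) \<partial>lborel) = top"
  proof (rule ccontr)
   assume "(\<integral>\<^sup>+l. ennreal (indicator {0<..} l * (r * k powr r * l powr (r - 1))) \<partial>lborel) \<noteq> top"
   then obtain b where b: "b \<ge> 0" "(\<integral>\<^sup>+l. ennreal (indicator {0<..} l * (r * k powr r * l powr (r - 1))) \<partial>lborel) = ennreal b"
    by (cases "(\<integral>\<^sup>+l. ennreal (indicator {0<..} l * (r * k powr r * l powr (r - 1))) \<partial>lborel)") auto
   define L where "L = (b + 1) powr (1 / r)"
   have "L powr r = b + 1" using b r by (simp add: L_def powr_powr)
   hence "ennreal (b + 1) = (\<integral>\<^sup>+l. ennreal (indicator {0<..<L / k} l * (r * k powr r * l powr (r - 1))) \<partial>lborel)"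
    using fin[of L] by (simp add: L_def)
   also have "\<dots> \<le> ennreal b" unfolding b(2)[symmetric]
    using r by (intro nn_integral_mono ennreal_leI) (auto simp: indicator_def)
   finally show False using b by simp
  qed
  thus ?thesis using top by (simp add: ennreal_less_top)
 qed
qed

interpretation lborel_wm: pair_sigma_finite lborel "wm al" for al
 by unfold_locales

text \<open>For al = -1/2 the density is 1, so \<open>wm (-1/2)\<close> is Lebesgue measure on the
  half-line, where the maximal theorems are proved.\<close>

lemma nn_integral_wm_change:
 assumes [measurable]: "f \<in> borel_measurable borel"
 shows "(\<integral>\<^sup>+u. f u \<partial>wm al) = (\<integral>\<^sup>+u. ennreal (u powr (2 * al + 1)) * f u \<partial>wm (-1/2))"
 by (simp add: nn_integral_wm) (auto intro!: nn_integral_cong simp: indicator_def)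

text \<open>A uniform bound on the masses of the kernels and a weak type \<open>(1, 1)\<close> bound give the strong type bounds:
 the part of \<open>F\<close> below the level \<open>l\<close> contributes at most \<open>A * l\<close> to the maximal function.\<close>
lemma marcinkiewicz:
 assumes [measurable]: "\<And>t. w t \<in> borel_measurable borel" and w0: "\<And>t u. w t u \<ge> 0" and r: "r > 1"
  and A: "A \<ge> 0" "\<And>t. t > 0 ==> pint (wm al) (w t) \<le> ennreal A" and B: "B \<ge> 0"
  and weak: "\<And>H l. H \<in> borel_measurable borel ==> (\<And>y. 0 \<le> H y) ==> l > 0 ==>
   emeasure (wm al) {x. ennreal l < (SUP t\<in>\<rat> \<inter> {0<..}. pint (wm al) (\<lambda>u. w t u * H (x * u)))} \<le> ennreal (B / l) * pint (wm al) H"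
 shows "strong al r w"
proof -
 \<comment> \<open>The part of F below l contributes at most A l, so where the maximal function of F
   exceeds (A + 1) l, that of the upper part exceeds l.\<close>
 define k where "k = A + 1"
 have k: "k > 0" using A by (simp add: k_def)
 define T where "T F x = (SUP t\<in>\<rat> \<inter> {0<..}. pint (wm al) (\<lambda>u. w t u * F (x * u)))" for F :: "real => real" and x
 have T_meas [measurable]: "T F \<in> borel_measurable borel" if [measurable]: "F \<in> borel_measurable borel" for F
  unfolding T_def[abs_def] by (intro borel_measurable_SUP; simp)
 define c where "c e l = indicator {0<..} l * (r * k powr r * l powr e)" for e l :: real
 have [measurable]: "c e \<in> borel_measurable borel" for e unfolding c_def[abs_def] by measurable
 have c0: "c e l \<ge> 0" for e l using r by (simp add: c_def)
 have "(\<integral>\<^sup>+x. (SUP t\<in>\<rat> \<inter> {0<..}. enn_powr (pint (wm al) (\<lambda>u. w t u * F (x * u))) r) \<partial>wm al) \<le> ennreal (B * r * k powr r / (r - 1)) * pint (wm al) (\<lambda>x. F x powr r)"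
  if [measurable]: "F \<in> borel_measurable borel" and F: "\<forall>y. 0 \<le> F y" for F
 proof -
  define H where "H l y = (if F y > l then F y else 0)" for l y
  have [measurable]: "case_prod H \<in> borel_measurable (borel \<Otimes>\<^sub>M borel)" "H l \<in> borel_measurable borel" for l
   unfolding H_def[abs_def] by measurable
  have H0: "H l y \<ge> 0" for l y using F by (simp add: H_def)
  have le: "T F x \<le> ennreal (A * l) + T (H l) x" if l: "l > 0" for x l
   unfolding T_def[of F]
  proof (rule SUP_least)
   fix t :: real assume t: "t \<in> \<rat> \<inter> {0<..}"
   have "pint (wm al) (\<lambda>u. w t u * F (x * u)) \<le> (\<integral>\<^sup>+u. ennreal l * ennreal (w t u) + ennreal (w t u * H l (x * u)) \<partial>wm al)"
   proof (intro nn_integral_mono)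
    fix u
    have "w t u * F (x * u) \<le> w t u * (l + H l (x * u))" using l w0 by (intro mult_left_mono) (auto simp: H_def)
    thus "ennreal (w t u * F (x * u)) \<le> ennreal l * ennreal (w t u) + ennreal (w t u * H l (x * u))"
     using l w0 H0 by (simp add: ennreal_mult[symmetric] ennreal_plus[symmetric] ennreal_leI algebra_simps del: ennreal_plus)
   qed
   also have "\<dots> = ennreal l * pint (wm al) (w t) + pint (wm al) (\<lambda>u. w t u * H l (x * u))"
    by (simp add: nn_integral_add nn_integral_cmult)
   also have "\<dots> \<le> ennreal l * ennreal A + T (H l) x"
    unfolding T_def using t by (intro add_mono mult_left_mono A SUP_upper) auto
   finally show "pint (wm al) (\<lambda>u. w t u * F (x * u)) \<le> ennreal (A * l) + T (H l) x"
    using l A by (simp add: ennreal_mult[symmetric] mult.commute)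
  qed
  have wk: "emeasure (wm al) {x. ennreal (k * l) < T F x} \<le> ennreal (B / l) * pint (wm al) (H l)" if l: "l > 0" for l
  proof -
   have "{x. ennreal (k * l) < T F x} \<subseteq> {x. ennreal l < T (H l) x}"
   proof safe
    fix x assume "ennreal (k * l) < T F x"
    hence "ennreal (A * l) + ennreal l < ennreal (A * l) + T (H l) x"
     using le[OF l, of x] l A by (simp add: ennreal_plus[symmetric] k_def distrib_right del: ennreal_plus)
    thus "ennreal l < T (H l) x" by (meson add_left_mono not_le)
   qed
   hence "emeasure (wm al) {x. ennreal (k * l) < T F x} \<le> emeasure (wm al) {x. ennreal l < T (H l) x}"
    by (intro emeasure_mono) auto
   also have "\<dots> \<le> ennreal (B / l) * pint (wm al) (H l)" unfolding T_def using H0 l by (intro weak) auto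
   finally show ?thesis .
  qed
  have "(\<integral>\<^sup>+x. (SUP t\<in>\<rat> \<inter> {0<..}. enn_powr (pint (wm al) (\<lambda>u. w t u * F (x * u))) r) \<partial>wm al) \<le> (\<integral>\<^sup>+x. enn_powr (T F x) r \<partial>wm al)"
   using r unfolding T_def by (intro nn_integral_mono SUP_least enn_powr_mono SUP_upper) auto
  also have "\<dots> = (\<integral>\<^sup>+x. (\<integral>\<^sup>+l. ennreal (c (r - 1) l) * (if ennreal (k * l) < T F x then 1 else 0) \<partial>lborel) \<partial>wm al)"
   using r k by (simp add: layer_cake_powr c_def)
  also have "\<dots> = (\<integral>\<^sup>+l. (\<integral>\<^sup>+x. ennreal (c (r - 1) l) * (if ennreal (k * l) < T F x then 1 else 0) \<partial>wm al) \<partial>lborel)"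
   by (rule lborel_wm.Fubini') measurable
  also have "\<dots> \<le> (\<integral>\<^sup>+l. (\<integral>\<^sup>+y. ennreal (B * c (r - 2) l) * ennreal (H l y) \<partial>wm al) \<partial>lborel)"
  proof (rule nn_integral_mono)
   fix l
   have "(\<integral>\<^sup>+x. ennreal (c (r - 1) l) * (if ennreal (k * l) < T F x then 1 else 0) \<partial>wm al)
     = (\<integral>\<^sup>+x. ennreal (c (r - 1) l) * indicator {x. ennreal (k * l) < T F x} x \<partial>wm al)"
    by (intro nn_integral_cong) (auto simp: indicator_def)
   also have "\<dots> = ennreal (c (r - 1) l) * emeasure (wm al) {x. ennreal (k * l) < T F x}"
    by (simp add: nn_integral_cmult_indicator)
   also have "\<dots> \<le> ennreal (B * c (r - 2) l) * pint (wm al) (H l)"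
   proof (cases "l > 0")
    case True
    have "c (r - 1) l * (B / l) = B * c (r - 2) l" using True powr_add[of l "r - 2" 1] by (simp add: c_def)
    thus ?thesis using mult_left_mono[OF wk[OF True], of "ennreal (c (r - 1) l)"] B True c0[of "r - 1" l]
     by (simp add: mult.assoc[symmetric] ennreal_mult[symmetric])
   qed (simp add: c_def)
   finally show "(\<integral>\<^sup>+x. ennreal (c (r - 1) l) * (if ennreal (k * l) < T F x then 1 else 0) \<partial>wm al)
     \<le> (\<integral>\<^sup>+y. ennreal (B * c (r - 2) l) * ennreal (H l y) \<partial>wm al)" by (simp add: nn_integral_cmult)
  qed
  also have "\<dots> = (\<integral>\<^sup>+y. (\<integral>\<^sup>+l. ennreal (B * c (r - 2) l) * ennreal (H l y) \<partial>lborel) \<partial>wm al)"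
   by (rule lborel_wm.Fubini'[symmetric]) measurable
  also have "\<dots> = (\<integral>\<^sup>+y. ennreal (B * r * k powr r / (r - 1)) * ennreal (F y powr r) \<partial>wm al)"
  proof (intro nn_integral_cong)
   fix y
   have "(\<integral>\<^sup>+l. ennreal (B * c (r - 2) l) * ennreal (H l y) \<partial>lborel)
     = (\<integral>\<^sup>+l. ennreal (B * r * k powr r * F y) * ennreal (indicator {0<..<F y} l * l powr (r - 2)) \<partial>lborel)"
    using B r F by (intro nn_integral_cong) (auto simp: ennreal_mult[symmetric] indicator_def mult_ac c_def H_def)
   also have "\<dots> = ennreal (B * r * k powr r * F y) * ennreal (F y powr (r - 2 + 1) / (r - 2 + 1))"
    using r F by (subst nn_integral_cmult) (auto simp: nn_integral_powr_0)
   also have "\<dots> = ennreal (B * r * k powr r / (r - 1)) * ennreal (F y powr r)"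
   proof -
    have "F y * F y powr (r - 1) = F y powr r"
     using F powr_add[of "F y" 1 "r - 1"] by (cases "F y = 0") (auto simp: less_le)
    hence "B * r * k powr r * F y * (F y powr (r - 1) / (r - 1)) = B * r * k powr r / (r - 1) * F y powr r"
     by (simp add: mult.assoc)
    thus ?thesis using B r F by (simp add: ennreal_mult[symmetric])
   qed
   finally show "(\<integral>\<^sup>+l. ennreal (B * c (r - 2) l) * ennreal (H l y) \<partial>lborel) = ennreal (B * r * k powr r / (r - 1)) * ennreal (F y powr r)" .
  qed
  finally show ?thesis by (simp add: nn_integral_cmult)
 qed
 thus ?thesis unfolding strong_def using B r by (intro exI[of _ "B * r * k powr r / (r - 1)"]) auto
qed

text \<open>The bound on the half-line is applied to G y = y^ka F y with ka = (2 al + 1) / s, for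
  which G^s dy is F^s times the density of \<open>wm al\<close>. The power of u is the quotient of G
  by F at x u together with the change of measure.\<close>

lemma strong_transfer:
 assumes w: "strong (-1/2) s w" and s: "s > 0"
  and [measurable]: "\<And>t. w t \<in> borel_measurable borel" and w0: "\<And>t u. w t u \<ge> 0"
 shows "strong al s (\<lambda>t u. w t u * u powr ((2*al+1)/s - (2*al+1)))"
proof -
 define ka where "ka = (2*al+1)/s"
 have ka: "ka * s = 2*al+1" using s by (simp add: ka_def)
 obtain C where C: "C \<ge> 0" "\<And>F. F \<in> borel_measurable borel ==> \<forall>y. 0 \<le> F y ==>
   (\<integral>\<^sup>+x. (SUP t\<in>\<rat> \<inter> {0<..}. enn_powr (pint (wm (-1/2)) (\<lambda>u. w t u * F (x * u))) s) \<partial>wm (-1/2))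
    \<le> ennreal C * pint (wm (-1/2)) (\<lambda>x. F x powr s)"
  using w unfolding strong_def by (auto simp: Ball_def)
 show ?thesis unfolding strong_def ka_def[symmetric]
 proof (intro exI[of _ C] conjI ballI impI C(1))
  fix F :: "real => real" assume [measurable]: "F \<in> borel_measurable borel" and F: "\<forall>y. 0 \<le> F y"
  define G where "G y = y powr ka * F y" for y
  have [measurable]: "G \<in> borel_measurable borel" unfolding G_def[abs_def] by measurable
  define S where "S x = (SUP t\<in>\<rat> \<inter> {0<..}. enn_powr (pint (wm (-1/2)) (\<lambda>u. w t u * G (x * u))) s)" for x
  have [measurable]: "S \<in> borel_measurable borel" unfolding S_def[abs_def] by (intro borel_measurable_SUP; simp)
  have "(\<integral>\<^sup>+x. (SUP t\<in>\<rat> \<inter> {0<..}. enn_powr (pint (wm al) (\<lambda>u. w t u * u powr (ka - (2*al+1)) * F (x * u))) s) \<partial>wm al)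
    \<le> (\<integral>\<^sup>+x. ennreal (x powr (-(2*al+1))) * S x \<partial>wm al)"
  proof (intro nn_integral_wm_mono SUP_least)
   fix x t :: real assume x: "x > 0" and t: "t \<in> \<rat> \<inter> {0<..}"
   have "pint (wm al) (\<lambda>u. w t u * u powr (ka - (2*al+1)) * F (x * u)) = (\<integral>\<^sup>+u. ennreal (x powr (-ka)) * ennreal (w t u * G (x * u)) \<partial>wm (-1/2))"
   proof (subst nn_integral_wm_change, measurable, intro nn_integral_wm_cong)
    fix u :: real assume u: "u > 0"
    have "u powr (2*al+1) * u powr (ka - (2*al+1)) = x powr (-ka) * (x * u) powr ka"
     using x u by (simp add: powr_add[symmetric] powr_mult mult.assoc[symmetric])
    thus "ennreal (u powr (2*al+1)) * ennreal (w t u * u powr (ka - (2*al+1)) * F (x * u)) = ennreal (x powr (-ka)) * ennreal (w t u * G (x * u))"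
     by (simp add: ennreal_mult'[symmetric] G_def mult_ac)
   qed
   also have "\<dots> = ennreal (x powr (-ka)) * pint (wm (-1/2)) (\<lambda>u. w t u * G (x * u))" by (simp add: nn_integral_cmult)
   also have "enn_powr \<dots> s = ennreal (x powr (-(2*al+1))) * enn_powr (pint (wm (-1/2)) (\<lambda>u. w t u * G (x * u))) s"
    using s ka by (simp add: enn_powr_cmult powr_powr)
   also have "\<dots> \<le> ennreal (x powr (-(2*al+1))) * S x" unfolding S_def by (intro mult_left_mono SUP_upper t) auto
   finally show "enn_powr (pint (wm al) (\<lambda>u. w t u * u powr (ka - (2*al+1)) * F (x * u))) s \<le> ennreal (x powr (-(2*al+1))) * S x" .
  qed
  also have "\<dots> = (\<integral>\<^sup>+x. S x \<partial>wm (-1/2))"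
  proof (subst nn_integral_wm_change, measurable, intro nn_integral_wm_cong)
   fix x :: real assume "x > 0"
   hence "x powr (2*al+1) * x powr (-(2*al+1)) = 1" by (simp add: powr_add[symmetric])
   thus "ennreal (x powr (2*al+1)) * (ennreal (x powr (-(2*al+1))) * S x) = S x"
    by (simp only: mult.assoc[symmetric] ennreal_mult'[symmetric] powr_ge_zero) simp
  qed
  also have "\<dots> \<le> ennreal C * pint (wm (-1/2)) (\<lambda>x. G x powr s)" unfolding S_def using F by (intro C(2)) (auto simp: G_def)
  also have "pint (wm (-1/2)) (\<lambda>x. G x powr s) = pint (wm al) (\<lambda>x. F x powr s)"
   using F by (subst nn_integral_wm_change[of _ al]) (auto intro!: nn_integral_cong simp: G_def powr_mult powr_powr ka ennreal_mult')
  finally show "(\<integral>\<^sup>+x. (SUP t\<in>\<rat> \<inter> {0<..}. enn_powr (pint (wm al) (\<lambda>u. w t u * u powr (ka - (2*al+1)) * F (x * u))) s) \<partial>wm al)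
   \<le> ennreal C * pint (wm al) (\<lambda>x. F x powr s)" .
 qed
qed

lemma emeasure_wm_half: "A \<in> sets borel ==> emeasure (wm (-1/2)) A = emeasure lborel (A \<inter> {0<..})"
 unfolding wm_def by (subst emeasure_density) (auto simp: indicator_def nn_integral_indicator[symmetric] simp del: nn_integral_indicator intro!: nn_integral_cong)

text \<open>Since w \<le> 1, all means at x are at most the integral of H (x u), which is the L^1
  norm of H divided by x. A multiple of 1 / x is in weak L^1, and this holds for all t at once,
  without any covering argument.\<close>

lemma strong_unit_scale:
 assumes [measurable]: "\<And>t. w t \<in> borel_measurable borel" and w: "\<And>t u. 0 \<le> w t u" "\<And>t u. w t u \<le> 1"
  and A: "A \<ge> 0" "\<And>t. t > 0 ==> pint (wm (-1/2)) (w t) \<le> ennreal A" and r: "r > 1"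
 shows "strong (-1/2) r w"
proof (rule marcinkiewicz[where B = 1])
 fix H :: "real => real" and l :: real assume [measurable]: "H \<in> borel_measurable borel" and H: "\<And>y. 0 \<le> H y" and l: "l > 0"
 define E where "E = {x. ennreal l < (SUP t\<in>\<rat> \<inter> {0<..}. pint (wm (-1/2)) (\<lambda>u. w t u * H (x * u)))}"
 define I where "I = pint (wm (-1/2)) H"
 have "(\<lambda>x. SUP t\<in>\<rat> \<inter> {0<..}. pint (wm (-1/2)) (\<lambda>u. w t u * H (x * u))) \<in> borel_measurable borel"
  by (intro borel_measurable_SUP; simp)
 hence E: "E \<in> sets borel" unfolding E_def by measurable
 have "emeasure (wm (-1/2)) E \<le> ennreal (1 / l) * I"
 proof (cases I)
  case top
  thus ?thesis using l by (simp add: ennreal_mult_top)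
 next
  case (real b)
  have "E \<inter> {0<..} \<subseteq> {0..b / l}"
  proof
   fix x assume x: "x \<in> E \<inter> {0<..}"
   hence "ennreal l < (SUP t\<in>\<rat> \<inter> {0<..}. pint (wm (-1/2)) (\<lambda>u. w t u * H (x * u)))" by (simp add: E_def)
   also have "\<dots> \<le> pint (wm (-1/2)) (\<lambda>u. H (x * u))"
    using w H by (intro SUP_least nn_integral_mono ennreal_leI) (auto intro: mult_left_le_one_le)
   also have "\<dots> = ennreal (b / x)"
    using nn_integral_wm_dilation[of "\<lambda>y. ennreal (H y)" x "-1/2"] x real I_def
    by (simp add: ennreal_mult[symmetric] powr_minus_divide)
   finally show "x \<in> {0..b / l}" using x l real by (simp add: ennreal_less_iff field_simps)
  qed
  hence "emeasure (wm (-1/2)) E \<le> emeasure lborel {0..b / l}"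
   unfolding emeasure_wm_half[OF E] by (intro emeasure_mono) auto
  also have "\<dots> = ennreal (1 / l) * I" using real l by (simp add: ennreal_mult[symmetric])
  finally show ?thesis .
 qed
 thus "emeasure (wm (-1/2)) {x. ennreal l < (SUP t\<in>\<rat> \<inter> {0<..}. pint (wm (-1/2)) (\<lambda>u. w t u * H (x * u)))} \<le> ennreal (1 / l) * pint (wm (-1/2)) H"
  by (simp add: E_def I_def)
qed (use assms in auto)

text \<open>In y = x u the mean is an average of H over |x - y| < t x, so this is the centred
  maximal function. By the Vitali covering lemma the level set is covered by disjoint intervals
  enlarged five times; an interval of radius 5 r has length 10 r, hence B = 10.\<close>

lemma strong_hardy_littlewood:
 assumes r: "r > 1"
 shows "strong (-1/2) r (\<lambda>t u. if \<bar>1 - u\<bar> < t then 1 / t else 0)"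
  (is "strong _ _ ?w")
proof -
 have w0: "0 \<le> ?w t u" for t u :: real by auto
 show ?thesis
 proof (rule marcinkiewicz[where A = 2 and B = 10, OF _ w0 r])
  fix t :: real assume t: "t > 0"
  have "pint (wm (-1/2)) (?w t) \<le> (\<integral>\<^sup>+u. ennreal (1 / t) * indicator {1-t..1+t} u \<partial>lborel)"
   by (subst nn_integral_wm) (auto intro!: nn_integral_mono simp: indicator_def)
  also have "\<dots> = ennreal 2" using t by (subst nn_integral_cmult_indicator) (auto simp: ennreal_mult[symmetric])
  finally show "pint (wm (-1/2)) (?w t) \<le> ennreal 2" .
 next
  fix H :: "real => real" and l :: real assume [measurable]: "H \<in> borel_measurable borel" and H: "\<And>y. 0 \<le> H y" and l: "l > 0"
  define S where "S x = (SUP t\<in>\<rat> \<inter> {0<..}. pint (wm (-1/2)) (\<lambda>u. ?w t u * H (x * u)))" for x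
  have [measurable]: "S \<in> borel_measurable borel" unfolding S_def[abs_def] by (intro borel_measurable_SUP; simp)
  define N where "N = density (wm (-1/2)) (\<lambda>y. ennreal (H y))"
  have N: "emeasure N A = (\<integral>\<^sup>+y. ennreal (H y) * indicator A y \<partial>wm (-1/2))" if "A \<in> sets borel" for A
   unfolding N_def using that by (intro emeasure_density) auto
  have setsN: "sets N = sets borel" by (simp add: N_def)
  define E where "E = {x. ennreal l < S x} \<inter> {0<..}"
  have "emeasure lborel E \<le> ennreal (10 / l) * pint (wm (-1/2)) H"
  proof (cases "pint (wm (-1/2)) H")
   case top
   thus ?thesis using l by (simp add: ennreal_mult_top)
  next
   case (real I)
   have spN: "emeasure N (space N) = ennreal I" using N[of UNIV] real by (simp add: N_def)
   have "\<exists>s. 0 < s \<and> ennreal (l * s) \<le> emeasure N (cball x s)" if x: "x \<in> E" for x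
   proof -
    have x0: "x > 0" using x by (simp add: E_def)
    obtain t where t: "t \<in> \<rat> \<inter> {0<..}" "ennreal l < pint (wm (-1/2)) (\<lambda>u. ?w t u * H (x * u))"
     using x unfolding E_def S_def less_SUP_iff by auto
    define h where "h y = ennreal (H y) * indicator (cball x (t * x)) y" for y
    have [measurable]: "h \<in> borel_measurable borel"
     unfolding h_def[abs_def] by (auto intro!: borel_measurable_times_ennreal borel_measurable_indicator)
    have "ennreal (l * (t * x)) = ennreal (t * x) * ennreal l" using t l x0 by (simp add: ennreal_mult[symmetric] mult.commute)
    also have "\<dots> \<le> ennreal (t * x) * pint (wm (-1/2)) (\<lambda>u. ?w t u * H (x * u))"
     using t by (intro mult_left_mono) auto
    also have "\<dots> \<le> ennreal (t * x) * (\<integral>\<^sup>+u. ennreal (1 / t) * h (x * u) \<partial>wm (-1/2))"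
    proof (intro mult_left_mono nn_integral_mono)
     fix u
     have "dist x (x * u) = x * \<bar>1 - u\<bar>" using x0 abs_mult[of x "1 - u"] by (simp add: dist_real_def right_diff_distrib)
     thus "ennreal (?w t u * H (x * u)) \<le> ennreal (1 / t) * h (x * u)"
      using x0 t H by (auto simp: h_def indicator_def ennreal_mult[symmetric] mult.commute)
    qed auto
    also have "\<dots> = ennreal (t * x) * (ennreal (1 / t) * (ennreal (1 / x) * emeasure N (cball x (t * x))))"
     using nn_integral_wm_dilation[of h x "-1/2"] x0 N[of "cball x (t * x)"]
     by (simp add: nn_integral_cmult powr_minus_divide h_def[symmetric])
    also have "\<dots> = (ennreal (t * x) * ennreal (1 / t) * ennreal (1 / x)) * emeasure N (cball x (t * x))"
     by (simp add: mult.assoc)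
    also have "ennreal (t * x) * ennreal (1 / t) * ennreal (1 / x) = 1" using t x0 by (simp add: ennreal_mult[symmetric])
    finally show ?thesis using t x0 by (intro exI[of _ "t * x"]) auto
   qed
   then obtain r where r: "\<And>x. x \<in> E ==> 0 < r x \<and> ennreal (l * r x) \<le> emeasure N (cball x (r x))" by metis
   have rb: "0 < r x \<and> r x \<le> I / l" if "x \<in> E" for x
   proof -
    have "ennreal (l * r x) \<le> emeasure N (space N)"
     using r[OF that] by (auto intro: order_trans emeasure_space)
    thus ?thesis using spN r[OF that] l real by (auto simp: ennreal_le_iff field_simps)
   qed
   have E1: "E \<subseteq> (\<Union>x\<in>E. cball (id x) (r x))" using rb by (force intro: less_imp_le)
   obtain C where C: "countable C" "C \<subseteq> E" "pairwise (\<lambda>i j. disjnt (cball (id i) (r i)) (cball (id j) (r j))) C"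
     "E \<subseteq> (\<Union>i\<in>C. cball (id i) (5 * r i))"
    by (rule Vitali_covering_lemma_cballs[OF E1 rb]) auto
   \<comment> \<open>The countable family of balls is indexed by natural numbers, with empty sets
     off J, for countable additivity.\<close>
   define J where "J = to_nat_on C ` C"
   define c where "c = from_nat_into C"
   define U where "U k n = (if n \<in> J then cball (c n) (k * r (c n)) else {})" for k :: real and n
   have cJ: "c n \<in> C" "to_nat_on C (c n) = n" if "n \<in> J" for n using that C by (auto simp: J_def c_def)
   have "E \<subseteq> (\<Union>n. U 5 n)"
   proof
    fix x assume "x \<in> E"
    then obtain i where i: "i \<in> C" "x \<in> cball i (5 * r i)" using C by auto
    hence "to_nat_on C i \<in> J" "c (to_nat_on C i) = i" using C by (auto simp: J_def c_def)
    thus "x \<in> (\<Union>n. U 5 n)" using i by (intro UN_I[of "to_nat_on C i"]) (auto simp: U_def)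
   qed
   hence "emeasure lborel E \<le> emeasure lborel (\<Union>n. U 5 n)" by (intro emeasure_mono) (auto simp: U_def)
   also have "\<dots> \<le> (\<Sum>n. emeasure lborel (U 5 n))"
    by (rule emeasure_subadditive_countably) (auto simp: U_def)
   also have "\<dots> \<le> (\<Sum>n. ennreal (10 / l) * emeasure N (U 1 n))"
   proof (intro suminf_le summableI)
    fix n
    show "emeasure lborel (U 5 n) \<le> ennreal (10 / l) * emeasure N (U 1 n)"
    proof (cases "n \<in> J")
     case True
     hence n: "0 < r (c n)" "ennreal (l * r (c n)) \<le> emeasure N (cball (c n) (r (c n)))"
      using r[of "c n"] C cJ by auto
     have "emeasure lborel (cball (c n) (5 * r (c n))) = ennreal (10 / l * (l * r (c n)))"
      using n l by (simp add: cball_eq_atLeastAtMost)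
     also have "\<dots> = ennreal (10 / l) * ennreal (l * r (c n))" using l n by (intro ennreal_mult) auto
     also have "\<dots> \<le> ennreal (10 / l) * emeasure N (cball (c n) (r (c n)))"
      by (intro mult_left_mono n) auto
     finally show ?thesis using True by (simp add: U_def)
    qed (simp add: U_def)
   qed
   also have "\<dots> = ennreal (10 / l) * (\<Sum>n. emeasure N (U 1 n))" by (rule ennreal_suminf_cmult)
   also have "(\<Sum>n. emeasure N (U 1 n)) = emeasure N (\<Union>n. U 1 n)"
   proof (rule suminf_emeasure)
    have "c m \<noteq> c n" if "m \<in> J" "n \<in> J" "m \<noteq> n" for m n using cJ that by metis
    thus "disjoint_family (U 1)" using C(3) cJ by (force simp: disjoint_family_on_def U_def pairwise_def disjnt_def)
   qed (auto simp: setsN U_def)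
   also have "\<dots> \<le> ennreal I" unfolding spN[symmetric] by (rule emeasure_space)
   finally show ?thesis using real by (simp add: mult_left_mono)
  qed
  thus "emeasure (wm (-1/2)) {x. ennreal l < (SUP t\<in>\<rat> \<inter> {0<..}. pint (wm (-1/2)) (\<lambda>u. ?w t u * H (x * u)))} \<le> ennreal (10 / l) * pint (wm (-1/2)) H"
   unfolding S_def[symmetric] by (subst emeasure_wm_half) (auto simp: E_def)
 qed auto
qed

lemma powr_le_add_endpoints:
 fixes a b x s :: real
 assumes "0 < a" "a \<le> x" "x \<le> b"
 shows "x powr s \<le> a powr s + b powr s"
proof (cases "s \<ge> 0")
 case True
 hence "x powr s \<le> b powr s" using assms by (intro powr_mono2) auto
 thus ?thesis using powr_ge_zero[of a s] by linarith
next
 case False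
 hence "x powr s \<le> a powr s" using assms by (intro powr_mono2') auto
 thus ?thesis using powr_ge_zero[of b s] by linarith
qed

section \<open>Integrals with singular points, uniformly in their position\<close>

lemma nn_integral_translate:
 fixes f :: "real => ennreal"
 assumes "f \<in> borel_measurable borel"
 shows "(\<integral>\<^sup>+x. f (x + c) \<partial>lborel) = (\<integral>\<^sup>+x. f x \<partial>lborel)"
  and "(\<integral>\<^sup>+x. f (c - x) \<partial>lborel) = (\<integral>\<^sup>+x. f x \<partial>lborel)"
 using nn_integral_real_affine[OF assms, of 1 c] nn_integral_real_affine[OF assms, of "-1" c]
 by (simp_all add: add.commute)

text \<open>The singular part of |y|^a for a \<le> 0; what it leaves out is at most 1.\<close>

definition bump :: "real => real => real" where
 "bump a y = (if \<bar>y\<bar> < 1 then \<bar>y\<bar> powr a else 0)"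

lemma bump_nonneg [simp]: "bump a y \<ge> 0"
 by (simp add: bump_def)

lemma bump_measurable [measurable]: "bump a \<in> borel_measurable borel"
 unfolding bump_def[abs_def] by measurable

lemma powr_le_bump: "a \<le> 0 ==> \<bar>y\<bar> powr a \<le> 1 + bump a y"
 using powr_mono2'[of a 1 "\<bar>y\<bar>"] by (auto simp: bump_def)

lemma nn_integral_bump:
 assumes a: "a > -1"
 shows "pint lborel (\<lambda>y. bump a (y - c)) \<le> ennreal (2 / (a + 1))"
proof -
 let ?Q = "\<lambda>y. indicator {0<..<1} y * y powr a"
 have "pint lborel (\<lambda>y. bump a (y - c)) = pint lborel (bump a)"
  using nn_integral_translate(1)[of "\<lambda>y. ennreal (bump a y)" "-c"] by simp
 also have "\<dots> \<le> (\<integral>\<^sup>+y. ennreal (?Q y) + ennreal (?Q (0 - y)) \<partial>lborel)"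
  by (intro nn_integral_mono) (auto simp: bump_def indicator_def)
 also have "\<dots> = ennreal (1 / (a + 1)) + ennreal (1 / (a + 1))"
  using nn_integral_translate(2)[of "\<lambda>y. ennreal (?Q y)" 0] nn_integral_powr_0[OF a, of 1] by (simp add: nn_integral_add)
 also have "\<dots> = ennreal (2 / (a + 1))" using a by (simp flip: ennreal_plus)
 finally show ?thesis .
qed

text \<open>Integrable decay in the distance to the front t = u, and two integrable singularities at
  t - u = \<plusminus>1; translation invariance makes the bound uniform in t.\<close>

lemma nn_integral_front:
 assumes a: "-1 < a" "a \<le> 0" and e: "e > 0"
 shows "\<exists>C\<ge>0. \<forall>t. pint lborel (\<lambda>u. (1 + \<bar>t - u\<bar>) powr (-1 - e) * (1 + bump a (t - u - 1) + bump a (t - u + 1))) \<le> ennreal C"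
proof (intro exI[of _ "2 * (2 powr e / e) + 4 / (a + 1)"] conjI allI)
 fix t
 let ?w = "\<lambda>h::real. (1 + \<bar>h\<bar>) powr (-1 - e)" and ?P = "\<lambda>y. indicator {1/2<..} y * y powr (-1 - e)"
 have w: "?w h * (1 + bump a (h - 1) + bump a (h + 1)) \<le> ?P (h + 1) + ?P (1 - h) + bump a (h - 1) + bump a (h - -1)" for h
 proof -
  have "?w h * (bump a (h - 1) + bump a (h + 1)) \<le> 1 * (bump a (h - 1) + bump a (h + 1))"
   using powr_mono2'[of "-1 - e" 1 "1 + \<bar>h\<bar>"] e by (intro mult_right_mono) auto
  moreover have "?w h \<le> ?P (h + 1) + ?P (1 - h)" by (auto simp: indicator_def add.commute abs_if)
  ultimately show ?thesis by (simp add: algebra_simps)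
 qed
 have P: "pint lborel ?P = ennreal (2 powr e / e)"
  using nn_integral_powr_inf[of "-1 - e" "1/2"] e by (simp add: powr_divide powr_minus_divide)
 have "pint lborel (\<lambda>u. ?w (t - u) * (1 + bump a (t - u - 1) + bump a (t - u + 1))) = pint lborel (\<lambda>h. ?w h * (1 + bump a (h - 1) + bump a (h + 1)))"
  by (rule nn_integral_translate(2)[of "\<lambda>h. ennreal (?w h * (1 + bump a (h - 1) + bump a (h + 1)))"]) measurable
 also have "\<dots> \<le> (\<integral>\<^sup>+h. ennreal (?P (h + 1)) + ennreal (?P (1 - h)) + ennreal (bump a (h - 1)) + ennreal (bump a (h - -1)) \<partial>lborel)"
  using w by (intro nn_integral_mono) (simp flip: ennreal_plus add: ennreal_leI)
 also have "\<dots> = pint lborel (\<lambda>h. ?P (h + 1)) + pint lborel (\<lambda>h. ?P (1 - h)) + pint lborel (\<lambda>h. bump a (h - 1)) + pint lborel (\<lambda>h. bump a (h - -1))"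
  by (simp add: nn_integral_add)
 also have "\<dots> \<le> ennreal (2 powr e / e) + ennreal (2 powr e / e) + ennreal (2 / (a + 1)) + ennreal (2 / (a + 1))"
  using nn_integral_translate[of "\<lambda>y. ennreal (?P y)" 1] P by (intro add_mono nn_integral_bump a) auto
 also have "\<dots> = ennreal (2 * (2 powr e / e) + 4 / (a + 1))" using a e by (simp flip: ennreal_plus)
 finally show "pint lborel (\<lambda>u. (1 + \<bar>t - u\<bar>) powr (-1 - e) * (1 + bump a (t - u - 1) + bump a (t - u + 1))) \<le> ennreal (2 * (2 powr e / e) + 4 / (a + 1))" .
qed (use a e in auto)

text \<open>The point s is arbitrary and may coincide with 0, hence the condition on a + b. For b
  \<le> 0 the smaller of the distances |u - s| and u takes over both powers; for b > 0 the second
  factor is bounded.\<close>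

lemma nn_integral_two_singularities:
 assumes a: "-1 < a" "a \<le> 0" and ab: "a + b > -1" and M: "M > 0"
 shows "\<exists>C\<ge>0. \<forall>s. pint lborel (\<lambda>u. indicator {0<..<M} u * (\<bar>u - s\<bar> powr a * u powr b)) \<le> ennreal C"
proof -
 define e where "e = (if b \<le> 0 then a + b else a)"
 define K where "K = 1 + M powr b"
 have e: "-1 < e" "e \<le> 0" using a ab by (auto simp: e_def)
 have pt: "\<bar>u - s\<bar> powr a * u powr b \<le> K * (\<bar>u - s\<bar> powr e + u powr e)" if u: "0 < u" "u < M" for u s
 proof (cases "b \<le> 0")
  case b: True
  have "\<bar>u - s\<bar> powr a * u powr b \<le> \<bar>u - s\<bar> powr e + u powr e"
  proof (cases "\<bar>u - s\<bar> \<le> u")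
   case True
   have "\<bar>u - s\<bar> powr a * u powr b \<le> \<bar>u - s\<bar> powr a * \<bar>u - s\<bar> powr b"
    using True b u by (cases "u = s") (auto intro!: mult_left_mono powr_mono2')
   thus ?thesis using b unfolding powr_add[symmetric] e_def by (simp add: add_increasing2)
  next
   case False
   have "\<bar>u - s\<bar> powr a * u powr b \<le> u powr a * u powr b"
    using False a u by (intro mult_right_mono powr_mono2') auto
   thus ?thesis using b unfolding powr_add[symmetric] e_def by (simp add: add_increasing)
  qed
  also have "\<dots> \<le> K * (\<bar>u - s\<bar> powr e + u powr e)"
   using mult_right_mono[of 1 K "\<bar>u - s\<bar> powr e + u powr e"] by (simp add: K_def)
  finally show ?thesis .
 next
  case False
  have "\<bar>u - s\<bar> powr a * u powr b \<le> \<bar>u - s\<bar> powr a * M powr b" using False u by (intro mult_left_mono powr_mono2) auto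
  also have "\<dots> \<le> K * (\<bar>u - s\<bar> powr e + u powr e)"
   using False by (auto simp: e_def K_def algebra_simps intro!: add_increasing add_increasing2)
  finally show ?thesis .
 qed
 show ?thesis
 proof (intro exI[of _ "K * (M + 2 / (e + 1) + M powr (e + 1) / (e + 1))"] conjI allI)
  fix s
  have "pint lborel (\<lambda>u. indicator {0<..<M} u * (\<bar>u - s\<bar> powr a * u powr b))
    \<le> (\<integral>\<^sup>+u. ennreal K * (indicator {0<..<M} u + ennreal (bump e (u - s)) + ennreal (indicator {0<..<M} u * u powr e)) \<partial>lborel)"
  proof (intro nn_integral_mono)
   fix u :: real
   have "indicator {0<..<M} u * (\<bar>u - s\<bar> powr a * u powr b) \<le> K * (indicator {0<..<M} u + bump e (u - s) + indicator {0<..<M} u * u powr e)"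
   proof (cases "u \<in> {0<..<M}")
    case True
    hence "\<bar>u - s\<bar> powr a * u powr b \<le> K * (\<bar>u - s\<bar> powr e + u powr e)" using pt by auto
    also have "\<dots> \<le> K * ((1 + bump e (u - s)) + u powr e)"
     using powr_le_bump[OF e(2)] by (intro mult_left_mono add_right_mono) (auto simp: K_def)
    finally show ?thesis using True by simp
   qed (simp add: K_def)
   thus "ennreal (indicator {0<..<M} u * (\<bar>u - s\<bar> powr a * u powr b)) \<le> ennreal K * (indicator {0<..<M} u + ennreal (bump e (u - s)) + ennreal (indicator {0<..<M} u * u powr e))"
    by (simp add: K_def ennreal_mult[symmetric] ennreal_indicator[symmetric] ennreal_leI flip: ennreal_plus)
  qed
  also have "\<dots> = ennreal K * (ennreal M + pint lborel (\<lambda>u. bump e (u - s)) + ennreal (M powr (e + 1) / (e + 1)))"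
   using nn_integral_powr_0[OF e(1), of M] M by (simp add: nn_integral_add nn_integral_cmult)
  also have "\<dots> \<le> ennreal K * (ennreal M + ennreal (2 / (e + 1)) + ennreal (M powr (e + 1) / (e + 1)))"
   using e by (intro mult_left_mono add_mono nn_integral_bump) auto
  also have "\<dots> = ennreal (K * (M + 2 / (e + 1) + M powr (e + 1) / (e + 1)))"
   using e M by (simp add: K_def ennreal_mult flip: ennreal_plus)
  finally show "pint lborel (\<lambda>u. indicator {0<..<M} u * (\<bar>u - s\<bar> powr a * u powr b)) \<le> ennreal (K * (M + 2 / (e + 1) + M powr (e + 1) / (e + 1)))" .
 qed (use e M in \<open>auto simp: K_def\<close>)
qed

section \<open>Sufficiency\<close>

text \<open>The kernel at \<open>x = 1\<close>, up to a constant.\<close>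
definition sk :: "real => real => real => real => real" where
 "sk al be t u = t powr (-2 * (al + be)) * u powr (be - 1) * prof al (al + be) (tau t 1 u)"

section \<open>Pointwise bounds for the kernel in each range of t and u\<close>

lemma abs_sk: "\<bar>sk al be t u\<bar> = t powr (-2 * (al + be)) * u powr (be - 1) * \<bar>prof al (al + be) (tau t 1 u)\<bar>"
 by (simp add: sk_def abs_mult)

lemma sk_measurable [measurable]: "sk al be t \<in> borel_measurable borel"
 unfolding sk_def[abs_def] tau_def by measurable

lemma sk_eq_0: "u > 0 ==> 0 < t ==> t \<le> \<bar>1 - u\<bar> ==> sk al be t u = 0"
proof -
 assume u: "u > 0" "0 < t" "t \<le> \<bar>1 - u\<bar>"
 have "t\<^sup>2 \<le> (1 - u)\<^sup>2" using u by (metis abs_le_square_iff abs_of_pos)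
 hence "tau t 1 u \<le> -1" using u by (simp add: tau_def field_simps power2_eq_square)
 thus ?thesis by (simp add: sk_def prof_def)
qed

lemma one_plus_tau: "u > 0 ==> 1 + tau t 1 u = (t - 1 + u) * (t + 1 - u) / (2 * u)"
 and one_minus_tau: "u > 0 ==> 1 - tau t 1 u = (1 + u - t) * (1 + u + t) / (2 * u)"
 by (simp_all add: tau_def field_simps power2_eq_square)

lemma tau_inner: "u > 0 ==> \<bar>1 - u\<bar> < t ==> t < 1 + u ==> -1 < tau t 1 u \<and> tau t 1 u < 1"
proof -
 assume u: "u > 0" "\<bar>1 - u\<bar> < t" "t < 1 + u"
 have "1 + tau t 1 u > 0" "1 - tau t 1 u > 0"
  unfolding one_plus_tau[OF u(1)] one_minus_tau[OF u(1)] using u by auto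
 thus ?thesis by simp
qed

lemma tau_outer: "u > 0 ==> 1 + u < t ==> tau t 1 u > 1"
proof -
 assume u: "u > 0" "1 + u < t"
 have "(1 + u - t) * (1 + u + t) / (2 * u) < 0"
  using u by (intro divide_neg_pos mult_neg_pos) auto
 thus ?thesis using one_minus_tau[OF u(1), of t] by simp
qed

lemma prof_1 [simp]: "prof al nu 1 = 0"
 by (simp add: prof_def)

lemma sk_eq_0': "u > 0 ==> sk al be (1 + u) u = 0"
 using one_minus_tau[of u "1 + u"] by (simp add: sk_def)

text \<open>g stands for min (nu - 1/2) 0 with a small loss, which absorbs a possible logarithm at
  \<tau> = 1 and lets nu below, at and above 1/2 be treated together.\<close>

locale kernel_estimate =
 fixes al be g :: real
 assumes al: "al > -1" and nu: "al + be > -1/2" and g: "g < 0" "g < al + be - 1/2"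
begin

abbreviation ak :: "real => real => real" where
 "ak t u \<equiv> \<bar>sk al be t u\<bar>"

text \<open>Separates the singularities: on each half of (-1, 1) one of the two powers with exponent
  g is at most 1, so their product is at most their sum.\<close>

lemma prof_bound_inner:
 "\<exists>C>0. \<forall>ta. -1 < ta --> ta < 1 --> \<bar>prof al (al + be) ta\<bar> \<le> C * ((1 + ta) powr g + (1 - ta) powr g)"
proof -
 obtain C where C: "C > 0" "\<And>ta. -1 < ta ==> ta < 1 ==> \<bar>prof al (al + be) ta\<bar> \<le> C * (ta + 1) powr (al + be - 1/2) * (1 - ta) powr g"
  using prof_bound[OF al nu g] by blast
 define d where "d = al + be - 1/2 - g"
 have d: "d > 0" using g by (simp add: d_def)
 show ?thesis
 proof (rule exI[of _ "C * 2 powr d"], intro conjI allI impI)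
  show "C * 2 powr d > 0" using C by simp
  fix ta :: real assume t: "-1 < ta" "ta < 1"
  have one: "y powr g \<le> 1" if "y \<ge> 1" for y :: real
   using powr_mono2'[of g 1 y] that g by simp
  have prod: "(1 + ta) powr g * (1 - ta) powr g \<le> (1 + ta) powr g + (1 - ta) powr g"
  proof (cases "ta \<ge> 0")
   case True
   thus ?thesis using mult_right_mono[OF one[of "1 + ta"], of "(1 - ta) powr g"] by (simp add: add_increasing)
  next
   case False
   thus ?thesis using mult_left_mono[OF one[of "1 - ta"], of "(1 + ta) powr g"] by (simp add: add_increasing2)
  qed
  have "(ta + 1) powr (al + be - 1/2) = (1 + ta) powr d * (1 + ta) powr g"
   unfolding powr_add[symmetric] by (simp add: d_def add.commute[of ta])
  also have "\<dots> \<le> 2 powr d * (1 + ta) powr g" using t d by (intro mult_right_mono powr_mono2) auto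
  finally have "C * (ta + 1) powr (al + be - 1/2) * (1 - ta) powr g \<le> C * (2 powr d * (1 + ta) powr g) * (1 - ta) powr g"
   using C by (intro mult_right_mono mult_left_mono) auto
  also have "\<dots> = C * 2 powr d * ((1 + ta) powr g * (1 - ta) powr g)" by simp
  also have "\<dots> \<le> C * 2 powr d * ((1 + ta) powr g + (1 - ta) powr g)"
   using C by (intro mult_left_mono prod) auto
  finally show "\<bar>prof al (al + be) ta\<bar> \<le> C * 2 powr d * ((1 + ta) powr g + (1 - ta) powr g)" using C(2)[OF t] by linarith
 qed
qed

lemma prof_bound_outer:
 "\<exists>C>0. \<forall>ta>1. \<bar>prof al (al + be) ta\<bar> \<le> C * ta powr (be - 1) * (1 - 1 / ta) powr g"
proof -
 obtain C where C: "C > 0" "\<And>ta. ta > 1 ==> \<bar>prof al (al + be) ta\<bar> \<le> C * ta powr (al + be - al - 1) * (1 - 1/ta\<^sup>2) powr g"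
  using prof_bound[OF al nu g] by blast
 show ?thesis
 proof (rule exI[of _ C], intro conjI allI impI)
  fix ta :: real assume t: "ta > 1"
  have "(1 - 1/ta\<^sup>2) powr g \<le> (1 - 1 / ta) powr g"
  proof (rule powr_mono2')
   show "1 - 1 / ta \<le> 1 - 1/ta\<^sup>2" using t by (simp add: power2_eq_square field_simps)
  qed (use t g in auto)
  hence "C * ta powr (be - 1) * (1 - 1/ta\<^sup>2) powr g \<le> C * ta powr (be - 1) * (1 - 1 / ta) powr g"
   using C by (intro mult_left_mono) auto
  thus "\<bar>prof al (al + be) ta\<bar> \<le> C * ta powr (be - 1) * (1 - 1 / ta) powr g" using C(2)[OF t] by simp
 qed (use C in auto)
qed

text \<open>With v = |1 - u| / t one has 1 + \<tau> = t^2 (1 - v^2) / (2 u), and t^(-2 nu) t^(2 nu -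
  1) = 1 / t: the kernel behaves like an average at scale t. For t < 1/4 only the singularity at
  \<tau> = -1 is met, since 1 - \<tau> \<ge> 1/2.\<close>

lemma sk_local:
 "\<exists>C>0. \<forall>t u. 0 < t --> t < 1/4 --> \<bar>1 - u\<bar> < t --> ak t u \<le> C * (1 / t * (1 - \<bar>1 - u\<bar> / t) powr g)"
proof -
 define gam where "gam = al + be - 1/2"
 obtain C where C: "C > 0" "\<And>ta. -1 < ta ==> ta < 1 ==> \<bar>prof al (al + be) ta\<bar> \<le> C * (ta + 1) powr gam * (1 - ta) powr g"
  using prof_bound[OF al nu g] unfolding gam_def by blast
 define k1 where "k1 = (3/4) powr (be - 1) + (5/4) powr (be - 1 :: real)"
 define k2 where "k2 = (1/4) powr gam + 1 powr gam"
 have k: "k1 > 0" "k2 > 0" by (auto simp: k1_def k2_def intro: add_pos_pos)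
 define D where "D = k1 * C * k2 * (1/2) powr g"
 have D: "D > 0" using C k by (simp add: D_def)
 show ?thesis
 proof (intro exI[of _ D] conjI allI impI D)
  fix t u :: real assume t: "0 < t" "t < 1/4" and ut: "\<bar>1 - u\<bar> < t"
  have ub: "3/4 \<le> u" "u \<le> 5/4" "u > 0" using t ut by auto
  define v where "v = \<bar>1 - u\<bar> / t"
  have v: "0 \<le> v" "v < 1" using t ut by (auto simp: v_def)
  have p1: "1 + tau t 1 u = t\<^sup>2 * ((1 + v) * (1 - v)) * (1 / (2 * u))"
  proof -
   have "t\<^sup>2 * ((1 + v) * (1 - v)) = t\<^sup>2 - \<bar>1 - u\<bar>\<^sup>2" using t by (simp add: v_def field_simps power2_eq_square)
   also have "\<dots> = (t - 1 + u) * (t + 1 - u)" by (simp add: power2_eq_square algebra_simps)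
   finally show ?thesis using one_plus_tau[OF ub(3), of t] by simp
  qed
  have a: "((1 + v) * (1 - v)) powr gam \<le> (1 - v) powr g"
  proof -
   have z: "0 < (1 + v) * (1 - v)" "(1 + v) * (1 - v) \<le> 1" "1 - v \<le> (1 + v) * (1 - v)" using v mult_mono[of v 1 v v] mult_strict_mono[of v 1 v 1] by (auto simp: algebra_simps)
   have "((1 + v) * (1 - v)) powr gam \<le> ((1 + v) * (1 - v)) powr g" using z g by (intro powr_mono') (auto simp: gam_def)
   also have "\<dots> \<le> (1 - v) powr g" using z v g by (intro powr_mono2') auto
   finally show ?thesis .
  qed
  have b: "(1 - tau t 1 u) powr g \<le> (1/2) powr g"
  proof (rule powr_mono2')
   have "u * 1 \<le> (1 + u + t) * (1 + u - t)" using ub t by (intro mult_mono) auto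
   thus "1/2 \<le> 1 - tau t 1 u" unfolding one_minus_tau[OF ub(3)] using ub by (simp add: field_simps)
  qed (use g in auto)
  have "\<bar>prof al (al + be) (tau t 1 u)\<bar> \<le> C * (1 + tau t 1 u) powr gam * (1 - tau t 1 u) powr g"
   using C(2)[of "tau t 1 u"] tau_inner[OF ub(3) ut] ub t by (simp add: add.commute[of 1])
  also have "(1 + tau t 1 u) powr gam = t powr (2 * gam) * ((1 + v) * (1 - v)) powr gam * (1 / (2 * u)) powr gam"
  proof -
   have "(t\<^sup>2) powr gam = t powr (2 * gam)" using t by (simp add: powr_powr flip: powr_numeral)
   thus ?thesis using v ub unfolding p1 by (subst powr_mult[of _ "1 / (2 * u)"]) (auto simp: powr_mult)
  qed
  also have "C * (t powr (2 * gam) * ((1 + v) * (1 - v)) powr gam * (1 / (2 * u)) powr gam) * (1 - tau t 1 u) powr g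
    \<le> C * (t powr (2 * gam) * (1 - v) powr g * k2) * (1/2) powr g"
   unfolding k2_def using C ub by (intro mult_mono mult_left_mono a b powr_le_add_endpoints mult_nonneg_nonneg add_nonneg_nonneg) (auto simp: field_simps)
  finally have P: "\<bar>prof al (al + be) (tau t 1 u)\<bar> \<le> C * (t powr (2 * gam) * (1 - v) powr g * k2) * (1/2) powr g" .
  have "ak t u \<le> t powr (-2 * (al + be)) * k1 * (C * (t powr (2 * gam) * (1 - v) powr g * k2) * (1/2) powr g)"
   unfolding abs_sk k1_def using C ub k by (intro mult_mono mult_left_mono P powr_le_add_endpoints mult_nonneg_nonneg add_nonneg_nonneg) auto
  also have "\<dots> = D * ((t powr (-2 * (al + be)) * t powr (2 * gam)) * (1 - v) powr g)" by (simp add: D_def)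
  also have "t powr (-2 * (al + be)) * t powr (2 * gam) = 1 / t"
   unfolding powr_add[symmetric] using t powr_minus_divide[of t 1] by (simp add: gam_def algebra_simps)
  finally show "ak t u \<le> D * (1 / t * (1 - \<bar>1 - u\<bar> / t) powr g)" by (simp add: v_def)
 qed
qed

text \<open>Here \<tau> is large and comparable to t^2 / u, so the powers of u cancel and the kernel
  is bounded by that of the average over (0, t).\<close>

lemma sk_far:
 "\<exists>C>0. \<forall>t u. 4 \<le> t --> 0 < u --> 2 * u \<le> t --> ak t u \<le> C * t powr (-(2*al+2))"
proof -
 obtain C2 where C2: "C2 > 0" "\<And>ta. ta > 1 ==> \<bar>prof al (al + be) ta\<bar> \<le> C2 * ta powr (be - 1) * (1 - 1 / ta) powr g"
  using prof_bound_outer by blast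
 define C where "C = C2 * 4 powr \<bar>be - 1\<bar> * (1/2) powr g"
 show ?thesis
 proof (intro exI[of _ C] conjI allI impI)
  fix t u :: real assume tu: "4 \<le> t" "0 < u" "2 * u \<le> t"
  have "2 * u * (2 * u) \<le> t * t" "4 * 4 \<le> t * t" using tu by (intro mult_mono; simp)+
  hence q: "t\<^sup>2 / 2 \<le> t\<^sup>2 - 1 - u\<^sup>2" "t\<^sup>2 - 1 - u\<^sup>2 \<le> t\<^sup>2" unfolding power2_eq_square using zero_le_square[of u] by linarith+
  hence tau: "(t\<^sup>2 / 2) / (2 * u) \<le> tau t 1 u" "tau t 1 u \<le> t\<^sup>2 / (2 * u)"
   using divide_right_mono[OF q(1), of "2 * u"] divide_right_mono[OF q(2), of "2 * u"] tu by (simp_all add: tau_def)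
  have "u * 8 \<le> t * t" using mult_mono[of "2 * u" t 4 t] tu by simp
  hence "2 \<le> (t\<^sup>2 / 2) / (2 * u)" using tu by (simp add: field_simps power2_eq_square)
  hence tau2: "tau t 1 u \<ge> 2" using tau by linarith
  have "(1 - 1 / tau t 1 u) powr g \<le> (1/2) powr g" using tau2 g by (intro powr_mono2') (auto simp: field_simps)
  moreover have "tau t 1 u powr (be - 1) \<le> 4 powr \<bar>be - 1\<bar> * (t\<^sup>2 / u) powr (be - 1)"
   using tau tau2 tu by (intro powr_comparable) (auto simp: field_simps)
  ultimately have "C2 * tau t 1 u powr (be - 1) * (1 - 1 / tau t 1 u) powr g \<le> C2 * (4 powr \<bar>be - 1\<bar> * (t\<^sup>2 / u) powr (be - 1)) * (1/2) powr g"
   using C2 by (intro mult_mono mult_left_mono) auto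
  hence "\<bar>prof al (al + be) (tau t 1 u)\<bar> \<le> C * (t\<^sup>2 / u) powr (be - 1)"
   using C2(2)[of "tau t 1 u"] tau2 by (simp add: C_def mult_ac)
  hence "ak t u \<le> t powr (-2 * (al + be)) * u powr (be - 1) * (C * (t\<^sup>2 / u) powr (be - 1))"
   unfolding abs_sk by (intro mult_left_mono) auto
  also have "\<dots> = C * (t powr (-2 * (al + be)) * (t powr 2) powr (be - 1))" using tu by (simp add: powr_divide powr_numeral)
  also have "t powr (-2 * (al + be)) * (t powr 2) powr (be - 1) = t powr (-(2*al+2))"
   by (simp add: powr_powr algebra_simps flip: powr_add)
  finally show "ak t u \<le> C * t powr (-(2*al+2))" .
 qed (use C2 in \<open>simp add: C_def\<close>)
qed

lemma powr_mult_le_sum: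
 assumes "X > 0" "Y > 0" "X + Y \<ge> 2 * c" "c > (0::real)" and k: "k > 0"
 shows "(X * Y / k) powr g \<le> (c / k) powr g * (X powr g + Y powr g)"
proof -
 have *: "(X * Y / k) powr g \<le> (c / k) powr g * Y powr g" if "X \<ge> c" "Y > 0" for X Y
 proof -
  have "(X * Y / k) powr g \<le> (c * Y / k) powr g"
   using that assms g by (intro powr_mono2') (auto intro!: divide_right_mono mult_right_mono)
  thus ?thesis using that assms by (simp add: powr_mult powr_divide)
 qed
 have "(X * Y / k) powr g \<le> (c / k) powr g * Y powr g \<or> (X * Y / k) powr g \<le> (c / k) powr g * X powr g"
  using *[of X Y] *[of Y X] assms by (cases "X \<ge> c") (auto simp: mult.commute)
 moreover have "(c / k) powr g * Y powr g \<ge> 0" "(c / k) powr g * X powr g \<ge> 0" by auto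
 ultimately show ?thesis unfolding distrib_left by linarith
qed

text \<open>Exponents of the second term of \<open>sing\<close>, dictated by
  \<open>sing_outer\<close>, where h^(be - 1 - g) (h - u)^g is to be bounded for u < h. If g \<le>
  be - 1, the power of h splits into powers of u and of h - u, leaving (h - u)^(be - 1), or a
  constant when be \<ge> 1. Otherwise h may be replaced by u and no new term arises.\<close>

definition sing_m :: real where "sing_m = (if g \<le> be - 1 then min (be - 1) 0 else g)"
definition sing_n :: real where "sing_n = (if g \<le> be - 1 then 0 else be - 1 - g)"

definition sing :: "real => real => real" where
 "sing s u = \<bar>u - s\<bar> powr g * u powr (be - 1 - g) + \<bar>u - s\<bar> powr sing_m * u powr sing_n"

lemma sing_nonneg [simp]: "sing s u \<ge> 0"
 by (simp add: sing_def)

lemma sing_outer: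
 assumes d: "d \<ge> 1"
 shows "\<exists>C>0. \<forall>h u. 0 < u --> u < h --> h \<le> d --> h powr (be - 1) * ((h - u) / h) powr g \<le> C * sing h u"
proof (intro exI[of _ "2 powr \<bar>be - 1 - g\<bar> * d powr \<bar>be - 1\<bar>"] conjI allI impI)
 fix h u :: real assume u: "0 < u" "u < h" "h \<le> d"
 define y where "y = h - u"
 let ?e = "be - 1 - g" and ?k = "2 powr \<bar>be - 1 - g\<bar>" and ?D = "d powr \<bar>be - 1\<bar>"
 have y: "y > 0" "y \<le> d" "\<bar>u - h\<bar> = y" using u by (auto simp: y_def)
 have D: "?D \<ge> 1" "?k \<ge> 1" using d by (auto intro: ge_one_powr_ge_zero)
 have "h powr (be - 1) * ((h - u) / h) powr g = h powr ?e * y powr g"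
  using u by (simp add: powr_divide powr_diff y_def)
 also have "\<dots> \<le> ?k * ?D * sing h u"
 proof (cases "g \<le> be - 1")
  case True
  have "h powr ?e \<le> ?k * (u powr ?e + y powr ?e)"
  proof -
   have "h powr ?e \<le> (2 * max u y) powr ?e" using True u by (intro powr_mono2) (auto simp: y_def max_def)
   also have "\<dots> \<le> ?k * (u powr ?e + y powr ?e)" using True by (auto simp: powr_mult max_def)
   finally show ?thesis .
  qed
  hence "h powr ?e * y powr g \<le> ?k * (u powr ?e + y powr ?e) * y powr g" by (rule mult_right_mono) simp
  also have "\<dots> = ?k * (y powr g * u powr ?e + y powr (be - 1))"
   by (simp add: algebra_simps flip: powr_add)
  also have "\<dots> \<le> ?k * (?D * (y powr g * u powr ?e) + ?D * (y powr sing_m * u powr sing_n))"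
  proof (intro mult_left_mono add_mono)
   have "y powr (be - 1) \<le> ?D * y powr sing_m"
   proof (cases "be \<ge> 1")
    case b: True
    thus ?thesis using True y by (simp add: sing_m_def powr_mono2)
   qed (use True mult_right_mono[OF D(1), of "y powr (be - 1)"] in \<open>simp add: sing_m_def\<close>)
   thus "y powr (be - 1) \<le> ?D * (y powr sing_m * u powr sing_n)" using True u by (simp add: sing_n_def)
  qed (use mult_right_mono[OF D(1), of "y powr g * u powr ?e"] in auto)
  also have "\<dots> = ?k * ?D * sing h u" by (simp add: sing_def y algebra_simps)
  finally show ?thesis .
 next
  case False
  have "h powr ?e * y powr g \<le> u powr ?e * y powr g" using False u by (intro mult_right_mono powr_mono2') auto
  also have "\<dots> \<le> 1 * sing h u" by (simp add: sing_def y)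
  also have "\<dots> \<le> ?k * ?D * sing h u" using mult_mono[OF D(2) D(1)] by (intro mult_right_mono) auto
  finally show ?thesis .
 qed
 finally show "h powr (be - 1) * ((h - u) / h) powr g \<le> ?k * ?D * sing h u" .
qed (use d in auto)

text \<open>For t in a compact range the singular points are u = 1 - t and u = t + 1, where \<tau> =
  -1, and u = t - 1, where \<tau> = 1. The power of u at the origin differs inside and outside
  |\<tau>| < 1, which is why \<open>sing\<close> has two terms.\<close>

lemma sk_bounded_range:
 assumes c: "c > 0" and cd: "c \<le> d" "1 \<le> d"
 shows "\<exists>C>0. \<forall>t u. c \<le> t --> t \<le> d --> 0 < u --> ak t u \<le> C * (sing (t - 1) u + sing (1 - t) u + sing (t + 1) u)"
proof -
 obtain C1 where C1: "C1 > 0" "\<And>ta. -1 < ta ==> ta < 1 ==> \<bar>prof al (al + be) ta\<bar> \<le> C1 * ((1 + ta) powr g + (1 - ta) powr g)"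
  using prof_bound_inner by blast
 obtain C2 where C2: "C2 > 0" "\<And>ta. ta > 1 ==> \<bar>prof al (al + be) ta\<bar> \<le> C2 * ta powr (be - 1) * (1 - 1 / ta) powr g"
  using prof_bound_outer by blast
 obtain C3 where C3: "C3 > 0" "\<And>h u. 0 < u ==> u < h ==> h \<le> d ==> h powr (be - 1) * ((h - u) / h) powr g \<le> C3 * sing h u"
  using sing_outer[OF cd(2)] by blast
 define M where "M = c powr (-2 * (al + be)) + d powr (-2 * (al + be))"
 have M: "M > 0" using c by (auto simp: M_def intro: add_pos_nonneg)
 define K1 where "K1 = M * C1 * ((1/2) powr g + (c/2) powr g)"
 define k2 where "k2 = (d + 2) powr \<bar>be - 1\<bar>"
 define K2 where "K2 = M * C2 * k2 * C3"
 have K: "K1 > 0" "K2 > 0" using M C1 C2 C3 c cd by (auto simp: K1_def K2_def k2_def intro!: mult_pos_pos add_pos_pos)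
 show ?thesis
 proof (intro exI[of _ "K1 + K2"] conjI allI impI)
  fix t u :: real assume t: "c \<le> t" "t \<le> d" and u: "0 < u"
  let ?S = "sing (t - 1) u + sing (1 - t) u + sing (t + 1) u"
  have S0: "?S \<ge> 0" by simp
  have tM: "t powr (-2 * (al + be)) \<le> M" unfolding M_def using c t by (intro powr_le_add_endpoints) auto
  consider (0) "t \<le> \<bar>1 - u\<bar>" | (L) "\<bar>1 - u\<bar> < t" "t < 1 + u" | (1) "t = 1 + u" | (G) "t > 1 + u" by linarith
  thus "ak t u \<le> (K1 + K2) * ?S"
  proof cases
   case L
   \<comment> \<open>1 + \<tau> = X Y / (2 u) with X + Y = 2 t \<ge> 2 c, so X and Y are not both
     small.\<close>
   define X where "X = u - (1 - t)"
   define Y where "Y = t + 1 - u"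
   have XY: "X > 0" "Y > 0" "X + Y \<ge> 2 * c" using L t by (auto simp: X_def Y_def)
   have "(1 - tau t 1 u) powr g \<le> ((1/2) * (\<bar>u - (t - 1)\<bar> / u)) powr g"
   proof (rule powr_mono2')
    have "(1 + u - t) * 1 \<le> (1 + u - t) * (1 + u + t)" using u t c L by (intro mult_left_mono) auto
    thus "(1/2) * (\<bar>u - (t - 1)\<bar> / u) \<le> 1 - tau t 1 u" unfolding one_minus_tau[OF u] using u L by (simp add: divide_right_mono algebra_simps)
    show "0 < (1/2) * (\<bar>u - (t - 1)\<bar> / u)" using u L(2) by simp
   qed (use g in simp)
   hence a: "(1 - tau t 1 u) powr g \<le> (1/2) powr g * \<bar>u - (t - 1)\<bar> powr g * u powr -g"
    using u by (simp only: powr_mult powr_divide powr_minus_divide times_divide_eq_right mult_1_right mult.assoc abs_ge_zero)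
   have "(1 + tau t 1 u) powr g \<le> (c / (2 * u)) powr g * (X powr g + Y powr g)"
    using powr_mult_le_sum[OF XY c, of "2 * u"] u by (simp add: one_plus_tau[OF u] X_def Y_def algebra_simps)
   hence b: "(1 + tau t 1 u) powr g \<le> (c/2) powr g * (X powr g + Y powr g) * u powr -g"
    using c u powr_divide[of "c/2" u g] by (simp add: powr_minus_divide)
   have "u powr (be - 1) * ((1 + tau t 1 u) powr g + (1 - tau t 1 u) powr g)
     \<le> u powr (be - 1) * (((1/2) powr g + (c/2) powr g) * (X powr g + Y powr g + \<bar>u - (t - 1)\<bar> powr g) * u powr -g)"
    by (intro mult_left_mono order_trans[OF add_mono[OF b a]]) (simp_all add: algebra_simps)
   also have "\<dots> = ((1/2) powr g + (c/2) powr g) * ((X powr g + Y powr g + \<bar>u - (t - 1)\<bar> powr g) * u powr (be - 1 - g))"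
    by (simp add: powr_diff powr_minus_divide)
   also have "\<dots> \<le> ((1/2) powr g + (c/2) powr g) * ?S"
    using XY abs_minus_commute[of u "t + 1"] by (intro mult_left_mono) (simp_all add: sing_def X_def Y_def algebra_simps)
   finally have P: "u powr (be - 1) * ((1 + tau t 1 u) powr g + (1 - tau t 1 u) powr g) \<le> ((1/2) powr g + (c/2) powr g) * ?S" .
   have "ak t u \<le> M * (u powr (be - 1) * (C1 * ((1 + tau t 1 u) powr g + (1 - tau t 1 u) powr g)))"
    unfolding abs_sk mult.assoc using C1(2) tau_inner[OF u L] M by (intro mult_mono[OF tM] mult_left_mono) auto
   also have "\<dots> = M * C1 * (u powr (be - 1) * ((1 + tau t 1 u) powr g + (1 - tau t 1 u) powr g))" by simp
   also have "\<dots> \<le> M * C1 * (((1/2) powr g + (c/2) powr g) * ?S)" using P M C1 by (intro mult_left_mono) auto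
   also have "\<dots> = K1 * ?S" by (simp only: K1_def mult.assoc)
   also have "\<dots> \<le> (K1 + K2) * ?S" using K S0 by (intro mult_right_mono) auto
   finally show ?thesis .
  next
   case G
   \<comment> \<open>For h = t - 1 > u the value \<tau> is comparable to h / u, and 1 - 1 / \<tau>
     is at least (h - u) / h.\<close>
   define h where "h = t - 1"
   have h: "h > u" "h \<le> d" using G t by (auto simp: h_def)
   have te: "tau t 1 u = (h * (h + 2) - u\<^sup>2) / (2 * u)" by (simp add: tau_def h_def power2_eq_square algebra_simps)
   have uu: "u\<^sup>2 \<le> h\<^sup>2" using h u by (auto simp: power2_eq_square intro!: mult_mono)
   have q: "h * (h + 2) - u\<^sup>2 \<ge> 2 * h" "h * (h + 2) - u\<^sup>2 \<le> h * (h + 2)"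
    using uu by (auto simp: algebra_simps power2_eq_square)
   have "2 * h / (2 * u) \<le> tau t 1 u" unfolding te using q(1) u by (intro divide_right_mono) auto
   hence tau: "h / u \<le> tau t 1 u" by simp
   hence tau1: "tau t 1 u > 1" using tau_outer[OF u] G by simp
   have "1 / tau t 1 u \<le> 1 / (h / u)" using tau tau1 h u by (intro divide_left_mono mult_pos_pos divide_pos_pos) auto
   hence "1 - u / h \<le> 1 - 1 / tau t 1 u" by simp
   hence a: "(1 - 1 / tau t 1 u) powr g \<le> ((h - u) / h) powr g" using g h u by (intro powr_mono2') (auto simp: diff_divide_distrib)
   have b: "tau t 1 u powr (be - 1) \<le> k2 * (h powr (be - 1) / u powr (be - 1))"
   proof -
    have "h * (h + 2) \<le> h * (2 * (d + 2))" using h u cd by (intro mult_left_mono) auto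
    hence "h * (h + 2) - u\<^sup>2 \<le> 2 * (d + 2) * h" using q(2) by (simp only: mult_ac)
    hence "tau t 1 u \<le> 2 * (d + 2) * h / (2 * u)" unfolding te using u by (intro divide_right_mono) auto
    also have "2 * (d + 2) * h / (2 * u) = (d + 2) * (h / u)" using u by (simp add: field_simps)
    finally have "tau t 1 u \<le> (d + 2) * (h / u)" .
    moreover have "1 * tau t 1 u \<le> (d + 2) * tau t 1 u" using tau1 cd by (intro mult_right_mono) auto
    hence "h / u \<le> (d + 2) * tau t 1 u" using tau by linarith
    ultimately have "tau t 1 u powr (be - 1) \<le> k2 * (h / u) powr (be - 1)" unfolding k2_def using tau1 cd by (intro powr_comparable) auto
    thus ?thesis using h u by (simp add: powr_divide)
   qed
   have "\<bar>prof al (al + be) (tau t 1 u)\<bar> \<le> C2 * tau t 1 u powr (be - 1) * (1 - 1 / tau t 1 u) powr g" by (rule C2(2)[OF tau1])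
   also have "\<dots> \<le> C2 * (k2 * (h powr (be - 1) / u powr (be - 1))) * ((h - u) / h) powr g"
    using C2(1) by (intro mult_mono a mult_left_mono[OF b]) (auto simp: k2_def)
   finally have "ak t u \<le> M * u powr (be - 1) * (C2 * (k2 * (h powr (be - 1) / u powr (be - 1))) * ((h - u) / h) powr g)"
    unfolding abs_sk using M by (intro mult_mono[OF mult_right_mono[OF tM]]) auto
   also have "\<dots> = M * C2 * k2 * (h powr (be - 1) * ((h - u) / h) powr g)" using u by simp
   also have "\<dots> \<le> M * C2 * k2 * (C3 * sing h u)"
    using C2 M C3(2)[OF u h] by (intro mult_left_mono) (auto simp: k2_def)
   also have "\<dots> = K2 * sing h u" by (simp add: K2_def)
   also have "\<dots> \<le> (K1 + K2) * ?S" using K by (intro mult_mono) (auto simp: h_def)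
   finally show ?thesis .
  qed (use sk_eq_0[of u t] sk_eq_0'[of u] u t c K S0 in \<open>auto intro!: mult_nonneg_nonneg\<close>)
 qed (use K in auto)
qed

text \<open>The distance h = t - u to the front decides: the kernel vanishes for h \<le> -1; for |h|
  < 1 one has 1 + \<tau> \<ge> (1 + h) / 2 and 1 - \<tau> \<ge> (1 - h) / 2; for h > 1, \<tau> lies
  between h and 2 h. The bumps carry the singularities at h = \<plusminus>1. Where the kernel is not
  0, t is comparable to u, which gives the power of u.\<close>

lemma sk_near:
 "\<exists>C>0. \<forall>t u. 0 < t --> 2 \<le> u --> t < 2 * u --> ak t u \<le>
   C * (u powr (-be-2*al-1) * ((1 + \<bar>t - u\<bar>) powr (be - 1) * (1 + bump g (t - u - 1) + bump g (t - u + 1))))"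
proof -
 obtain C1 where C1: "C1 > 0" "\<And>ta. -1 < ta ==> ta < 1 ==> \<bar>prof al (al + be) ta\<bar> \<le> C1 * ((1 + ta) powr g + (1 - ta) powr g)"
  using prof_bound_inner by blast
 obtain C2 where C2: "C2 > 0" "\<And>ta. ta > 1 ==> \<bar>prof al (al + be) ta\<bar> \<le> C2 * ta powr (be - 1) * (1 - 1 / ta) powr g"
  using prof_bound_outer by blast
 define k where "k = 2 powr \<bar>be - 1\<bar>"
 define K where "K = 2 powr \<bar>-2 * (al + be)\<bar> * (2 * C1 + k * C2) * (1/2) powr g * k"
 have k: "k > 0" by (simp add: k_def)
 show ?thesis
 proof (intro exI[of _ K] conjI allI impI)
  fix t u :: real assume t: "0 < t" and u: "2 \<le> u" "t < 2 * u"
  define h where "h = t - u"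
  define S where "S = 1 + bump g (h - 1) + bump g (h + 1)"
  have S: "S \<ge> 1" by (simp add: S_def)
  have half: "(y/2) powr g = (1/2) powr g * y powr g" if "y > 0" for y using powr_mult[of "1/2" y g] that by simp
  have "ak t u \<le> K * (u powr (-be-2*al-1) * ((1 + \<bar>h\<bar>) powr (be - 1) * S))"
  proof (cases "t \<le> \<bar>1 - u\<bar> \<or> t = 1 + u")
   case False
   hence hu: "h > -1" "h \<noteq> 1" "h < u" using u by (auto simp: h_def abs_if split: if_splits)
   have P: "\<bar>prof al (al + be) (tau t 1 u)\<bar> \<le> (2 * C1 + k * C2) * ((1/2) powr g * S) * (k * (1 + \<bar>h\<bar>) powr (be - 1))"
   proof (cases "h < 1")
    case True
    have L: "\<bar>1 - u\<bar> < t" "t < 1 + u" using False True u by (auto simp: h_def)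
    have a: "((1 - eps * h) / 2) powr g \<le> (1/2) powr g * S" if "eps = 1 \<or> eps = -1" for eps
    proof -
     have "\<bar>1 - eps * h\<bar> powr g \<le> 1 + bump g (1 - eps * h)" using g by (intro powr_le_bump) auto
     also have "\<dots> \<le> S" using that by (auto simp: S_def bump_def abs_minus_commute add.commute)
     finally show ?thesis using half[of "1 - eps * h"] that hu True by auto
    qed
    have "(1 + tau t 1 u) powr g \<le> ((1 - (-1) * h) / 2) powr g"
    proof (rule powr_mono2')
     have "u * (1 + h) \<le> (t - 1 + u) * (t + 1 - u)" using u L hu unfolding h_def by (intro mult_mono) auto
     thus "(1 - (-1) * h) / 2 \<le> 1 + tau t 1 u" using u by (simp add: one_plus_tau field_simps)
    qed (use g hu in auto)
    moreover have "(1 - tau t 1 u) powr g \<le> ((1 - 1 * h) / 2) powr g"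
    proof (rule powr_mono2')
     have "(1 - h) * u \<le> (1 + u - t) * (1 + u + t)" using u L t True unfolding h_def by (intro mult_mono) auto
     thus "(1 - 1 * h) / 2 \<le> 1 - tau t 1 u" using u by (simp add: one_minus_tau field_simps)
    qed (use g True in auto)
    ultimately have s: "(1 + tau t 1 u) powr g + (1 - tau t 1 u) powr g \<le> 2 * ((1/2) powr g * S)" using a[of 1] a[of "-1"] by linarith
    have "\<bar>prof al (al + be) (tau t 1 u)\<bar> \<le> C1 * (2 * ((1/2) powr g * S))"
     using C1 tau_inner[OF _ L] u by (intro order_trans[OF C1(2) mult_left_mono[OF s]]) auto
    also have "\<dots> \<le> (2 * C1 + k * C2) * ((1/2) powr g * S) * 1" using C2 k S by (simp add: distrib_right)
    also have "\<dots> \<le> (2 * C1 + k * C2) * ((1/2) powr g * S) * (k * (1 + \<bar>h\<bar>) powr (be - 1))"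
     using powr_comparable[of 1 2 "1 + \<bar>h\<bar>" "be - 1"] C1 C2 k S hu True by (intro mult_left_mono) (auto simp: k_def)
    finally show ?thesis .
   next
    case False
    hence h1: "h > 1" using hu by simp
    have te: "tau t 1 u = (h * (h + 2 * u) - 1) / (2 * u)" by (simp add: tau_def h_def power2_eq_square algebra_simps)
    have "1 * 1 \<le> h * h" using h1 by (intro mult_mono) auto
    hence "2 * u * h \<le> h * (h + 2 * u) - 1" by (simp add: algebra_simps)
    moreover have "h * (h + 2 * u) \<le> h * (4 * u)" using h1 hu by (intro mult_left_mono) auto
    hence "h * (h + 2 * u) - 1 \<le> 2 * u * (2 * h)" by (simp add: mult_ac)
    ultimately have "2 * u * h / (2 * u) \<le> tau t 1 u" "tau t 1 u \<le> 2 * u * (2 * h) / (2 * u)" unfolding te using u by (intro divide_right_mono; simp)+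
    hence tau: "h \<le> tau t 1 u" "tau t 1 u \<le> 2 * h" using u by auto
    have "(1 - 1 / tau t 1 u) powr g \<le> ((h - 1) / h) powr g"
    proof (rule powr_mono2')
     have "1 / tau t 1 u \<le> 1 / h" using tau h1 by (intro divide_left_mono) auto
     thus "(h - 1) / h \<le> 1 - 1 / tau t 1 u" using h1 by (simp add: diff_divide_distrib)
    qed (use g h1 in auto)
    also have "\<dots> \<le> (1/2) powr g * S"
    proof (cases "h < 2")
     case True
     have "((h - 1) / h) powr g \<le> ((h - 1) / 2) powr g" using True h1 g by (intro powr_mono2' divide_left_mono) auto
     also have "\<dots> = (1/2) powr g * bump g (h - 1)" using half[of "h - 1"] True h1 by (simp add: bump_def)
     also have "\<dots> \<le> (1/2) powr g * S" by (intro mult_left_mono) (auto simp: S_def)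
     finally show ?thesis .
    next
     case False
     have "((h - 1) / h) powr g \<le> (1/2) powr g" using False g by (intro powr_mono2') (auto simp: field_simps)
     also have "(1/2) powr g \<le> (1/2) powr g * S" using S by simp
     finally show ?thesis .
    qed
    finally have a: "(1 - 1 / tau t 1 u) powr g \<le> (1/2) powr g * S" .
    have "tau t 1 u powr (be - 1) \<le> k * h powr (be - 1)" unfolding k_def using tau h1 by (intro powr_comparable) auto
    also have "h powr (be - 1) \<le> k * (1 + \<bar>h\<bar>) powr (be - 1)" unfolding k_def using h1 by (intro powr_comparable) auto
    finally have b: "tau t 1 u powr (be - 1) \<le> k * (k * (1 + \<bar>h\<bar>) powr (be - 1))" using k by (simp add: mult_left_mono)
    have "\<bar>prof al (al + be) (tau t 1 u)\<bar> \<le> C2 * (k * (k * (1 + \<bar>h\<bar>) powr (be - 1))) * ((1/2) powr g * S)"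
     using C2(1) tau h1 k by (intro order_trans[OF C2(2)] mult_mono[OF mult_left_mono[OF b] a]) auto
    also have "\<dots> \<le> (2 * C1 + k * C2) * ((1/2) powr g * S) * (k * (1 + \<bar>h\<bar>) powr (be - 1))" using C1 k S by (simp add: algebra_simps)
    finally show ?thesis .
   qed
   have "t powr (-2 * (al + be)) \<le> 2 powr \<bar>-2 * (al + be)\<bar> * u powr (-2 * (al + be))" using hu u t by (intro powr_comparable) (auto simp: h_def)
   hence "ak t u \<le> (2 powr \<bar>-2 * (al + be)\<bar> * u powr (-2 * (al + be))) * u powr (be - 1) * ((2 * C1 + k * C2) * ((1/2) powr g * S) * (k * (1 + \<bar>h\<bar>) powr (be - 1)))"
    unfolding abs_sk using P by (intro mult_mono) auto
   also have "\<dots> = K * ((u powr (-2 * (al + be)) * u powr (be - 1)) * ((1 + \<bar>h\<bar>) powr (be - 1) * S))" by (simp add: K_def)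
   also have "u powr (-2 * (al + be)) * u powr (be - 1) = u powr (-be-2*al-1)"
    unfolding powr_add[symmetric] by (rule arg_cong[where f = "\<lambda>e. u powr e"]) simp
   finally show ?thesis .
  qed (use sk_eq_0[of u t] sk_eq_0'[of u] u t C1 C2 k S in \<open>auto simp: K_def intro!: mult_nonneg_nonneg\<close>)
  thus "ak t u \<le> K * (u powr (-be-2*al-1) * ((1 + \<bar>t - u\<bar>) powr (be - 1) * (1 + bump g (t - u - 1) + bump g (t - u + 1))))"
   by (simp add: S_def h_def)
 qed (use C1(1) C2(1) k in \<open>auto simp: K_def intro!: mult_pos_pos add_pos_pos\<close>)
qed

end

section \<open>Bounds for the maximal operator, region by region\<close>

lemma nn_integral_two_powers:
 assumes e1: "e1 > -1" and e2: "e2 < -1"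
 shows "\<exists>D\<ge>0. (\<integral>\<^sup>+u. ennreal (indicator {0<..} u * (if u < 2 then u powr e1 else u powr e2)) \<partial>lborel) \<le> ennreal (D::real)"
proof -
 have "(\<integral>\<^sup>+u. ennreal (indicator {0<..} u * (if u < 2 then u powr e1 else u powr e2)) \<partial>lborel)
   \<le> (\<integral>\<^sup>+u. ennreal (indicator {0<..<2} u * u powr e1) + ennreal (indicator {1<..} u * u powr e2) \<partial>lborel)"
  by (intro nn_integral_mono) (auto simp: indicator_def)
 also have "\<dots> = ennreal (2 powr (e1 + 1) / (e1 + 1)) + ennreal (- (1 powr (e2 + 1)) / (e2 + 1))"
  using nn_integral_powr_0[OF e1, of 2] nn_integral_powr_inf[OF e2, of 1] by (subst nn_integral_add) auto
 also have "\<dots> = ennreal (2 powr (e1 + 1) / (e1 + 1) + (- 1) / (e2 + 1))"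
  using e1 e2 by (subst ennreal_plus) (auto simp: divide_nonpos_neg)
 finally have le: "(\<integral>\<^sup>+u. ennreal (indicator {0<..} u * (if u < 2 then u powr e1 else u powr e2)) \<partial>lborel) \<le> ennreal (2 powr (e1 + 1) / (e1 + 1) + (- 1) / (e2 + 1))" .
 show ?thesis
 proof (intro exI[of _ "2 powr (e1 + 1) / (e1 + 1) + (- 1) / (e2 + 1)"] conjI)
  have "(- 1) / (e2 + 1) \<ge> 0" using e2 by (intro divide_nonpos_neg) auto
  thus "0 \<le> 2 powr (e1 + 1) / (e1 + 1) + (- 1) / (e2 + 1)" using e1 by (intro add_nonneg_nonneg) auto
 qed (rule le)
qed

lemma pint_wm:
 "f \<in> borel_measurable borel ==> pint (wm al) f = pint lborel (\<lambda>u. indicator {0<..} u * (u powr (2 * al + 1) * f u))"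
 by (subst nn_integral_wm) (auto intro!: nn_integral_cong simp: indicator_def ennreal_mult')

lemma powr_add_le:
 fixes x y r :: real
 assumes "x \<ge> 0" "y \<ge> 0" "r \<ge> 0"
 shows "(x + y) powr r \<le> 2 powr r * (x powr r + y powr r)"
proof -
 have "(x + y) powr r \<le> (2 * max x y) powr r" using assms by (intro powr_mono2) (auto simp: max_def)
 thus ?thesis using assms by (auto simp: powr_mult max_def distrib_left split: if_splits intro: order_trans)
qed

lemma powr_add3_le:
 fixes x y z r :: real
 assumes "x \<ge> 0" "y \<ge> 0" "z \<ge> 0" "r \<ge> 0"
 shows "(x + y + z) powr r \<le> 4 powr r * (x powr r + y powr r + z powr r)"
proof -
 have "(x + y + z) powr r \<le> 2 powr r * (2 powr r * (x powr r + y powr r) + z powr r)"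
  using assms by (intro order_trans[OF powr_add_le] mult_left_mono add_right_mono powr_add_le) auto
 also have "\<dots> \<le> 2 powr r * (2 powr r * (x powr r + y powr r) + 2 powr r * z powr r)"
  using mult_right_mono[OF ge_one_powr_ge_zero[of 2 r], of "z powr r"] assms by (intro mult_left_mono add_left_mono) auto
 also have "\<dots> = 4 powr r * (x powr r + y powr r + z powr r)"
  using powr_mult[of 2 2 r] by (simp add: algebra_simps)
 finally show ?thesis .
qed

lemma front_powr_le:
 assumes "r > 0"
 shows "(1 + bump g y + bump g z) powr r \<le> 4 powr r * (1 + bump (g * r) y + bump (g * r) z)"
proof -
 have "bump g x powr r = bump (g * r) x" for x using assms by (simp add: bump_def powr_powr)
 thus ?thesis using powr_add3_le[of 1 "bump g y" "bump g z" r] assms by simp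
qed

text \<open>\<open>gr\<close> is condition (i) in terms of g. The weight is u^d near 0, with d > 0
  so that it is integrable against du / u; \<open>dr\<close> and \<open>upper\<close> then say that
  the dual moments of the kernel converge at u = 0. For d = 0 the last one would be the upper bound
  in (ii).\<close>

locale weighted_estimate = kernel_estimate +
 fixes p r d :: real
 assumes p: "p > 1" and r: "r > 1" and pr: "1/p + 1/r = 1" and gr: "g * r > -1"
  and d: "d > 0" and dr: "d * (r - 1) < 2 * al + 2" and upper: "(be - 1) * r + 2 * al + 2 - d * (r - 1) > 0"
begin

lemma p_r: "p * (r - 1) = r"
 using p r pr by (auto simp: field_simps)

text \<open>\<open>strong_power\<close> with q = p and a weight independent of t: u^d near 0 and
  u^(-e) at infinity are integrable against du / u, so \<open>strong_dilation\<close> handles the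
  weight in L^1.\<close>

lemma strong_weighted:
 assumes [measurable]: "\<And>t. N t \<in> borel_measurable borel" and N0: "\<And>t u. N t u \<ge> 0" and e: "e > 0"
  and D: "\<And>t. t > 0 ==> pint (wm al) (\<lambda>u. N t u powr r * (if u < 2 then u powr (d * (1 - r)) else u powr (e * (r - 1)))) \<le> ennreal D"
 shows "strong al p N"
proof -
 define w where "w u = (if u < 2 then u powr d else u powr (- e))" for u :: real
 have [measurable]: "w \<in> borel_measurable borel" unfolding w_def[abs_def] by measurable
 have w: "w u \<ge> 0" "u > 0 ==> w u \<noteq> 0" for u by (auto simp: w_def)
 obtain D' where D': "D' \<ge> 0" "pint lborel (\<lambda>u. indicator {0<..} u * (if u < 2 then u powr (d - 1) else u powr (- e - 1))) \<le> ennreal D'"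
  using nn_integral_two_powers[of "d - 1" "- e - 1"] d e by auto
 have "pint (wm al) (\<lambda>u. w u * u powr (-(2*al+2))) = pint lborel (\<lambda>u. indicator {0<..} u * (if u < 2 then u powr (d - 1) else u powr (- e - 1)))"
 proof (subst pint_wm, measurable, intro nn_integral_cong arg_cong[where f = ennreal])
  fix u :: real
  have "u powr (2*al+1) * (u powr k * u powr (-(2*al+2))) = u powr (k - 1)" for k by (simp flip: powr_add)
  thus "indicator {0<..} u * (u powr (2*al+1) * (w u * u powr (-(2*al+2)))) = indicator {0<..} u * (if u < 2 then u powr (d - 1) else u powr (- e - 1))"
   by (simp add: w_def)
 qed
 hence W: "strong al (p/p) (\<lambda>t. w)" using D' w p by (simp add: strong_dilation)
 have e: "w u powr (1 - r) = (if u < 2 then u powr (d * (1 - r)) else u powr (e * (r - 1)))" for u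
  by (simp add: w_def powr_powr algebra_simps)
 show ?thesis
 proof (rule strong_power[OF W p r pr])
  show "pint (wm al) (\<lambda>u. N t u powr r * w u powr (1 - r)) \<le> ennreal D" if "t > 0" for t
   unfolding e by (rule D[OF that])
  show "N t u = 0" if "u > 0" "w u = 0" for t u using w(2)[OF that(1)] that(2) by simp
 qed (use p N0 w in simp_all)
qed

text \<open>Both terms of \<open>sing\<close> fit \<open>nn_integral_two_singularities\<close>. When
  the singular point s meets 0, the exponents add up to (be - 1) r or 0, plus the exponent of the
  weighted measure, which is where \<open>upper\<close> and \<open>dr\<close> enter.\<close>

lemma sing_moment:
 assumes M: "M > 0"
 shows "\<exists>D\<ge>0. \<forall>s. pint (wm al) (\<lambda>u. indicator {0<..<M} u * (sing s u powr r * u powr (d * (1 - r)))) \<le> ennreal D"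
proof -
 define e where "e = 2 * al + 1 + d * (1 - r)"
 have m: "g \<le> sing_m" "sing_m \<le> 0" using g by (auto simp: sing_m_def)
 have b: "(be - 1) * r + e > -1" "e > -1" using upper dr by (auto simp: e_def algebra_simps)
 have "\<exists>C\<ge>0. \<forall>s. pint lborel (\<lambda>u. indicator {0<..<M} u * (\<bar>u - s\<bar> powr (g * r) * u powr ((be - 1 - g) * r + e))) \<le> ennreal C"
  using gr g r b M by (intro nn_integral_two_singularities) (auto simp: algebra_simps mult_nonpos_nonneg)
 then obtain C1 where C1: "C1 \<ge> 0" "\<And>s. pint lborel (\<lambda>u. indicator {0<..<M} u * (\<bar>u - s\<bar> powr (g * r) * u powr ((be - 1 - g) * r + e))) \<le> ennreal C1" by blast
 have mr: "-1 < sing_m * r" "sing_m * r \<le> 0"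
  using order.strict_trans2[OF gr mult_right_mono[OF m(1)]] r m(2) by (auto simp: mult_nonpos_nonneg)
 have "(sing_m + sing_n) * r + e > -1" using b by (auto simp: sing_m_def sing_n_def min_def)
 hence mn: "sing_m * r + (sing_n * r + e) > -1" by (simp add: algebra_simps)
 obtain C2 where C2: "C2 \<ge> 0" "\<And>s. pint lborel (\<lambda>u. indicator {0<..<M} u * (\<bar>u - s\<bar> powr (sing_m * r) * u powr (sing_n * r + e))) \<le> ennreal C2"
  using nn_integral_two_singularities[OF mr mn M] by blast
 show ?thesis
 proof (intro exI[of _ "2 powr r * (C1 + C2)"] conjI allI)
  fix s
  have "pint (wm al) (\<lambda>u. indicator {0<..<M} u * (sing s u powr r * u powr (d * (1 - r))))
   \<le> (\<integral>\<^sup>+u. ennreal (2 powr r) * (ennreal (indicator {0<..<M} u * (\<bar>u - s\<bar> powr (g * r) * u powr ((be - 1 - g) * r + e)))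
     + ennreal (indicator {0<..<M} u * (\<bar>u - s\<bar> powr (sing_m * r) * u powr (sing_n * r + e)))) \<partial>lborel)"
  proof (subst pint_wm, unfold sing_def, measurable, rule nn_integral_mono)
   fix u :: real
   let ?x = "\<bar>u - s\<bar> powr g * u powr (be - 1 - g)" and ?y = "\<bar>u - s\<bar> powr sing_m * u powr sing_n"
   have "u powr (2 * al + 1) * ((?x + ?y) powr r * u powr (d * (1 - r))) = (?x + ?y) powr r * u powr e"
    by (simp add: e_def powr_add)
   also have "\<dots> \<le> 2 powr r * (?x powr r + ?y powr r) * u powr e" using r by (intro mult_right_mono powr_add_le) auto
   also have "\<dots> = 2 powr r * (\<bar>u - s\<bar> powr (g * r) * u powr ((be - 1 - g) * r + e) + \<bar>u - s\<bar> powr (sing_m * r) * u powr (sing_n * r + e))"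
    by (simp add: powr_mult powr_powr powr_add distrib_left distrib_right mult.assoc)
   finally have "indicator {0<..} u * (u powr (2 * al + 1) * (indicator {0<..<M} u * ((?x + ?y) powr r * u powr (d * (1 - r)))))
    \<le> 2 powr r * (indicator {0<..<M} u * (\<bar>u - s\<bar> powr (g * r) * u powr ((be - 1 - g) * r + e)) + indicator {0<..<M} u * (\<bar>u - s\<bar> powr (sing_m * r) * u powr (sing_n * r + e)))"
    by (cases "u \<in> {0<..<M}") auto
   thus "ennreal (indicator {0<..} u * (u powr (2 * al + 1) * (indicator {0<..<M} u * ((?x + ?y) powr r * u powr (d * (1 - r))))))
    \<le> ennreal (2 powr r) * (ennreal (indicator {0<..<M} u * (\<bar>u - s\<bar> powr (g * r) * u powr ((be - 1 - g) * r + e)))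
     + ennreal (indicator {0<..<M} u * (\<bar>u - s\<bar> powr (sing_m * r) * u powr (sing_n * r + e))))"
    by (simp add: ennreal_mult[symmetric] ennreal_leI flip: ennreal_plus)
  qed
  also have "\<dots> \<le> ennreal (2 powr r) * (ennreal C1 + ennreal C2)"
   by (subst nn_integral_cmult, measurable, subst nn_integral_add, measurable) (intro mult_left_mono add_mono C1 C2, simp)
  finally show "pint (wm al) (\<lambda>u. indicator {0<..<M} u * (sing s u powr r * u powr (d * (1 - r)))) \<le> ennreal (2 powr r * (C1 + C2))"
   using C1 C2 by (simp add: ennreal_mult)
 qed (use C1 C2 in auto)
qed

lemma bulk_moment:
 assumes c: "c > 0" "c \<le> b" "1 \<le> b" and M: "M > 0"
 shows "\<exists>D\<ge>0. \<forall>t\<in>{c..b}. pint (wm al) (\<lambda>u. indicator {0<..<M} u * (ak t u powr r * u powr (d * (1 - r)))) \<le> ennreal D"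
proof -
 obtain C where C: "C > 0" "\<And>t u. c \<le> t ==> t \<le> b ==> 0 < u ==> ak t u \<le> C * (sing (t - 1) u + sing (1 - t) u + sing (t + 1) u)"
  using sk_bounded_range[OF c] by blast
 obtain D where D: "D \<ge> 0" "\<And>s. pint (wm al) (\<lambda>u. indicator {0<..<M} u * (sing s u powr r * u powr (d * (1 - r)))) \<le> ennreal D"
  using sing_moment[OF M] by blast
 have [measurable]: "sing s \<in> borel_measurable borel" for s unfolding sing_def[abs_def] by measurable
 let ?f = "\<lambda>s u. indicator {0<..<M} u * (sing s u powr r * u powr (d * (1 - r)))"
 show ?thesis
 proof (intro exI[of _ "C powr r * 4 powr r * (3 * D)"] conjI ballI)
  fix t assume t: "t \<in> {c..b}"
  have "pint (wm al) (\<lambda>u. indicator {0<..<M} u * (ak t u powr r * u powr (d * (1 - r))))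
   \<le> (\<integral>\<^sup>+u. ennreal (C powr r * 4 powr r) * (ennreal (?f (t - 1) u) + ennreal (?f (1 - t) u) + ennreal (?f (t + 1) u)) \<partial>wm al)"
  proof (rule nn_integral_wm_mono)
   fix u :: real assume u: "u > 0"
   have "ak t u powr r \<le> (C * (sing (t - 1) u + sing (1 - t) u + sing (t + 1) u)) powr r"
    using C(2)[of t u] t u r by (intro powr_mono2) auto
   also have "\<dots> \<le> C powr r * (4 powr r * (sing (t - 1) u powr r + sing (1 - t) u powr r + sing (t + 1) u powr r))"
    using C r by (subst powr_mult) (auto intro!: mult_left_mono powr_add3_le add_nonneg_nonneg)
   finally have "ak t u powr r * u powr (d * (1 - r)) \<le> C powr r * (4 powr r * (sing (t - 1) u powr r + sing (1 - t) u powr r + sing (t + 1) u powr r)) * u powr (d * (1 - r))"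
    by (rule mult_right_mono) simp
   hence "indicator {0<..<M} u * (ak t u powr r * u powr (d * (1 - r))) \<le> C powr r * 4 powr r * (?f (t - 1) u + ?f (1 - t) u + ?f (t + 1) u)"
    by (cases "u \<in> {0<..<M}") (auto simp: algebra_simps)
   thus "ennreal (indicator {0<..<M} u * (ak t u powr r * u powr (d * (1 - r)))) \<le> ennreal (C powr r * 4 powr r) * (ennreal (?f (t - 1) u) + ennreal (?f (1 - t) u) + ennreal (?f (t + 1) u))"
    by (simp add: ennreal_mult[symmetric] ennreal_leI flip: ennreal_plus)
  qed
  also have "\<dots> \<le> ennreal (C powr r * 4 powr r) * (ennreal D + ennreal D + ennreal D)"
   by (subst nn_integral_cmult, measurable, (subst nn_integral_add, measurable)+) (intro mult_left_mono add_mono D, simp)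
  finally show "pint (wm al) (\<lambda>u. indicator {0<..<M} u * (ak t u powr r * u powr (d * (1 - r)))) \<le> ennreal (C powr r * 4 powr r * (3 * D))"
   using D by (simp add: ennreal_mult[symmetric] flip: ennreal_plus)
 qed (use D in auto)
qed

lemma strong_bulk: "strong al p (\<lambda>t u. if 1/4 \<le> t \<and> t \<le> 4 \<and> u < 2 then ak t u else 0)"
proof -
 obtain D where D: "D \<ge> 0" "\<And>t. t \<in> {1/4..4} ==> pint (wm al) (\<lambda>u. indicator {0<..<2} u * (ak t u powr r * u powr (d * (1 - r)))) \<le> ennreal D"
  using bulk_moment[of "1/4" 4 2] by auto
 show ?thesis
 \<comment> \<open>The exponent at infinity is arbitrary, since the kernel is cut off at u <
   2.\<close>
 proof (rule strong_weighted[where e = 1 and D = D])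
  fix t :: real assume "t > 0"
  show "pint (wm al) (\<lambda>u. (if 1/4 \<le> t \<and> t \<le> 4 \<and> u < 2 then ak t u else 0) powr r * (if u < 2 then u powr (d * (1 - r)) else u powr (1 * (r - 1)))) \<le> ennreal D"
  proof (cases "t \<in> {1/4..4}")
   case True
   show ?thesis by (rule order_trans[OF nn_integral_wm_mono D(2)[OF True]]) (use True r in \<open>simp add: indicator_def\<close>)
  next
   case False
   thus ?thesis using r by (cases "t < 1/4") auto
  qed
 qed auto
qed

lemma strong_far: "strong al p (\<lambda>t u. if 4 \<le> t \<and> 2 * u \<le> t then ak t u else 0)"
proof -
 obtain C where C: "C > 0" "\<And>t u. 4 \<le> t ==> 0 < u ==> 2 * u \<le> t ==> ak t u \<le> C * t powr (-(2*al+2))"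
  using sk_far by blast
 define a where "a = 2 * al + 1 + d * (1 - r)"
 have a: "a > -1" using dr by (simp add: a_def algebra_simps)
 define K where "K = C powr r * (1 / (a + 1) + 1 / (2 * al + 1 + 1))"
 have K: "K \<ge> 0" using a al by (simp add: K_def)
 show ?thesis
 \<comment> \<open>The midpoint of 0 and 2 al + 2: e has to be positive, and at most 2 al + 2 for
   the resulting powers of t to be nonpositive.\<close>
 proof (rule strong_weighted[where e = "al + 1" and D = K])
  fix t :: real assume "t > 0"
  let ?N = "\<lambda>u. if 4 \<le> t \<and> 2 * u \<le> t then ak t u else 0"
  let ?W = "\<lambda>u. if u < 2 then u powr (d * (1 - r)) else u powr ((al + 1) * (r - 1))"
  show "pint (wm al) (\<lambda>u. ?N u powr r * ?W u) \<le> ennreal K"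
  proof (cases "t \<ge> 4")
   case t: True
   define k where "k = C powr r * t powr (-(2*al+2) * r)"
   have "pint (wm al) (\<lambda>u. ?N u powr r * ?W u)
    \<le> (\<integral>\<^sup>+u. ennreal k * (ennreal (indicator {0<..<t} u * u powr a) + ennreal (t powr ((al + 1) * (r - 1))) * ennreal (indicator {0<..<t} u * u powr (2 * al + 1))) \<partial>lborel)"
   proof (subst pint_wm, measurable, rule nn_integral_mono)
    fix u :: real
    have "indicator {0<..} u * (u powr (2 * al + 1) * (?N u powr r * ?W u)) \<le> k * (indicator {0<..<t} u * u powr a + t powr ((al + 1) * (r - 1)) * (indicator {0<..<t} u * u powr (2 * al + 1)))"
    proof (cases "u > 0 \<and> 2 * u \<le> t")
     case True
     have "?N u powr r \<le> (C * t powr (-(2*al+2))) powr r" using C(2)[of t u] t True r by (intro powr_mono2) auto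
     also have "\<dots> = k" unfolding k_def using C by (simp only: powr_mult powr_powr)
     finally have "?N u powr r \<le> k" .
     moreover have "?W u \<le> u powr (d * (1 - r)) + t powr ((al + 1) * (r - 1))"
      using True al r by (auto intro: order_trans[OF powr_mono2[of _ u t]])
     ultimately have "u powr (2 * al + 1) * (?N u powr r * ?W u) \<le> u powr (2 * al + 1) * (k * (u powr (d * (1 - r)) + t powr ((al + 1) * (r - 1))))"
      by (intro mult_left_mono mult_mono) (auto simp: k_def)
     also have "\<dots> = k * (u powr a + t powr ((al + 1) * (r - 1)) * u powr (2 * al + 1))"
      unfolding a_def powr_add[of u _ "d * (1 - r)"] by (simp only: distrib_left mult_ac)
     finally show ?thesis using True t by simp
    qed (use r in \<open>auto simp: k_def\<close>)
    thus "ennreal (indicator {0<..} u * (u powr (2 * al + 1) * (?N u powr r * ?W u))) \<le> ennreal k * (ennreal (indicator {0<..<t} u * u powr a) + ennreal (t powr ((al + 1) * (r - 1))) * ennreal (indicator {0<..<t} u * u powr (2 * al + 1)))"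
     by (simp add: k_def ennreal_mult[symmetric] ennreal_leI flip: ennreal_plus)
   qed
   also have "\<dots> = ennreal k * (ennreal (t powr (a + 1) / (a + 1)) + ennreal (t powr ((al + 1) * (r - 1))) * ennreal (t powr (2 * al + 1 + 1) / (2 * al + 1 + 1)))"
    using nn_integral_powr_0[OF a, of t] nn_integral_powr_0[of "2 * al + 1" t] al t by (simp add: nn_integral_cmult nn_integral_add)
   also have "\<dots> = ennreal (k * (t powr (a + 1) / (a + 1) + t powr ((al + 1) * (r - 1)) * (t powr (2 * al + 1 + 1) / (2 * al + 1 + 1))))"
    using a al by (simp add: k_def ennreal_mult[symmetric] flip: ennreal_plus)
   also have "k * (t powr (a + 1) / (a + 1) + t powr ((al + 1) * (r - 1)) * (t powr (2 * al + 1 + 1) / (2 * al + 1 + 1)))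
    = C powr r * (t powr (-(2*al+2) * r + (a + 1)) / (a + 1) + t powr (-(2*al+2) * r + ((al + 1) * (r - 1) + (2 * al + 1 + 1))) / (2 * al + 1 + 1))"
    by (simp only: k_def powr_add distrib_left times_divide_eq_right times_divide_eq_left mult_ac)
   also have "\<dots> \<le> C powr r * (t powr 0 / (a + 1) + t powr 0 / (2 * al + 1 + 1))"
   proof (intro mult_left_mono add_mono divide_right_mono powr_mono)
    have "(2 * al + 2) * (r - 1) \<ge> 0" "d * (r - 1) \<ge> 0" using al r d by auto
    thus "-(2*al+2) * r + (a + 1) \<le> 0" "-(2*al+2) * r + ((al + 1) * (r - 1) + (2 * al + 1 + 1)) \<le> 0"
     by (auto simp: a_def algebra_simps)
   qed (use a al t in auto)
   finally show ?thesis using t by (simp add: K_def ennreal_leI)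
  qed (use r in simp)
 qed (use al in auto)
qed

lemma near_bound:
 assumes q: "q > 1"
 shows "\<exists>C>0. \<forall>t u. 0 < t --> 2 \<le> u --> t < 2 * u --> ak t u powr q \<le>
   C * (u powr ((-be-2*al-1) * q) * ((1 + \<bar>t - u\<bar>) powr ((be - 1) * q) * (1 + bump (g * q) (t - u - 1) + bump (g * q) (t - u + 1))))"
proof -
 obtain C where C: "C > 0" "\<And>t u. 0 < t ==> 2 \<le> u ==> t < 2 * u ==> ak t u \<le>
   C * (u powr (-be-2*al-1) * ((1 + \<bar>t - u\<bar>) powr (be - 1) * (1 + bump g (t - u - 1) + bump g (t - u + 1))))"
  using sk_near by blast
 show ?thesis
 proof (intro exI[of _ "C powr q * 4 powr q"] conjI allI impI)
  fix t u :: real assume tu: "0 < t" "2 \<le> u" "t < 2 * u"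
  let ?S = "1 + bump g (t - u - 1) + bump g (t - u + 1)"
  have S0: "?S \<ge> 0" by simp
  have "ak t u powr q \<le> (C * (u powr (-be-2*al-1) * ((1 + \<bar>t - u\<bar>) powr (be - 1) * ?S))) powr q"
   using C(2)[OF tu] q by (intro powr_mono2) auto
  also have "\<dots> = C powr q * (u powr ((-be-2*al-1) * q) * ((1 + \<bar>t - u\<bar>) powr ((be - 1) * q) * ?S powr q))"
   using C S0 by (simp only: powr_mult powr_powr mult_nonneg_nonneg powr_ge_zero less_imp_le)
  also have "\<dots> \<le> C powr q * (u powr ((-be-2*al-1) * q) * ((1 + \<bar>t - u\<bar>) powr ((be - 1) * q) * (4 powr q * (1 + bump (g * q) (t - u - 1) + bump (g * q) (t - u + 1)))))"
   using q by (intro mult_left_mono front_powr_le) auto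
  finally show "ak t u powr q \<le> C powr q * 4 powr q * (u powr ((-be-2*al-1) * q) * ((1 + \<bar>t - u\<bar>) powr ((be - 1) * q) * (1 + bump (g * q) (t - u - 1) + bump (g * q) (t - u + 1))))"
   by (simp only: mult_ac)
 qed (use C in simp)
qed

text \<open>Below the critical exponent a power weight handles the part near \<open>t = u\<close>, which acts at unit
 scale; at the critical exponent a maximal operator with a translation invariant kernel is needed.\<close>
lemma strong_near:
 assumes e: "e > 0" "e < 2 * al + 2" "e \<le> be * p + 2 * al + 1"
 shows "strong al p (\<lambda>t u. if 2 \<le> u \<and> t < 2 * u then ak t u else 0)"
proof -
 obtain C where C: "C > 0" "\<And>t u. 0 < t ==> 2 \<le> u ==> t < 2 * u ==> ak t u powr r \<le>
   C * (u powr ((-be-2*al-1) * r) * ((1 + \<bar>t - u\<bar>) powr ((be - 1) * r) * (1 + bump (g * r) (t - u - 1) + bump (g * r) (t - u + 1))))"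
  using near_bound[OF r] by blast
 \<comment> \<open>With the weight the integrand is u^(-E) (1 + |t - u|)^((be - 1) r), and E \<ge> 0
   by the lower bound in (ii). Since 1 + |t - u| \<le> 2 u, the factor u^(-E) is traded for decay in
   |t - u|, and the total exponent becomes -1 - f.\<close>
 define f where "f = (2 * al + 2 - e) * (r - 1)"
 define E where "E = (be + 2 * al + 1) * r - e * (r - 1) - 2 * al - 1"
 have f: "f > 0" using e r by (simp add: f_def)
 have "e * (r - 1) \<le> (be * p + 2 * al + 1) * (r - 1)" using e r by (intro mult_right_mono) auto
 also have "\<dots> = be * (p * (r - 1)) + (2 * al + 1) * (r - 1)" by (simp add: algebra_simps)
 finally have E: "E \<ge> 0" unfolding p_r E_def by (simp add: algebra_simps)
 obtain D where D: "D \<ge> 0" "\<And>t. pint lborel (\<lambda>u. (1 + \<bar>t - u\<bar>) powr (-1 - f) * (1 + bump (g * r) (t - u - 1) + bump (g * r) (t - u + 1))) \<le> ennreal D"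
  using nn_integral_front[of "g * r" f] f gr g r by (auto simp: mult_nonpos_nonneg)
 show ?thesis
 proof (rule strong_weighted[where e = e and D = "C * 2 powr E * D"])
  fix t :: real assume t: "t > 0"
  let ?N = "\<lambda>u. if 2 \<le> u \<and> t < 2 * u then ak t u else 0"
  let ?W = "\<lambda>u. if u < 2 then u powr (d * (1 - r)) else u powr (e * (r - 1))"
  let ?S = "\<lambda>u. 1 + bump (g * r) (t - u - 1) + bump (g * r) (t - u + 1)"
  have "pint (wm al) (\<lambda>u. ?N u powr r * ?W u) \<le> (\<integral>\<^sup>+u. ennreal (C * 2 powr E) * ennreal ((1 + \<bar>t - u\<bar>) powr (-1 - f) * ?S u) \<partial>lborel)"
  proof (subst pint_wm, measurable, rule nn_integral_mono)
   fix u :: real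
   have "indicator {0<..} u * (u powr (2 * al + 1) * (?N u powr r * ?W u)) \<le> C * 2 powr E * ((1 + \<bar>t - u\<bar>) powr (-1 - f) * ?S u)"
   proof (cases "2 \<le> u \<and> t < 2 * u")
    case True
    define h where "h = 1 + \<bar>t - u\<bar>"
    have h: "h > 0" "h \<le> 2 * u" using True t by (auto simp: h_def)
    have "u powr (2 * al + 1) * (?N u powr r * ?W u) \<le> u powr (2 * al + 1) * (C * (u powr ((-be-2*al-1) * r) * (h powr ((be - 1) * r) * ?S u)) * u powr (e * (r - 1)))"
     using C(2)[of t u] True t by (intro mult_left_mono) (auto intro!: mult_right_mono simp: h_def)
    also have "\<dots> = C * ((u powr (2 * al + 1) * u powr ((-be-2*al-1) * r) * u powr (e * (r - 1))) * (h powr ((be - 1) * r) * ?S u))" by (simp only: mult_ac)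
    also have "u powr (2 * al + 1) * u powr ((-be-2*al-1) * r) * u powr (e * (r - 1)) = u powr - E"
     unfolding powr_add[symmetric] by (rule arg_cong[where f = "\<lambda>e. u powr e"]) (simp add: E_def algebra_simps)
    also have "C * (u powr - E * (h powr ((be - 1) * r) * ?S u)) \<le> C * ((h / 2) powr - E * (h powr ((be - 1) * r) * ?S u))"
     using h E C by (intro mult_left_mono mult_right_mono powr_mono2') auto
    also have "(h / 2) powr - E = 2 powr E * h powr - E" using h by (simp add: powr_divide powr_minus_divide)
    also have "C * (2 powr E * h powr - E * (h powr ((be - 1) * r) * ?S u)) = C * 2 powr E * ((h powr - E * h powr ((be - 1) * r)) * ?S u)" by (simp only: mult_ac)
    also have "h powr - E * h powr ((be - 1) * r) = h powr (-1 - f)"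
     unfolding powr_add[symmetric] by (rule arg_cong[where f = "\<lambda>e. h powr e"]) (simp add: E_def f_def algebra_simps)
    finally show ?thesis using True C by (simp add: h_def)
   qed (use C r in \<open>auto intro!: mult_nonneg_nonneg\<close>)
   thus "ennreal (indicator {0<..} u * (u powr (2 * al + 1) * (?N u powr r * ?W u))) \<le> ennreal (C * 2 powr E) * ennreal ((1 + \<bar>t - u\<bar>) powr (-1 - f) * ?S u)"
    using C by (simp add: ennreal_mult'[symmetric] ennreal_leI)
  qed
  also have "\<dots> \<le> ennreal (C * 2 powr E) * ennreal D"
   by (subst nn_integral_cmult, measurable) (intro mult_left_mono D, simp)
  finally show "pint (wm al) (\<lambda>u. ?N u powr r * ?W u) \<le> ennreal (C * 2 powr E * D)" using C D by (simp add: ennreal_mult)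
 qed (use e in auto)
qed

text \<open>g r > -1 is an open condition, so r may be enlarged to s, that is, p lowered to q. The
  remaining exponent p/q exceeds 1, as the maximal theorems require.\<close>

lemma smaller_exponent: "\<exists>q s. 1 < q \<and> q < p \<and> s > 1 \<and> 1/q + 1/s = 1 \<and> g * s > -1"
proof -
 have "r < -1 / g" using gr g by (simp add: field_simps)
 then obtain s where s: "r < s" "s < -1 / g" using dense by blast
 have s1: "s > 1" using s r by simp
 define q where "q = s / (s - 1)"
 have q: "1/q + 1/s = 1" "1 < q" using s1 by (auto simp: q_def field_simps)
 have "1 / s < 1 / r" using s r by (intro divide_strict_left_mono) auto
 hence "1 / p < 1 / q" using q pr by linarith
 hence "q < p" using q p by (simp add: field_simps)
 moreover have "g * s > -1" using s g by (simp add: field_simps)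
 ultimately show ?thesis using q s1 by blast
qed

text \<open>No positive e is left for \<open>strong_near\<close>. Hoelder's inequality with q < p
  splits off the weight (1 + |t - u|)^(be - 1), which is at most 1 and integrable as be < 0, so
  \<open>strong_unit_scale\<close> applies on the half-line and \<open>strong_transfer\<close>
  returns to \<open>wm al\<close>. At criticality the power of u left in the dual moment is exactly
  0.\<close>

lemma strong_near_critical:
 assumes be: "be < 0" and crit: "be * p + 2 * al + 1 = 0"
 shows "strong al p (\<lambda>t u. if 2 \<le> u \<and> t < 2 * u then ak t u else 0)"
proof -
 obtain q s where qs: "1 < q" "q < p" "s > 1" "1/q + 1/s = 1" "g * s > -1" using smaller_exponent by blast
 have sq: "q * (1 - s) = - s" using qs by (simp add: field_simps)
 obtain C where C: "C > 0" "\<And>t u. 0 < t ==> 2 \<le> u ==> t < 2 * u ==> ak t u powr s \<le>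
   C * (u powr ((-be-2*al-1) * s) * ((1 + \<bar>t - u\<bar>) powr ((be - 1) * s) * (1 + bump (g * s) (t - u - 1) + bump (g * s) (t - u + 1))))"
  using near_bound[OF qs(3)] by blast
 define w where "w t u = (1 + \<bar>t - u\<bar>) powr (be - 1)" for t u :: real
 have [measurable]: "w t \<in> borel_measurable borel" for t unfolding w_def[abs_def] by measurable
 have w: "w t u \<ge> 0" "w t u > 0" "w t u \<le> 1" for t u
  using powr_mono2'[of "be - 1" 1 "1 + \<bar>t - u\<bar>"] be by (auto simp: w_def)
 have gs: "g * s \<le> 0" using g qs by (simp add: mult_nonpos_nonneg)
 obtain D where D: "D \<ge> 0" "\<And>t. pint lborel (\<lambda>u. w t u * (1 + bump (g * s) (t - u - 1) + bump (g * s) (t - u + 1))) \<le> ennreal D"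
  using nn_integral_front[OF qs(5) gs, of "-be"] be by (auto simp: w_def add.commute)
 have "strong (-1/2) (p/q) w"
 proof (rule strong_unit_scale[OF _ w(1,3) D(1)])
  fix t
  show "pint (wm (-1/2)) (w t) \<le> ennreal D"
   by (subst pint_wm, measurable, rule order_trans[OF nn_integral_mono D(2)[of t]])
     (use w in \<open>auto simp: indicator_def intro!: ennreal_leI mult_left_mono[of 1, simplified]\<close>)
 qed (use qs in auto)
 hence "strong al (p/q) (\<lambda>t u. w t u * u powr ((2*al+1)/(p/q) - (2*al+1)))"
  using p qs w by (intro strong_transfer) auto
 also have "(2*al+1)/(p/q) - (2*al+1) = -be * q - (2*al+1)"
 proof -
  have "2*al+1 = -be * p" using crit by simp
  thus ?thesis using p by simp
 qed
 finally have W: "strong al (p/q) (\<lambda>t u. w t u * u powr (-be * q - (2*al+1)))" .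
 show ?thesis
 proof (rule strong_power[OF W qs(1,3,4), where D = "C * D"])
  fix t :: real assume t: "t > 0"
  let ?N = "\<lambda>u. if 2 \<le> u \<and> t < 2 * u then ak t u else 0"
  let ?W = "\<lambda>u. w t u * u powr (-be * q - (2*al+1))"
  let ?S = "\<lambda>u. 1 + bump (g * s) (t - u - 1) + bump (g * s) (t - u + 1)"
  have "pint (wm al) (\<lambda>u. ?N u powr s * ?W u powr (1 - s)) \<le> (\<integral>\<^sup>+u. ennreal C * ennreal (w t u * ?S u) \<partial>lborel)"
  proof (subst pint_wm, measurable, rule nn_integral_mono)
   fix u :: real
   have "indicator {0<..} u * (u powr (2 * al + 1) * (?N u powr s * ?W u powr (1 - s))) \<le> C * (w t u * ?S u)"
   proof (cases "2 \<le> u \<and> t < 2 * u")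
    case True
    let ?h = "1 + \<bar>t - u\<bar>"
    have "?W u powr (1 - s) = ?h powr ((be - 1) * (1 - s)) * u powr ((-be * q - (2*al+1)) * (1 - s))"
     by (simp only: w_def powr_mult powr_powr powr_ge_zero)
    hence "u powr (2 * al + 1) * (?N u powr s * ?W u powr (1 - s)) \<le> u powr (2 * al + 1) * (C * (u powr ((-be-2*al-1) * s) * (?h powr ((be - 1) * s) * ?S u))
      * (?h powr ((be - 1) * (1 - s)) * u powr ((-be * q - (2*al+1)) * (1 - s))))"
     using C(2)[of t u] True t by (intro mult_left_mono) (auto intro!: mult_right_mono)
    also have "\<dots> = C * ((u powr (2 * al + 1) * u powr ((-be-2*al-1) * s) * u powr ((-be * q - (2*al+1)) * (1 - s))) * ((?h powr ((be - 1) * s) * ?h powr ((be - 1) * (1 - s))) * ?S u))"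
     by (simp only: mult_ac)
    also have "?h powr ((be - 1) * s) * ?h powr ((be - 1) * (1 - s)) = w t u"
     unfolding powr_add[symmetric] w_def by (rule arg_cong[where f = "\<lambda>e. ?h powr e"]) (simp add: algebra_simps)
    also have "u powr (2 * al + 1) * u powr ((-be-2*al-1) * s) * u powr ((-be * q - (2*al+1)) * (1 - s)) = u powr 0"
    proof -
     have "(-be * q - (2*al+1)) * (1 - s) = -be * (q * (1 - s)) - (2*al+1) * (1 - s)" by (simp add: algebra_simps)
     hence "2 * al + 1 + (-be-2*al-1) * s + (-be * q - (2*al+1)) * (1 - s) = 0" unfolding sq by (simp add: algebra_simps)
     thus ?thesis unfolding powr_add[symmetric] by simp
    qed
    finally show ?thesis using True by simp
   qed (use C qs w in \<open>auto intro!: mult_nonneg_nonneg\<close>)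
   thus "ennreal (indicator {0<..} u * (u powr (2 * al + 1) * (?N u powr s * ?W u powr (1 - s)))) \<le> ennreal C * ennreal (w t u * ?S u)"
    using C by (simp add: ennreal_mult'[symmetric] ennreal_leI)
  qed
  also have "\<dots> \<le> ennreal C * ennreal D"
   by (subst nn_integral_cmult, measurable) (intro mult_left_mono D, simp)
  finally show "pint (wm al) (\<lambda>u. ?N u powr s * ?W u powr (1 - s)) \<le> ennreal (C * D)" using C D by (simp add: ennreal_mult)
 next
  fix t u :: real assume "u > 0" "w t u * u powr (-be * q - (2*al+1)) = 0"
  thus "(if 2 \<le> u \<and> t < 2 * u then ak t u else 0) = 0" using w(2)[of t u] by simp
 qed (use p w in auto)
qed

text \<open>The averages over |1 - u| < t serve as weight and are controlled in L^(p/q) by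
  \<open>strong_hardy_littlewood\<close>. What remains is the s-th moment of (1 - v)^g in v = |1 -
  u| / t, finite because g s > -1.\<close>

lemma strong_local: "strong al p (\<lambda>t u. if t < 1/4 \<and> \<bar>1 - u\<bar> < t then ak t u else 0)"
proof -
 obtain q s where qs: "1 < q" "q < p" "s > 1" "1/q + 1/s = 1" "g * s > -1" using smaller_exponent by blast
 obtain C where C: "C > 0" "\<And>t u. 0 < t ==> t < 1/4 ==> \<bar>1 - u\<bar> < t ==> ak t u \<le> C * (1 / t * (1 - \<bar>1 - u\<bar> / t) powr g)"
  using sk_local by blast
 let ?w = "\<lambda>t u. if \<bar>1 - u\<bar> < t then 1 / t else 0 :: real"
 define k where "k = (2*al+1)/(p/q) - (2*al+1)"
 have w0: "?w t u \<ge> 0" for t u by auto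
 have W: "strong al (p/q) (\<lambda>t u. ?w t u * u powr k)"
  unfolding k_def using strong_hardy_littlewood[of "p/q"] p qs w0 by (intro strong_transfer) auto
 define a where "a = g * s"
 have a: "a > -1" "a \<le> 0" using qs g by (auto simp: a_def mult_nonpos_nonneg)
 define e where "e = 2 * al + 1 + k * (1 - s)"
 define K where "K = C powr s * ((3/4) powr e + (5/4) powr e)"
 have K: "K \<ge> 0" by (simp add: K_def)
 show ?thesis
 proof (rule strong_power[OF W qs(1,3,4), where D = "K * (2 + 4 / (a + 1))"])
  fix t :: real assume t: "t > 0"
  let ?N = "\<lambda>u. if t < 1/4 \<and> \<bar>1 - u\<bar> < t then ak t u else 0"
  let ?f = "\<lambda>u. if \<bar>1 - u\<bar> < t then (1 - \<bar>1 - u\<bar> / t) powr a else 0"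
  have "pint (wm al) (\<lambda>u. ?N u powr s * (?w t u * u powr k) powr (1 - s)) \<le> (\<integral>\<^sup>+u. ennreal (K * (1 / t)) * ennreal (?f u) \<partial>lborel)"
  proof (subst pint_wm, measurable, rule nn_integral_mono)
   fix u :: real
   have "indicator {0<..} u * (u powr (2 * al + 1) * (?N u powr s * (?w t u * u powr k) powr (1 - s))) \<le> K * (1 / t) * ?f u"
   proof (cases "t < 1/4 \<and> \<bar>1 - u\<bar> < t")
    case True
    hence u: "3/4 \<le> u" "u \<le> 5/4" "\<bar>1 - u\<bar> / t \<le> 1" using t by auto
    have "?N u powr s \<le> (C * (1 / t * (1 - \<bar>1 - u\<bar> / t) powr g)) powr s" using C(2)[of t u] True t qs by (intro powr_mono2) auto
    also have "\<dots> = C powr s * ((1 / t) powr s * (1 - \<bar>1 - u\<bar> / t) powr a)"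
     using C t by (simp only: powr_mult powr_powr a_def powr_ge_zero mult_nonneg_nonneg divide_nonneg_nonneg less_imp_le zero_le_one)
    finally have "u powr (2 * al + 1) * (?N u powr s * (1 / t * u powr k) powr (1 - s)) \<le> u powr (2 * al + 1) * (C powr s * ((1 / t) powr s * (1 - \<bar>1 - u\<bar> / t) powr a) * (1 / t * u powr k) powr (1 - s))"
     by (intro mult_left_mono mult_right_mono) auto
    also have "\<dots> = C powr s * u powr e * (((1 / t) powr s * (1 / t) powr (1 - s)) * (1 - \<bar>1 - u\<bar> / t) powr a)"
     using t by (subst powr_mult) (auto simp: e_def powr_add powr_powr mult_ac)
    also have "(1 / t) powr s * (1 / t) powr (1 - s) = 1 / t" unfolding powr_add[symmetric] using t by simp
    also have "C powr s * u powr e * (1 / t * (1 - \<bar>1 - u\<bar> / t) powr a) \<le> K * (1 / t * (1 - \<bar>1 - u\<bar> / t) powr a)"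
     unfolding K_def using u t by (intro mult_right_mono mult_left_mono powr_le_add_endpoints) auto
    finally show ?thesis using True u by (simp add: mult.assoc)
   qed (use qs K t in \<open>auto intro!: mult_nonneg_nonneg\<close>)
   thus "ennreal (indicator {0<..} u * (u powr (2 * al + 1) * (?N u powr s * (?w t u * u powr k) powr (1 - s)))) \<le> ennreal (K * (1 / t)) * ennreal (?f u)"
    using K t by (simp add: ennreal_mult'[symmetric] ennreal_leI)
  qed
  also have "\<dots> = ennreal (K * (1 / t)) * (ennreal t * pint lborel (\<lambda>v. ?f (1 + t * v)))"
   using nn_integral_real_affine[of "\<lambda>u. ennreal (?f u)" t 1] t by (simp add: nn_integral_cmult)
  also have "pint lborel (\<lambda>v. ?f (1 + t * v)) \<le> (\<integral>\<^sup>+v. indicator {-1..1} v + ennreal (bump a (v - 1)) + ennreal (bump a (v - -1)) \<partial>lborel)"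
  proof (rule nn_integral_mono)
   fix v :: real
   have "?f (1 + t * v) = (if \<bar>v\<bar> < 1 then (1 - \<bar>v\<bar>) powr a else 0)" using t by (auto simp: abs_mult)
   also have "\<dots> \<le> indicator {-1..1} v + bump a (v - 1) + bump a (v - -1)"
   proof (cases "\<bar>v\<bar> < 1")
    case True
    hence "(1 - \<bar>v\<bar>) powr a \<le> (1 + bump a (v - 1)) \<or> (1 - \<bar>v\<bar>) powr a \<le> 1 + bump a (v - -1)"
     using powr_le_bump[OF a(2), of "v - 1"] powr_le_bump[OF a(2), of "v - -1"] by (cases "v \<ge> 0") (auto simp: add.commute)
    moreover have "indicator {-1..1} v = (1::real)" using True by (auto simp: indicator_def)
    ultimately show ?thesis using True bump_nonneg[of a "v - 1"] bump_nonneg[of a "v - -1"] by (smt (verit))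
   qed simp
   finally have "?f (1 + t * v) \<le> indicator {-1..1} v + bump a (v - 1) + bump a (v - -1)" .
   thus "ennreal (?f (1 + t * v)) \<le> indicator {-1..1} v + ennreal (bump a (v - 1)) + ennreal (bump a (v - -1))"
    by (simp add: ennreal_leI ennreal_indicator[symmetric] flip: ennreal_plus)
  qed
  also have "\<dots> \<le> ennreal 2 + ennreal (2 / (a + 1)) + ennreal (2 / (a + 1))"
   by (subst nn_integral_add; (measurable)?)+ (intro add_mono nn_integral_bump a, simp)
  also have "\<dots> = ennreal (2 + 2 / (a + 1) + 2 / (a + 1))"
  proof -
   have E: "ennreal x + ennreal y + ennreal z = ennreal (x + y + z)" if "x \<ge> 0" "y \<ge> 0" "z \<ge> 0" for x y z :: real
    using that by simp
   show ?thesis by (rule E) (use a in simp_all)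
  qed
  also have "ennreal (K * (1 / t)) * (ennreal t * ennreal (2 + 2 / (a + 1) + 2 / (a + 1))) = ennreal (K * (2 + 4 / (a + 1)))"
   using K t a by (simp add: ennreal_mult[symmetric] del: ennreal_plus)
  finally show "pint (wm al) (\<lambda>u. ?N u powr s * (?w t u * u powr k) powr (1 - s)) \<le> ennreal (K * (2 + 4 / (a + 1)))"
   by (simp add: mult_left_mono)
 qed (use p w0 in auto)
qed

text \<open>The four regions cover everything but |1 - u| \<ge> t, where the kernel vanishes: for u
  \<ge> 2 either t < 2 u or t \<ge> 2 u \<ge> 4; for u < 2 the cases are t < 1/4, t up to 4, and t >
  4 > 2 u.\<close>

lemma strong_sk:
 assumes lower: "be * p + 2 * al + 1 > 0 \<or> (be * p + 2 * al + 1 = 0 \<and> be < 0)"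
 shows "strong al p (\<lambda>t u. ak t u)"
proof -
 let ?part = "\<lambda>P t u. if P t u then ak t u else 0"
 have near: "strong al p (?part (\<lambda>t u. 2 \<le> u \<and> t < 2 * u))"
 proof (cases "be * p + 2 * al + 1 > 0")
  case True
  thus ?thesis using strong_near[of "min (be * p + 2 * al + 1) (al + 1)"] al by auto
 qed (use lower strong_near_critical in auto)
 have add: "strong al p (?part (\<lambda>t u. P t u \<or> Q t u))"
  if "strong al p (?part P)" "strong al p (?part Q)" "\<And>t. ?part P t \<in> borel_measurable borel" "\<And>t. ?part Q t \<in> borel_measurable borel" for P Q
  by (rule strong_mono_add[OF that(1,2), of 1]) (use p that in auto)
 have "strong al p (?part (\<lambda>t u. (1/4 \<le> t \<and> t \<le> 4 \<and> u < 2) \<or> (4 \<le> t \<and> 2 * u \<le> t)))"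
  by (intro add strong_bulk strong_far) measurable
 moreover have "strong al p (?part (\<lambda>t u. (2 \<le> u \<and> t < 2 * u) \<or> (t < 1/4 \<and> \<bar>1 - u\<bar> < t)))"
  by (intro add near strong_local) measurable
 ultimately show ?thesis
 proof (rule strong_mono_add[where K = 1])
  fix t u :: real assume "t > 0" "u > 0"
  thus "ak t u \<le> 1 * (?part (\<lambda>t u. (1/4 \<le> t \<and> t \<le> 4 \<and> u < 2) \<or> (4 \<le> t \<and> 2 * u \<le> t)) t u + ?part (\<lambda>t u. (2 \<le> u \<and> t < 2 * u) \<or> (t < 1/4 \<and> \<bar>1 - u\<bar> < t)) t u)"
   using sk_eq_0[of u t al be] by (cases "\<bar>1 - u\<bar> < t") auto
 qed (use p in auto)
qed

end

text \<open>Needed for all nu > -1/2, whereas \<open>DERIV_prof\<close> yields continuity only for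
  orders above 1/2; so it is read off from the power series.\<close>

lemma isCont_prof:
 assumes al: "al > -1" and nu: "nu > -1/2" and ta: "ta \<noteq> -1" "ta \<noteq> 1"
 shows "isCont (prof al nu) ta"
proof -
 have ser: "isCont (\<lambda>w. \<Sum>k. c k * w ^ k) w"
  if "\<And>v. \<bar>v\<bar> < R ==> summable (\<lambda>k. c k * v ^ k)" "\<bar>w\<bar> < R" for c and w R :: real
  by (rule isCont_powser[of c "(\<bar>w\<bar> + R) / 2"]) (use that in auto)
 have A: "isCont (serA al nu) w" if "\<bar>w\<bar> < 2" for w
  unfolding serA_def[abs_def] by (rule ser[OF serA_summable[OF nu] that])
 have B: "isCont (serB al nu) w" if "\<bar>w\<bar> < 1" for w
  unfolding serB_def[abs_def] by (rule ser[OF serB_summable[OF al nu] that])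
 have ev: "isCont (prof al nu) ta" if "open U" "ta \<in> U" "\<And>x. x \<in> U ==> prof al nu x = h x" "isCont h ta" for U h
  using isCont_cong[of "prof al nu" h ta, OF eventually_mono[OF eventually_nhds_in_open[OF that(1,2)] that(3)]] that(4) by blast
 consider "ta < -1" | "-1 < ta" "ta < 1" | "ta > 1" using ta by linarith
 thus ?thesis
 proof cases
  case 1
  thus ?thesis by (intro ev[of "{..<-1}" "\<lambda>_. 0"]) (auto simp: prof_def)
 next
  case 2
  show ?thesis
  proof (rule ev[of "{-1<..<1}" "\<lambda>ta. (ta + 1) powr (nu - 1/2) * serA al nu (ta + 1)"])
   show "isCont (\<lambda>ta. (ta + 1) powr (nu - 1/2) * serA al nu (ta + 1)) ta"
    using 2 by (intro continuous_intros isCont_o2[OF _ A]) auto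
  qed (use 2 in \<open>auto simp: prof_def\<close>)
 next
  case 3
  show ?thesis
  proof (rule ev[of "{1<..}" "\<lambda>ta. ta powr (nu - al - 1) * serB al nu (1 / ta\<^sup>2)"])
   show "isCont (\<lambda>ta. ta powr (nu - al - 1) * serB al nu (1 / ta\<^sup>2)) ta"
    using 3 by (intro continuous_intros isCont_o2[OF _ B]) (auto simp: one_less_power)
  qed (use 3 in \<open>auto simp: prof_def\<close>)
 qed
qed

section \<open>Continuity in t and the passage to the means and the maximal function\<close>

lemma AE_wm_neq: "AE u in wm al. u \<noteq> c"
 unfolding wm_def by (subst AE_density) (use AE_lborel_neq[of c] in \<open>auto elim: eventually_mono\<close>)

lemma sk_tendsto:
 assumes al: "al > -1" and nu: "al + be > -1/2" and s: "s > 0" and t: "t \<longlonglongrightarrow> s"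
 shows "AE u in wm al. (\<lambda>n. sk al be (t n) u) \<longlonglongrightarrow> sk al be s u"
 using AE_wm[of al] AE_wm_neq[of "s - 1" al] AE_wm_neq[of "1 - s" al] AE_wm_neq[of "1 + s" al]
proof eventually_elim
 case (elim u)
 have "1 + tau s 1 u \<noteq> 0" "1 - tau s 1 u \<noteq> 0"
  unfolding one_plus_tau[OF elim(1)] one_minus_tau[OF elim(1)] using elim s by auto
 hence "isCont (prof al (al + be)) (tau s 1 u)" using al nu by (intro isCont_prof) auto
 moreover have "isCont (\<lambda>s. tau s 1 u) s" unfolding tau_def using elim(1) by (intro continuous_intros) auto
 ultimately have "isCont (\<lambda>s. prof al (al + be) (tau s 1 u)) s" by (rule isCont_o2[rotated])
 moreover have "isCont (\<lambda>s. s powr (-2 * (al + be)) * u powr (be - 1)) s" using s by (intro continuous_intros) auto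
 ultimately have "isCont (\<lambda>s. sk al be s u) s" unfolding sk_def by (rule isCont_mult[rotated])
 thus ?case using isCont_tendsto_compose t by blast
qed

text \<open>Vitali convergence: a bounded r-th moment with r > 1 makes the functions uniformly
  integrable. Truncated at c they converge by domination on A, and the excess is at most c^(1 - r)
  D.\<close>

lemma nn_integral_tendsto_0_if_bounded_moment:
 fixes dl :: "nat => 'a => real"
 assumes r: "r > 1" and [measurable]: "\<And>n. dl n \<in> borel_measurable M" "A \<in> sets M" and dl0: "\<And>n x. dl n x \<ge> 0"
  and A: "emeasure M A < \<infinity>" "\<And>n x. x \<notin> A ==> dl n x = 0" and lim: "AE x in M. (\<lambda>n. dl n x) \<longlonglongrightarrow> 0"
  and D: "\<And>n. pint M (\<lambda>x. dl n x powr r) \<le> ennreal D"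
 shows "(\<lambda>n. pint M (dl n)) \<longlonglongrightarrow> 0"
proof (rule order_tendstoI)
 fix a :: ennreal assume "0 < a"
 then obtain m where m: "0 < m" "m < a" using dense by blast
 then obtain b where b: "0 < b" "ennreal b < a" by (cases m) auto
 define e where "e = b / 2"
 have e: "e > 0" "ennreal e + ennreal e < a" using b by (simp_all add: e_def flip: ennreal_plus)
 \<comment> \<open>Chosen so large that c^(1 - r) |D| \<le> e.\<close>
 define c where "c = (\<bar>D\<bar> / e + 1) powr (1 / (r - 1))"
 have "\<bar>D\<bar> / e + 1 > 0" using e by (intro add_nonneg_pos) auto
 hence c: "c > 0" by (simp add: c_def)
 have cr: "c powr (1 - r) * \<bar>D\<bar> \<le> e"
 proof -
  have pos: "\<bar>D\<bar> / e + 1 > 0" using e by (intro add_nonneg_pos) auto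
  hence "c powr (r - 1) = \<bar>D\<bar> / e + 1" using r by (simp add: c_def powr_powr)
  hence "c powr (1 - r) * \<bar>D\<bar> = \<bar>D\<bar> / (\<bar>D\<bar> / e + 1)" using powr_minus_divide[of c "r - 1"] by simp
  also have "\<dots> \<le> e" unfolding pos_divide_le_eq[OF pos] using e by (simp add: distrib_left)
  finally show ?thesis .
 qed
 have le: "pint M (dl n) \<le> pint M (\<lambda>x. min (dl n x) c) + ennreal e" for n
 proof -
  have "pint M (dl n) \<le> (\<integral>\<^sup>+x. ennreal (min (dl n x) c) + ennreal (c powr (1 - r)) * ennreal (dl n x powr r) \<partial>M)"
  proof (rule nn_integral_mono)
   fix x
   have "dl n x \<le> min (dl n x) c + c powr (1 - r) * dl n x powr r"
   proof (cases "dl n x \<le> c")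
    case False
    hence x: "dl n x > 0" using c by simp
    have "dl n x = dl n x powr (1 - r) * dl n x powr r" using x by (simp flip: powr_add)
    also have "\<dots> \<le> c powr (1 - r) * dl n x powr r" using False c r by (intro mult_right_mono powr_mono2') auto
    finally show ?thesis using False c by simp
   qed simp
   thus "ennreal (dl n x) \<le> ennreal (min (dl n x) c) + ennreal (c powr (1 - r)) * ennreal (dl n x powr r)"
    using dl0 c by (simp add: ennreal_mult[symmetric] ennreal_leI flip: ennreal_plus)
  qed
  also have "\<dots> = pint M (\<lambda>x. min (dl n x) c) + ennreal (c powr (1 - r)) * pint M (\<lambda>x. dl n x powr r)"
   by (simp add: nn_integral_add nn_integral_cmult)
  also have "\<dots> \<le> pint M (\<lambda>x. min (dl n x) c) + ennreal (c powr (1 - r)) * ennreal \<bar>D\<bar>"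
   using D[of n] by (intro add_left_mono mult_left_mono) (auto intro: order_trans ennreal_leI)
  also have "\<dots> \<le> pint M (\<lambda>x. min (dl n x) c) + ennreal e"
   using cr by (intro add_left_mono) (simp add: ennreal_mult[symmetric] ennreal_leI)
  finally show ?thesis .
 qed
 have "(\<lambda>n. pint M (\<lambda>x. min (dl n x) c)) \<longlonglongrightarrow> (\<integral>\<^sup>+x. 0 \<partial>M)"
 proof (rule nn_integral_dominated_convergence[where w = "\<lambda>x. ennreal c * indicator A x"])
  show "(\<integral>\<^sup>+x. ennreal c * indicator A x \<partial>M) < \<infinity>" using A by (simp add: nn_integral_cmult_indicator ennreal_mult_less_top)
  show "AE x in M. ennreal (min (dl n x) c) \<le> ennreal c * indicator A x" for n
   using A(2) c by (intro AE_I2) (auto simp: indicator_def intro: ennreal_leI)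
  show "AE x in M. (\<lambda>n. ennreal (min (dl n x) c)) \<longlonglongrightarrow> 0"
   using lim
  proof eventually_elim
   case (elim x)
   hence "(\<lambda>n. min (dl n x) c) \<longlonglongrightarrow> min 0 c" by (intro tendsto_intros)
   thus ?case using c by (auto dest: tendsto_ennrealI)
  qed
 qed auto
 hence "eventually (\<lambda>n. pint M (\<lambda>x. min (dl n x) c) < ennreal e) sequentially" using e by (intro order_tendstoD(2)) auto
 thus "eventually (\<lambda>n. pint M (dl n) < a) sequentially"
  by eventually_elim (rule order.strict_trans1[OF order_trans[OF le add_right_mono[OF less_imp_le]] e(2)])
qed simp

lemma mu_eq: "mu al = restrict_space (wm al) {0<..}"
proof (rule measure_eqI)
 show "sets (mu al) = sets (restrict_space (wm al) {0<..})" by (simp add: mu_def sets_restrict_space)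
next
 fix A assume "A \<in> sets (mu al)"
 hence A: "A \<in> sets (restrict_space lborel {0<..})" by (simp add: mu_def)
 hence A': "A \<in> sets borel" "A \<subseteq> {0<..}" by (auto simp: sets_restrict_space)
 have "emeasure (mu al) A = (\<integral>\<^sup>+x. ennreal (x powr (2 * al + 1)) * indicator A x \<partial>restrict_space lborel {0<..})"
  unfolding mu_def using A by (intro emeasure_density) (auto intro: measurable_restrict_space1)
 also have "\<dots> = (\<integral>\<^sup>+x. ennreal (indicator {0<..} x * x powr (2 * al + 1)) * indicator A x \<partial>lborel)"
  by (subst nn_integral_restrict_space) (auto intro!: nn_integral_cong simp: indicator_def)
 also have "\<dots> = emeasure (restrict_space (wm al) {0<..}) A"
  using A' by (subst emeasure_restrict_space) (auto simp: wm_def emeasure_density)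
 finally show "emeasure (mu al) A = emeasure (restrict_space (wm al) {0<..}) A" .
qed

lemma AE_mu_iff: "(AE x in mu al. P x) \<longleftrightarrow> (AE x in wm al. P x)"
 unfolding mu_eq by (subst AE_restrict_space_iff, simp, rule eventually_subst, rule eventually_mono[OF AE_wm]) simp

lemma nn_integral_mu: "(\<integral>\<^sup>+x. f x \<partial>mu al) = (\<integral>\<^sup>+x. f x \<partial>wm al)"
 unfolding mu_eq by (subst nn_integral_restrict_space) (auto intro!: nn_integral_wm_cong)

lemma emeasure_wm_singleton [simp]: "emeasure (wm al) {x} = 0"
 using AE_wm_neq[of x al] by (subst (asm) AE_iff_measurable[of "{x}"]) auto

lemma integrable_scaleR_iff:
 fixes g :: "'a => 'b::{banach, second_countable_topology}"
 assumes "c \<noteq> 0"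
 shows "integrable M (\<lambda>x. c *\<^sub>R g x) \<longleftrightarrow> integrable M g"
 using integrable_scaleR_right[of c M g] integrable_scaleR_right[of "1 / c" M "\<lambda>x. c *\<^sub>R g x"] assms by auto

lemma wm_dilation:
 fixes g :: "real => 'b::{banach, second_countable_topology}"
 assumes [measurable]: "g \<in> borel_measurable borel" and x: "x > 0"
 shows "integrable (wm al) g \<longleftrightarrow> integrable (wm al) (\<lambda>u. g (x * u))"
  and "integral\<^sup>L (wm al) g = x powr (2 * al + 2) *\<^sub>R (LINT u|wm al. g (x * u))"
proof -
 have xx: "ennreal (x powr (2 * al + 2)) * ennreal (x powr (-(2 * al + 2))) = 1"
  using x by (simp add: ennreal_mult'[symmetric] powr_add[symmetric])
 have "wm al = density (distr (wm al) borel (\<lambda>u. x * u)) (\<lambda>_. ennreal (x powr (2 * al + 2)))"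
 proof (rule measure_eqI)
  fix A assume "A \<in> sets (wm al)"
  hence [measurable]: "A \<in> sets borel" by simp
  have "emeasure (density (distr (wm al) borel (\<lambda>u. x * u)) (\<lambda>_. ennreal (x powr (2 * al + 2)))) A
   = ennreal (x powr (2 * al + 2)) * (\<integral>\<^sup>+u. indicator A (x * u) \<partial>wm al)"
   by (subst emeasure_density, simp, simp, subst nn_integral_distr, measurable, subst nn_integral_cmult) auto
  also have "\<dots> = (ennreal (x powr (2 * al + 2)) * ennreal (x powr (-(2 * al + 2)))) * emeasure (wm al) A"
   using nn_integral_wm_dilation[of "indicator A" x al] x by (simp add: mult.assoc)
  finally show "emeasure (wm al) A = emeasure (density (distr (wm al) borel (\<lambda>u. x * u)) (\<lambda>_. ennreal (x powr (2 * al + 2)))) A"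
   unfolding xx by simp
 qed simp
 note * = this
 show "integrable (wm al) g \<longleftrightarrow> integrable (wm al) (\<lambda>u. g (x * u))"
  using x by (subst *) (simp add: integrable_density integrable_distr_eq integrable_scaleR_iff)
 show "integral\<^sup>L (wm al) g = x powr (2 * al + 2) *\<^sub>R (LINT u|wm al. g (x * u))"
  by (subst *) (simp add: integral_density integral_distr)
qed

definition kconst :: "real => real" where
 "kconst nu = 2 powr nu * Gamma (nu + 1)"

lemma kconst_pos: "nu > -1 ==> kconst nu > 0"
 by (auto simp: kconst_def intro!: mult_pos_pos Gamma_real_pos)

lemma kernel_sk:
 assumes al: "al > -1" and nu: "al + be > -1/2" and pos: "t > 0" "x > 0" "z > 0" "t \<noteq> \<bar>x - z\<bar>" "t \<noteq> x + z"
 shows "kernel al be t x z = kconst (al + be) * x powr (-(2 * al + 2)) * sk al be (t / x) (z / x)"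
proof -
 have "tau (t / x) 1 (z / x) = tau t x z"
  using pos by (simp add: tau_def field_simps power2_eq_square)
 moreover have K: "x powr (-(2 * al + 2)) * ((t / x) powr (-2 * (al + be)) * (z / x) powr (be - 1)) = t powr (-2 * (al + be)) * (x * z) powr (be - 1)"
 proof -
  have "x powr (-(2 * al + 2)) = x powr (-2 * (al + be)) * x powr (be - 1) * x powr (be - 1)"
   unfolding powr_add[symmetric] by (rule arg_cong[where f = "\<lambda>e. x powr e"]) (simp add: algebra_simps)
  thus ?thesis using pos by (simp add: powr_divide powr_mult)
 qed
 ultimately show ?thesis
  unfolding kernel_eq[OF al nu pos] sk_def kconst_def K[symmetric] by (simp only: mult_ac)
qed

text \<open>By homogeneity of the kernel the mean at x with parameter t is the one at 1 with
  parameter t / x, applied to the dilate f (x u). This turns the operator into the form treated by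
  \<open>strong\<close>.\<close>

lemma mean_op_eq:
 assumes al: "al > -1" and nu: "al + be > -1/2" and t: "t > 0" and x: "x > 0"
  and [measurable]: "f \<in> borel_measurable borel" and f: "\<And>z. z \<le> 0 ==> f z = 0" "\<And>z. z > 0 ==> f z = h z"
 shows "integrable (mu al) (\<lambda>z. kernel al be t x z *\<^sub>R h z) \<longleftrightarrow> integrable (wm al) (\<lambda>u. sk al be (t / x) u *\<^sub>R f (x * u))"
  and "mean_op al be t h x = kconst (al + be) *\<^sub>R (LINT u|wm al. sk al be (t / x) u *\<^sub>R f (x * u))"
proof -
 define c where "c = kconst (al + be) * x powr (-(2 * al + 2))"
 have c: "c > 0" using kconst_pos[of "al + be"] nu x by (simp add: c_def)
 define g where "g z = (c * sk al be (t / x) (z / x)) *\<^sub>R f z" for z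
 have [measurable]: "g \<in> borel_measurable borel" unfolding g_def[abs_def] by measurable
 let ?X = "{x + t, x - t, t - x}"
 have eq: "(indicator {0<..} z * kernel al be t x z) *\<^sub>R h z = g z" if "z \<notin> ?X" for z
 proof (cases "z > 0")
  case True
  have "t \<noteq> \<bar>x - z\<bar>" "t \<noteq> x + z" using that by (auto simp: abs_if)
  thus ?thesis using kernel_sk[OF al nu t x True] f True by (simp add: g_def c_def)
 qed (use f in \<open>simp add: g_def\<close>)
 have gx: "g (x * u) = c *\<^sub>R (sk al be (t / x) u *\<^sub>R f (x * u))" for u using x by (simp add: g_def)
 have "integrable (mu al) (\<lambda>z. kernel al be t x z *\<^sub>R h z) \<longleftrightarrow> integrable (wm al) (\<lambda>z. indicator {0<..} z *\<^sub>R (kernel al be t x z *\<^sub>R h z))"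
  unfolding mu_eq by (rule integrable_restrict_space) simp
 also have "\<dots> \<longleftrightarrow> integrable (wm al) g"
  by (rule integrable_discrete_difference[where X = ?X]) (auto simp: eq)
 also have "\<dots> \<longleftrightarrow> integrable (wm al) (\<lambda>u. sk al be (t / x) u *\<^sub>R f (x * u))"
  using c x by (subst wm_dilation(1)[of _ x]) (simp_all add: gx integrable_scaleR_iff del: scaleR_scaleR)
 finally show "integrable (mu al) (\<lambda>z. kernel al be t x z *\<^sub>R h z) \<longleftrightarrow> integrable (wm al) (\<lambda>u. sk al be (t / x) u *\<^sub>R f (x * u))" .
 have "mean_op al be t h x = (LINT z|wm al. indicator {0<..} z *\<^sub>R (kernel al be t x z *\<^sub>R h z))"
  unfolding mean_op_def mu_eq by (rule integral_restrict_space) simp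
 also have "\<dots> = integral\<^sup>L (wm al) g"
  by (rule integral_discrete_difference[where X = ?X]) (auto simp: eq)
 also have "\<dots> = x powr (2 * al + 2) *\<^sub>R (c *\<^sub>R (LINT u|wm al. sk al be (t / x) u *\<^sub>R f (x * u)))"
  using x by (subst wm_dilation(2)[of _ x]) (simp_all add: gx del: scaleR_scaleR)
 also have "\<dots> = kconst (al + be) *\<^sub>R (LINT u|wm al. sk al be (t / x) u *\<^sub>R f (x * u))"
 proof -
  have "x powr (2 * al + 2) * x powr (-(2 * al + 2)) = 1" using x by (simp flip: powr_add)
  hence "x powr (2 * al + 2) * c = kconst (al + be)" by (simp add: c_def)
  thus ?thesis by simp
 qed
 finally show "mean_op al be t h x = kconst (al + be) *\<^sub>R (LINT u|wm al. sk al be (t / x) u *\<^sub>R f (x * u))" .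
qed

lemma borel_measurable_completion_AE:
 assumes [measurable]: "g \<in> borel_measurable M" and eq: "AE x in M. f x = g x"
 shows "f \<in> borel_measurable (completion M)"
proof (rule measurableI)
 fix A :: "'b set" assume [measurable]: "A \<in> sets borel"
 have [measurable]: "g \<in> borel_measurable (completion M)" by (rule measurable_completion) measurable
 have [measurable]: "Measurable.pred (completion M) (\<lambda>x. f x \<noteq> g x \<and> f x \<in> A)" "Measurable.pred (completion M) (\<lambda>x. f x \<noteq> g x)"
  by (rule sets_completion_AE, use eq in eventually_elim, simp)+
 have "{x \<in> space (completion M). (f x \<noteq> g x \<and> f x \<in> A) \<or> (\<not> f x \<noteq> g x \<and> g x \<in> A)} \<in> sets (completion M)" by measurable
 also have "{x \<in> space (completion M). (f x \<noteq> g x \<and> f x \<in> A) \<or> (\<not> f x \<noteq> g x \<and> g x \<in> A)} = f -` A \<inter> space (completion M)" by auto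
 finally show "f -` A \<inter> space (completion M) \<in> sets (completion M)" .
qed simp

context weighted_estimate
begin

text \<open>Fatou's lemma along rational parameters decreasing to s extends the rational supremum in
  \<open>strong\<close> to all s > 0.\<close>

lemma pint_sk_le_of_rational:
 assumes [measurable]: "G \<in> borel_measurable borel" and s: "s > 0"
  and B: "\<And>t. t \<in> \<rat> \<inter> {0<..} ==> pint (wm al) (\<lambda>u. ak t u * G u) \<le> B"
 shows "pint (wm al) (\<lambda>u. ak s u * G u) \<le> B"
proof -
 have "\<exists>t. t \<in> \<rat> \<and> s < t \<and> t < s + 1 / real (Suc n)" for n using Rats_dense_in_real[of s "s + 1 / real (Suc n)"] by auto
 then obtain t where t: "\<And>n. t n \<in> \<rat> \<and> s < t n \<and> t n < s + 1 / real (Suc n)" by metis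
 have "(\<lambda>n. s + 1 / real (Suc n)) \<longlonglongrightarrow> s + 0" by (intro tendsto_intros LIMSEQ_Suc[OF lim_1_over_n])
 hence lim: "t \<longlonglongrightarrow> s" by (intro tendsto_sandwich[of "\<lambda>_. s" t _ "\<lambda>n. s + 1 / real (Suc n)"]) (use t in \<open>auto intro: always_eventually less_imp_le\<close>)
 have "pint (wm al) (\<lambda>u. ak s u * G u) = (\<integral>\<^sup>+u. liminf (\<lambda>n. ennreal (ak (t n) u * G u)) \<partial>wm al)"
  by (rule nn_integral_cong_AE, use sk_tendsto[OF al nu s lim] in eventually_elim)
    (auto intro!: lim_imp_Liminf[symmetric] tendsto_ennrealI tendsto_intros)
 also have "\<dots> \<le> liminf (\<lambda>n. pint (wm al) (\<lambda>u. ak (t n) u * G u))" by (rule nn_integral_liminf) measurable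
 also have "\<dots> \<le> liminf (\<lambda>n. B)" using t s by (intro Liminf_mono always_eventually allI B) (auto intro: order.strict_trans)
 finally show ?thesis by (simp add: Liminf_const)
qed

text \<open>For bounded \<open>f\<close> with bounded support, the singularities of the kernel are equi-integrable.\<close>
lemma mean_continuous:
 fixes f :: "real => complex"
 assumes [measurable]: "f \<in> borel_measurable borel" and f: "\<And>z. cmod (f z) \<le> K" "\<And>z. z > K ==> f z = 0" "K > 0"
  and x: "x > 0" and c: "0 < c" "c \<le> b" "1 \<le> b"
 shows "\<And>s. s \<in> {c..b} ==> integrable (wm al) (\<lambda>u. sk al be s u *\<^sub>R f (x * u))"
  and "continuous_on {c..b} (\<lambda>s. LINT u|wm al. sk al be s u *\<^sub>R f (x * u))"
proof -
 \<comment> \<open>For u \<ge> K / x + 1 the argument x u exceeds K, where f vanishes.\<close>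
 define M where "M = K / x + 1"
 have M: "M > 0" using f x by (simp add: M_def add_pos_pos)
 have f0: "f (x * u) = 0" if "u \<ge> M" for u
 proof (rule f(2))
  have "x * u \<ge> x * M" using that x by (intro mult_left_mono) auto
  thus "x * u > K" using x by (simp add: M_def distrib_left)
 qed
 obtain D where D: "D \<ge> 0" "\<And>t. t \<in> {c..b} ==> pint (wm al) (\<lambda>u. indicator {0<..<M} u * (ak t u powr r * u powr (d * (1 - r)))) \<le> ennreal D"
  using bulk_moment[OF c M] by blast
 \<comment> \<open>On (0, M) the weight u^(d (1 - r)) in \<open>bulk_moment\<close> is at least M^(d
   (1 - r)), so k removes it.\<close>
 define k where "k = M powr (d * (r - 1))"
 have Dr: "pint (wm al) (\<lambda>u. indicator {0<..<M} u * ak t u powr r) \<le> ennreal (k * D)" if "t \<in> {c..b}" for t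
 proof -
  have "pint (wm al) (\<lambda>u. indicator {0<..<M} u * ak t u powr r)
   \<le> (\<integral>\<^sup>+u. ennreal k * ennreal (indicator {0<..<M} u * (ak t u powr r * u powr (d * (1 - r)))) \<partial>wm al)"
  proof (rule nn_integral_mono)
   fix u
   have "1 \<le> k * u powr (d * (1 - r))" if "0 < u" "u < M"
   proof -
    have "k * M powr (d * (1 - r)) \<le> k * u powr (d * (1 - r))" using that d r by (intro mult_left_mono powr_mono2') (auto simp: k_def mult_nonneg_nonpos)
    moreover have "k * M powr (d * (1 - r)) = 1" using M by (simp add: k_def algebra_simps flip: powr_add)
    ultimately show ?thesis by simp
   qed
   hence "indicator {0<..<M} u * ak t u powr r \<le> k * (indicator {0<..<M} u * (ak t u powr r * u powr (d * (1 - r))))"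
    using mult_left_mono[of 1 "k * u powr (d * (1 - r))" "ak t u powr r"] by (auto simp: indicator_def mult_ac)
   thus "ennreal (indicator {0<..<M} u * ak t u powr r) \<le> ennreal k * ennreal (indicator {0<..<M} u * (ak t u powr r * u powr (d * (1 - r))))"
    by (simp add: k_def ennreal_mult'[symmetric] ennreal_leI)
  qed
  also have "\<dots> \<le> ennreal k * ennreal D" by (subst nn_integral_cmult, measurable) (intro mult_left_mono D(2) that, simp)
  finally show ?thesis using D by (simp add: k_def ennreal_mult)
 qed
 have A: "emeasure (wm al) {0<..<M} < \<infinity>"
 proof -
  have "emeasure (wm al) {0<..<M} = pint lborel (\<lambda>u. indicator {0<..<M} u * u powr (2 * al + 1))"
   unfolding wm_def by (subst emeasure_density) (auto intro!: nn_integral_cong simp: indicator_def)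
  thus ?thesis using nn_integral_powr_0[of "2 * al + 1" M] al M by simp
 qed
 show int: "integrable (wm al) (\<lambda>u. sk al be s u *\<^sub>R f (x * u))" if s: "s \<in> {c..b}" for s
 proof (rule integrableI_bounded)
  have "(\<integral>\<^sup>+u. ennreal (norm (sk al be s u *\<^sub>R f (x * u))) \<partial>wm al)
    \<le> (\<integral>\<^sup>+u. ennreal K * (indicator {0<..<M} u + ennreal (indicator {0<..<M} u * ak s u powr r)) \<partial>wm al)"
  proof (rule nn_integral_wm_mono)
   fix u :: real assume u: "u > 0"
   have "ak s u \<le> 1 + ak s u powr r"
   proof (cases "ak s u \<ge> 1")
    case True
    thus ?thesis using powr_mono[of 1 r "ak s u"] r by simp
   qed (use powr_ge_zero[of "ak s u" r] in linarith)
   hence "ak s u * cmod (f (x * u)) \<le> (1 + ak s u powr r) * K" by (intro mult_mono f) auto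
   hence "norm (sk al be s u *\<^sub>R f (x * u)) \<le> K * (indicator {0<..<M} u + indicator {0<..<M} u * ak s u powr r)"
    using f0[of u] u by (cases "u < M") (auto simp: mult.commute)
   thus "ennreal (norm (sk al be s u *\<^sub>R f (x * u))) \<le> ennreal K * (indicator {0<..<M} u + ennreal (indicator {0<..<M} u * ak s u powr r))"
    using f(3) by (simp add: ennreal_mult'[symmetric] ennreal_indicator[symmetric] ennreal_leI flip: ennreal_plus)
  qed
  also have "\<dots> = ennreal K * (emeasure (wm al) {0<..<M} + pint (wm al) (\<lambda>u. indicator {0<..<M} u * ak s u powr r))"
   by (simp add: nn_integral_cmult nn_integral_add)
  also have "\<dots> < \<infinity>" using A Dr[OF s] by (auto simp: ennreal_mult_less_top intro: le_less_trans)
  finally show "(\<integral>\<^sup>+u. ennreal (norm (sk al be s u *\<^sub>R f (x * u))) \<partial>wm al) < \<infinity>" .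
 qed measurable
 show "continuous_on {c..b} (\<lambda>s. LINT u|wm al. sk al be s u *\<^sub>R f (x * u))"
  unfolding continuous_on_sequentially
 proof (intro allI ballI impI, elim conjE)
  fix t s assume s: "s \<in> {c..b}" and t: "\<forall>n. t n \<in> {c..b}" "t \<longlonglongrightarrow> s"
  define dl where "dl n u = indicator {0<..<M} u * (\<bar>sk al be (t n) u - sk al be s u\<bar> * cmod (f (x * u)))" for n u
  have [measurable]: "dl n \<in> borel_measurable borel" for n unfolding dl_def[abs_def] by measurable
  have lim: "(\<lambda>n. pint (wm al) (dl n)) \<longlonglongrightarrow> 0"
  proof (rule nn_integral_tendsto_0_if_bounded_moment[OF r, where A = "{0<..<M}" and D = "K powr r * 2 powr r * (k * D + k * D)"])
   show "AE u in wm al. (\<lambda>n. dl n u) \<longlonglongrightarrow> 0"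
   proof (rule eventually_mono[OF sk_tendsto[OF al nu _ t(2)]])
    fix u assume "(\<lambda>n. sk al be (t n) u) \<longlonglongrightarrow> sk al be s u"
    hence "(\<lambda>n. dl n u) \<longlonglongrightarrow> indicator {0<..<M} u * (\<bar>sk al be s u - sk al be s u\<bar> * cmod (f (x * u)))"
     unfolding dl_def by (intro tendsto_intros)
    thus "(\<lambda>n. dl n u) \<longlonglongrightarrow> 0" by simp
   qed (use s c(1) in simp)
   show "pint (wm al) (\<lambda>u. dl n u powr r) \<le> ennreal (K powr r * 2 powr r * (k * D + k * D))" for n
   proof -
    let ?m = "\<lambda>t u. indicator {0<..<M} u * ak t u powr r"
    have "pint (wm al) (\<lambda>u. dl n u powr r) \<le> (\<integral>\<^sup>+u. ennreal (K powr r * 2 powr r) * (ennreal (?m (t n) u) + ennreal (?m s u)) \<partial>wm al)"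
    proof (rule nn_integral_mono)
     fix u
     have "(\<bar>sk al be (t n) u - sk al be s u\<bar> * cmod (f (x * u))) powr r \<le> ((ak (t n) u + ak s u) * K) powr r"
      using r f by (intro powr_mono2 mult_mono) auto
     also have "\<dots> = K powr r * (ak (t n) u + ak s u) powr r" using f(3) by (simp add: powr_mult)
     also have "\<dots> \<le> K powr r * (2 powr r * (ak (t n) u powr r + ak s u powr r))"
      using r by (intro mult_left_mono powr_add_le) auto
     finally have "dl n u powr r \<le> K powr r * 2 powr r * (?m (t n) u + ?m s u)"
      using r by (simp add: dl_def indicator_def)
     thus "ennreal (dl n u powr r) \<le> ennreal (K powr r * 2 powr r) * (ennreal (?m (t n) u) + ennreal (?m s u))"
      by (simp add: ennreal_mult'[symmetric] ennreal_leI flip: ennreal_plus)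
    qed
    also have "\<dots> \<le> ennreal (K powr r * 2 powr r) * (ennreal (k * D) + ennreal (k * D))"
     by (subst nn_integral_cmult, measurable, subst nn_integral_add, measurable) (intro mult_left_mono add_mono Dr s t(1)[rule_format], simp)
    also have "\<dots> = ennreal (K powr r * 2 powr r * (k * D + k * D))" using D by (simp add: k_def ennreal_mult'[symmetric] flip: ennreal_plus)
    finally show ?thesis .
   qed
  qed (use A in \<open>auto simp: dl_def\<close>)
  have le: "ennreal (norm ((LINT u|wm al. sk al be (t n) u *\<^sub>R f (x * u)) - (LINT u|wm al. sk al be s u *\<^sub>R f (x * u)))) \<le> pint (wm al) (dl n)" for n
  proof -
   have i: "integrable (wm al) (\<lambda>u. sk al be (t n) u *\<^sub>R f (x * u))" "integrable (wm al) (\<lambda>u. sk al be s u *\<^sub>R f (x * u))" using int s t by auto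
   have "ennreal (norm (LINT u|wm al. sk al be (t n) u *\<^sub>R f (x * u) - sk al be s u *\<^sub>R f (x * u))) \<le> (\<integral>\<^sup>+u. ennreal (norm (sk al be (t n) u *\<^sub>R f (x * u) - sk al be s u *\<^sub>R f (x * u))) \<partial>wm al)"
    by (intro integral_norm_bound_ennreal Bochner_Integration.integrable_diff i)
   also have "\<dots> = pint (wm al) (dl n)"
    using f0 by (intro nn_integral_wm_cong) (auto simp: dl_def indicator_def simp flip: scaleR_diff_left)
   finally show ?thesis using i by simp
  qed
  have "(\<lambda>n. ennreal (norm ((LINT u|wm al. sk al be (t n) u *\<^sub>R f (x * u)) - (LINT u|wm al. sk al be s u *\<^sub>R f (x * u))))) \<longlonglongrightarrow> 0"
   by (rule tendsto_sandwich[OF always_eventually always_eventually tendsto_const lim]) (use le in simp_all)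
  hence "(\<lambda>n. norm ((LINT u|wm al. sk al be (t n) u *\<^sub>R f (x * u)) - (LINT u|wm al. sk al be s u *\<^sub>R f (x * u)))) \<longlonglongrightarrow> 0"
   by (simp add: ennreal_0[symmetric] del: ennreal_0)
  thus "((\<lambda>s. LINT u|wm al. sk al be s u *\<^sub>R f (x * u)) \<circ> t) \<longlonglongrightarrow> (LINT u|wm al. sk al be s u *\<^sub>R f (x * u))"
   unfolding o_def by (subst Lim_null) (rule tendsto_norm_zero_cancel)
 qed
qed

end

context weighted_estimate
begin

text \<open>Integrability and the norm bound come from the rational supremum by Fatou. Measurability
  is the delicate part: the supremum over all t has to be reduced to rational t, which needs
  continuity of the means in t, known only for bounded f of bounded support. Truncations approximate
  a general f with an error bounded by the maximal function of the remainder, uniformly in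
  t.\<close>

theorem max_op_bounded_if_strong:
 assumes "strong al p (\<lambda>t u. ak t u)"
 shows "max_op_bounded al be p"
proof -
 define S where "S F x = (SUP t\<in>\<rat> \<inter> {0<..}. enn_powr (pint (wm al) (\<lambda>u. ak t u * F (x * u))) p)" for F :: "real => real" and x
 have S_meas [measurable]: "S F \<in> borel_measurable borel" if [measurable]: "F \<in> borel_measurable borel" for F
  unfolding S_def[abs_def] by (intro borel_measurable_SUP; simp)
 obtain C where C: "C \<ge> 0" "\<And>F. F \<in> borel_measurable borel ==> (\<And>y. 0 \<le> F y) ==> (\<integral>\<^sup>+x. S F x \<partial>wm al) \<le> ennreal C * pint (wm al) (\<lambda>x. F x powr p)"
  using assms unfolding strong_def S_def by (auto simp: Ball_def)
 have S_le: "pint (wm al) (\<lambda>u. ak s u * F (x * u)) \<le> enn_powr (S F x) (1 / p)"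
  if [measurable]: "F \<in> borel_measurable borel" and "s > 0" for F s x
 proof (rule pint_sk_le_of_rational[OF _ that(2)])
  fix t :: real assume t: "t \<in> \<rat> \<inter> {0<..}"
  have "enn_powr (pint (wm al) (\<lambda>u. ak t u * F (x * u))) p \<le> S F x" unfolding S_def by (rule SUP_upper[OF t])
  thus "pint (wm al) (\<lambda>u. ak t u * F (x * u)) \<le> enn_powr (S F x) (1 / p)" using p by (simp add: enn_powr_le_iff)
 qed measurable
 define K where "K = kconst (al + be)"
 have K: "K > 0" using kconst_pos[of "al + be"] nu by (simp add: K_def)
 show ?thesis unfolding max_op_bounded_def
 proof (rule exI[of _ "K * C powr (1 / p)"], intro ballI)
  fix h assume h: "h \<in> Lp_space (mu al) p"
  define f where "f z = (if z > 0 then h z else 0)" for z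
  have "(\<lambda>z. indicator {0<..} z *\<^sub>R h z) \<in> borel_measurable (wm al)"
   using h unfolding Lp_space_def mu_eq by (subst (asm) borel_measurable_restrict_space_iff) auto
  also have "(\<lambda>z. indicator {0<..} z *\<^sub>R h z) = f" by (auto simp: f_def indicator_def)
  finally have [measurable]: "f \<in> borel_measurable borel" by simp
  define F where "F z = cmod (f z)" for z
  have [measurable]: "F \<in> borel_measurable borel" unfolding F_def[abs_def] by measurable
  have F0: "F z \<ge> 0" for z by (simp add: F_def)
  define I where "I = pint (wm al) (\<lambda>z. F z powr p)"
  have N: "Lp_norm (mu al) p (\<lambda>x. ennreal (cmod (h x))) = enn_powr I (1 / p)"
   unfolding Lp_norm_def nn_integral_mu I_def by (intro arg_cong2[where f = enn_powr] nn_integral_wm_cong) (auto simp: F_def f_def)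
  have I: "I < \<infinity>" using h N by (cases I) (auto simp: Lp_space_def)
  have SI: "(\<integral>\<^sup>+x. S F x \<partial>wm al) \<le> ennreal C * I" unfolding I_def using F0 by (intro C(2)) auto
  also have "\<dots> < \<infinity>" using I by (simp add: ennreal_mult_less_top)
  finally have fin: "AE x in wm al. S F x \<noteq> \<infinity>" by (intro nn_integral_PInf_AE) auto
  define B where "B x s = (LINT u|wm al. sk al be s u *\<^sub>R f (x * u))" for x s
  have int: "integrable (wm al) (\<lambda>u. sk al be s u *\<^sub>R f (x * u))" and B_le: "ennreal (cmod (B x s)) \<le> enn_powr (S F x) (1 / p)"
   if "S F x \<noteq> \<infinity>" "s > 0" for x s
  proof -
   have le: "(\<integral>\<^sup>+u. ennreal (norm (sk al be s u *\<^sub>R f (x * u))) \<partial>wm al) \<le> enn_powr (S F x) (1 / p)"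
    using S_le[of F s x] that by (simp add: F_def)
   also have "\<dots> < \<infinity>" using that by (cases "S F x") auto
   finally show i: "integrable (wm al) (\<lambda>u. sk al be s u *\<^sub>R f (x * u))" by (intro integrableI_bounded) measurable
   show "ennreal (cmod (B x s)) \<le> enn_powr (S F x) (1 / p)"
    unfolding B_def by (rule order_trans[OF integral_norm_bound_ennreal[OF i] le])
  qed
  have mean: "cmod (mean_op al be t h x) = K * cmod (B x (t / x))" if "t > 0" "x > 0" for t x
   using mean_op_eq(2)[OF al nu that, of f h] K by (simp add: B_def K_def f_def)
  have "AE x in mu al. \<forall>t>0. integrable (mu al) (\<lambda>z. kernel al be t x z *\<^sub>R h z)"
   unfolding AE_mu_iff using fin AE_wm
  proof eventually_elim
   case (elim x)
   show ?case
   proof (intro allI impI)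
    fix t :: real assume "t > 0"
    thus "integrable (mu al) (\<lambda>z. kernel al be t x z *\<^sub>R h z)"
     using mean_op_eq(1)[OF al nu _ elim(2), of t f h] int[OF elim(1), of "t / x"] elim(2) by (simp add: f_def)
   qed
  qed
  moreover have "Lp_norm (mu al) p (max_op al be h) \<le> ennreal (K * C powr (1 / p)) * Lp_norm (mu al) p (\<lambda>x. ennreal (cmod (h x)))"
  proof -
   have "(\<integral>\<^sup>+x. enn_powr (max_op al be h x) p \<partial>wm al) \<le> (\<integral>\<^sup>+x. ennreal (K powr p) * S F x \<partial>wm al)"
   proof (rule nn_integral_mono_AE, use fin AE_wm in eventually_elim)
    case (elim x)
    have "max_op al be h x \<le> ennreal K * enn_powr (S F x) (1 / p)"
     unfolding max_op_def using B_le[OF elim(1)] elim(2) K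
     by (intro SUP_least) (auto simp: mean ennreal_mult intro!: mult_left_mono)
    hence "enn_powr (max_op al be h x) p \<le> enn_powr (ennreal K * enn_powr (S F x) (1 / p)) p" using p by (intro enn_powr_mono) auto
    thus ?case using K p by (simp add: enn_powr_cmult enn_powr_inverse')
   qed
   also have "\<dots> \<le> ennreal (K powr p * C) * I"
    using SI C by (simp add: nn_integral_cmult ennreal_mult mult.assoc mult_left_mono)
   finally have "Lp_norm (mu al) p (max_op al be h) \<le> enn_powr (ennreal (K powr p * C) * I) (1 / p)"
    unfolding Lp_norm_def nn_integral_mu using p by (intro enn_powr_mono) auto
   also have "\<dots> = ennreal (K * C powr (1 / p)) * enn_powr I (1 / p)"
    using p K C by (simp add: enn_powr_cmult powr_mult powr_powr)
   finally show ?thesis unfolding N .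
  qed
  moreover have "max_op al be h \<in> borel_measurable (completion (mu al))"
  proof (rule borel_measurable_completion_AE)
   define T where "T x = (SUP s\<in>\<rat> \<inter> {0<..}. ennreal (cmod (B x s)))" for x
   have [measurable]: "(\<lambda>x. B x s) \<in> borel_measurable borel" for s unfolding B_def by measurable
   have "(\<lambda>x. ennreal K * T x) \<in> borel_measurable borel" unfolding T_def by (intro borel_measurable_times_ennreal borel_measurable_SUP) auto
   thus "(\<lambda>x. ennreal K * T x) \<in> borel_measurable (mu al)" unfolding mu_eq by (intro measurable_restrict_space1) simp
   \<comment> \<open>Truncation both in size and in range; the moduli R n of the remainders tend to
     0 in L^p.\<close>
   define fn where "fn n z = (if cmod (f z) \<le> real n + 1 \<and> z \<le> real n + 1 then f z else 0)" for n :: nat and z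
   define R where "R n z = cmod (f z - fn n z)" for n z
   have [measurable]: "fn n \<in> borel_measurable borel" "R n \<in> borel_measurable borel" for n
    unfolding R_def[abs_def] fn_def[abs_def] by measurable
   have R0: "R n z \<ge> 0" for n z by (simp add: R_def)
   have R: "R n z \<le> F z" for n z by (auto simp: R_def F_def fn_def)
   have "(\<lambda>n. pint (wm al) (\<lambda>z. R n z powr p)) \<longlonglongrightarrow> (\<integral>\<^sup>+z. 0 \<partial>wm al)"
   proof (rule nn_integral_dominated_convergence[where w = "\<lambda>z. ennreal (F z powr p)"])
    show "AE z in wm al. ennreal (R n z powr p) \<le> ennreal (F z powr p)" for n
     using R R0 p by (intro AE_I2 ennreal_leI powr_mono2) auto
    show "AE z in wm al. (\<lambda>n. ennreal (R n z powr p)) \<longlonglongrightarrow> 0"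
    proof (intro AE_I2 tendsto_eventually)
     fix z
     show "eventually (\<lambda>n. ennreal (R n z powr p) = 0) sequentially"
      using eventually_ge_at_top[of "nat \<lceil>max (cmod (f z)) z\<rceil>"]
     proof eventually_elim
      case (elim n)
      hence "max (cmod (f z)) z \<le> real n" by linarith
      thus ?case by (simp add: R_def fn_def)
     qed
    qed
   qed (use I in \<open>auto simp: I_def\<close>)
   hence lim: "(\<lambda>n. ennreal C * pint (wm al) (\<lambda>z. R n z powr p)) \<longlonglongrightarrow> ennreal C * 0"
    by (intro ennreal_tendsto_cmult) auto
   have "(\<integral>\<^sup>+x. (INF n. S (R n) x) \<partial>wm al) \<le> ennreal C * pint (wm al) (\<lambda>z. R n z powr p)" for n
    using R0 by (intro order_trans[OF nn_integral_mono C(2)]) (auto intro: INF_lower)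
   hence "(\<integral>\<^sup>+x. (INF n. S (R n) x) \<partial>wm al) \<le> 0" using LIMSEQ_le_const[OF lim] by auto
   \<comment> \<open>The maximal functions of the remainders tend to 0 in mean only, but for each x
     a single good n suffices below, so the infimum over n is enough.\<close>
   hence "AE x in wm al. (INF n. S (R n) x) = 0" by (subst (asm) le_zero_eq, subst (asm) nn_integral_0_iff_AE) auto
   hence "AE x in wm al. max_op al be h x = ennreal K * T x"
    using fin AE_wm
   proof eventually_elim
    case (elim x)
    \<comment> \<open>A rational s' close to s: the truncation errors at s and at s' and the
      oscillation of the truncated mean cost e/3 each.\<close>
    have T: "ennreal (cmod (B x s)) \<le> T x" if s: "s > 0" for s
    proof (rule ennreal_le_epsilon)
     fix e :: real assume e: "e > 0"
     have "(INF n. S (R n) x) < ennreal ((e/3) powr p)" using e elim(1) by simp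
     then obtain n where n: "S (R n) x < ennreal ((e/3) powr p)" by (auto simp: INF_less_iff)
     define Bn where "Bn s = (LINT u|wm al. sk al be s u *\<^sub>R fn n (x * u))" for s
     have c: "0 < s/2" "s/2 \<le> s + 1" "1 \<le> s + 1" using s by auto
     note mc = mean_continuous[of "fn n" "real n + 1", OF _ _ _ _ elim(3) c]
     have fni: "integrable (wm al) (\<lambda>u. sk al be s' u *\<^sub>R fn n (x * u))" if "s' \<in> {s/2..s+1}" for s'
      by (rule mc(1)) (use that in \<open>auto simp: fn_def\<close>)
     have cont: "continuous_on {s/2..s+1} Bn" unfolding Bn_def by (rule mc(2)) (auto simp: fn_def)
     have close: "cmod (B x s' - Bn s') \<le> e / 3" if s': "s' \<in> {s/2..s+1}" for s'
     proof -
      have i: "integrable (wm al) (\<lambda>u. sk al be s' u *\<^sub>R f (x * u))" using int[OF elim(2), of s'] s' s by auto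
      have "B x s' - Bn s' = (LINT u|wm al. sk al be s' u *\<^sub>R f (x * u) - sk al be s' u *\<^sub>R fn n (x * u))"
       unfolding B_def Bn_def using i fni[OF s'] by simp
      hence "ennreal (cmod (B x s' - Bn s')) \<le> (\<integral>\<^sup>+u. ennreal (norm (sk al be s' u *\<^sub>R f (x * u) - sk al be s' u *\<^sub>R fn n (x * u))) \<partial>wm al)"
       using i fni[OF s'] by (simp only:) (intro integral_norm_bound_ennreal Bochner_Integration.integrable_diff)
      also have "\<dots> = pint (wm al) (\<lambda>u. \<bar>sk al be s' u\<bar> * R n (x * u))"
       by (simp add: R_def flip: scaleR_diff_right)
      also have "\<dots> \<le> enn_powr (S (R n) x) (1 / p)" using s s' by (intro S_le) auto
      also have "\<dots> \<le> enn_powr (ennreal ((e/3) powr p)) (1 / p)" using n p by (intro enn_powr_mono) auto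
      also have "\<dots> = ennreal (e/3)" using e p by (simp add: powr_powr)
      finally show ?thesis using e by (simp add: ennreal_le_iff)
     qed
     obtain dl where dl: "dl > 0" "\<And>s'. s' \<in> {s/2..s+1} ==> dist s' s < dl ==> dist (Bn s') (Bn s) < e / 3"
      using cont[unfolded continuous_on_iff, rule_format, of s "e/3"] e s by auto
     obtain s' where s': "s' \<in> \<rat>" "s < s'" "s' < s + min dl 1" using Rats_dense_in_real[of s "s + min dl 1"] dl(1) by auto
     have s2: "s' \<in> {s/2..s+1}" "dist s' s < dl" using s' s by (auto simp: dist_real_def)
     have "cmod (B x s) \<le> cmod (B x s') + cmod (B x s - Bn s) + cmod (Bn s' - Bn s) + cmod (B x s' - Bn s')"
      by norm
     also have "\<dots> \<le> cmod (B x s') + e / 3 + e / 3 + e / 3"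
      using close[of s] close[OF s2(1)] dl(2)[OF s2] s by (intro add_mono) (auto simp: dist_norm)
     finally have "ennreal (cmod (B x s)) \<le> ennreal (cmod (B x s')) + ennreal e"
      using e by (simp add: ennreal_leI flip: ennreal_plus)
     also have "ennreal (cmod (B x s')) \<le> T x" unfolding T_def using s s' by (intro SUP_upper) auto
     finally show "ennreal (cmod (B x s)) \<le> T x + ennreal e" by (simp add: add_right_mono)
    qed
    show ?case
    proof (rule antisym)
     show "max_op al be h x \<le> ennreal K * T x"
      unfolding max_op_def using T elim(3) K by (intro SUP_least) (auto simp: mean ennreal_mult intro!: mult_left_mono)
     have "ennreal K * ennreal (cmod (B x s)) \<le> max_op al be h x" if "s > 0" for s
     proof -
      have "ennreal K * ennreal (cmod (B x s)) = ennreal (cmod (mean_op al be (s * x) h x))"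
       using mean[of "s * x" x] that elim(3) K by (simp add: ennreal_mult)
      also have "\<dots> \<le> max_op al be h x" unfolding max_op_def using that elim(3) by (intro SUP_upper) auto
      finally show ?thesis .
     qed
     thus "ennreal K * T x \<le> max_op al be h x" unfolding T_def SUP_mult_left_ennreal by (intro SUP_least) auto
    qed
   qed
   thus "AE x in mu al. max_op al be h x = ennreal K * T x" by (simp add: AE_mu_iff)
  qed
  ultimately show "(AE x in mu al. \<forall>t>0. integrable (mu al) (\<lambda>z. kernel al be t x z *\<^sub>R h z)) \<and>
    max_op al be h \<in> borel_measurable (completion (mu al)) \<and>
    Lp_norm (mu al) p (max_op al be h) \<le> ennreal (K * C powr (1 / p)) * Lp_norm (mu al) p (\<lambda>x. ennreal (cmod (h x)))" by blast
 qed
qed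

end

text \<open>In be p + 2 al + 1 = p (al + be + 1/2) + (2 al + 1) (1 - p/2) the first term exceeds 1
  by (i) and the second exceeds -1. This is why no lower bound on 1/p appears for al \<le>
  -1/2.\<close>

lemma critical_number_pos:
 assumes "al > -1" "al + be > -1/2" "p > 1" "cond_i al be p" "2 * al + 1 \<le> 0"
 shows "be * p + 2 * al + 1 > 0"
proof -
 have "p * (al + be + 1/2) > 1" using assms(3,4) by (simp add: cond_i_def field_simps)
 moreover have "be * p + 2 * al + 1 = p * (al + be + 1/2) + (2 * al + 1) * (1 - p / 2)" by (simp add: algebra_simps)
 moreover have "(2 * al + 1) * (1 - p / 2) > -1"
 proof (cases "p \<ge> 2")
  case True
  thus ?thesis using mult_nonpos_nonpos[of "2 * al + 1" "1 - p / 2"] assms(5) by simp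
 next
  case False
  have "(2 * al + 1) * (1 - p / 2) \<ge> (- 1) * (1 - p / 2)" using assms False by (intro mult_right_mono) auto
  thus ?thesis using assms(3) by simp
 qed
 ultimately show ?thesis by linarith
qed

theorem sufficiency:
 assumes al: "al > -1" and nu: "al + be > -1/2" and p: "1 < p"
  and ci: "cond_i al be p" and low: "lower_weak al be p" and up: "upper al be p"
 shows "max_op_bounded al be p"
proof -
 define r where "r = p / (p - 1)"
 have r: "r > 1" "1/p + 1/r = 1" "1/r = 1 - 1/p" using p by (auto simp: r_def field_simps)
 \<comment> \<open>Condition (i) in the form that leaves room for g.\<close>
 have "-1/r < min (al + be - 1/2) 0" using ci r p by (simp add: cond_i_def)
 then obtain g where g: "-1/r < g" "g < min (al + be - 1/2) 0" using dense by blast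
 have gr: "g * r > -1" using g(1) r(1) by (simp add: field_simps)
 have "(1 - be) / (2 * al + 2) < 1 / r" using up r(3) by (simp add: upper_def)
 hence u: "(be - 1) * r + 2 * al + 2 > 0" using al r(1) by (simp add: field_simps)
 \<comment> \<open>m is the room left by al > -1 and by the upper bound in (ii); d uses up half of
   it, so both strict inequalities for d survive.\<close>
 define m where "m = min (2 * al + 2) ((be - 1) * r + 2 * al + 2)"
 have m: "m > 0" "m \<le> 2 * al + 2" "m \<le> (be - 1) * r + 2 * al + 2" using u al by (auto simp: m_def)
 define d where "d = m / 2 / (r - 1)"
 have d: "d > 0" "d * (r - 1) = m / 2"
  using m(1) r(1) unfolding d_def by (auto intro!: divide_pos_pos nonzero_eq_divide_eq[THEN iffD1] simp del: times_divide_eq_left)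
 interpret weighted_estimate al be g p r d
  by unfold_locales (use al nu p r g gr d m in auto)
 show ?thesis
 proof (rule max_op_bounded_if_strong, rule strong_sk)
  show "be * p + 2 * al + 1 > 0 \<or> (be * p + 2 * al + 1 = 0 \<and> be < 0)"
  proof (cases "2 * al + 1 > 0")
   case True
   hence "-be * p \<le> 2 * al + 1" using low p by (simp add: lower_weak_def field_simps)
   hence "be * p + 2 * al + 1 \<ge> 0" by simp
   \<comment> \<open>The critical near part requires be < 0; here be p = -(2 al + 1) is
     negative.\<close>
   moreover have "be < 0" if "be * p + 2 * al + 1 = 0"
   proof (rule ccontr)
    assume "\<not> be < 0"
    hence "be * p \<ge> 0" using p by (intro mult_nonneg_nonneg) auto
    thus False using that True by linarith
   qed
   ultimately show ?thesis by linarith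
  qed (use critical_number_pos[OF al nu p ci] in auto)
 qed
qed

section \<open>Necessity\<close>

text \<open>For t = |x - 1| the point z = 1 lies exactly at \<tau> = -1. Moving z by w towards x
  gives 1 + \<tau> = w (2 t - w) / (2 x z), which is positive and comparable to w / min 1 x, and
  there \<open>prof_lower_bound\<close> applies. The sign sg is the direction from 1 to x.\<close>

lemma kernel_lower_bound:
 assumes al: "al > -1" and nu: "al + be > -1/2"
 obtains c eta where "c > 0" "eta > 0" "eta \<le> 1/2"
  "\<And>x w sg. 2 \<le> x \<and> sg = 1 \<or> 0 < x \<and> x \<le> 1/2 \<and> sg = -1 ==> 0 < w ==> w < eta * min 1 x ==>
    c * (max 1 x powr (-2 * (al + be)) * x powr (be - 1) * (w / min 1 x) powr (al + be - 1/2)) \<le> kernel al be \<bar>x - 1\<bar> x (1 + sg * w)"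
proof -
 define gam where "gam = al + be - 1/2"
 obtain c eta where c: "c > 0" "eta > 0" and low: "\<And>ta. -1 < ta ==> ta < -1 + eta ==> prof al (al + be) ta \<ge> c * (ta + 1) powr gam"
  using prof_lower_bound[OF nu, of al] unfolding gam_def by blast
 define k where "k = 2 powr \<bar>-2 * (al + be)\<bar> * 2 powr \<bar>be - 1\<bar> * 4 powr \<bar>gam\<bar>"
 define K where "K = kconst (al + be) * c"
 have k: "k > 0" and K: "K > 0" using c kconst_pos[of "al + be"] nu by (auto simp: k_def K_def)
 show thesis
 \<comment> \<open>1 + \<tau> is at most 2 w / min 1 x, hence eta/2; the cap 1/2 keeps z within
   [1/2, 3/2].\<close>
 proof (rule that[of "K / k" "min (eta/2) (1/2)", folded gam_def])
  fix x w sg :: real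
  assume x: "2 \<le> x \<and> sg = 1 \<or> 0 < x \<and> x \<le> 1/2 \<and> sg = -1" and w: "0 < w" "w < min (eta/2) (1/2) * min 1 x"
  define t z m where "t = \<bar>x - 1\<bar>" and "z = 1 + sg * w" and "m = min 1 x"
  have m: "m > 0" "m \<le> 1" "m = 1 \<and> 2 \<le> x \<and> sg = 1 \<or> m = x \<and> x \<le> 1/2 \<and> sg = -1" using x by (auto simp: m_def)
  have "w / m < min (eta/2) (1/2)" using w(2) m(1) unfolding m_def[symmetric] by (subst pos_divide_less_eq)
  hence wm: "w / m < eta/2" "w < 1/2" using w m pos_divide_less_eq[of m w "1/2"] by auto
  have pos: "x > 0" "t > 0" "z > 0" "1/2 \<le> z" "z \<le> 3/2" using x w wm by (auto simp: t_def z_def)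
  have ne: "t \<noteq> \<bar>x - z\<bar>" "t \<noteq> x + z" using m w wm by (auto simp: t_def z_def)
  have tau: "1 + tau t x z = w * (2 * t - w) / (2 * x * z)"
  proof -
   have "2 * x * z \<noteq> 0" using pos by simp
   hence "1 + tau t x z = (2 * x * z + (t\<^sup>2 - x\<^sup>2 - z\<^sup>2)) / (2 * x * z)" by (simp add: tau_def add_divide_distrib)
   also have "2 * x * z + (t\<^sup>2 - x\<^sup>2 - z\<^sup>2) = w * (2 * t - w)"
    using m(3) by (auto simp: t_def z_def algebra_simps power2_eq_square)
   finally show ?thesis .
  qed
  have "w / m \<le> 4 * (1 + tau t x z) \<and> 1 + tau t x z \<le> 2 * (w / m)"
   using m(3)
  proof
   assume m1: "m = 1 \<and> 2 \<le> x \<and> sg = 1"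
   have x2: "2 \<le> x" "t = x - 1" using m1 by (auto simp: t_def)
   define q where "q = x * z"
   have "q \<le> x * (3/2)" "x * (1/2) \<le> q" unfolding q_def using pos by (intro mult_left_mono; simp)+
   with x2 w(1) wm(2) have "q \<le> 2 * (2 * t - w)" "2 * t - w \<le> 4 * q" by simp_all
   hence "w * (x * z) \<le> w * (2 * (2 * t - w))" "w * (2 * t - w) \<le> w * (4 * (x * z))" using w by (simp_all add: q_def)
   thus ?thesis unfolding tau using m1 pos by (simp add: field_simps)
  next
   assume m1: "m = x \<and> x \<le> 1/2 \<and> sg = -1"
   have "w * z \<le> w * (2 * (2 * t - w))" "w * (2 * t - w) \<le> w * (4 * z)"
    using m1 w wm pos by (auto simp: t_def z_def intro!: mult_left_mono)
   hence "x * (w * (2 * t - w)) \<le> x * (w * (4 * z))" "w * z \<le> w * (2 * (2 * t - w))" using pos by (auto intro: mult_left_mono)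
   thus ?thesis unfolding tau using m1 pos by (simp add: field_simps)
  qed
  hence F: "w / m \<le> 4 * (1 + tau t x z)" "1 + tau t x z \<le> 2 * (w / m)" by blast+
  have W: "w / m > 0" using w m by simp
  have T: "1 + tau t x z \<le> 4 * (w / m)" "1 + tau t x z < eta" "1 + tau t x z > 0"
   using F(2) W le_less_trans[OF F(2), of eta] wm(1) less_le_trans[OF W F(1)] by (simp_all add: mult.commute)
  have A: "max 1 x powr (-2 * (al + be)) \<le> 2 powr \<bar>-2 * (al + be)\<bar> * t powr (-2 * (al + be))" using x by (intro powr_comparable) (auto simp: t_def)
  have B: "x powr (be - 1) \<le> 2 powr \<bar>be - 1\<bar> * (x * z) powr (be - 1)" using pos by (intro powr_comparable) auto
  have G: "(w / m) powr gam \<le> 4 powr \<bar>gam\<bar> * (1 + tau t x z) powr gam" using F(1) W T by (intro powr_comparable) auto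
  have "K / k * (max 1 x powr (-2 * (al + be)) * x powr (be - 1) * (w / m) powr gam)
   \<le> K / k * ((2 powr \<bar>-2 * (al + be)\<bar> * t powr (-2 * (al + be))) * (2 powr \<bar>be - 1\<bar> * (x * z) powr (be - 1)) * (4 powr \<bar>gam\<bar> * (1 + tau t x z) powr gam))"
   using K k by (intro mult_left_mono mult_mono[OF mult_mono[OF A B] G]) auto
  also have "\<dots> = kconst (al + be) * (t powr (-2 * (al + be)) * (x * z) powr (be - 1) * (c * (1 + tau t x z) powr gam))"
   using k by (simp add: K_def k_def)
  also have "\<dots> \<le> kconst (al + be) * (t powr (-2 * (al + be)) * (x * z) powr (be - 1) * prof al (al + be) (tau t x z))"
   using low[of "tau t x z"] T kconst_pos[of "al + be"] nu by (intro mult_left_mono) (auto simp: add.commute)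
  also have "\<dots> = kernel al be t x z" unfolding kernel_eq[OF al nu pos(2,1,3) ne] kconst_def ..
  finally show "K / k * (max 1 x powr (-2 * (al + be)) * x powr (be - 1) * (w / min 1 x) powr gam) \<le> kernel al be \<bar>x - 1\<bar> x (1 + sg * w)"
   unfolding t_def z_def m_def .
 qed (use c k K in auto)
qed

text \<open>The supremum is bounded below by the single value t = |x - 1|, and a kernel bound of
  product form b x * \<psi> z separates the variables, so that the L^p bound becomes an inequality
  between integrals of one variable.\<close>

lemma test_function_bound:
 assumes bounded: "max_op_bounded al be p" and p: "p > 1"
 obtains C where "C > 0" "\<And>\<phi> \<psi> b A. \<phi> \<in> borel_measurable borel ==> \<psi> \<in> borel_measurable borel ==> b \<in> borel_measurable borel ==> A \<in> sets borel ==>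
   (\<And>z. 0 \<le> \<phi> z) ==> (\<And>z. 0 \<le> \<psi> z) ==> (\<And>x. 0 \<le> b x) ==>
   (\<And>x z. x \<in> A ==> x > 0 \<and> x \<noteq> 1 \<and> (\<phi> z \<noteq> 0 --> b x * \<psi> z \<le> kernel al be \<bar>x - 1\<bar> x z)) ==>
   pint (wm al) (\<lambda>x. indicator A x * b x powr p) * enn_powr (pint (wm al) (\<lambda>z. \<psi> z * \<phi> z)) p \<le> ennreal C * pint (wm al) (\<lambda>z. \<phi> z powr p)"
proof -
 obtain C where C: "\<And>f. f \<in> Lp_space (mu al) p ==> (AE x in mu al. \<forall>t>0. integrable (mu al) (\<lambda>z. kernel al be t x z *\<^sub>R f z))"
  "\<And>f. f \<in> Lp_space (mu al) p ==> Lp_norm (mu al) p (max_op al be f) \<le> ennreal C * Lp_norm (mu al) p (\<lambda>x. ennreal (cmod (f x)))"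
  using bounded unfolding max_op_bounded_def by blast
 show thesis
 proof (rule that[of "\<bar>C\<bar> powr p + 1"])
  show "\<bar>C\<bar> powr p + 1 > 0" by (intro add_nonneg_pos) auto
  fix \<phi> \<psi> b :: "real => real" and A :: "real set"
  assume [measurable]: "\<phi> \<in> borel_measurable borel" "\<psi> \<in> borel_measurable borel" "b \<in> borel_measurable borel" "A \<in> sets borel"
   and nn: "\<And>z. 0 \<le> \<phi> z" "\<And>z. 0 \<le> \<psi> z" "\<And>x. 0 \<le> b x"
   and ker: "\<And>x z. x \<in> A ==> x > 0 \<and> x \<noteq> 1 \<and> (\<phi> z \<noteq> 0 --> b x * \<psi> z \<le> kernel al be \<bar>x - 1\<bar> x z)"
  define I where "I = pint (wm al) (\<lambda>z. \<phi> z powr p)"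
  define J where "J = pint (wm al) (\<lambda>z. \<psi> z * \<phi> z)"
  define f where "f z = complex_of_real (\<phi> z)" for z
  have N: "Lp_norm (mu al) p (\<lambda>x. ennreal (cmod (f x))) = enn_powr I (1 / p)"
   using nn by (simp add: Lp_norm_def nn_integral_mu I_def f_def)
  show "pint (wm al) (\<lambda>x. indicator A x * b x powr p) * enn_powr J p \<le> ennreal (\<bar>C\<bar> powr p + 1) * I"
  proof (cases "I = top")
   case True
   have "\<bar>C\<bar> powr p + 1 > 0" by (intro add_nonneg_pos) auto
   hence "ennreal (\<bar>C\<bar> powr p + 1) \<noteq> 0" by (simp only: ennreal_eq_0_iff)
   thus ?thesis using True by (simp add: ennreal_mult_top del: ennreal_plus)
  next
   case False
   have "f \<in> borel_measurable (mu al)" unfolding mu_eq f_def by (intro measurable_restrict_space1) measurable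
   hence f: "f \<in> Lp_space (mu al) p" using False N by (cases I) (auto simp: Lp_space_def)
   have "pint (wm al) (\<lambda>x. indicator A x * b x powr p) * enn_powr J p = (\<integral>\<^sup>+x. ennreal (indicator A x * b x powr p) * enn_powr J p \<partial>wm al)"
    by (simp add: nn_integral_multc)
   also have "\<dots> \<le> (\<integral>\<^sup>+x. enn_powr (max_op al be f x) p \<partial>wm al)"
   proof (rule nn_integral_mono_AE, use C(1)[OF f, unfolded AE_mu_iff] in eventually_elim)
    case (elim x)
    show ?case
    proof (cases "x \<in> A")
     case True
     let ?t = "\<bar>x - 1\<bar>"
     have t: "?t > 0" using ker True by auto
     have knn: "b x * (\<psi> z * \<phi> z) \<le> kernel al be ?t x z * \<phi> z" for z
      using ker[OF True, of z] nn by (cases "\<phi> z = 0") (auto simp: mult.assoc[symmetric] intro!: mult_right_mono)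
     hence k0: "kernel al be ?t x z * \<phi> z \<ge> 0" for z by (rule order_trans[rotated]) (use nn in simp)
     have eq: "kernel al be ?t x z *\<^sub>R f z = complex_of_real (kernel al be ?t x z * \<phi> z)" for z by (simp add: f_def scaleR_conv_of_real)
     have i: "integrable (mu al) (\<lambda>z. kernel al be ?t x z * \<phi> z)"
      using elim[rule_format, OF t] unfolding eq by (subst (asm) complex_of_real_integrable_eq)
     have "ennreal (b x) * J = (\<integral>\<^sup>+z. ennreal (b x * (\<psi> z * \<phi> z)) \<partial>mu al)"
      using nn by (simp add: J_def nn_integral_mu nn_integral_cmult ennreal_mult)
     also have "\<dots> \<le> (\<integral>\<^sup>+z. ennreal (kernel al be ?t x z * \<phi> z) \<partial>mu al)"
      by (intro nn_integral_mono ennreal_leI knn)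
     also have "\<dots> = ennreal (LINT z|mu al. kernel al be ?t x z * \<phi> z)"
      by (intro nn_integral_eq_integral i AE_I2 k0)
     also have "\<dots> \<le> ennreal (cmod (mean_op al be ?t f x))"
      unfolding mean_op_def eq by (subst integral_complex_of_real) (simp add: ennreal_leI)
     also have "\<dots> \<le> max_op al be f x" unfolding max_op_def using t by (intro SUP_upper) auto
     finally have "enn_powr (ennreal (b x) * J) p \<le> enn_powr (max_op al be f x) p" using p by (intro enn_powr_mono) auto
     thus ?thesis using True nn p by (simp add: enn_powr_cmult)
    qed simp
   qed
   also have "\<dots> = enn_powr (Lp_norm (mu al) p (max_op al be f)) p" using p by (simp add: Lp_norm_def nn_integral_mu enn_powr_inverse')
   also have "\<dots> \<le> enn_powr (ennreal \<bar>C\<bar> * enn_powr I (1 / p)) p"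
    using p by (intro enn_powr_mono order_trans[OF C(2)[OF f]]) (auto simp: N intro!: mult_right_mono ennreal_leI)
   also have "\<dots> = ennreal (\<bar>C\<bar> powr p) * I" using p by (simp add: enn_powr_cmult enn_powr_inverse')
   also have "\<dots> \<le> ennreal (\<bar>C\<bar> powr p + 1) * I" by (intro mult_right_mono ennreal_leI) auto
   finally show ?thesis .
  qed
 qed
qed

section \<open>Integrals of test functions and the three necessary conditions\<close>

lemma pint_shifted_power:
 assumes e: "e > -1" and eta: "0 < eta" "eta \<le> 1/2"
 shows "ennreal (eta powr (e + 1) / (e + 1)) \<le> ennreal (2 powr \<bar>2*al+1\<bar>) * pint (wm al) (\<lambda>z. indicator {1<..<1+eta} z * (z - 1) powr e)"
  and "pint (wm al) (\<lambda>z. indicator {1<..<1+eta} z * (z - 1) powr e) \<le> ennreal (2 powr \<bar>2*al+1\<bar> * (eta powr (e + 1) / (e + 1)))"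
proof -
 let ?f = "\<lambda>z. indicator {1<..<1+eta} z * (z - 1) powr e" and ?k = "2 powr \<bar>2*al+1\<bar>"
 have V: "pint lborel ?f = ennreal (eta powr (e + 1) / (e + 1))"
 proof -
  have "pint lborel ?f = pint lborel (\<lambda>w. ?f (w + 1))" using nn_integral_translate(1)[of "\<lambda>z. ennreal (?f z)" 1] by simp
  also have "\<dots> = pint lborel (\<lambda>w. indicator {0<..<eta} w * w powr e)" by (intro nn_integral_cong) (auto simp: indicator_def)
  finally show ?thesis using nn_integral_powr_0[OF e, of eta] eta by simp
 qed
 have c: "1 powr (2*al+1) \<le> ?k * z powr (2*al+1)" "z powr (2*al+1) \<le> ?k * 1 powr (2*al+1)" if "z \<in> {1<..<1+eta}" for z
  using that eta by (intro powr_comparable; auto)+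
 have "ennreal (eta powr (e + 1) / (e + 1)) \<le> (\<integral>\<^sup>+z. ennreal ?k * ennreal (indicator {0<..} z * (z powr (2*al+1) * ?f z)) \<partial>lborel)"
  unfolding V[symmetric]
 proof (rule nn_integral_mono)
  fix z show "ennreal (?f z) \<le> ennreal ?k * ennreal (indicator {0<..} z * (z powr (2*al+1) * ?f z))"
   using mult_right_mono[OF c(1), of z "(z - 1) powr e"] by (auto simp: indicator_def ennreal_mult'[symmetric] mult.assoc intro!: ennreal_leI)
 qed
 thus "ennreal (eta powr (e + 1) / (e + 1)) \<le> ennreal ?k * pint (wm al) ?f"
  by (subst pint_wm, measurable) (simp add: nn_integral_cmult)
 have "pint (wm al) ?f \<le> (\<integral>\<^sup>+z. ennreal ?k * ennreal (?f z) \<partial>lborel)"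
 proof (subst pint_wm, measurable, rule nn_integral_mono)
  fix z show "ennreal (indicator {0<..} z * (z powr (2*al+1) * ?f z)) \<le> ennreal ?k * ennreal (?f z)"
   using mult_right_mono[OF c(2), of z "(z - 1) powr e"] by (auto simp: indicator_def ennreal_mult'[symmetric] intro!: ennreal_leI)
 qed
 also have "\<dots> = ennreal ?k * ennreal (eta powr (e + 1) / (e + 1))" by (subst nn_integral_cmult, measurable) (simp only: V)
 also have "\<dots> = ennreal (?k * (eta powr (e + 1) / (e + 1)))" using e by (intro ennreal_mult[symmetric]) auto
 finally show "pint (wm al) ?f \<le> ennreal (?k * (eta powr (e + 1) / (e + 1)))" .
qed

lemma pint_wm_ge:
 fixes f :: "real => real"
 assumes [measurable]: "f \<in> borel_measurable borel" and ab: "0 \<le> a" "a \<le> b"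
  and k: "0 \<le> k" "\<And>x. a < x ==> x < b ==> k \<le> x powr (2*al+1) * f x"
 shows "ennreal (k * (b - a)) \<le> pint (wm al) (\<lambda>x. indicator {a<..<b} x * f x)"
proof -
 have "ennreal (k * (b - a)) = (\<integral>\<^sup>+x. ennreal k * indicator {a<..<b} x \<partial>lborel)"
  using ab k by (simp add: nn_integral_cmult_indicator ennreal_mult)
 also have "\<dots> \<le> pint (wm al) (\<lambda>x. indicator {a<..<b} x * f x)"
  using ab k by (subst pint_wm, measurable) (intro nn_integral_mono, auto simp: indicator_def intro!: ennreal_leI)
 finally show ?thesis .
qed

lemma pint_wm_le:
 fixes f :: "real => real"
 assumes [measurable]: "f \<in> borel_measurable borel" and ab: "0 \<le> a" "a \<le> b"
  and k: "0 \<le> k" "\<And>x. a < x ==> x < b ==> x powr (2*al+1) * f x \<le> k"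
 shows "pint (wm al) (\<lambda>x. indicator {a<..<b} x * f x) \<le> ennreal (k * (b - a))"
proof -
 have "pint (wm al) (\<lambda>x. indicator {a<..<b} x * f x) \<le> (\<integral>\<^sup>+x. ennreal k * indicator {a<..<b} x \<partial>lborel)"
  using ab k by (subst pint_wm, measurable) (intro nn_integral_mono, auto simp: indicator_def intro!: ennreal_leI)
 also have "\<dots> = ennreal (k * (b - a))"
  using ab k by (simp add: nn_integral_cmult_indicator ennreal_mult)
 finally show ?thesis .
qed

text \<open>Let eps tend to 0. All three necessity proofs reach their contradiction here, with a
  positive constant in the role of a.\<close>

lemma le_powr_imp_nonpos:
 fixes a K q :: real
 assumes q: "q > 0" and le: "\<And>eps. 0 < eps ==> eps < 1 ==> a \<le> K * eps powr q"
 shows "a \<le> 0"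
proof (rule tendsto_lowerbound)
 show "((\<lambda>eps. K * eps powr q) \<longlongrightarrow> 0) (at_right (0::real))"
  using tendsto_mult_right_zero[OF tendsto_zero_powrI[of "\<lambda>eps. eps" "at_right 0" "\<lambda>_. q" q], of K] q
  by (auto simp: eventually_at_filter)
 show "eventually (\<lambda>eps. a \<le> K * eps powr q) (at_right 0)"
  by (rule eventually_at_rightI[of 0 1]) (auto intro: le)
qed simp

text \<open>Collects the constants of \<open>kernel_lower_bound\<close> and
  \<open>test_function_bound\<close>, so that the three conditions are derived from the same
  data.\<close>

locale necessity =
 fixes al be p c eta C :: real
 assumes al: "al > -1" and nu: "al + be > -1/2" and p: "1 < p" and c: "c > 0" "eta > 0" "eta \<le> 1/2" and C: "C > 0"
  and ker: "\<And>x w sg. 2 \<le> x \<and> sg = 1 \<or> 0 < x \<and> x \<le> 1/2 \<and> sg = -1 ==> 0 < w ==> w < eta * min 1 x ==>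
   c * (max 1 x powr (-2 * (al + be)) * x powr (be - 1) * (w / min 1 x) powr (al + be - 1/2)) \<le> kernel al be \<bar>x - 1\<bar> x (1 + sg * w)"
  and test: "\<And>\<phi> \<psi> b A. \<phi> \<in> borel_measurable borel ==> \<psi> \<in> borel_measurable borel ==> b \<in> borel_measurable borel ==> A \<in> sets borel ==>
   (\<And>z. 0 \<le> \<phi> z) ==> (\<And>z. 0 \<le> \<psi> z) ==> (\<And>x. 0 \<le> b x) ==>
   (\<And>x z. x \<in> A ==> x > 0 \<and> x \<noteq> 1 \<and> (\<phi> z \<noteq> 0 --> b x * \<psi> z \<le> kernel al be \<bar>x - 1\<bar> x z)) ==>
   pint (wm al) (\<lambda>x. indicator A x * b x powr p) * enn_powr (pint (wm al) (\<lambda>z. \<psi> z * \<phi> z)) p \<le> ennreal C * pint (wm al) (\<lambda>z. \<phi> z powr p)"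
begin

definition gam :: real where "gam = al + be - 1/2"
definition K :: real where "K = (2 powr \<bar>2*al+1\<bar>) powr p * c powr -p * C * 2 powr \<bar>2*al+1\<bar>"

lemma K_pos: "K > 0"
 using c C by (simp add: K_def)

text \<open>Tested on (z - 1)^e to the right of 1, with x far out. Varying e probes the singularity
  at \<tau> = -1 and gives (i); varying A probes the decay at infinity and gives the upper bound in
  (ii).\<close>

lemma outer_bound:
 assumes A [measurable]: "A \<in> sets borel" and A2: "A \<subseteq> {2..}" and e: "-1 < e * p" "-1 < e + gam"
 shows "pint (wm al) (\<lambda>x. indicator A x * x powr (-(2*al+be+1) * p)) * ennreal ((eta powr (e + gam + 1) / (e + gam + 1)) powr p)
  \<le> ennreal (K * (eta powr (e * p + 1) / (e * p + 1)))"
proof -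
 let ?k = "2 powr \<bar>2*al+1\<bar>"
 note ker = ker[folded gam_def]
  define I where "I = pint (wm al) (\<lambda>x. indicator A x * x powr (-(2*al+be+1) * p))"
  define J where "J = pint (wm al) (\<lambda>z. indicator {1<..<1+eta} z * (z - 1) powr (e + gam))"
  let ?a = "eta powr (e + gam + 1) / (e + gam + 1)" and ?v = "eta powr (e * p + 1) / (e * p + 1)"
  have "pint (wm al) (\<lambda>x. indicator A x * (c * x powr (-(2*al+be+1))) powr p) * enn_powr (pint (wm al) (\<lambda>z. (z - 1) powr gam * (indicator {1<..<1+eta} z * (z - 1) powr e))) p
    \<le> ennreal C * pint (wm al) (\<lambda>z. (indicator {1<..<1+eta} z * (z - 1) powr e) powr p)"
  proof (rule test)
   fix x z assume x: "x \<in> A"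
   have "c * x powr (-(2*al+be+1)) * (z - 1) powr gam \<le> kernel al be \<bar>x - 1\<bar> x z" if "1 < z" "z < 1 + eta"
    using ker[of x 1 "z - 1"] x A2 that powr_add[of x "-2 * (al + be)" "be - 1"] by (auto simp: max_def min_def algebra_simps)
   thus "x > 0 \<and> x \<noteq> 1 \<and> (indicator {1<..<1+eta} z * (z - 1) powr e \<noteq> 0 --> c * x powr (-(2*al+be+1)) * (z - 1) powr gam \<le> kernel al be \<bar>x - 1\<bar> x z)"
    using x A2 by (auto simp: indicator_def)
  qed (use c in auto)
  also have "pint (wm al) (\<lambda>x. indicator A x * (c * x powr (-(2*al+be+1))) powr p) = ennreal (c powr p) * I"
   unfolding I_def using c by (subst nn_integral_cmult[symmetric], measurable) (auto simp: powr_mult powr_powr ennreal_mult'[symmetric] mult_ac)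
  also have "pint (wm al) (\<lambda>z. (z - 1) powr gam * (indicator {1<..<1+eta} z * (z - 1) powr e)) = J"
   unfolding J_def by (intro nn_integral_cong) (simp add: powr_add mult_ac)
  also have "pint (wm al) (\<lambda>z. (indicator {1<..<1+eta} z * (z - 1) powr e) powr p) \<le> ennreal (?k * ?v)"
  proof -
   have "(indicator {1<..<1+eta} z * (z - 1) powr e) powr p = indicator {1<..<1+eta} z * (z - 1) powr (e * p)" for z
    by (auto simp: indicator_def powr_powr)
   thus ?thesis using pint_shifted_power(2)[OF e(1) c(2,3), of al] by (simp only:)
  qed
  finally have T: "ennreal (c powr p) * I * enn_powr J p \<le> ennreal C * ennreal (?k * ?v)" by (simp add: mult_left_mono)
  have "enn_powr (ennreal ?a) p \<le> enn_powr (ennreal ?k * J) p"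
   using pint_shifted_power(1)[OF e(2) c(2,3), of al] p unfolding J_def by (intro enn_powr_mono) auto
  hence "ennreal (?a powr p) \<le> ennreal (?k powr p) * enn_powr J p" using e p by (simp add: enn_powr_cmult)
  hence "I * ennreal (?a powr p) \<le> I * (ennreal (?k powr p) * enn_powr J p)" by (rule mult_left_mono) simp
  also have "\<dots> = ennreal (?k powr p * c powr -p) * (ennreal (c powr p) * I * enn_powr J p)"
  proof -
   have "ennreal (?k powr p * c powr -p) * ennreal (c powr p) = ennreal (?k powr p)" using c by (simp add: ennreal_mult'[symmetric] powr_minus)
   hence "ennreal (?k powr p) = ennreal (?k powr p * c powr -p) * ennreal (c powr p)" ..
   thus ?thesis by (simp only: mult.assoc mult.left_commute[of I])
  qed
  also have "\<dots> \<le> ennreal (?k powr p * c powr -p) * (ennreal C * ennreal (?k * ?v))" using T by (rule mult_left_mono) simp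
  also have "\<dots> = ennreal (?k powr p * c powr -p * C * ?k * ?v)" using C e by (simp add: ennreal_mult'[symmetric] mult_ac)
  finally show ?thesis unfolding I_def K_def .
qed

text \<open>If (i) fails, then (gam + 1) p \<le> 1, and for e slightly above -gam - 1 the function
  (z - 1)^e is locally in L^p while its integral against (z - 1)^gam is of order 1 / eps. The left
  side of \<open>outer_bound\<close> then grows like eps^(-p), the right side at most like 1 /
  eps.\<close>

lemma cond_i: "cond_i al be p"
proof (rule ccontr)
 assume "\<not> cond_i al be p"
 hence g: "gam > -1" "(gam + 1) * p \<le> 1" using nu p by (auto simp: cond_i_def gam_def field_simps)
 note le = outer_bound[of "{2<..<3}"]
 define s where "s = 2*al+1 + -(2*al+be+1) * p"
 define a where "a = 3 powr -\<bar>s\<bar>"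
 have "a * eta powr p \<le> 0"
 proof (rule le_powr_imp_nonpos)
  show "p - 1 > 0" using p by simp
  fix eps :: real assume eps: "0 < eps" "eps < 1"
  \<comment> \<open>So that e + gam + 1 = eps.\<close>
  define e where "e = eps - gam - 1"
  have ep: "e * p + 1 \<ge> eps * p" using g by (simp add: e_def algebra_simps)
  have ep0: "eps * p > 0" using eps p by simp
  have "ennreal (a * (3 - 2)) \<le> pint (wm al) (\<lambda>x. indicator {2<..<3} x * x powr (-(2*al+be+1) * p))"
  proof (rule pint_wm_ge)
   fix x :: real assume "2 < x" "x < 3"
   hence "1 powr s \<le> 3 powr \<bar>s\<bar> * x powr s" by (intro powr_comparable) auto
   hence "a \<le> x powr s" by (simp add: a_def powr_minus field_simps)
   also have "x powr s = x powr (2*al+1) * x powr (-(2*al+be+1) * p)" unfolding s_def by (rule powr_add)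
   finally show "a \<le> x powr (2*al+1) * x powr (-(2*al+be+1) * p)" .
  qed (auto simp: a_def)
  hence "ennreal a * ennreal ((eta powr eps / eps) powr p) \<le> pint (wm al) (\<lambda>x. indicator {2<..<3} x * x powr (-(2*al+be+1) * p)) * ennreal ((eta powr eps / eps) powr p)"
   by (intro mult_right_mono) auto
  also have "\<dots> \<le> ennreal (K * (eta powr (e * p + 1) / (e * p + 1)))" using le[of e] eps ep ep0 by (simp add: e_def subset_iff)
  finally have "a * (eta powr eps / eps) powr p \<le> K * (eta powr (e * p + 1) / (e * p + 1))"
   using K_pos ep ep0 by (subst (asm) ennreal_mult'[symmetric]) (auto simp: a_def)
  also have "\<dots> \<le> K * (1 / eps)"
  proof -
   have "eta powr (e * p + 1) \<le> 1" using c ep ep0 by (intro powr_le1) auto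
   moreover have "eps \<le> e * p + 1" using ep mult_left_mono[of 1 p eps] eps p by linarith
   ultimately show ?thesis using K_pos eps by (intro mult_left_mono frac_le) auto
  qed
  finally have "a * (eta powr eps / eps) powr p * eps powr p \<le> K * (1 / eps) * eps powr p" by (rule mult_right_mono) simp
  hence "a * (eta powr eps) powr p \<le> K * eps powr (p - 1)" using eps by (simp add: powr_divide powr_diff)
  moreover have "eta powr p \<le> (eta powr eps) powr p" using c eps p by (simp add: powr_powr powr_mono')
  hence "a * eta powr p \<le> a * (eta powr eps) powr p" by (intro mult_left_mono) (auto simp: a_def)
  ultimately show "a * eta powr p \<le> K * eps powr (p - 1)" by linarith
 qed
 thus False using c by (simp add: a_def mult_le_0_iff)
qed

text \<open>If the bound fails, x^(-(2 al + be + 1)) is not in L^p at infinity: its p-th power has,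
  with the density, the exponent s \<ge> -1. The exponent e = 0, an indicator as test function,
  suffices.\<close>

lemma upper: "upper al be p"
proof (rule ccontr)
 assume "\<not> upper al be p"
 define s where "s = 2*al+1 + -(2*al+be+1) * p"
 have "1 / p \<ge> (2*al+1+be) / (2*al+2)" using \<open>\<not> upper al be p\<close> al by (simp add: upper_def field_simps)
 hence s: "s \<ge> -1" using al p by (simp add: s_def field_simps)
 define I where "I = pint (wm al) (\<lambda>x. indicator {2<..} x * x powr (-(2*al+be+1) * p))"
 define a where "a = (eta powr (gam + 1) / (gam + 1)) powr p"
 have g: "gam > -1" using nu by (simp add: gam_def)
 hence le: "I * ennreal a \<le> ennreal (K * eta)" using outer_bound[of "{2<..}" 0] c by (simp add: I_def a_def subset_iff)
 have a: "a > 0" using c g by (simp add: a_def)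
 have "1/2 * a \<le> 0"
 proof (rule le_powr_imp_nonpos)
  fix dl :: real assume dl: "0 < dl" "dl < 1"
  \<comment> \<open>The divergence is made quantitative by the minorant x^(-1 - dl), whose integral
    blows up like 1 / dl.\<close>
  have "ennreal (2 powr -dl / dl) = pint lborel (\<lambda>x. indicator {2<..} x * x powr (-1 - dl))"
   using dl by (subst nn_integral_powr_inf) auto
  also have "\<dots> \<le> I" unfolding I_def
  proof (subst pint_wm, measurable, intro nn_integral_mono ennreal_leI)
   fix x :: real
   have "x powr (-1 - dl) \<le> x powr (2*al+1) * x powr (-(2*al+be+1) * p)" if "x > 2"
    using s dl that powr_mono[of "-1 - dl" s x] by (simp only: s_def powr_add[symmetric])
   thus "indicator {2<..} x * x powr (-1 - dl) \<le> indicator {0<..} x * (x powr (2*al+1) * (indicator {2<..} x * x powr (-(2*al+be+1) * p)))"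
    by (auto simp: indicator_def)
  qed
  finally have "ennreal (2 powr -dl / dl) * ennreal a \<le> I * ennreal a" by (rule mult_right_mono) simp
  also have "\<dots> \<le> ennreal (K * eta)" by (rule le)
  finally have "ennreal (2 powr -dl / dl * a) \<le> ennreal (K * eta)" using a dl by (subst ennreal_mult) auto
  hence "2 powr -dl / dl * a \<le> K * eta" using K_pos c by (subst (asm) ennreal_le_iff) auto
  hence "2 powr -dl * a \<le> K * eta * dl" using dl by (simp add: field_simps)
  moreover have "1/2 * a \<le> 2 powr -dl * a" using dl a powr_mono[of "-1" "-dl" "2::real"] by (intro mult_right_mono) (auto simp: powr_minus)
  ultimately show "1/2 * a \<le> K * eta * dl powr 1" using dl by simp
 qed simp
 thus False using a by simp
qed

text \<open>For x between y/2 and y the kernel is at least a multiple of x^(be - 1) when z runs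
  through a suitable interval of length comparable to y next to 1. Its indicator as test function
  bounds y^(2 al + 2 + (be - 1) p) y^p by a multiple of y. So y^(be p + 2 al + 1) stays bounded as y
  tends to 0, which excludes a negative exponent.\<close>

lemma lower_weak: "lower_weak al be p"
proof (rule ccontr)
 assume "\<not> lower_weak al be p"
 hence neg: "be * p + 2*al+1 < 0" using p by (auto simp: lower_weak_def field_simps)
 have ker: "c * (x powr (be - 1) * (w / x) powr gam) \<le> kernel al be \<bar>x - 1\<bar> x (1 - w)"
  if "0 < x" "x \<le> 1/2" "0 < w" "w < eta * x" for x w
  using ker[of x "-1" w] that by (simp add: max_def min_def gam_def)
 define d where "d = c * (eta/8) powr \<bar>gam\<bar>"
 define s where "s = 2*al+1 + (be - 1) * p"
 define k where "k = 2 powr -\<bar>2*al+1\<bar> * (eta/8)"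
 have dk: "d > 0" "k > 0" using c by (auto simp: d_def k_def)
 define q where "q = - (be * p + 2*al+1)"
 define a where "a = d powr p * (2 powr -\<bar>s\<bar> * (1/2)) * k powr p"
 define h where "h = 2 powr \<bar>2*al+1\<bar> * (eta/8)"
 have h: "h > 0" using c by (simp add: h_def)
 have "a \<le> 0"
 proof (rule le_powr_imp_nonpos)
  show q: "q > 0" using neg by (simp add: q_def)
  fix eps :: real assume eps: "0 < eps" "eps < 1"
  define y where "y = eps / 2"
  have y: "0 < y" "y < 1/2" using eps by (auto simp: y_def)
  \<comment> \<open>Chosen so that (1 - z) / x lies between eta/8 and eta for all x in (y/2, y) and
    z in (u, v).\<close>
  define u v where "u = 1 - eta * y / 4" and "v = 1 - eta * y / 8"
  have "eta * y \<le> 1/2 * (1/2)" using c y by (intro mult_mono) auto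
  moreover have "eta * y > 0" using c y by simp
  ultimately have uv: "1/2 < u" "u < v" "v < 1" "v - u = eta * y / 8" by (auto simp: u_def v_def)
  have I: "ennreal (2 powr -\<bar>s\<bar> * y powr s * (y - y/2)) \<le> pint (wm al) (\<lambda>x. indicator {y/2<..<y} x * x powr ((be - 1) * p))"
  proof (rule pint_wm_ge)
   fix x assume x: "y/2 < x" "x < y"
   hence "y powr s \<le> 2 powr \<bar>s\<bar> * x powr s" using y by (intro powr_comparable) auto
   hence "2 powr -\<bar>s\<bar> * y powr s \<le> x powr s" by (simp add: powr_minus field_simps)
   thus "2 powr -\<bar>s\<bar> * y powr s \<le> x powr (2*al+1) * x powr ((be - 1) * p)" by (simp add: s_def powr_add)
  qed (use y in auto)
  have cmp: "1 powr (2*al+1) \<le> 2 powr \<bar>2*al+1\<bar> * z powr (2*al+1)" "z powr (2*al+1) \<le> 2 powr \<bar>2*al+1\<bar> * 1 powr (2*al+1)" if "u < z" "z < v" for z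
   using that uv by (intro powr_comparable; auto)+
  have "ennreal (2 powr -\<bar>2*al+1\<bar> * (v - u)) \<le> pint (wm al) (\<lambda>z. indicator {u<..<v} z * 1)"
   using uv cmp(1) by (intro pint_wm_ge) (auto simp: powr_minus field_simps)
  hence J: "ennreal (k * y) \<le> pint (wm al) (indicator {u<..<v})" using uv(4) by (simp add: k_def mult.assoc)
  have "pint (wm al) (\<lambda>z. indicator {u<..<v} z * 1) \<le> ennreal (2 powr \<bar>2*al+1\<bar> * (v - u))"
   using uv cmp(2) by (intro pint_wm_le) auto
  hence J': "pint (wm al) (indicator {u<..<v}) \<le> ennreal (h * y)" using uv(4) by (simp add: h_def mult.assoc)
  have "pint (wm al) (\<lambda>x. indicator {y/2<..<y} x * (d * x powr (be - 1)) powr p) * enn_powr (pint (wm al) (\<lambda>z. 1 * indicator {u<..<v} z)) p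
   \<le> ennreal C * pint (wm al) (\<lambda>z. indicator {u<..<v} z powr p)"
  proof (rule test)
   fix x z assume x: "x \<in> {y/2<..<y}"
   have "d * x powr (be - 1) \<le> kernel al be \<bar>x - 1\<bar> x z" if z: "u < z" "z < v"
   proof -
    have w: "1 - z > eta * y / 8" "1 - z < eta * y / 4" using z by (auto simp: u_def v_def)
    have yx: "eta * y < eta * (2 * x)" "eta * x < eta * y" using x c by auto
    have "eta * x > 0" using x y c by auto
    hence b: "1 - z < eta * x" "1 - z > eta / 8 * x" "1 - z > 0" using w yx by auto
    have x1: "x > 0" using x y by auto
    define rho where "rho = (1 - z) / x"
    have "rho > eta / 8" "rho < eta" using b x1 by (simp_all add: rho_def pos_less_divide_eq pos_divide_less_eq)
    \<comment> \<open>As rho < 1, replacing gam by \<open>\<bar>gam\<bar>\<close> only lowers the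
      power, whatever the sign of gam.\<close>
    hence "(eta/8) powr \<bar>gam\<bar> \<le> rho powr \<bar>gam\<bar>" "rho powr \<bar>gam\<bar> \<le> rho powr gam"
     using c by (auto intro!: powr_mono2 powr_mono')
    hence "(eta/8) powr \<bar>gam\<bar> \<le> ((1 - z) / x) powr gam" unfolding rho_def by linarith
    hence "d * x powr (be - 1) \<le> c * (x powr (be - 1) * ((1 - z) / x) powr gam)"
     unfolding d_def mult.assoc using c by (subst mult.commute[of "(eta/8) powr _"]) (intro mult_left_mono, auto)
    also have "\<dots> \<le> kernel al be \<bar>x - 1\<bar> x (1 - (1 - z))" using x y b by (intro ker) auto
    finally show ?thesis by simp
   qed
   thus "x > 0 \<and> x \<noteq> 1 \<and> (indicator {u<..<v} z \<noteq> (0::real) --> d * x powr (be - 1) * 1 \<le> kernel al be \<bar>x - 1\<bar> x z)"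
    using x y by (auto simp: indicator_def)
  qed (use dk in auto)
  also have "(\<lambda>z. indicator {u<..<v} z powr p) = (indicator {u<..<v} :: real => real)" by (auto simp: indicator_def)
  also have "pint (wm al) (\<lambda>x. indicator {y/2<..<y} x * (d * x powr (be - 1)) powr p)
   = ennreal (d powr p) * pint (wm al) (\<lambda>x. indicator {y/2<..<y} x * x powr ((be - 1) * p))"
   using dk by (subst nn_integral_cmult[symmetric], measurable) (auto simp: powr_mult powr_powr ennreal_mult'[symmetric] mult_ac)
  finally have T: "ennreal (d powr p) * pint (wm al) (\<lambda>x. indicator {y/2<..<y} x * x powr ((be - 1) * p)) * enn_powr (pint (wm al) (indicator {u<..<v})) p
   \<le> ennreal C * pint (wm al) (indicator {u<..<v})" by simp
  have "ennreal (d powr p) * ennreal (2 powr -\<bar>s\<bar> * y powr s * (y - y/2)) * enn_powr (ennreal (k * y)) p \<le> ennreal C * ennreal (h * y)"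
   by (rule order_trans[OF mult_mono[OF mult_left_mono[OF I] enn_powr_mono[OF _ J]] order_trans[OF T mult_left_mono[OF J']]]) (use p in auto)
  hence "d powr p * (2 powr -\<bar>s\<bar> * y powr s * (y - y/2)) * (k * y) powr p \<le> C * (h * y)"
   using dk y C h by (simp add: ennreal_mult'[symmetric] flip: ennreal_mult)
  hence "(a * y powr (s + p)) * y \<le> C * h * y" using dk y by (simp add: a_def powr_mult powr_add mult_ac)
  hence "a * y powr (s + p) \<le> C * h" using y by simp
  hence "a * y powr (s + p) * y powr q \<le> C * h * y powr q" by (rule mult_right_mono) simp
  hence *: "a * (y powr (s + p) * y powr q) \<le> C * h * y powr q" by (simp only: mult.assoc)
  have e1: "y powr (s + p) * y powr q = 1" using y by (simp add: powr_add[symmetric] s_def q_def algebra_simps)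
  have e2: "y powr q = (1/2) powr q * eps powr q" using eps by (simp add: y_def powr_divide)
  show "a \<le> C * h * (1/2) powr q * eps powr q" using * unfolding e1 unfolding e2 by (simp only: mult.assoc mult_1_right)
 qed
 thus False using dk by (simp add: a_def mult_le_0_iff)
qed

end

lemma necessity_if_bounded:
 assumes "al > -1" "al + be > -1/2" "1 < p" "max_op_bounded al be p"
 obtains c eta C where "necessity al be p c eta C"
proof (rule kernel_lower_bound[OF assms(1,2)], rule test_function_bound[OF assms(4,3)], goal_cases)
 case (1 c eta C)
 show ?case by (rule that, rule necessity.intro) (fact assms 1)+
qed

theorem corollary1p7:
  fixes \<alpha> \<beta> p :: real
  assumes "\<alpha> > -1" and "\<alpha> + \<beta> > -1/2" and "1 < p"
  shows "(cond_i \<alpha> \<beta> p \<and> cond_ii \<alpha> \<beta> p \<longrightarrow> max_op_bounded \<alpha> \<beta> p) \<and>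
         (max_op_bounded \<alpha> \<beta> p \<longrightarrow>
            cond_i \<alpha> \<beta> p \<and>
            (cond_ii \<alpha> \<beta> p \<or>
             (0 < -\<beta> \<and> -\<beta> \<notin> \<nat> \<and> \<alpha> + \<beta> \<le> 1/2 \<and> lower_weak \<alpha> \<beta> p \<and> upper \<alpha> \<beta> p)))"
proof (intro conjI impI)
 assume "cond_i \<alpha> \<beta> p \<and> cond_ii \<alpha> \<beta> p"
 moreover have "lower_strict \<alpha> \<beta> p --> lower_weak \<alpha> \<beta> p" by (simp add: lower_strict_def lower_weak_def less_imp_le)
 ultimately show "max_op_bounded \<alpha> \<beta> p"
  using assms by (intro sufficiency) (auto simp: cond_ii_def split: if_splits)
next
 assume "max_op_bounded \<alpha> \<beta> p"
 then obtain c eta C where "necessity \<alpha> \<beta> p c eta C" using necessity_if_bounded[OF assms] by blast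
 then interpret necessity \<alpha> \<beta> p c eta C .
 show "cond_i \<alpha> \<beta> p" by (rule cond_i)
 \<comment> \<open>For \<beta> \<ge> 0 the strict lower bound is automatic. Hence
   \<open>cond_ii\<close> can ask for more than \<open>lower_weak\<close> and \<open>upper\<close>
   only if 0 < -\<beta>, -\<beta> is no natural number and \<alpha> + \<beta> \<le> 1/2, which is
   the second alternative.\<close>
 have "lower_strict \<alpha> \<beta> p" if "-\<beta> \<le> 0"
  unfolding lower_strict_def
 proof
  assume "2 * \<alpha> + 1 > 0"
  hence "-\<beta> / (2*\<alpha>+1) \<le> 0" using that by (intro divide_nonpos_pos) auto
  also have "0 < 1 / p" using assms by simp
  finally show "-\<beta> / (2*\<alpha>+1) < 1 / p" .
 qed
 thus "cond_ii \<alpha> \<beta> p \<or> (0 < -\<beta> \<and> -\<beta> \<notin> \<nat> \<and> \<alpha> + \<beta> \<le> 1/2 \<and> lower_weak \<alpha> \<beta> p \<and> upper \<alpha> \<beta> p)"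
  using upper lower_weak unfolding cond_ii_def by auto
qed

end
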